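(* Let $Z\sim(Z^0,\dots,Z^n)$ be a nonnegative (or bounded), right-continuous $\mathbb{G}$-optional process, and let $\tau\sim(\tau^0,\dots,\tau^n)$ be a finite $\mathbb{G}$-stopping time satisfying $\tau\leq T$, where $T\in[0,\infty]$ is a constant. Then the expectation $\mathbb{E}[Z_\tau]$ can be computed by a backward induction as $$\mathbb{E}[Z_\tau]=J_0,$$ where $J_0,\dots,J_n$ are given by $$J_n(\pmb\theta_n,\pmb e_n)=\mathbb{E}\Big[Z_{\tau^n}^n\,\alpha_{\tau^n}^n(\pmb\theta_n,\pmb e_n)\,\big|\,\mathcal{F}_{\theta_n}\Big],\qquad (\pmb\theta_n,\pmb e_n)\in\Delta_n(T)\times E^n,$$ and, for $k=0,\dots,n-1$ and $(\pmb\theta_k,\pmb e_k)\in\Delta_k(T)\times E^k$, $$J_k(\pmb\theta_k,\pmb e_k)=\mathbb{E}\bigg[Z_{\tau^k}^k\,\alpha_{\tau^k}^k(\pmb\theta_k,\pmb e_k)+\int_{\theta_k}^{\tau^k(\pmb\theta_k,\pmb e_k)\wedge T}\int_E J_{k+1}(\pmb\theta_k,\theta_{k+1},\pmb e_k,e_{k+1})\,\eta(de_{k+1})\,d\theta_{k+1}\,\Big|\,\mathcal{F}_{\theta_k}\bigg].$$ Here $Z^k_{\tau^k}$ and $\alpha^k_{\tau^k}$ are evaluated at the fixed $(\pmb\theta_k,\pmb e_k)$ and at the time $\tau^k(\pmb\theta_k,\pmb e_k)$, and $\theta_0:=0$.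
   Context: Probabilistic setting. On a probability space $(\Omega,\mathbb{P})$, $\mathbb{F}=(\mathcal{F}_t)_{t\ge 0}$ is the filtration generated by a Brownian motion, satisfying the usual conditions. There are at most $n\ge 1$ jumps: $0\le\zeta_1\le\dots\le\zeta_n$ are random (jump) times and $\ell_1,\dots,\ell_n$ are random marks valued in a Borel subset $E$ of $\mathbb{R}^{\hat d}$. Write $\pmb\zeta_k=(\zeta_1,\dots,\zeta_k)$, $\pmb\ell_k=(\ell_1,\dots,\ell_k)$; fixed (deterministic) values of these are written $\pmb\theta_k=(\theta_1,\dots,\theta_k)$, $\pmb e_k=(e_1,\dots,e_k)$. For $k=0,\dots,n$ let $$\mathcal{D}^{k}_t=\bigvee_{i=1}^{k}\big(\sigma(1_{\{\zeta_i\leq s\}},\ s\leq t)\vee\sigma(\ell_i1_{\{\zeta_i\leq s\}},\ s\leq t)\big),\qquad \mathcal{G}^k_t=\mathcal{F}_t\vee\mathcal{D}^k_t,$$ $\mathbb{G}^k=(\mathcal{G}^k_t)_{t\ge0}$ (so $\mathbb{G}^0=\mathbb{F}$), and $\mathbb{G}=\mathbb{G}^n$ (not assumed right-continuous). $\Delta_0=\emptyset$ (no argument), $\Delta_k=\{(\theta_1,\dots,\theta_k):0\le\theta_1\le\dots\le\theta_k\}$, and $\Delta_k(T)=\Delta_k\cap[0,T]^k$. A $\mathcal{G}^k_\infty$-measurable random variable is written $X(\pmb\zeta_k,\pmb\ell_k)$ (a function of the Brownian path and of $(\pmb\zeta_k,\pmb\ell_k)$), and $X(\pmb\theta_k,\pmb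 e_k)$ is its value for given $\pmb\zeta_k=\pmb\theta_k$, $\pmb\ell_k=\pmb e_k$. $\mathcal{O}_\mathbb{F}$ (resp. $\mathcal{O}_\mathbb{G}$) is the $\sigma$-algebra on $\mathbb{R}_+\times\Omega$ generated by the right-continuous $\mathbb{F}$- (resp. $\mathbb{G}$-) adapted processes; a process is $\mathbb G$-optional if it is $\mathcal O_{\mathbb G}$-measurable. $\mathcal{O}_{\mathbb{F}}(\Delta_k,E^k)$ is the set of indexed processes $Z^k$ such that $(t,\omega,\pmb\theta_k,\pmb e_k)\mapsto Z^k_t(\omega,\pmb\theta_k,\pmb e_k)$ is $\mathcal{O}_\mathbb{F}\otimes\mathcal{B}(\Delta_k)\otimes\mathcal{B}(E^k)$-measurable ($\mathcal{O}_{\mathbb{F}}(\Delta_0,E^0)=\mathcal{O}_\mathbb{F}$). Standing assumption (density). There is $\alpha\in\mathcal{O}_{\mathbb{F}}(\Delta_n,E^n)$ with, for all $t$, $$\mathbb{P}\big[(\zeta_1,\dots,\zeta_n,\ell_1,\dots,\ell_n)\in d\theta_1\cdots d\theta_n\, de_1\cdots de_n\,|\,\mathcal{F}_t\big]=\alpha_t(\pmb\theta_n,\pmb e_n)\,d\theta_1\cdots d\theta_n\,\eta(de_1)\cdots\eta(de_n)\quad\text{a.s.},$$ where $d\theta_k$ is Lebesgue measure and $\eta(de_k)$ is a probability measure which may depend on $(\pmb\theta_{k-1},\pmb e_{k-1})$ (a transition kernel). Moreover $t\mapsto\alpha_t$ is right-continuous and $\mathbb{E}\big[\int_{E^n}\int_{\Delta_n}\sup_{t\ge0}\alpha_t(\pmb\theta_n,\pmb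 e_n)\,d\theta_1\cdots d\theta_n\,\eta(de_1)\cdots\eta(de_n)\big]<\infty$. ($\alpha=0$ when $\theta_1,\dots,\theta_n$ are not in ascending order.) Set $\alpha^n_t=\alpha_t$ and, for $k=0,\dots,n-1$, $$\alpha_t^k(\pmb\theta_k,\pmb e_k)=\int_E\int_t^\infty \alpha_t^{k+1}(\pmb\theta_k,\theta_{k+1},\pmb e_k,e_{k+1})\,d\theta_{k+1}\,\eta(de_{k+1}).$$ Notation $Z\sim(Z^0,\dots,Z^n)$: $Z^k\in\mathcal{O}_{\mathbb{F}}(\Delta_k,E^k)$ and $Z_t=Z_t^0 1_{\{t<\zeta_1\}}+\sum_{k=1}^{n-1}Z_t^k(\pmb\zeta_k,\pmb\ell_k)1_{\{\zeta_k\leq t<\zeta_{k+1}\}}+Z_t^n(\pmb\zeta_n,\pmb\ell_n)1_{\{\zeta_n\leq t\}}$ (every $\mathbb{G}$-optional process has such a decomposition). Notation $\tau\sim(\tau^0,\dots,\tau^n)$: $\tau^0$ is an $\mathbb{F}$-stopping time, $\tau^k=\tau^k(\pmb\zeta_k,\pmb\ell_k)$ is a $\mathbb{G}^k$-stopping time with $\tau^k\ge\zeta_k$ for $k=1,\dots,n$, and $$\tau=\tau^0 1_{\{\tau^0<\zeta_1\}}+\sum_{k=1}^{n-1}\tau^k 1_{\{\tau^0\geq\zeta_1\}\cap\dots\cap\{\tau^{k-1}\geq\zeta_k\}\cap\{\tau^k <\zeta_{k+1}\}}+\tau^n 1_{\{\tau^0\geq\zeta_1\}\cap\dots\cap\{\tau^{n-1}\geq\zeta_n\}}$$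 (every $\mathbb{G}$-stopping time has such a decomposition).
   Formalization: The functions τ^k are additionally assumed to be F-stopping times with τ^k(θ_k,e_k) ≥ θ_k at every fixed (θ_k,e_k); for an arbitrary representative of τ^k(ζ_k,ℓ_k) the formula can fail. The term Z^k α^k is read as 0 where τ^k = ∞. *)

theory Defs
  imports "HOL-Probability.Probability"
begin

section \<open>Brownian filtration\<close>

text \<open>
  Filtrations are indexed by \<^typ>\<open>ennreal\<close>, so that the library predicate \<^const>\<open>stopping_time\<close>
  covers stopping times with values in \<open>[0,\<infinity>]\<close>; the index \<open>\<infinity>\<close> carries the terminal
  sigma-algebra. Processes are indexed by real \<open>t \<ge> 0\<close>.
\<close>

definition rv_events :: "'a set \<Rightarrow> ('a \<Rightarrow> 'b::topological_space) \<Rightarrow> 'a set set" where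
  "rv_events \<Omega> X = {X -` B \<inter> \<Omega> | B. B \<in> sets borel}"

definition brownian_motion :: "'a measure \<Rightarrow> (real \<Rightarrow> 'a \<Rightarrow> 'w::euclidean_space) \<Rightarrow> bool" where
  "brownian_motion M W \<longleftrightarrow>
     prob_space M \<and>
     (\<forall>t\<ge>0. W t \<in> borel_measurable M) \<and>
     (AE \<omega> in M. W 0 \<omega> = 0) \<and>
     (\<forall>\<omega>\<in>space M. continuous_on {0..} (\<lambda>t. W t \<omega>)) \<and>
     (\<forall>s t. 0 \<le> s \<and> s < t \<longrightarrow>
        distributed M lborel (\<lambda>\<omega>. W t \<omega> - W s \<omega>)
          (\<lambda>x. ennreal (\<Prod>b\<in>Basis. normal_density 0 (sqrt (t - s)) (x \<bullet> b)))) \<and>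
     (\<forall>(t::nat \<Rightarrow> real) m. 0 \<le> t 0 \<and> mono t \<longrightarrow>
        prob_space.indep_vars M (\<lambda>_. borel) (\<lambda>i \<omega>. W (t (Suc i)) \<omega> - W (t i) \<omega>) {..<m})"

definition brownian_filtration ::
    "'a measure \<Rightarrow> (real \<Rightarrow> 'a \<Rightarrow> 'w::euclidean_space) \<Rightarrow> ennreal \<Rightarrow> 'a measure" where
  "brownian_filtration M W t =
     sigma (space M) ((\<Union>s\<in>{s. 0 \<le> s \<and> ennreal s \<le> t}. rv_events (space M) (W s)) \<union> null_sets M)"

definition usual_conditions :: "'a measure \<Rightarrow> (ennreal \<Rightarrow> 'a measure) \<Rightarrow> bool" where
  "usual_conditions M F \<longleftrightarrow>
     complete_measure M \<and> null_sets M \<subseteq> sets (F 0) \<and>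
     (\<forall>t<\<infinity>. (\<Inter>s\<in>{t<..}. sets (F s)) = sets (F t))"

section \<open>Jump times and marks\<close>

text \<open>
  A vector \<open>(x\<^sub>1, \<dots>, x\<^sub>k)\<close> is an extensional function on \<open>{1..k}\<close>; the empty vector is
  \<open>\<lambda>_. undefined\<close>, and a vector of length \<open>k\<close> is extended by \<open>x\<close> as \<open>v(Suc k := x)\<close>.
\<close>

definition initial :: "nat \<Rightarrow> (nat \<Rightarrow> 'a \<Rightarrow> 'b) \<Rightarrow> 'a \<Rightarrow> nat \<Rightarrow> 'b" where
  "initial k X \<omega> = (\<lambda>i\<in>{1..k}. X i \<omega>)"

definition Delta :: "nat \<Rightarrow> (nat \<Rightarrow> real) set" where
  "Delta k = {\<theta> \<in> {1..k} \<rightarrow>\<^sub>E UNIV.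
     (\<forall>i\<in>{1..k}. 0 \<le> \<theta> i) \<and> (\<forall>i\<in>{1..k}. \<forall>j\<in>{1..k}. i \<le> j \<longrightarrow> \<theta> i \<le> \<theta> j)}"

definition Delta_upto :: "nat \<Rightarrow> ennreal \<Rightarrow> (nat \<Rightarrow> real) set" where
  "Delta_upto k T = {\<theta> \<in> Delta k. \<forall>i\<in>{1..k}. ennreal (\<theta> i) \<le> T}"

definition time_space :: "nat \<Rightarrow> (nat \<Rightarrow> real) set \<Rightarrow> (nat \<Rightarrow> real) measure" where
  "time_space k D = restrict_space (\<Pi>\<^sub>M i\<in>{1..k}. borel) D"

definition mark_space :: "'e::euclidean_space set \<Rightarrow> nat \<Rightarrow> (nat \<Rightarrow> 'e) measure" where
  "mark_space E k = (\<Pi>\<^sub>M i\<in>{1..k}. restrict_space borel E)"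

definition last_time :: "nat \<Rightarrow> (nat \<Rightarrow> real) \<Rightarrow> real" where
  "last_time k \<theta> = (if k = 0 then 0 else \<theta> k)"

definition jump_times_marks ::
    "'a measure \<Rightarrow> 'e::euclidean_space set \<Rightarrow> nat \<Rightarrow> (nat \<Rightarrow> 'a \<Rightarrow> real) \<Rightarrow> (nat \<Rightarrow> 'a \<Rightarrow> 'e) \<Rightarrow> bool"
  where
  "jump_times_marks M E n \<zeta> L \<longleftrightarrow>
     (\<forall>i\<in>{1..n}. \<zeta> i \<in> borel_measurable M \<and> L i \<in> M \<rightarrow>\<^sub>M restrict_space borel E) \<and>
     (\<forall>\<omega>\<in>space M. initial n \<zeta> \<omega> \<in> Delta n)"

definition jump_algebra ::
    "'a measure \<Rightarrow> (nat \<Rightarrow> 'a \<Rightarrow> real) \<Rightarrow> (nat \<Rightarrow> 'a \<Rightarrow> 'e::euclidean_space) \<Rightarrow> nat \<Rightarrow> ennreal \<Rightarrow> 'a measure"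
  where
  "jump_algebra M \<zeta> L k t = sigma (space M)
     (\<Union>i\<in>{1..k}. \<Union>s\<in>{s. 0 \<le> s \<and> ennreal s \<le> t}.
        rv_events (space M) (\<lambda>\<omega>. of_bool (\<zeta> i \<omega> \<le> s) :: real) \<union>
        rv_events (space M) (\<lambda>\<omega>. of_bool (\<zeta> i \<omega> \<le> s) *\<^sub>R L i \<omega>))"

definition enlarged_filtration ::
    "'a measure \<Rightarrow> (ennreal \<Rightarrow> 'a measure) \<Rightarrow> (nat \<Rightarrow> 'a \<Rightarrow> real) \<Rightarrow> (nat \<Rightarrow> 'a \<Rightarrow> 'e::euclidean_space)
      \<Rightarrow> nat \<Rightarrow> ennreal \<Rightarrow> 'a measure" where
  "enlarged_filtration M F \<zeta> L k t = sigma (space M) (sets (F t) \<union> sets (jump_algebra M \<zeta> L k t))"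

section \<open>Optional processes\<close>

definition right_continuous_process :: "'a measure \<Rightarrow> (real \<Rightarrow> 'a \<Rightarrow> real) \<Rightarrow> bool" where
  "right_continuous_process M X \<longleftrightarrow> (\<forall>\<omega>\<in>space M. \<forall>t\<ge>0. continuous (at_right t) (\<lambda>s. X s \<omega>))"

definition adapted_process :: "(ennreal \<Rightarrow> 'a measure) \<Rightarrow> (real \<Rightarrow> 'a \<Rightarrow> real) \<Rightarrow> bool" where
  "adapted_process F X \<longleftrightarrow> (\<forall>t\<ge>0. X t \<in> borel_measurable (F (ennreal t)))"

definition optional_algebra :: "'a measure \<Rightarrow> (ennreal \<Rightarrow> 'a measure) \<Rightarrow> (real \<times> 'a) measure" where
  "optional_algebra M F = sigma ({0..} \<times> space M)
     (\<Union>X\<in>{X. right_continuous_process M X \<and> adapted_process F X}.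
        rv_events ({0..} \<times> space M) (\<lambda>(t, \<omega>). X t \<omega>))"

definition optional_process ::
    "'a measure \<Rightarrow> (ennreal \<Rightarrow> 'a measure) \<Rightarrow> (real \<Rightarrow> 'a \<Rightarrow> real) \<Rightarrow> bool" where
  "optional_process M F Z \<longleftrightarrow> (\<lambda>(t, \<omega>). Z t \<omega>) \<in> borel_measurable (optional_algebra M F)"

definition indexed_optional ::
    "'a measure \<Rightarrow> (ennreal \<Rightarrow> 'a measure) \<Rightarrow> 'e::euclidean_space set \<Rightarrow> nat
      \<Rightarrow> (real \<Rightarrow> 'a \<Rightarrow> (nat \<Rightarrow> real) \<Rightarrow> (nat \<Rightarrow> 'e) \<Rightarrow> real) \<Rightarrow> bool" where
  "indexed_optional M F E k Z \<longleftrightarrow>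
     (\<lambda>((t, \<omega>), (\<theta>, e)). Z t \<omega> \<theta> e)
       \<in> borel_measurable (optional_algebra M F \<Otimes>\<^sub>M (time_space k (Delta k) \<Otimes>\<^sub>M mark_space E k))"

section \<open>The density assumption\<close>

type_synonym 'e mark_kernels = "nat \<Rightarrow> (nat \<Rightarrow> real) \<Rightarrow> (nat \<Rightarrow> 'e) \<Rightarrow> 'e measure"

text \<open>\<open>\<eta> (Suc k) \<theta> e\<close> is the measure \<open>\<eta>(de\<^bsub>k+1\<^esub>)\<close>, given the first \<open>k\<close> times and marks.\<close>

definition transition_kernels :: "'e::euclidean_space set \<Rightarrow> nat \<Rightarrow> 'e mark_kernels \<Rightarrow> bool" where
  "transition_kernels E n \<eta> \<longleftrightarrow>
     (\<forall>k<n. (\<lambda>(\<theta>, e). \<eta> (Suc k) \<theta> e)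
        \<in> time_space k (Delta k) \<Otimes>\<^sub>M mark_space E k \<rightarrow>\<^sub>M prob_algebra (restrict_space borel E))"

text \<open>
  \<open>ref_integral \<eta> f m k \<theta> e\<close> integrates \<open>f\<close> over the \<open>m\<close> times and marks that follow
  the first \<open>k\<close> ones \<open>(\<theta>, e)\<close>, times being restricted to ascending order. Since \<open>\<eta>\<close> may
  depend on the earlier times and marks, the integral against
  \<open>d\<theta>\<^sub>1 \<dots> d\<theta>\<^sub>n \<eta>(de\<^sub>1) \<dots> \<eta>(de\<^sub>n)\<close> has to be iterated, with \<open>(\<theta>\<^sub>1, e\<^sub>1)\<close> outermost.
\<close>

primrec ref_integral ::
    "'e mark_kernels \<Rightarrow> ((nat \<Rightarrow> real) \<Rightarrow> (nat \<Rightarrow> 'e) \<Rightarrow> ennreal)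
      \<Rightarrow> nat \<Rightarrow> nat \<Rightarrow> (nat \<Rightarrow> real) \<Rightarrow> (nat \<Rightarrow> 'e) \<Rightarrow> ennreal" where
  "ref_integral \<eta> f 0 k \<theta> e = f \<theta> e"
| "ref_integral \<eta> f (Suc m) k \<theta> e =
     (\<integral>\<^sup>+u\<in>{last_time k \<theta>..}.
        (\<integral>\<^sup>+x. ref_integral \<eta> f m (Suc k) (\<theta>(Suc k := u)) (e(Suc k := x)) \<partial>\<eta> (Suc k) \<theta> e) \<partial>lborel)"

definition jump_density ::
    "'a measure \<Rightarrow> (ennreal \<Rightarrow> 'a measure) \<Rightarrow> 'e::euclidean_space set \<Rightarrow> nat
      \<Rightarrow> (nat \<Rightarrow> 'a \<Rightarrow> real) \<Rightarrow> (nat \<Rightarrow> 'a \<Rightarrow> 'e) \<Rightarrow> 'e mark_kernels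
      \<Rightarrow> (real \<Rightarrow> 'a \<Rightarrow> (nat \<Rightarrow> real) \<Rightarrow> (nat \<Rightarrow> 'e) \<Rightarrow> real) \<Rightarrow> bool" where
  "jump_density M F E n \<zeta> L \<eta> \<alpha> \<longleftrightarrow>
     indexed_optional M F E n \<alpha> \<and>
     (\<forall>t\<ge>0. \<forall>\<omega>\<in>space M. \<forall>\<theta>\<in>Delta n. \<forall>e\<in>space (mark_space E n). 0 \<le> \<alpha> t \<omega> \<theta> e) \<and>
     (\<forall>t \<omega> \<theta> e. \<theta> \<notin> Delta n \<longrightarrow> \<alpha> t \<omega> \<theta> e = 0) \<and>
     (\<forall>\<theta>\<in>Delta n. \<forall>e\<in>space (mark_space E n). right_continuous_process M (\<lambda>t \<omega>. \<alpha> t \<omega> \<theta> e)) \<and>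
     (\<forall>t\<ge>0. \<forall>A\<in>sets (time_space n (Delta n) \<Otimes>\<^sub>M mark_space E n). AE \<omega> in M.
        nn_cond_exp M (F (ennreal t)) (\<lambda>\<omega>. indicator A (initial n \<zeta> \<omega>, initial n L \<omega>)) \<omega> =
        ref_integral \<eta> (\<lambda>\<theta> e. indicator A (\<theta>, e) * ennreal (\<alpha> t \<omega> \<theta> e)) n 0
          (\<lambda>_. undefined) (\<lambda>_. undefined)) \<and>
     (\<integral>\<^sup>+\<omega>. ref_integral \<eta> (\<lambda>\<theta> e. SUP t\<in>{0..}. ennreal (\<alpha> t \<omega> \<theta> e)) n 0
        (\<lambda>_. undefined) (\<lambda>_. undefined) \<partial>M) < \<infinity>"

text \<open>\<open>alpha_rec \<eta> \<alpha> m k\<close> is \<open>\<alpha>\<^sup>k\<close> when \<open>k + m = n\<close>; the recursion runs downwards from \<open>\<alpha>\<^sup>n = \<alpha>\<close>.\<close>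

primrec alpha_rec ::
    "'e mark_kernels \<Rightarrow> (real \<Rightarrow> 'a \<Rightarrow> (nat \<Rightarrow> real) \<Rightarrow> (nat \<Rightarrow> 'e) \<Rightarrow> real)
      \<Rightarrow> nat \<Rightarrow> nat \<Rightarrow> real \<Rightarrow> 'a \<Rightarrow> (nat \<Rightarrow> real) \<Rightarrow> (nat \<Rightarrow> 'e) \<Rightarrow> ennreal" where
  "alpha_rec \<eta> \<alpha> 0 k t \<omega> \<theta> e = ennreal (\<alpha> t \<omega> \<theta> e)"
| "alpha_rec \<eta> \<alpha> (Suc m) k t \<omega> \<theta> e =
     (\<integral>\<^sup>+x. (\<integral>\<^sup>+u\<in>{t..}.
        alpha_rec \<eta> \<alpha> m (Suc k) t \<omega> (\<theta>(Suc k := u)) (e(Suc k := x)) \<partial>lborel) \<partial>\<eta> (Suc k) \<theta> e)"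

definition alpha_k ::
    "nat \<Rightarrow> 'e mark_kernels \<Rightarrow> (real \<Rightarrow> 'a \<Rightarrow> (nat \<Rightarrow> real) \<Rightarrow> (nat \<Rightarrow> 'e) \<Rightarrow> real)
      \<Rightarrow> nat \<Rightarrow> real \<Rightarrow> 'a \<Rightarrow> (nat \<Rightarrow> real) \<Rightarrow> (nat \<Rightarrow> 'e) \<Rightarrow> ennreal" where
  "alpha_k n \<eta> \<alpha> k = alpha_rec \<eta> \<alpha> (n - k) k"

section \<open>Decompositions\<close>

definition process_decomposition ::
    "'a measure \<Rightarrow> (ennreal \<Rightarrow> 'a measure) \<Rightarrow> 'e::euclidean_space set \<Rightarrow> nat
      \<Rightarrow> (nat \<Rightarrow> 'a \<Rightarrow> real) \<Rightarrow> (nat \<Rightarrow> 'a \<Rightarrow> 'e) \<Rightarrow> (real \<Rightarrow> 'a \<Rightarrow> real)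
      \<Rightarrow> (nat \<Rightarrow> real \<Rightarrow> 'a \<Rightarrow> (nat \<Rightarrow> real) \<Rightarrow> (nat \<Rightarrow> 'e) \<Rightarrow> real) \<Rightarrow> bool" where
  "process_decomposition M F E n \<zeta> L Z Zs \<longleftrightarrow>
     (\<forall>k\<le>n. indexed_optional M F E k (Zs k)) \<and>
     (AE \<omega> in M. \<forall>t\<ge>0.
        (let z = (\<lambda>k. Zs k t \<omega> (initial k \<zeta> \<omega>) (initial k L \<omega>))
         in Z t \<omega> = z 0 * of_bool (t < \<zeta> 1 \<omega>)
              + (\<Sum>k=1..n - 1. z k * of_bool (\<zeta> k \<omega> \<le> t \<and> t < \<zeta> (Suc k) \<omega>))
              + z n * of_bool (\<zeta> n \<omega> \<le> t)))"

text \<open>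
  \<open>\<tau>s k\<close> is the function of the Brownian path and of the first \<open>k\<close> times and marks that
  represents \<open>\<tau>\<^sup>k\<close>. That \<open>\<tau>\<^sup>k(\<theta>, e)\<close> is an \<open>F\<close>-stopping time for fixed \<open>(\<theta>, e)\<close> does not follow
  from \<open>\<tau>\<^sup>k(\<zeta>, L)\<close> being a \<open>G\<^sup>k\<close>-stopping time, because the latter does not constrain \<open>\<tau>s k\<close>
  where the joint law of path, times and marks has no mass (for instance where the density
  has become zero). For \<open>k = 0\<close> it says that \<open>\<tau>\<^sup>0\<close> is an \<open>F\<close>-stopping time.
\<close>

definition stopping_decomposition ::
    "'a measure \<Rightarrow> (ennreal \<Rightarrow> 'a measure) \<Rightarrow> 'e::euclidean_space set \<Rightarrow> nat
      \<Rightarrow> (nat \<Rightarrow> 'a \<Rightarrow> real) \<Rightarrow> (nat \<Rightarrow> 'a \<Rightarrow> 'e) \<Rightarrow> ('a \<Rightarrow> ennreal)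
      \<Rightarrow> (nat \<Rightarrow> 'a \<Rightarrow> (nat \<Rightarrow> real) \<Rightarrow> (nat \<Rightarrow> 'e) \<Rightarrow> ennreal) \<Rightarrow> bool" where
  "stopping_decomposition M F E n \<zeta> L \<tau> \<tau>s \<longleftrightarrow>
     (\<forall>k\<le>n. (\<lambda>(\<omega>, \<theta>, e). \<tau>s k \<omega> \<theta> e)
        \<in> borel_measurable (F \<infinity> \<Otimes>\<^sub>M (time_space k (Delta k) \<Otimes>\<^sub>M mark_space E k))) \<and>
     (\<forall>k\<le>n. \<forall>\<theta>\<in>Delta k. \<forall>e\<in>space (mark_space E k). stopping_time F (\<lambda>\<omega>. \<tau>s k \<omega> \<theta> e)) \<and>
     (\<forall>k\<in>{1..n}. stopping_time (enlarged_filtration M F \<zeta> L k)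
        (\<lambda>\<omega>. \<tau>s k \<omega> (initial k \<zeta> \<omega>) (initial k L \<omega>))) \<and>
     (\<forall>k\<in>{1..n}. \<forall>\<omega>\<in>space M. \<forall>\<theta>\<in>Delta k. \<forall>e\<in>space (mark_space E k).
        ennreal (\<theta> k) \<le> \<tau>s k \<omega> \<theta> e) \<and>
     (AE \<omega> in M.
        (let r = (\<lambda>k. \<tau>s k \<omega> (initial k \<zeta> \<omega>) (initial k L \<omega>));
             s = (\<lambda>k. ennreal (\<zeta> k \<omega>))
         in \<tau> \<omega> = r 0 * of_bool (r 0 < s 1)
              + (\<Sum>k=1..n - 1. r k * of_bool ((\<forall>j<k. r j \<ge> s (Suc j)) \<and> r k < s (Suc k)))
              + r n * of_bool (\<forall>j<n. r j \<ge> s (Suc j))))"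

section \<open>The backward recursion\<close>

text \<open>
  The term \<open>Z\<^sup>k \<alpha>\<^sup>k\<close> at time \<open>\<tau>\<^sup>k\<close> is read as \<open>0\<close> where \<open>\<tau>\<^sup>k = \<infinity>\<close>. For \<open>k < n\<close> this agrees with
  \<open>\<alpha>\<^sup>k\<^sub>t \<longlongrightarrow> 0\<close> as \<open>t \<longlongrightarrow> \<infinity>\<close> (dominated convergence); for \<open>k = n\<close> a finite \<open>\<tau>\<close> leaves that event without mass.
\<close>

definition stopped_nn ::
    "nat \<Rightarrow> 'e mark_kernels \<Rightarrow> (real \<Rightarrow> 'a \<Rightarrow> (nat \<Rightarrow> real) \<Rightarrow> (nat \<Rightarrow> 'e) \<Rightarrow> real)
      \<Rightarrow> (nat \<Rightarrow> real \<Rightarrow> 'a \<Rightarrow> (nat \<Rightarrow> real) \<Rightarrow> (nat \<Rightarrow> 'e) \<Rightarrow> real)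
      \<Rightarrow> (nat \<Rightarrow> 'a \<Rightarrow> (nat \<Rightarrow> real) \<Rightarrow> (nat \<Rightarrow> 'e) \<Rightarrow> ennreal)
      \<Rightarrow> nat \<Rightarrow> 'a \<Rightarrow> (nat \<Rightarrow> real) \<Rightarrow> (nat \<Rightarrow> 'e) \<Rightarrow> ennreal" where
  "stopped_nn n \<eta> \<alpha> Zs \<tau>s k \<omega> \<theta> e =
     (if \<tau>s k \<omega> \<theta> e = \<infinity> then 0
      else let t = enn2real (\<tau>s k \<omega> \<theta> e) in ennreal (Zs k t \<omega> \<theta> e) * alpha_k n \<eta> \<alpha> k t \<omega> \<theta> e)"

definition stopped_real ::
    "nat \<Rightarrow> 'e mark_kernels \<Rightarrow> (real \<Rightarrow> 'a \<Rightarrow> (nat \<Rightarrow> real) \<Rightarrow> (nat \<Rightarrow> 'e) \<Rightarrow> real)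
      \<Rightarrow> (nat \<Rightarrow> real \<Rightarrow> 'a \<Rightarrow> (nat \<Rightarrow> real) \<Rightarrow> (nat \<Rightarrow> 'e) \<Rightarrow> real)
      \<Rightarrow> (nat \<Rightarrow> 'a \<Rightarrow> (nat \<Rightarrow> real) \<Rightarrow> (nat \<Rightarrow> 'e) \<Rightarrow> ennreal)
      \<Rightarrow> nat \<Rightarrow> 'a \<Rightarrow> (nat \<Rightarrow> real) \<Rightarrow> (nat \<Rightarrow> 'e) \<Rightarrow> real" where
  "stopped_real n \<eta> \<alpha> Zs \<tau>s k \<omega> \<theta> e =
     (if \<tau>s k \<omega> \<theta> e = \<infinity> then 0
      else let t = enn2real (\<tau>s k \<omega> \<theta> e) in Zs k t \<omega> \<theta> e * enn2real (alpha_k n \<eta> \<alpha> k t \<omega> \<theta> e))"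

text \<open>
  Conditional expectations are unique only up to null sets, so \<open>J\<close> ranges over families of
  versions; joint measurability is what makes the integral of \<open>J (Suc k)\<close> meaningful.
  \<open>backward_nn\<close> is the recursion with values in \<open>[0,\<infinity>]\<close>, for nonnegative processes,
  \<open>backward_real\<close> the one with real values, for bounded processes.
\<close>

definition backward_nn ::
    "'a measure \<Rightarrow> (ennreal \<Rightarrow> 'a measure) \<Rightarrow> 'e::euclidean_space set \<Rightarrow> nat \<Rightarrow> 'e mark_kernels
      \<Rightarrow> (real \<Rightarrow> 'a \<Rightarrow> (nat \<Rightarrow> real) \<Rightarrow> (nat \<Rightarrow> 'e) \<Rightarrow> real)
      \<Rightarrow> (nat \<Rightarrow> real \<Rightarrow> 'a \<Rightarrow> (nat \<Rightarrow> real) \<Rightarrow> (nat \<Rightarrow> 'e) \<Rightarrow> real)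
      \<Rightarrow> (nat \<Rightarrow> 'a \<Rightarrow> (nat \<Rightarrow> real) \<Rightarrow> (nat \<Rightarrow> 'e) \<Rightarrow> ennreal) \<Rightarrow> ennreal
      \<Rightarrow> (nat \<Rightarrow> 'a \<Rightarrow> (nat \<Rightarrow> real) \<Rightarrow> (nat \<Rightarrow> 'e) \<Rightarrow> ennreal) \<Rightarrow> bool" where
  "backward_nn M F E n \<eta> \<alpha> Zs \<tau>s T J \<longleftrightarrow>
     (\<forall>k\<le>n. (\<lambda>(\<omega>, \<theta>, e). J k \<omega> \<theta> e)
        \<in> borel_measurable (M \<Otimes>\<^sub>M (time_space k (Delta_upto k T) \<Otimes>\<^sub>M mark_space E k))) \<and>
     (\<forall>\<theta>\<in>Delta_upto n T. \<forall>e\<in>space (mark_space E n). AE \<omega> in M.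
        J n \<omega> \<theta> e =
        nn_cond_exp M (F (ennreal (last_time n \<theta>))) (\<lambda>\<omega>. stopped_nn n \<eta> \<alpha> Zs \<tau>s n \<omega> \<theta> e) \<omega>) \<and>
     (\<forall>k<n. \<forall>\<theta>\<in>Delta_upto k T. \<forall>e\<in>space (mark_space E k). AE \<omega> in M.
        J k \<omega> \<theta> e =
        nn_cond_exp M (F (ennreal (last_time k \<theta>)))
          (\<lambda>\<omega>. stopped_nn n \<eta> \<alpha> Zs \<tau>s k \<omega> \<theta> e +
             (\<integral>\<^sup>+u\<in>{u. last_time k \<theta> \<le> u \<and> ennreal u \<le> min (\<tau>s k \<omega> \<theta> e) T}.
                (\<integral>\<^sup>+x. J (Suc k) \<omega> (\<theta>(Suc k := u)) (e(Suc k := x)) \<partial>\<eta> (Suc k) \<theta> e) \<partial>lborel)) \<omega>)"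

definition backward_real ::
    "'a measure \<Rightarrow> (ennreal \<Rightarrow> 'a measure) \<Rightarrow> 'e::euclidean_space set \<Rightarrow> nat \<Rightarrow> 'e mark_kernels
      \<Rightarrow> (real \<Rightarrow> 'a \<Rightarrow> (nat \<Rightarrow> real) \<Rightarrow> (nat \<Rightarrow> 'e) \<Rightarrow> real)
      \<Rightarrow> (nat \<Rightarrow> real \<Rightarrow> 'a \<Rightarrow> (nat \<Rightarrow> real) \<Rightarrow> (nat \<Rightarrow> 'e) \<Rightarrow> real)
      \<Rightarrow> (nat \<Rightarrow> 'a \<Rightarrow> (nat \<Rightarrow> real) \<Rightarrow> (nat \<Rightarrow> 'e) \<Rightarrow> ennreal) \<Rightarrow> ennreal
      \<Rightarrow> (nat \<Rightarrow> 'a \<Rightarrow> (nat \<Rightarrow> real) \<Rightarrow> (nat \<Rightarrow> 'e) \<Rightarrow> real) \<Rightarrow> bool" where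
  "backward_real M F E n \<eta> \<alpha> Zs \<tau>s T J \<longleftrightarrow>
     (\<forall>k\<le>n. (\<lambda>(\<omega>, \<theta>, e). J k \<omega> \<theta> e)
        \<in> borel_measurable (M \<Otimes>\<^sub>M (time_space k (Delta_upto k T) \<Otimes>\<^sub>M mark_space E k))) \<and>
     (\<forall>\<theta>\<in>Delta_upto n T. \<forall>e\<in>space (mark_space E n). AE \<omega> in M.
        J n \<omega> \<theta> e =
        real_cond_exp M (F (ennreal (last_time n \<theta>))) (\<lambda>\<omega>. stopped_real n \<eta> \<alpha> Zs \<tau>s n \<omega> \<theta> e) \<omega>) \<and>
     (\<forall>k<n. \<forall>\<theta>\<in>Delta_upto k T. \<forall>e\<in>space (mark_space E k). AE \<omega> in M.
        J k \<omega> \<theta> e =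
        real_cond_exp M (F (ennreal (last_time k \<theta>)))
          (\<lambda>\<omega>. stopped_real n \<eta> \<alpha> Zs \<tau>s k \<omega> \<theta> e +
             (LINT u:{u. last_time k \<theta> \<le> u \<and> ennreal u \<le> min (\<tau>s k \<omega> \<theta> e) T}|lborel.
                (LINT x|\<eta> (Suc k) \<theta> e. J (Suc k) \<omega> (\<theta>(Suc k := u)) (e(Suc k := x))))) \<omega>)"

end

theory Submission
  imports Defs
begin

text \<open>
  On the event that \<open>\<tau>\<close> stops after exactly \<open>k\<close> jumps, \<open>Z\<^sub>\<tau> = Z\<^sup>k\<close> at time \<open>\<tau>\<^sup>k\<close>. The joint law of path, jump times
  and marks has the density \<open>\<alpha>\<^sub>t\<close> on \<open>F\<^sub>t\<close> with respect to the product of \<open>P\<close> and the reference measure, for every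
  fixed \<open>t\<close>. This extends to stopping times \<open>\<tau>\<^sup>k(\<theta>, e)\<close> that depend on the jumps: approximate \<open>\<tau>\<^sup>k\<close> from the right
  by dyadic times and use right continuity of \<open>\<alpha>\<close> and the integrable bound \<open>sup\<^sub>t \<alpha>\<^sub>t\<close>. Integrating out the jumps after
  the \<open>k\<close>-th one turns \<open>\<alpha>\<close> into \<open>\<alpha>\<^sup>k\<close>, so the expectation of \<open>Z\<^sub>\<tau>\<close> on this event is the integral of
  \<open>Z\<^sup>k \<alpha>\<^sup>k\<close> at time \<open>\<tau>\<^sup>k\<close> over the set where \<open>\<tau>\<^sup>0 \<ge> \<theta>\<^sub>1, \<dots>, \<tau>\<^sup>k\<^sup>-\<^sup>1 \<ge> \<theta>\<^sub>k\<close>. That set is \<open>F\<close>-measurable at time \<open>\<theta>\<^sub>k\<close>, so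
  the conditional expectations in the recursion drop out and \<open>J\<^sub>0\<close> sums up the same integrals; it is
  constant because \<open>F\<^sub>0\<close> is trivial. Versions of the \<open>J\<^sub>k\<close> that are jointly measurable exist because
  conditional expectations given \<open>F\<^sub>t\<close> are right continuous in \<open>t\<close>. A bounded \<open>Z\<close> is split into its
  positive and negative parts; the real recursion agrees with the difference of the two nonnegative ones
  only where the \<open>k\<close>-th stage is reached.
\<close>

section \<open>Conditional expectations along a right-continuous filtration\<close>

text \<open>The obstacle is joint measurability. For fixed \<open>(\<theta>, e)\<close> the data of
  stage \<open>k\<close> are adapted, but as functions of path and jumps they are measurable only
  for \<open>F \<infinity>\<close>, whereas the density assumption speaks of \<open>F t\<close> at a
  fixed finite \<open>t\<close>. An integrand with \<open>F t\<close>-measurable sections is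
  therefore replaced by a version of its conditional expectation given \<open>F t\<close> that is
  jointly measurable for \<open>F t\<close> and the jumps. Both agree almost everywhere for the
  product of \<open>M\<close> and the reference measure, and the domination of the joint law on
  \<open>F \<infinity>\<close> carries the null set over to the actual jumps. Nonnegative
  expectations are formed with \<open>ennreal\<close>, which cuts negative numbers off at 0; the
  same statements applied to \<open>Z\<close> and \<open>-Z\<close> thus yield both parts of a
  bounded process. In the real recursion an integral that does not exist has the value 0, so
  differences may be formed only where both parts are finite. This is known almost everywhere on the
  set where a stage is reached, hence the comparison is an almost everywhere statement on that
  set.\<close>

locale usual_filtration = prob_space M for M :: "'a measure" +
  fixes F :: "ennreal \<Rightarrow> 'a measure"
  assumes subalg: "subalgebra M (F t)"
    and sets_F_mono: "s \<le> t \<Longrightarrow> sets (F s) \<subseteq> sets (F t)"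
    and right_cont: "t < \<infinity> \<Longrightarrow> (\<Inter>s\<in>{t<..}. sets (F s)) = sets (F t)"
begin

lemma space_F [simp]: "space (F t) = space M"
  using subalg[of t] by (simp add: subalgebra_def)

lemma sets_F_le: "sets (F t) \<subseteq> sets M"
  using subalg[of t] by (simp add: subalgebra_def)

lemma F_sub_M: "f \<in> F t \<rightarrow>\<^sub>M N \<Longrightarrow> f \<in> M \<rightarrow>\<^sub>M N"
  using measurable_from_subalg[OF subalg] by blast

lemma F_sub_F: "s \<le> t \<Longrightarrow> f \<in> F s \<rightarrow>\<^sub>M N \<Longrightarrow> f \<in> F t \<rightarrow>\<^sub>M N"
  using sets_F_mono[of s t] by (auto simp: measurable_def)

lemma sigma_finite_subalgebra_F: "sigma_finite_subalgebra M (F t)"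
  by (intro finite_measure_subalgebra_is_sigma_finite)
     (simp add: finite_measure_subalgebra_def finite_measure_subalgebra_axioms_def subalg finite_measure_axioms)

end

section \<open>Dyadic times to the right of a time, and almost sure convergence along them\<close>

definition dyadic_above :: "nat \<Rightarrow> real \<Rightarrow> real" where
  "dyadic_above m t = (of_int \<lfloor>2 ^ m * t\<rfloor> + 1) / 2 ^ m"

text \<open>The floor plus one, not the ceiling, so that the dyadic time lies strictly to the right
  of \<open>t\<close> even when \<open>t\<close> is itself dyadic; \<open>at_right t\<close>
  excludes \<open>t\<close>.\<close>

lemma dyadic_above_gt: "t < dyadic_above m t"
proof -
  have "2 ^ m * t < of_int \<lfloor>2 ^ m * t\<rfloor> + 1" by linarith
  then show ?thesis by (simp add: dyadic_above_def field_simps)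
qed

lemma dyadic_above_le: "dyadic_above m t \<le> t + (1/2) ^ m"
proof -
  have "of_int \<lfloor>2 ^ m * t\<rfloor> \<le> 2 ^ m * t" by linarith
  then show ?thesis by (simp add: dyadic_above_def field_simps power_divide)
qed

lemma dyadic_above_tendsto: "(\<lambda>m. dyadic_above m t) \<longlonglongrightarrow> t"
proof (rule tendsto_sandwich[of "\<lambda>_. t"])
  have "(\<lambda>m. t + (1/2) ^ m) \<longlonglongrightarrow> t + 0"
    by (intro tendsto_intros LIMSEQ_realpow_zero) auto
  then show "(\<lambda>m. t + (1/2) ^ m) \<longlonglongrightarrow> t" by simp
qed (auto intro!: always_eventually dyadic_above_le less_imp_le[OF dyadic_above_gt])

lemma measurable_dyadic_above [measurable]: "dyadic_above m \<in> borel_measurable borel"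
  unfolding dyadic_above_def by measurable

lemma summable_diff_imp_convergent:
  fixes f :: "nat \<Rightarrow> real"
  assumes "summable (\<lambda>n. f (Suc n) - f n)"
  shows "convergent f"
proof -
  have "convergent (\<lambda>n. \<Sum>i<n. f (Suc i) - f i)"
    using assms by (simp add: summable_iff_convergent)
  then have "convergent (\<lambda>n. f n - f 0)" by (simp add: sum_lessThan_telescope)
  then have "convergent (\<lambda>n. (f n - f 0) + f 0)" by (intro convergent_add convergent_const)
  then show ?thesis by simp
qed


text \<open>A limit depends on the tail of the sequence alone. Dropping finitely many terms later
  makes a limit of conditional expectations measurable for every \<open>F r\<close> with
  \<open>r\<close> beyond \<open>t\<close>. Both sides are the same definite description, so the
  identity holds for divergent sequences too.\<close>

lemma lim_shift:
  fixes f :: "nat \<Rightarrow> 'b::t2_space"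
  shows "lim (\<lambda>n. f (n + k)) = lim f"
proof -
  have "(\<lambda>n. f (n + k)) \<longlonglongrightarrow> L \<longleftrightarrow> f \<longlonglongrightarrow> L" for L
    using LIMSEQ_ignore_initial_segment LIMSEQ_offset by blast
  then show ?thesis by (simp add: lim_def)
qed

text \<open>The sum of the absolute increments has finite expectation by monotone convergence, hence
  is finite almost surely, and the sequence is the partial sum of its increments.\<close>

lemma (in finite_measure) AE_convergent_of_summable_increments:
  fixes X :: "nat \<Rightarrow> 'a \<Rightarrow> real" and b :: "nat \<Rightarrow> real"
  assumes int: "\<And>j. integrable M (X j)"
    and b: "\<And>j. (\<integral>x. \<bar>X (Suc j) x - X j x\<bar> \<partial>M) \<le> b j" and "summable b"
  shows "AE x in M. convergent (\<lambda>j. X j x)"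
proof -
  have [measurable]: "X j \<in> borel_measurable M" for j using int by auto
  have b0: "0 \<le> b j" for j
    using b[of j] by (smt (verit) integral_nonneg_AE AE_I2 abs_ge_zero)
  have "(\<integral>\<^sup>+x. (\<Sum>j. ennreal \<bar>X (Suc j) x - X j x\<bar>) \<partial>M) = (\<Sum>j. \<integral>\<^sup>+x. ennreal \<bar>X (Suc j) x - X j x\<bar> \<partial>M)"
    by (intro nn_integral_suminf) measurable
  also have "\<dots> \<le> (\<Sum>j. ennreal (b j))"
  proof (rule suminf_le)
    fix j
    have "(\<integral>\<^sup>+x. ennreal \<bar>X (Suc j) x - X j x\<bar> \<partial>M) = ennreal (\<integral>x. \<bar>X (Suc j) x - X j x\<bar> \<partial>M)"
      by (intro nn_integral_eq_integral) (auto intro!: integrable_abs Bochner_Integration.integrable_diff int)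
    also have "\<dots> \<le> ennreal (b j)" using b by (intro ennreal_leI)
    finally show "(\<integral>\<^sup>+x. ennreal \<bar>X (Suc j) x - X j x\<bar> \<partial>M) \<le> ennreal (b j)" .
  qed auto
  also have "\<dots> < \<infinity>" using \<open>summable b\<close> b0 by (simp add: suminf_ennreal2 less_top)
  finally have "AE x in M. (\<Sum>j. ennreal \<bar>X (Suc j) x - X j x\<bar>) \<noteq> \<infinity>"
    by (intro nn_integral_PInf_AE) auto
  then show ?thesis
  proof eventually_elim
    case (elim x)
    then have "summable (\<lambda>j. \<bar>X (Suc j) x - X j x\<bar>)"
      by (intro summable_suminf_not_top) auto
    then show "convergent (\<lambda>j. X j x)"
      by - (rule summable_diff_imp_convergent, rule summable_rabs_cancel)
  qed
qed

context usual_filtration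
begin

text \<open>
  Almost sure convergence of backward martingales is avoided: the norms \<open>v t = E[P(A|F\<^sub>t)\<^sup>2]\<close> are monotone in
  \<open>t\<close>, and \<open>E[(P(A|F\<^sub>t) - P(A|F\<^sub>s))\<^sup>2] = v t - v s\<close>. Hence along dyadic times \<open>s j t\<close> that decrease to \<open>t\<close>
  and are chosen, measurably in \<open>t\<close>, with \<open>v (s j t)\<close> within \<open>4\<^sup>-\<^sup>j\<close> of the right limit of \<open>v\<close>, the versions
  \<open>c (s j t)\<close> converge almost surely.
\<close>

lemma cond_exp_indicator_jointly_measurable:
  assumes A [measurable]: "A \<in> sets M"
  shows "\<exists>Y\<in>borel_measurable (borel \<Otimes>\<^sub>M M). \<forall>t::real. 0 \<le> t \<longrightarrow>
    (AE \<omega> in M. Y (t, \<omega>) = real_cond_exp M (F (ennreal t)) (indicator A) \<omega>)"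
proof -
  define c where "c t = real_cond_exp M (F (ennreal t)) (indicator A)" for t :: real
  define v where "v t = (\<integral>\<omega>. c t \<omega> * c t \<omega> \<partial>M)" for t
  have c_F: "c t \<in> borel_measurable (F (ennreal t))" for t unfolding c_def by measurable
  have [measurable]: "c t \<in> borel_measurable M" for t using F_sub_M[OF c_F] .
  have int_A: "integrable M (indicator A :: 'a \<Rightarrow> real)" by (simp add: integrable_const emeasure_finite less_top[symmetric])
  have c_bound: "AE \<omega> in M. 0 \<le> c t \<omega> \<and> c t \<omega> \<le> 1" for t
  proof -
    interpret sigma_finite_subalgebra M "F (ennreal t)" by (rule sigma_finite_subalgebra_F)
    have "AE \<omega> in M. 0 \<le> c t \<omega>" "AE \<omega> in M. c t \<omega> \<le> 1" unfolding c_def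
      by (intro real_cond_exp_ge_c real_cond_exp_le_c int_A AE_I2; simp add: indicator_def)+
    then show ?thesis by eventually_elim auto
  qed
  have c_bound2: "AE \<omega> in M. \<bar>c s \<omega> * c t \<omega>\<bar> \<le> 1" for s t
    using c_bound[of s] c_bound[of t] by eventually_elim (auto simp: abs_mult intro: mult_le_one)
  have int_cc: "integrable M (\<lambda>\<omega>. c s \<omega> * c t \<omega>)" for s t
    by (rule integrable_const_bound[where B = 1]) (use c_bound2 in auto)
  have int_c: "integrable M (c t)" for t
    by (rule integrable_const_bound[where B = 1]) (use c_bound[of t] in auto)
  have int_cA: "integrable M (\<lambda>\<omega>. c s \<omega> * indicator A \<omega>)" for s
    using integrable_real_mult_indicator[OF A int_c[of s]] by simp
  \<comment> \<open>\<open>c s\<close> is \<open>F t\<close>-measurable, so the conditional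
    expectation \<open>c t\<close> may be replaced by \<open>indicator A\<close> under the integral.
    The value depends on \<open>s\<close> alone and equals \<open>v s\<close>; the next step is then
    Pythagoras for orthogonal projections.\<close>
  have proj: "(\<integral>\<omega>. c s \<omega> * c t \<omega> \<partial>M) = (\<integral>\<omega>. c s \<omega> * indicator A \<omega> \<partial>M)" if "s \<le> t" for s t
  proof -
    interpret sigma_finite_subalgebra M "F (ennreal t)" by (rule sigma_finite_subalgebra_F)
    have "c s \<in> borel_measurable (F (ennreal t))"
      by (rule F_sub_F[OF _ c_F]) (simp add: that ennreal_leI)
    then show ?thesis
      unfolding c_def[of t] by (intro real_cond_exp_intg int_cA) auto
  qed
  have diff: "(\<integral>\<omega>. (c t \<omega> - c s \<omega>)\<^sup>2 \<partial>M) = v t - v s" if "s \<le> t" for s t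
  proof -
    have "(\<lambda>\<omega>. (c t \<omega> - c s \<omega>)\<^sup>2) = (\<lambda>\<omega>. c t \<omega> * c t \<omega> + c s \<omega> * c s \<omega> - 2 * (c s \<omega> * c t \<omega>))"
      by (auto simp: power2_eq_square algebra_simps)
    then have "(\<integral>\<omega>. (c t \<omega> - c s \<omega>)\<^sup>2 \<partial>M) = v t + v s - 2 * (\<integral>\<omega>. c s \<omega> * c t \<omega> \<partial>M)"
      by (simp add: v_def int_cc)
    also have "\<dots> = v t - v s"
      using proj[OF that] proj[of s s] by (simp add: v_def)
    finally show ?thesis .
  qed
  have int_sq: "integrable M (\<lambda>\<omega>. (c t \<omega> - c s \<omega>)\<^sup>2)" for s t
  proof -
    have "(\<lambda>\<omega>. (c t \<omega> - c s \<omega>)\<^sup>2) = (\<lambda>\<omega>. c t \<omega> * c t \<omega> + c s \<omega> * c s \<omega> - 2 * (c s \<omega> * c t \<omega>))"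
      by (auto simp: power2_eq_square algebra_simps)
    then show ?thesis by (simp add: int_cc)
  qed
  have v_mono: "v s \<le> v t" if "s \<le> t" for s t
    using diff[OF that] integral_nonneg_AE[of "\<lambda>\<omega>. (c t \<omega> - c s \<omega>)\<^sup>2" M] by simp
  have v_nonneg: "0 \<le> v t" for t unfolding v_def by (intro integral_nonneg_AE) auto
  have diff_abs: "(\<integral>\<omega>. (c t \<omega> - c s \<omega>)\<^sup>2 \<partial>M) = \<bar>v t - v s\<bar>" for s t
    using diff[of s t] diff[of t s] v_mono[of s t] v_mono[of t s]
    by (cases "s \<le> t") (auto simp: power2_commute)
  have diff_L1: "(\<integral>\<omega>. \<bar>c t \<omega> - c s \<omega>\<bar> \<partial>M) \<le> (1/2)^j" if "\<bar>v t - v s\<bar> \<le> (1/4)^j" for s t j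
  proof -
    \<comment> \<open>A completed square. The weight \<open>2^j\<close> turns the bound
      \<open>(1/4)^j\<close> on the second moment into the summable bound \<open>(1/2)^j\<close> on
      the first.\<close>
    have pt: "\<bar>x\<bar> \<le> (2^j * x\<^sup>2 + (1/2)^j) / 2" for x :: real
    proof -
      have "0 \<le> 2^j * (\<bar>x\<bar> - (1/2)^j)\<^sup>2" by simp
      also have "\<dots> = 2^j * x\<^sup>2 + (1/2)^j - 2 * \<bar>x\<bar>"
        by (simp add: power2_diff algebra_simps power_divide power2_eq_square)
      finally show ?thesis by simp
    qed
    have "(\<integral>\<omega>. \<bar>c t \<omega> - c s \<omega>\<bar> \<partial>M) \<le> (\<integral>\<omega>. (2^j * (c t \<omega> - c s \<omega>)\<^sup>2 + (1/2)^j) / 2 \<partial>M)"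
      using pt by (intro integral_mono integrable_abs Bochner_Integration.integrable_diff int_c
        integrable_divide Bochner_Integration.integrable_add integrable_mult_right int_sq) auto
    also have "\<dots> = (2^j * \<bar>v t - v s\<bar> + (1/2)^j) / 2"
      using int_sq diff_abs by (simp add: prob_space)
    also have "\<dots> \<le> (2^j * (1/4)^j + (1/2)^j) / 2" using that by simp
    also have "\<dots> = (1/2)^j" by (simp add: power_mult_distrib[symmetric])
    finally show ?thesis .
  qed
  \<comment> \<open>The right limit of the increasing function \<open>v\<close>. The times
    \<open>s j t\<close> stay strictly above \<open>t\<close>, so their values of \<open>v\<close>
    are compared with \<open>vp t\<close> and never with \<open>v t\<close>.\<close>
  define vp where "vp t = (INF s\<in>{t<..}. v s)" for t
  have bdd: "bdd_below (v ` {t<..})" for t using v_nonneg by (intro bdd_belowI) auto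
  have vp_le: "vp t \<le> v s" if "t < s" for s t
    unfolding vp_def using that bdd by (intro cINF_lower) auto
  have vp_mono: "vp s \<le> vp t" if "s \<le> t" for s t
    unfolding vp_def using that bdd by (intro cINF_superset_mono) auto
  have [measurable]: "vp \<in> borel_measurable borel" using vp_mono by (intro borel_measurable_mono monoI)
  have [measurable]: "v \<in> borel_measurable borel" using v_mono by (intro borel_measurable_mono monoI)
  \<comment> \<open>\<open>j \<le> m\<close> forces \<open>s j t\<close> to approach
    \<open>t\<close>; the other condition makes the increments of \<open>v\<close> summable. Taking
    the least such \<open>m\<close> makes the choice measurable in \<open>t\<close>, because
    \<open>v\<close> and \<open>vp\<close> are monotone and therefore Borel.\<close>
  define good where "good j t m \<longleftrightarrow> j \<le> m \<and> v (dyadic_above m t) \<le> vp t + (1/4)^j" for j t m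
  define N where "N j t = (LEAST m. good j t m)" for j t
  have ex_good: "\<exists>m. good j t m" for j t
  proof -
    have "vp t < vp t + (1/4)^j" by simp
    then obtain s where s: "t < s" "v s < vp t + (1/4)^j"
      unfolding vp_def using cINF_less_iff[OF _ bdd, of t] by (metis greaterThan_iff greaterThan_non_empty)
    have "eventually (\<lambda>m. dyadic_above m t < s) sequentially"
      using dyadic_above_tendsto s(1) by (rule order_tendstoD)
    then have "eventually (\<lambda>m. dyadic_above m t < s \<and> j \<le> m) sequentially"
      using eventually_ge_at_top[of j] by eventually_elim auto
    then obtain m where "dyadic_above m t < s" "j \<le> m"
      using eventually_happens'[OF sequentially_bot] by blast
    then show ?thesis unfolding good_def using v_mono[of "dyadic_above m t" s] s(2)
      by (intro exI[of _ m]) auto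
  qed
  have N_good: "good j t (N j t)" for j t
    unfolding N_def using ex_good by (rule LeastI_ex)
  have [measurable]: "N j \<in> borel \<rightarrow>\<^sub>M count_space UNIV" for j
    unfolding N_def[abs_def] good_def by measurable
  define s where "s j t = dyadic_above (N j t) t" for j t
  have s_gt: "t < s j t" for j t by (simp add: s_def dyadic_above_gt)
  have s_le: "s j t \<le> t + (1/2)^j" for j t
  proof -
    have "s j t \<le> t + (1/2)^N j t" by (simp add: s_def dyadic_above_le)
    also have "\<dots> \<le> t + (1/2)^j"
      using N_good[of j t] by (simp add: good_def power_decreasing)
    finally show ?thesis .
  qed
  have s_v: "\<bar>v (s (Suc j) t) - v (s j t)\<bar> \<le> (1/4)^j" for j t
  proof -
    have "(1/4::real)^Suc j \<le> (1/4)^j" by (intro power_decreasing) auto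
    then show ?thesis
    using N_good[of j t] N_good[of "Suc j" t] vp_le[OF s_gt[of t j]] vp_le[OF s_gt[of t "Suc j"]]
    unfolding good_def s_def by linarith
  qed
  define Y where "Y = (\<lambda>(t, \<omega>). lim (\<lambda>j. c (s j t) \<omega>))"
  have "(\<lambda>p. c (s j (fst p)) (snd p)) \<in> borel_measurable (borel \<Otimes>\<^sub>M M)" for j
  proof -
    \<comment> \<open>For fixed \<open>m\<close> only an integer varies with the time, and for each
      integer the function is a single \<open>c r\<close>; a countable composition avoids any joint
      measurability of \<open>c\<close>.\<close>
    have 1: "(\<lambda>p. c (dyadic_above m (fst p)) (snd p)) \<in> borel_measurable (borel \<Otimes>\<^sub>M M)" for m
      unfolding dyadic_above_def
      by (rule measurable_compose_countable[of "\<lambda>i p. c ((of_int i + 1) / 2 ^ m) (snd p)" _ _ "\<lambda>p. \<lfloor>2 ^ m * fst p\<rfloor>"]) measurable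
    show ?thesis unfolding s_def
      by (rule measurable_compose_countable[of "\<lambda>i p. c (dyadic_above i (fst p)) (snd p)" _ _ "\<lambda>p. N j (fst p)"])
         (use 1 in measurable)
  qed
  then have Y_meas: "Y \<in> borel_measurable (borel \<Otimes>\<^sub>M M)"
    unfolding Y_def case_prod_beta by (intro borel_measurable_lim_metric) auto
  have "AE \<omega> in M. Y (t, \<omega>) = real_cond_exp M (F (ennreal t)) (indicator A) \<omega>" if "0 \<le> t" for t
  proof -
    interpret sigma_finite_subalgebra M "F (ennreal t)" by (rule sigma_finite_subalgebra_F)
    have conv: "AE \<omega> in M. convergent (\<lambda>j. c (s j t) \<omega>)"
      by (rule AE_convergent_of_summable_increments[where b = "\<lambda>j. (1/2)^j"])
         (auto intro!: int_c diff_L1 s_v)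
    have lim: "AE \<omega> in M. (\<lambda>j. c (s j t) \<omega>) \<longlonglongrightarrow> Y (t, \<omega>)"
      using conv by eventually_elim (simp add: Y_def convergent_LIMSEQ_iff)
    \<comment> \<open>From some index \<open>k\<close> on all times \<open>s j t\<close> lie below
      \<open>r\<close>, and the limit ignores the earlier ones. Since \<open>r\<close> beyond
      \<open>t\<close> is arbitrary, right continuity of the filtration gives measurability for
      \<open>F t\<close> itself.\<close>
    have "(\<lambda>\<omega>. Y (t, \<omega>)) \<in> borel_measurable (F r)" if r: "ennreal t < r" for r
    proof -
      have "(\<lambda>k. ennreal (t + (1/2)^k)) \<longlonglongrightarrow> ennreal (t + 0)"
        by (intro tendsto_intros LIMSEQ_realpow_zero) auto
      with r have "eventually (\<lambda>k. ennreal (t + (1/2)^k) < r) sequentially"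
        by (intro order_tendstoD(2)) auto
      then obtain k where k: "ennreal (t + (1/2)^k) < r"
        using eventually_happens'[OF sequentially_bot] by blast
      have "c (s (j + k) t) \<in> borel_measurable (F r)" for j
      proof (rule F_sub_F[OF _ c_F])
        have "s (j + k) t \<le> t + (1/2)^k"
          using s_le[of "j + k" t] power_decreasing[of k "j + k" "1/2::real"] by linarith
        then show "ennreal (s (j + k) t) \<le> r" using k by (meson ennreal_leI less_imp_le order_trans)
      qed
      then have "(\<lambda>\<omega>. lim (\<lambda>j. c (s (j + k) t) \<omega>)) \<in> borel_measurable (F r)"
        by (intro borel_measurable_lim_metric)
      then show ?thesis by (simp add: Y_def lim_shift[of "\<lambda>j. c (s j t) _"])
    qed
    then have Y_F: "(\<lambda>\<omega>. Y (t, \<omega>)) \<in> borel_measurable (F (ennreal t))"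
      using right_cont[of "ennreal t"] by (auto simp: measurable_def set_eq_iff)
    have [measurable]: "(\<lambda>\<omega>. Y (t, \<omega>)) \<in> borel_measurable M" using F_sub_M[OF Y_F] .
    have Y_bound: "AE \<omega> in M. norm (Y (t, \<omega>)) \<le> 1"
    proof -
      have "AE \<omega> in M. \<forall>j. 0 \<le> c (s j t) \<omega> \<and> c (s j t) \<omega> \<le> 1" using c_bound by (simp add: AE_all_countable)
      with lim show ?thesis
      proof eventually_elim
        case (elim \<omega>)
        then have "0 \<le> Y (t, \<omega>)" "Y (t, \<omega>) \<le> 1"
          using LIMSEQ_le_const[of _ "Y (t,\<omega>)" 0] LIMSEQ_le_const2[of _ "Y (t,\<omega>)" 1] by blast+
        then show ?case by simp
      qed
    qed
    have int_Y: "integrable M (\<lambda>\<omega>. Y (t, \<omega>))"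
      by (rule integrable_const_bound[where B = 1]) (use Y_bound in auto)
    have "AE \<omega> in M. real_cond_exp M (F (ennreal t)) (indicator A) \<omega> = Y (t, \<omega>)"
    proof (rule real_cond_exp_charact[OF _ int_A int_Y Y_F])
      fix B assume B: "B \<in> sets (F (ennreal t))"
      then have BM [measurable]: "B \<in> sets M" using sets_F_le by blast
      \<comment> \<open>\<open>B\<close> is known at \<open>t\<close>, hence at the later time
        \<open>s j t\<close>, so every \<open>c (s j t)\<close> has the same integral over
        \<open>B\<close>; bounded convergence passes this on to \<open>Y\<close>.\<close>
      have eq: "(\<integral>\<omega>\<in>B. c (s j t) \<omega> \<partial>M) = (\<integral>\<omega>\<in>B. indicator A \<omega> \<partial>M)" for j
      proof -
        interpret s: sigma_finite_subalgebra M "F (ennreal (s j t))" by (rule sigma_finite_subalgebra_F)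
        have "B \<in> sets (F (ennreal (s j t)))"
          using B sets_F_mono[of "ennreal t" "ennreal (s j t)"] s_gt[of t j] by (auto simp: ennreal_leI)
        then show ?thesis unfolding c_def using s.real_cond_exp_intA[OF int_A] by simp
      qed
      have "(\<lambda>j. \<integral>\<omega>. indicator B \<omega> *\<^sub>R c (s j t) \<omega> \<partial>M) \<longlonglongrightarrow> (\<integral>\<omega>. indicator B \<omega> *\<^sub>R Y (t, \<omega>) \<partial>M)"
      proof (rule integral_dominated_convergence[where w = "\<lambda>_. 1"])
        show "AE \<omega> in M. (\<lambda>j. indicator B \<omega> *\<^sub>R c (s j t) \<omega>) \<longlonglongrightarrow> indicator B \<omega> *\<^sub>R Y (t, \<omega>)"
          using lim by eventually_elim (intro tendsto_intros)
        show "AE \<omega> in M. norm (indicator B \<omega> *\<^sub>R c (s j t) \<omega>) \<le> 1" for j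
          using c_bound[of "s j t"] by eventually_elim (auto simp: indicator_def)
      qed auto
      then have "(\<lambda>j. \<integral>\<omega>\<in>B. indicator A \<omega> \<partial>M) \<longlonglongrightarrow> (\<integral>\<omega>\<in>B. Y (t, \<omega>) \<partial>M)"
        using eq by (simp add: set_lebesgue_integral_def)
      then show "(\<integral>\<omega>\<in>B. indicator A \<omega> \<partial>M) = (\<integral>\<omega>\<in>B. Y (t, \<omega>) \<partial>M)"
        by (rule LIMSEQ_unique[OF tendsto_const])
    qed
    then show ?thesis by eventually_elim simp
  qed
  with Y_meas show ?thesis by blast
qed


end

section \<open>Jointly measurable versions of nonnegative conditional expectations\<close>

lemma (in sigma_finite_subalgebra) nn_cond_exp_suminf:
  assumes [measurable]: "\<And>i::nat. f i \<in> borel_measurable M"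
  shows "AE x in M. (\<Sum>i. nn_cond_exp M F (f i) x) = nn_cond_exp M F (\<lambda>x. \<Sum>i. f i x) x"
proof (rule nn_cond_exp_charact)
  fix A assume A [measurable]: "A \<in> sets F"
  then have [measurable]: "A \<in> sets M" using subalg by (auto simp: subalgebra_def)
  have "(\<integral>\<^sup>+x\<in>A. (\<Sum>i. f i x) \<partial>M) = (\<Sum>i. \<integral>\<^sup>+x. indicator A x * f i x \<partial>M)"
    by (subst nn_integral_suminf[symmetric]) (auto intro!: nn_integral_cong simp: mult.commute)
  also have "\<dots> = (\<Sum>i. \<integral>\<^sup>+x. indicator A x * nn_cond_exp M F (f i) x \<partial>M)"
    by (subst nn_cond_exp_intg) auto
  also have "\<dots> = (\<integral>\<^sup>+x\<in>A. (\<Sum>i. nn_cond_exp M F (f i) x) \<partial>M)"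
    by (subst nn_integral_suminf[symmetric]) (auto intro!: nn_integral_cong simp: mult.commute)
  finally show "(\<integral>\<^sup>+x\<in>A. (\<Sum>i. f i x) \<partial>M) = (\<integral>\<^sup>+x\<in>A. (\<Sum>i. nn_cond_exp M F (f i) x) \<partial>M)" .
qed measurable

lemma (in sigma_finite_subalgebra) nn_cond_exp_SUP:
  assumes [measurable]: "\<And>i::nat. f i \<in> borel_measurable M" and "incseq f"
  shows "AE x in M. (SUP i. nn_cond_exp M F (f i) x) = nn_cond_exp M F (\<lambda>x. SUP i. f i x) x"
proof (rule nn_cond_exp_charact)
  fix A assume A [measurable]: "A \<in> sets F"
  then have [measurable]: "A \<in> sets M" using subalg by (auto simp: subalgebra_def)
  have mono: "AE x in M. nn_cond_exp M F (f i) x \<le> nn_cond_exp M F (f (Suc i)) x" for i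
    by (rule nn_cond_exp_mono) (use \<open>incseq f\<close> in \<open>auto simp: incseq_Suc_iff le_fun_def\<close>)
  have "(\<integral>\<^sup>+x\<in>A. (SUP i. f i x) \<partial>M) = (\<integral>\<^sup>+x. (SUP i. indicator A x * f i x) \<partial>M)"
    by (intro nn_integral_cong) (simp add: SUP_mult_left_ennreal mult.commute)
  also have "\<dots> = (SUP i. \<integral>\<^sup>+x. indicator A x * f i x \<partial>M)"
    by (intro nn_integral_monotone_convergence_SUP)
       (use \<open>incseq f\<close> in \<open>auto simp: incseq_def le_fun_def mult_left_mono\<close>)
  also have "\<dots> = (SUP i. \<integral>\<^sup>+x. indicator A x * nn_cond_exp M F (f i) x \<partial>M)"
    by (subst nn_cond_exp_intg) auto
  also have "\<dots> = (\<integral>\<^sup>+x. (SUP i. indicator A x * nn_cond_exp M F (f i) x) \<partial>M)"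
  proof (intro nn_integral_monotone_convergence_SUP_AE[symmetric])
    show "AE x in M. indicator A x * nn_cond_exp M F (f i) x \<le> indicator A x * nn_cond_exp M F (f (Suc i)) x" for i
      using mono[of i] by eventually_elim (simp add: mult_left_mono)
  qed measurable
  also have "\<dots> = (\<integral>\<^sup>+x\<in>A. (SUP i. nn_cond_exp M F (f i) x) \<partial>M)"
    by (intro nn_integral_cong) (simp add: SUP_mult_left_ennreal mult.commute)
  finally show "(\<integral>\<^sup>+x\<in>A. (SUP i. f i x) \<partial>M) = (\<integral>\<^sup>+x\<in>A. (SUP i. nn_cond_exp M F (f i) x) \<partial>M)" .
qed measurable

lemma (in sigma_finite_subalgebra) nn_cond_exp_const:
  "AE x in M. nn_cond_exp M F (\<lambda>_. c) x = c"
  using nn_cond_exp_F_meas[of "\<lambda>_. c"] by (auto elim: eventually_mono)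

lemma (in sigma_finite_subalgebra) nn_cond_exp_indicator_eq_real_cond_exp:
  assumes [measurable]: "A \<in> sets M"
  shows "AE x in M. nn_cond_exp M F (indicator A) x = ennreal (real_cond_exp M F (indicator A) x)"
proof -
  have 1: "(\<lambda>x. ennreal (indicator A x)) = indicator A" "(\<lambda>x. ennreal (- indicator A x)) = (\<lambda>_. 0)"
    by (auto simp: indicator_def fun_eq_iff ennreal_neg)
  have "AE x in M. nn_cond_exp M F (indicator A) x \<le> nn_cond_exp M F (\<lambda>_. 1) x"
    by (rule nn_cond_exp_mono) (auto simp: indicator_def)
  with nn_cond_exp_const[of 1] nn_cond_exp_const[of 0] show ?thesis
  proof eventually_elim
    case (elim x)
    then have "nn_cond_exp M F (indicator A) x \<le> 1" by simp
    then have "nn_cond_exp M F (indicator A) x < top" by (rule le_less_trans) simp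
    then show ?case using elim by (simp add: real_cond_exp_def 1)
  qed
qed

text \<open>\<open>H\<close> carries the measurability of the versions: \<open>M \<Otimes>\<^sub>M N\<close> when the time of conditioning varies
  with \<open>y\<close>, \<open>F t \<Otimes>\<^sub>M N\<close> when it is fixed.\<close>

lemma (in prob_space) nn_cond_exp_jointly_measurable:
  assumes sub: "\<And>y. y \<in> space N \<Longrightarrow> subalgebra M (G y)"
    and space_H: "space H = space M \<times> space N"
    and snd_H [measurable]: "snd \<in> H \<rightarrow>\<^sub>M N"
    and ind: "\<And>A. A \<in> sets M \<Longrightarrow> \<exists>Y\<in>borel_measurable H. \<forall>y\<in>space N.
       AE \<omega> in M. Y (\<omega>, y) = nn_cond_exp M (G y) (indicator A) \<omega>"
    and X: "X \<in> borel_measurable (M \<Otimes>\<^sub>M N)"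
  shows "\<exists>Y\<in>borel_measurable H. \<forall>y\<in>space N. AE \<omega> in M. Y (\<omega>, y) = nn_cond_exp M (G y) (\<lambda>\<omega>. X (\<omega>, y)) \<omega>"
    (is "?P X")
proof -
  have sf: "sigma_finite_subalgebra M (G y)" if "y \<in> space N" for y
    using sub[OF that] by (intro finite_measure_subalgebra_is_sigma_finite)
      (simp add: finite_measure_subalgebra_def finite_measure_subalgebra_axioms_def finite_measure_axioms)
  have sets: "?P (indicator D)" if "D \<in> sets (M \<Otimes>\<^sub>M N)" for D
  proof -
    note D = that[unfolded sets_pair_measure]
    show ?thesis
    proof (rule sigma_sets_induct_disjoint[OF Int_stable_pair_measure_generator pair_measure_closed D])
      fix A assume "A \<in> {a \<times> b |a b. a \<in> sets M \<and> b \<in> sets N}"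
      then obtain a b where A: "A = a \<times> b" and [measurable]: "a \<in> sets M" "b \<in> sets N" by auto
      from ind[of a] obtain Y where [measurable]: "Y \<in> borel_measurable H"
        and Y: "\<And>y. y \<in> space N \<Longrightarrow> AE \<omega> in M. Y (\<omega>, y) = nn_cond_exp M (G y) (indicator a) \<omega>" by auto
      show "?P (indicator A)"
      proof (intro bexI[of _ "\<lambda>p. indicator b (snd p) * Y p"] ballI)
        fix y assume y: "y \<in> space N"
        interpret sigma_finite_subalgebra M "G y" by (rule sf[OF y])
        have "AE \<omega> in M. indicator b y * nn_cond_exp M (G y) (indicator a) \<omega> =
            nn_cond_exp M (G y) (\<lambda>\<omega>. indicator b y * indicator a \<omega>) \<omega>"
          by (rule nn_cond_exp_prod) auto
        with Y[OF y] show "AE \<omega> in M. indicator b (snd (\<omega>, y)) * Y (\<omega>, y) =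
            nn_cond_exp M (G y) (\<lambda>\<omega>. indicator A (\<omega>, y)) \<omega>"
          by eventually_elim (simp add: A indicator_times mult.commute)
      qed measurable
    next
      show "?P (indicator {})"
      proof (intro bexI[of _ "\<lambda>_. 0"] ballI)
        fix y assume "y \<in> space N"
        then interpret sigma_finite_subalgebra M "G y" by (rule sf)
        show "AE \<omega> in M. 0 = nn_cond_exp M (G y) (\<lambda>\<omega>. indicator {} (\<omega>, y)) \<omega>"
          using nn_cond_exp_const[of 0] by eventually_elim simp
      qed auto
    next
      fix A assume "A \<in> sigma_sets (space M \<times> space N) {a \<times> b |a b. a \<in> sets M \<and> b \<in> sets N}"
      then have [measurable]: "A \<in> sets (M \<Otimes>\<^sub>M N)" by (simp add: sets_pair_measure)
      assume "?P (indicator A)"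
      then obtain Y where [measurable]: "Y \<in> borel_measurable H"
        and Y: "\<And>y. y \<in> space N \<Longrightarrow> AE \<omega> in M. Y (\<omega>, y) = nn_cond_exp M (G y) (\<lambda>\<omega>. indicator A (\<omega>, y)) \<omega>" by auto
      show "?P (indicator (space M \<times> space N - A))"
      proof (intro bexI[of _ "\<lambda>p. 1 - Y p"] ballI)
        fix y assume y: "y \<in> space N"
        then interpret sigma_finite_subalgebra M "G y" by (rule sf)
        have "(\<lambda>\<omega>. indicator A (\<omega>, y) :: ennreal) \<in> borel_measurable M"
          and "(\<lambda>\<omega>. indicator (space M \<times> space N - A) (\<omega>, y) :: ennreal) \<in> borel_measurable M"
          using y by measurable
        note s = nn_cond_exp_sum[OF this]
        have c: "AE \<omega> in M. nn_cond_exp M (G y) (\<lambda>\<omega>. indicator A (\<omega>, y) + indicator (space M \<times> space N - A) (\<omega>, y)) \<omega>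
            = nn_cond_exp M (G y) (\<lambda>_. 1) \<omega>"
          by (rule nn_cond_exp_cong) (use y in \<open>auto simp: indicator_def\<close>)
        show "AE \<omega> in M. 1 - Y (\<omega>, y) = nn_cond_exp M (G y) (\<lambda>\<omega>. indicator (space M \<times> space N - A) (\<omega>, y)) \<omega>"
          using s c nn_cond_exp_const[of 1] Y[OF y]
        proof eventually_elim
          case (elim \<omega>)
          let ?a = "nn_cond_exp M (G y) (\<lambda>\<omega>. indicator A (\<omega>, y)) \<omega>"
          let ?b = "nn_cond_exp M (G y) (\<lambda>\<omega>. indicator (space M \<times> space N - A) (\<omega>, y)) \<omega>"
          \<comment> \<open>Cancelling in \<open>ennreal\<close> needs a finite \<open>?a\<close>,
            which the finite sum provides.\<close>
          have "?a + ?b = 1" using elim by simp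
          moreover from this have "?a \<noteq> top" by auto
          ultimately have "1 - ?a = ?b" by (metis ennreal_add_diff_cancel_left)
          with elim show ?case by simp
        qed
      qed measurable
    next
      fix A :: "nat \<Rightarrow> _" assume disj: "disjoint_family A"
        and r: "range A \<subseteq> sigma_sets (space M \<times> space N) {a \<times> b |a b. a \<in> sets M \<and> b \<in> sets N}"
      then have [measurable]: "A i \<in> sets (M \<Otimes>\<^sub>M N)" for i by (auto simp: sets_pair_measure)
      assume "\<And>i. ?P (indicator (A i))"
      then have "\<forall>i. \<exists>Y. Y \<in> borel_measurable H \<and> (\<forall>y\<in>space N. AE \<omega> in M. Y (\<omega>, y) = nn_cond_exp M (G y) (\<lambda>\<omega>. indicator (A i) (\<omega>, y)) \<omega>)"
        by blast
      then obtain Y where [measurable]: "\<And>i. Y i \<in> borel_measurable H"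
        and Y: "\<And>i y. y \<in> space N \<Longrightarrow> AE \<omega> in M. Y i (\<omega>, y) = nn_cond_exp M (G y) (\<lambda>\<omega>. indicator (A i) (\<omega>, y)) \<omega>"
        by metis
      show "?P (indicator (\<Union>i. A i))"
      proof (intro bexI[of _ "\<lambda>p. \<Sum>i. Y i p"] ballI)
        fix y assume y: "y \<in> space N"
        then interpret sigma_finite_subalgebra M "G y" by (rule sf)
        have m: "(\<lambda>\<omega>. indicator (A i) (\<omega>, y) :: ennreal) \<in> borel_measurable M" for i
          using y by measurable
        have "AE \<omega> in M. \<forall>i. Y i (\<omega>, y) = nn_cond_exp M (G y) (\<lambda>\<omega>. indicator (A i) (\<omega>, y)) \<omega>"
          using Y[OF y] by (simp add: AE_all_countable)
        with nn_cond_exp_suminf[of "\<lambda>i \<omega>. indicator (A i) (\<omega>, y)", OF m]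
        show "AE \<omega> in M. (\<Sum>i. Y i (\<omega>, y)) = nn_cond_exp M (G y) (\<lambda>\<omega>. indicator (\<Union>i. A i) (\<omega>, y)) \<omega>"
          by eventually_elim (simp add: suminf_indicator[OF disj])
      qed measurable
    qed
  qed
  show ?thesis
    using X
  proof (induction rule: borel_measurable_induct)
    case (cong f g)
    from cong.IH obtain Y where Y: "Y \<in> borel_measurable H"
      "\<And>y. y \<in> space N \<Longrightarrow> AE \<omega> in M. Y (\<omega>, y) = nn_cond_exp M (G y) (\<lambda>\<omega>. g (\<omega>, y)) \<omega>" by auto
    show ?case
    proof (intro bexI[OF _ Y(1)] ballI)
      fix y assume y: "y \<in> space N"
      then interpret sigma_finite_subalgebra M "G y" by (rule sf)
      have "AE \<omega> in M. nn_cond_exp M (G y) (\<lambda>\<omega>. g (\<omega>, y)) \<omega> = nn_cond_exp M (G y) (\<lambda>\<omega>. f (\<omega>, y)) \<omega>"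
        by (rule nn_cond_exp_cong) (use cong.hyps y in \<open>auto simp: space_pair_measure\<close>)
      with Y(2)[OF y] show "AE \<omega> in M. Y (\<omega>, y) = nn_cond_exp M (G y) (\<lambda>\<omega>. f (\<omega>, y)) \<omega>"
        by eventually_elim simp
    qed
  next
    case (set A) then show ?case by (rule sets)
  next
    case (mult u c)
    note [measurable] = mult.hyps(2)
    from mult.IH obtain Y where [measurable]: "Y \<in> borel_measurable H"
      and Y: "\<And>y. y \<in> space N \<Longrightarrow> AE \<omega> in M. Y (\<omega>, y) = nn_cond_exp M (G y) (\<lambda>\<omega>. u (\<omega>, y)) \<omega>" by auto
    show ?case
    proof (intro bexI[of _ "\<lambda>p. c * Y p"] ballI)
      fix y assume y: "y \<in> space N"
      then interpret sigma_finite_subalgebra M "G y" by (rule sf)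
      have "(\<lambda>\<omega>. u (\<omega>, y)) \<in> borel_measurable M" using y by measurable
      then show "AE \<omega> in M. c * Y (\<omega>, y) = nn_cond_exp M (G y) (\<lambda>\<omega>. c * u (\<omega>, y)) \<omega>"
        using nn_cond_exp_prod[of "\<lambda>_. c" "\<lambda>\<omega>. u (\<omega>, y)"] Y[OF y] by (auto elim: eventually_elim2)
    qed measurable
  next
    case (add u v)
    note [measurable] = add.hyps(1,3)
    from add.IH obtain Y Y' where [measurable]: "Y \<in> borel_measurable H" "Y' \<in> borel_measurable H"
      and Y: "\<And>y. y \<in> space N \<Longrightarrow> AE \<omega> in M. Y (\<omega>, y) = nn_cond_exp M (G y) (\<lambda>\<omega>. u (\<omega>, y)) \<omega>"
        "\<And>y. y \<in> space N \<Longrightarrow> AE \<omega> in M. Y' (\<omega>, y) = nn_cond_exp M (G y) (\<lambda>\<omega>. v (\<omega>, y)) \<omega>" by auto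
    show ?case
    proof (intro bexI[of _ "\<lambda>p. Y' p + Y p"] ballI)
      fix y assume y: "y \<in> space N"
      then interpret sigma_finite_subalgebra M "G y" by (rule sf)
      have "(\<lambda>\<omega>. u (\<omega>, y)) \<in> borel_measurable M" "(\<lambda>\<omega>. v (\<omega>, y)) \<in> borel_measurable M" using y by measurable
      from nn_cond_exp_sum[OF this(2,1)] Y(1)[OF y] Y(2)[OF y]
      show "AE \<omega> in M. Y' (\<omega>, y) + Y (\<omega>, y) = nn_cond_exp M (G y) (\<lambda>\<omega>. v (\<omega>, y) + u (\<omega>, y)) \<omega>"
        by eventually_elim simp
    qed measurable
  next
    case (seq U)
    note [measurable] = seq.hyps(1)
    have "\<forall>i. \<exists>Y. Y \<in> borel_measurable H \<and> (\<forall>y\<in>space N. AE \<omega> in M. Y (\<omega>, y) = nn_cond_exp M (G y) (\<lambda>\<omega>. U i (\<omega>, y)) \<omega>)"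
      using seq.IH by blast
    then obtain Y where [measurable]: "\<And>i. Y i \<in> borel_measurable H"
      and Y: "\<And>i y. y \<in> space N \<Longrightarrow> AE \<omega> in M. Y i (\<omega>, y) = nn_cond_exp M (G y) (\<lambda>\<omega>. U i (\<omega>, y)) \<omega>"
      by metis
    show ?case
    proof (intro bexI[of _ "\<lambda>p. SUP i. Y i p"] ballI)
      fix y assume y: "y \<in> space N"
      then interpret sigma_finite_subalgebra M "G y" by (rule sf)
      have m: "(\<lambda>\<omega>. U i (\<omega>, y)) \<in> borel_measurable M" for i using y by measurable
      have "AE \<omega> in M. \<forall>i. Y i (\<omega>, y) = nn_cond_exp M (G y) (\<lambda>\<omega>. U i (\<omega>, y)) \<omega>"
        using Y[OF y] by (simp add: AE_all_countable)
      moreover have "incseq (\<lambda>i \<omega>. U i (\<omega>, y))" using \<open>incseq U\<close> by (auto simp: incseq_def le_fun_def)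
      note nn_cond_exp_SUP[of "\<lambda>i \<omega>. U i (\<omega>, y)", OF m this]
      ultimately show "AE \<omega> in M. (SUP i. Y i (\<omega>, y)) = nn_cond_exp M (G y) (\<lambda>\<omega>. (SUP i. U i) (\<omega>, y)) \<omega>"
        by eventually_elim (simp add: image_comp)
    qed measurable
  qed
qed

context usual_filtration
begin

lemma nn_cond_exp_version_at_times:
  assumes [measurable]: "p \<in> borel_measurable N" and p: "\<And>y. y \<in> space N \<Longrightarrow> 0 \<le> (p y :: real)"
    and X: "X \<in> borel_measurable (M \<Otimes>\<^sub>M N)"
  shows "\<exists>Y\<in>borel_measurable (M \<Otimes>\<^sub>M N). \<forall>y\<in>space N.
    AE \<omega> in M. Y (\<omega>, y) = nn_cond_exp M (F (ennreal (p y))) (\<lambda>\<omega>. X (\<omega>, y)) \<omega>"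
proof (rule nn_cond_exp_jointly_measurable[OF _ _ _ _ X])
  fix A assume A: "A \<in> sets M"
  from cond_exp_indicator_jointly_measurable[OF A] obtain Y
    where [measurable]: "Y \<in> borel_measurable (borel \<Otimes>\<^sub>M M)"
      and Y: "\<And>t. 0 \<le> t \<Longrightarrow> AE \<omega> in M. Y (t, \<omega>) = real_cond_exp M (F (ennreal t)) (indicator A) \<omega>" by blast
  show "\<exists>Y\<in>borel_measurable (M \<Otimes>\<^sub>M N). \<forall>y\<in>space N.
      AE \<omega> in M. Y (\<omega>, y) = nn_cond_exp M (F (ennreal (p y))) (indicator A) \<omega>"
  proof (intro bexI[of _ "\<lambda>(\<omega>, y). ennreal (Y (p y, \<omega>))"] ballI)
    fix y assume y: "y \<in> space N"
    interpret sigma_finite_subalgebra M "F (ennreal (p y))" by (rule sigma_finite_subalgebra_F)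
    show "AE \<omega> in M. (case (\<omega>, y) of (\<omega>, y) \<Rightarrow> ennreal (Y (p y, \<omega>))) =
        nn_cond_exp M (F (ennreal (p y))) (indicator A) \<omega>"
      using nn_cond_exp_indicator_eq_real_cond_exp[OF A] Y[OF p[OF y]] by eventually_elim simp
  qed measurable
qed (auto simp: subalg space_pair_measure)

text \<open>Meant for integrands whose sections are already \<open>F t\<close>-measurable: the
  version then equals each section almost surely, and joint measurability for \<open>F t\<close>
  instead of \<open>M\<close> is gained.\<close>

lemma nn_cond_exp_version_at_fixed_time:
  assumes X: "X \<in> borel_measurable (M \<Otimes>\<^sub>M N)"
  shows "\<exists>Y\<in>borel_measurable (F t \<Otimes>\<^sub>M N). \<forall>y\<in>space N.
    AE \<omega> in M. Y (\<omega>, y) = nn_cond_exp M (F t) (\<lambda>\<omega>. X (\<omega>, y)) \<omega>"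
proof (rule nn_cond_exp_jointly_measurable[OF _ _ _ _ X])
  fix A assume A: "A \<in> sets M"
  show "\<exists>Y\<in>borel_measurable (F t \<Otimes>\<^sub>M N). \<forall>y\<in>space N. AE \<omega> in M. Y (\<omega>, y) = nn_cond_exp M (F t) (indicator A) \<omega>"
    by (intro bexI[of _ "\<lambda>(\<omega>, y). nn_cond_exp M (F t) (indicator A) \<omega>"]) auto
qed (auto simp: subalg space_pair_measure)

end

section \<open>Optional processes\<close>

text \<open>A right-continuous adapted \<open>X\<close> at \<open>t\<close> is the limit of
  \<open>X\<close> at dyadic times to the right of \<open>t\<close>. For \<open>t < q\<close> these
  are eventually below \<open>q\<close>, hence known at \<open>q\<close>; at \<open>t = q\<close>
  they would not be, which is why the time interval is open at its end.\<close>

lemma measurable_id_optional_algebra: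
  fixes F :: "ennreal \<Rightarrow> 'a measure"
  assumes filt: "filtration (space M) F"
  shows "(\<lambda>x. x) \<in> restrict_space (borel \<Otimes>\<^sub>M F q) {(t, \<omega>). 0 \<le> t \<and> ennreal t < q \<and> \<omega> \<in> space M}
    \<rightarrow>\<^sub>M optional_algebra M F" (is "_ \<in> ?R \<rightarrow>\<^sub>M _")
proof -
  interpret filtration "space M" F by (rule filt)
  have sp: "space ?R = {(t, \<omega>). 0 \<le> t \<and> ennreal t < q \<and> \<omega> \<in> space M}"
    by (auto simp: space_restrict_space space_pair_measure space_F)
  have X: "(\<lambda>(t, \<omega>). X t \<omega>) \<in> borel_measurable ?R"
    if rc: "right_continuous_process M X" and ad: "adapted_process F X" for X
  proof (rule borel_measurable_LIMSEQ_metric)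
    \<comment> \<open>Beyond \<open>q\<close> the value is set to 0, since \<open>X\<close> there
      need not be \<open>F q\<close>-measurable; for fixed \<open>t < q\<close> this affects only
      finitely many \<open>m\<close>.\<close>
    define g where "g m = (\<lambda>(t, \<omega>). if 0 \<le> dyadic_above m t \<and> ennreal (dyadic_above m t) \<le> q
      then X (dyadic_above m t) \<omega> else 0)" for m
    have [measurable]: "(\<lambda>\<omega>. if 0 \<le> r \<and> ennreal r \<le> q then X r \<omega> else 0) \<in> borel_measurable (F q)" for r
    proof (cases "0 \<le> r \<and> ennreal r \<le> q")
      case True
      then have "X r \<in> borel_measurable (F (ennreal r))" using ad by (simp add: adapted_process_def)
      with True show ?thesis using sets_F_mono[of "ennreal r" q] by (auto simp: measurable_def space_F)
    qed auto
    have "g m \<in> borel_measurable (borel \<Otimes>\<^sub>M F q)" for m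
      unfolding g_def dyadic_above_def case_prod_beta
      by (rule measurable_compose_countable[of "\<lambda>i p. if 0 \<le> (real_of_int i + 1) / 2 ^ m \<and> ennreal ((real_of_int i + 1) / 2 ^ m) \<le> q
          then X ((real_of_int i + 1) / 2 ^ m) (snd p) else 0" _ _ "\<lambda>p. \<lfloor>2 ^ m * fst p\<rfloor>"])
         (auto intro: measurable_compose[OF measurable_snd])
    then show "g m \<in> borel_measurable ?R" for m by (rule measurable_restrict_space1)
    show "(\<lambda>m. g m p) \<longlonglongrightarrow> (case p of (t, \<omega>) \<Rightarrow> X t \<omega>)" if pR: "p \<in> space ?R" for p
    proof -
      obtain t \<omega> where p: "p = (t, \<omega>)" "0 \<le> t" "ennreal t < q" "\<omega> \<in> space M" using pR sp by (cases p) auto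
      have "((\<lambda>s. X s \<omega>) \<longlongrightarrow> X t \<omega>) (at_right t)"
        using rc p by (auto simp: right_continuous_process_def continuous_within)
      moreover have "filterlim (\<lambda>m. dyadic_above m t) (at_right t) sequentially"
        unfolding filterlim_at using dyadic_above_tendsto by (auto simp: dyadic_above_gt less_imp_neq[OF dyadic_above_gt, symmetric])
      ultimately have lim: "(\<lambda>m. X (dyadic_above m t) \<omega>) \<longlonglongrightarrow> X t \<omega>" by (rule filterlim_compose)
      have "(\<lambda>m. ennreal (dyadic_above m t)) \<longlonglongrightarrow> ennreal t"
        by (intro tendsto_ennrealI dyadic_above_tendsto)
      then have "eventually (\<lambda>m. ennreal (dyadic_above m t) < q) sequentially"
        using p(3) by (rule order_tendstoD)
      then have "eventually (\<lambda>m. X (dyadic_above m t) \<omega> = g m p) sequentially"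
      proof eventually_elim
        case (elim m)
        moreover have "0 \<le> dyadic_above m t" using dyadic_above_gt[of t m] p(2) by linarith
        ultimately show ?case by (simp add: g_def p(1))
      qed
      from Lim_transform_eventually[OF lim this] show ?thesis by (simp add: p(1))
    qed
  qed
  show ?thesis
    unfolding optional_algebra_def
  proof (rule measurable_measure_of)
    show "(\<Union>X\<in>{X. right_continuous_process M X \<and> adapted_process F X}.
        rv_events ({0..} \<times> space M) (\<lambda>(t, \<omega>). X t \<omega>)) \<subseteq> Pow ({0..} \<times> space M)"
      by (auto simp: rv_events_def)
    show "(\<lambda>x. x) \<in> space ?R \<rightarrow> {0..} \<times> space M" unfolding sp by auto
    fix A assume "A \<in> (\<Union>X\<in>{X. right_continuous_process M X \<and> adapted_process F X}.
        rv_events ({0..} \<times> space M) (\<lambda>(t, \<omega>). X t \<omega>))"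
    then obtain X B where XB: "right_continuous_process M X" "adapted_process F X" "B \<in> sets borel"
      and A: "A = (\<lambda>(t, \<omega>). X t \<omega>) -` B \<inter> {0..} \<times> space M" by (auto simp: rv_events_def)
    have "(\<lambda>x. x) -` A \<inter> space ?R = (\<lambda>(t, \<omega>). X t \<omega>) -` B \<inter> space ?R"
      unfolding sp A by auto
    also have "\<dots> \<in> sets ?R" using X[OF XB(1,2)] XB(3) by (rule measurable_sets)
    finally show "(\<lambda>x. x) -` A \<inter> space ?R \<in> sets ?R" .
  qed
qed

text \<open>The free source \<open>L\<close> and the map \<open>w\<close> into the path space cover
  two uses: joint measurability in path and jumps, with \<open>q = \<infinity>\<close> and
  \<open>w\<close> a projection, and adaptedness of sections, with \<open>L = F q\<close> and
  constant jumps.\<close>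

lemma measurable_optional_at_random_time:
  fixes F :: "ennreal \<Rightarrow> 'a measure" and \<tau> :: "'c \<Rightarrow> ennreal" and f :: "(real \<times> 'a) \<times> 'b \<Rightarrow> 'd::real_normed_vector"
  assumes filt: "filtration (space M) F"
    and f: "f \<in> borel_measurable (optional_algebra M F \<Otimes>\<^sub>M N)"
    and w [measurable]: "w \<in> L \<rightarrow>\<^sub>M F q" and y [measurable]: "y \<in> L \<rightarrow>\<^sub>M N"
    and \<tau> [measurable]: "(\<lambda>x. if \<tau> x < q then \<tau> x else 0) \<in> borel_measurable L" "{x\<in>space L. \<tau> x < q} \<in> sets L"
  shows "(\<lambda>x. if \<tau> x < q then f ((enn2real (\<tau> x), w x), y x) else 0) \<in> borel_measurable L"
proof -
  interpret filtration "space M" F by (rule filt)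
  let ?A = "{x. \<tau> x < q}"
  let ?R = "restrict_space (borel \<Otimes>\<^sub>M F q) {(t, \<omega>). 0 \<le> t \<and> ennreal t < q \<and> \<omega> \<in> space M}"
  have sp: "space (restrict_space L ?A) = {x\<in>space L. \<tau> x < q}" by (auto simp: space_restrict_space)
  have "(\<lambda>x. enn2real (if \<tau> x < q then \<tau> x else 0)) \<in> borel_measurable (restrict_space L ?A)"
    by (intro measurable_restrict_space1) measurable
  then have t: "(\<lambda>x. enn2real (\<tau> x)) \<in> borel_measurable (restrict_space L ?A)"
    by (rule measurable_cong[THEN iffD1, rotated]) (auto simp: sp)
  have lt: "ennreal (enn2real (\<tau> x)) < q" if "\<tau> x < q" for x
    using that less_le_trans[OF that top_greatest] by simp
  have "w \<in> space L \<rightarrow> space M" using measurable_space[OF w] by (auto simp: space_F)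
  then have "(\<lambda>x. (enn2real (\<tau> x), w x)) \<in> restrict_space L ?A \<rightarrow>\<^sub>M ?R"
    by (intro measurable_restrict_space2 measurable_Pair t measurable_restrict_space1[OF w])
       (auto simp: sp lt)
  then have "(\<lambda>x. (enn2real (\<tau> x), w x)) \<in> restrict_space L ?A \<rightarrow>\<^sub>M optional_algebra M F"
    using measurable_compose[OF _ measurable_id_optional_algebra[OF filt]] by blast
  then have "(\<lambda>x. ((enn2real (\<tau> x), w x), y x)) \<in> restrict_space L ?A \<rightarrow>\<^sub>M optional_algebra M F \<Otimes>\<^sub>M N"
    by (intro measurable_Pair measurable_restrict_space1[OF y])
  from measurable_compose[OF this f]
  have "(\<lambda>x. f ((enn2real (\<tau> x), w x), y x)) \<in> borel_measurable (restrict_space L ?A)" .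
  then show ?thesis
    by (subst measurable_If_restrict_space_iff) auto
qed

text \<open>On the event that it comes before \<open>q\<close>, the value of a stopping time is
  known at \<open>q\<close>; the 0 elsewhere is a placeholder.\<close>

lemma measurable_stopping_time_before:
  fixes F :: "ennreal \<Rightarrow> 'a measure"
  assumes filt: "filtration \<Omega> F" and \<tau>: "stopping_time F \<tau>"
  shows "{x\<in>\<Omega>. \<tau> x < q} \<in> sets (F q)"
    and "(\<lambda>x. if \<tau> x < q then \<tau> x else 0) \<in> borel_measurable (F q)"
proof -
  interpret filtration \<Omega> F by (rule filt)
  have [measurable]: "Measurable.pred (F q) (\<lambda>x. \<tau> x < q)"
    by (rule stopping_time_less_const[OF \<tau>])
  then show "{x\<in>\<Omega>. \<tau> x < q} \<in> sets (F q)" using predE space_F by metis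
  show "(\<lambda>x. if \<tau> x < q then \<tau> x else 0) \<in> borel_measurable (F q)"
  proof (rule borel_measurableI_le)
    fix a
    show "{x \<in> space (F q). (if \<tau> x < q then \<tau> x else 0) \<le> a} \<in> sets (F q)"
    proof (cases "q \<le> a")
      case True
      then have "{x \<in> space (F q). (if \<tau> x < q then \<tau> x else 0) \<le> a} = space (F q)" by auto
      then show ?thesis by simp
    next
      case False
      then have [measurable]: "Measurable.pred (F q) (\<lambda>x. \<tau> x \<le> a)"
        by (intro stopping_time_le_const[OF \<tau>]) auto
      have "{x \<in> space (F q). (if \<tau> x < q then \<tau> x else 0) \<le> a} = {x \<in> space (F q). \<tau> x \<le> a \<or> \<not> \<tau> x < q}"
        using False by auto
      then show ?thesis by simp
    qed
  qed
qed

section \<open>The reference measure\<close>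

type_synonym 'e jump_data = "(nat \<Rightarrow> real) \<times> (nat \<Rightarrow> 'e)"
type_synonym ('a, 'e) stage_processes = "nat \<Rightarrow> real \<Rightarrow> 'a \<Rightarrow> (nat \<Rightarrow> real) \<Rightarrow> (nat \<Rightarrow> 'e) \<Rightarrow> real"

definition jump_space :: "'e::euclidean_space set \<Rightarrow> nat \<Rightarrow> 'e jump_data measure" where
  "jump_space E k = time_space k (Delta k) \<Otimes>\<^sub>M mark_space E k"

text \<open>The maximum only serves to make \<open>extend\<close> map into the ordered vectors for all arguments.\<close>

definition extend :: "nat \<Rightarrow> 'e jump_data \<Rightarrow> real \<times> 'e \<Rightarrow> 'e jump_data" where
  "extend k p q = ((fst p)(Suc k := max (fst q) (last_time k (fst p))), (snd p)(Suc k := snd q))"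

lemma space_time_space: "space (time_space k D) = D \<inter> ({1..k} \<rightarrow>\<^sub>E UNIV)"
  by (auto simp: time_space_def space_restrict_space space_PiM)

lemma space_time_space_Delta [simp]: "space (time_space k (Delta k)) = Delta k"
  by (auto simp: space_time_space Delta_def)

lemma space_jump_space: "space (jump_space E k) = Delta k \<times> space (mark_space E k)"
  by (simp add: jump_space_def space_pair_measure)

lemma measurable_time_space_PiM: "(\<lambda>\<theta>. \<theta>) \<in> time_space k D \<rightarrow>\<^sub>M (\<Pi>\<^sub>M i\<in>{1..k}. borel)"
  unfolding time_space_def by (intro measurable_restrict_space1) simp

lemma measurable_component_time_space:
  assumes "i \<in> {1..k}" shows "(\<lambda>\<theta>. \<theta> i) \<in> borel_measurable (time_space k D)"
  by (rule measurable_compose[OF measurable_time_space_PiM measurable_component_singleton[OF assms]])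

lemma measurable_last_time: "last_time k \<in> borel_measurable (time_space k D)"
  by (cases "k = 0") (auto simp: last_time_def[abs_def] intro: measurable_component_time_space)

lemma last_time_nonneg: "\<theta> \<in> Delta k \<Longrightarrow> 0 \<le> last_time k \<theta>"
  by (auto simp: last_time_def Delta_def)

lemma Delta_extend_iff:
  assumes "\<theta> \<in> Delta k" shows "\<theta>(Suc k := u) \<in> Delta (Suc k) \<longleftrightarrow> last_time k \<theta> \<le> u"
proof
  assume "\<theta>(Suc k := u) \<in> Delta (Suc k)"
  then have *: "\<forall>i\<in>{1..Suc k}. 0 \<le> (\<theta>(Suc k := u)) i"
    "\<forall>i\<in>{1..Suc k}. \<forall>j\<in>{1..Suc k}. i \<le> j \<longrightarrow> (\<theta>(Suc k := u)) i \<le> (\<theta>(Suc k := u)) j"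
    by (auto simp: Delta_def)
  show "last_time k \<theta> \<le> u"
  proof (cases "k = 0")
    case True then show ?thesis using *(1) by (auto simp: last_time_def)
  next
    case False
    then show ?thesis using *(2)[rule_format, of k "Suc k"] by (auto simp: last_time_def)
  qed
next
  assume u: "last_time k \<theta> \<le> u"
  have le: "\<theta> i \<le> u" if "i \<in> {1..k}" for i
  proof -
    have "\<theta> i \<le> \<theta> k" using assms that by (auto simp: Delta_def)
    then show ?thesis using u that by (auto simp: last_time_def)
  qed
  have "0 \<le> u" using u last_time_nonneg[OF assms] by simp
  then show "\<theta>(Suc k := u) \<in> Delta (Suc k)"
    using assms le by (auto simp: Delta_def PiE_iff extensional_def le_Suc_eq)
qed

lemma extend_eq: "last_time k \<theta> \<le> u \<Longrightarrow> extend k (\<theta>, e) (u, x) = (\<theta>(Suc k := u), e(Suc k := x))"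
  by (simp add: extend_def)

lemma measurable_extend:
  "(\<lambda>(p, q). extend k p q) \<in> jump_space E k \<Otimes>\<^sub>M (borel \<Otimes>\<^sub>M restrict_space borel E) \<rightarrow>\<^sub>M jump_space E (Suc k)"
proof -
  let ?L = "jump_space E k \<Otimes>\<^sub>M ((borel :: real measure) \<Otimes>\<^sub>M restrict_space borel E)"
  have f1: "(\<lambda>z. fst (fst z)) \<in> ?L \<rightarrow>\<^sub>M time_space k (Delta k)"
    and f2: "(\<lambda>z. snd (fst z)) \<in> ?L \<rightarrow>\<^sub>M mark_space E k"
    unfolding jump_space_def by measurable
  note f1' = measurable_compose[OF f1 measurable_last_time] measurable_compose[OF f1 measurable_time_space_PiM]
  have "(\<lambda>z. (fst (fst z))(Suc k := max (fst (snd z)) (last_time k (fst (fst z))))) \<in> ?L \<rightarrow>\<^sub>M time_space (Suc k) (Delta (Suc k))"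
    unfolding time_space_def
  proof (rule measurable_restrict_space2)
    show "(\<lambda>z. (fst (fst z))(Suc k := max (fst (snd z)) (last_time k (fst (fst z))))) \<in> space ?L \<rightarrow> Delta (Suc k)"
    proof
      fix z assume "z \<in> space ?L"
      then have "fst (fst z) \<in> Delta k" using measurable_space[OF f1] by simp
      then show "(fst (fst z))(Suc k := max (fst (snd z)) (last_time k (fst (fst z)))) \<in> Delta (Suc k)"
        by (simp add: Delta_extend_iff)
    qed
    show "(\<lambda>z. (fst (fst z))(Suc k := max (fst (snd z)) (last_time k (fst (fst z))))) \<in> ?L \<rightarrow>\<^sub>M (\<Pi>\<^sub>M i\<in>{1..Suc k}. borel)"
      by (rule measurable_fun_upd[OF _ f1'(2)]) (use f1'(1) in \<open>auto\<close>)
  qed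
  moreover have "(\<lambda>z. (snd (fst z))(Suc k := snd (snd z))) \<in> ?L \<rightarrow>\<^sub>M mark_space E (Suc k)"
    unfolding mark_space_def
    by (rule measurable_fun_upd[OF _ f2[unfolded mark_space_def]]) auto
  ultimately show ?thesis
    unfolding jump_space_def[of E "Suc k"] extend_def case_prod_beta by (rule measurable_Pair)
qed

lemma measurable_extend_compose [measurable (raw)]:
  assumes f: "f \<in> L \<rightarrow>\<^sub>M jump_space E k" and g: "g \<in> borel_measurable L" and h: "h \<in> L \<rightarrow>\<^sub>M restrict_space borel E"
  shows "(\<lambda>z. extend k (f z) (g z, h z)) \<in> L \<rightarrow>\<^sub>M jump_space E (Suc k)"
  using measurable_compose[OF measurable_Pair[OF f measurable_Pair[OF g h]] measurable_extend] by simp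

lemma measurable_last_time_fst [measurable (raw)]:
  assumes "f \<in> L \<rightarrow>\<^sub>M jump_space E k"
  shows "(\<lambda>z. last_time k (fst (f z))) \<in> borel_measurable L"
  using measurable_compose[OF measurable_compose[OF assms[unfolded jump_space_def] measurable_fst] measurable_last_time] .

text \<open>Measurability of iterated integrals is proved with a parameter \<open>a\<close>; the
  statement without parameter is the case of the one-point type.\<close>

lemma measurable_unit_parameter:
  assumes "(\<lambda>(a, p). g p) \<in> count_space (UNIV :: unit set) \<Otimes>\<^sub>M N \<rightarrow>\<^sub>M K"
  shows "g \<in> N \<rightarrow>\<^sub>M K"
  using measurable_compose[OF measurable_Pair1'[of "()" "count_space UNIV" N] assms] by simp

section \<open>Iterated integrals over further jumps\<close>

locale jump_kernels =
  fixes E :: "'e::euclidean_space set" and n :: nat and \<eta> :: "'e mark_kernels"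
  assumes kernels: "transition_kernels E n \<eta>"
begin

lemma measurable_kernel:
  assumes "k < n"
  shows "(\<lambda>p. \<eta> (Suc k) (fst p) (snd p)) \<in> jump_space E k \<rightarrow>\<^sub>M prob_algebra (restrict_space borel E)"
  using kernels assms by (auto simp: transition_kernels_def jump_space_def case_prod_beta)

lemma kernel_space:
  assumes "k < n" "p \<in> space (jump_space E k)"
  shows "sets (\<eta> (Suc k) (fst p) (snd p)) = sets (restrict_space borel E)" "prob_space (\<eta> (Suc k) (fst p) (snd p))"
  using measurable_space[OF measurable_kernel[OF assms(1)] assms(2)] by (auto simp: space_prob_algebra)

lemma kernel_space':
  assumes "k < n" "p \<in> space (jump_space E k)"
  shows "space (\<eta> (Suc k) (fst p) (snd p)) = E"
  using sets_eq_imp_space_eq[OF kernel_space(1)[OF assms]] by (simp add: space_restrict_space)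

text \<open>One layer of \<open>ref_integral\<close>, separated so that each property is proved for
  a single layer and passed on by induction.\<close>

definition next_jump_integral :: "nat \<Rightarrow> ('e jump_data \<Rightarrow> ennreal) \<Rightarrow> 'e jump_data \<Rightarrow> ennreal" where
  "next_jump_integral k f p = (\<integral>\<^sup>+u\<in>{last_time k (fst p)..}.
     (\<integral>\<^sup>+x. f ((fst p)(Suc k := u), (snd p)(Suc k := x)) \<partial>\<eta> (Suc k) (fst p) (snd p)) \<partial>lborel)"

lemma next_jump_integral_extend:
  "next_jump_integral k f p = (\<integral>\<^sup>+u\<in>{last_time k (fst p)..}.
     (\<integral>\<^sup>+x. f (extend k p (u, x)) \<partial>\<eta> (Suc k) (fst p) (snd p)) \<partial>lborel)"
  unfolding next_jump_integral_def by (cases p) (auto intro!: nn_integral_cong simp: extend_eq split: split_indicator)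

lemma measurable_mark_integral:
  assumes k: "k < n" and f: "(\<lambda>(a, p). f a p) \<in> borel_measurable (A \<Otimes>\<^sub>M jump_space E (Suc k))"
  shows "(\<lambda>((a, p), u). \<integral>\<^sup>+x. f a (extend k p (u, x)) \<partial>\<eta> (Suc k) (fst p) (snd p))
    \<in> borel_measurable ((A \<Otimes>\<^sub>M jump_space E k) \<Otimes>\<^sub>M borel)"
proof -
  have "(\<lambda>z. f (fst (fst (fst z))) (extend k (snd (fst (fst z))) (snd (fst z), snd z)))
      \<in> borel_measurable (((A \<Otimes>\<^sub>M jump_space E k) \<Otimes>\<^sub>M borel) \<Otimes>\<^sub>M restrict_space borel E)"
  proof -
    have "(\<lambda>z. (fst (fst (fst z)), extend k (snd (fst (fst z))) (snd (fst z), snd z)))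
      \<in> ((A \<Otimes>\<^sub>M jump_space E k) \<Otimes>\<^sub>M borel) \<Otimes>\<^sub>M restrict_space borel E \<rightarrow>\<^sub>M A \<Otimes>\<^sub>M jump_space E (Suc k)"
      by measurable
    from measurable_compose[OF this f] show ?thesis by simp
  qed
  moreover have "(\<lambda>z. \<eta> (Suc k) (fst (snd (fst z))) (snd (snd (fst z)))) \<in>
      (A \<Otimes>\<^sub>M jump_space E k) \<Otimes>\<^sub>M borel \<rightarrow>\<^sub>M subprob_algebra (restrict_space borel E)"
    by (rule measurable_compose[OF _ measurable_prob_algebraD[OF measurable_kernel[OF k]]]) measurable
  ultimately show ?thesis
    unfolding case_prod_beta
    by (intro nn_integral_measurable_subprob_algebra2[where N = "restrict_space borel E"]) (simp_all add: split_beta')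
qed

lemma measurable_next_jump_integral:
  assumes k: "k < n" and f: "(\<lambda>(a, p). f a p) \<in> borel_measurable (A \<Otimes>\<^sub>M jump_space E (Suc k))"
  shows "(\<lambda>(a, p). next_jump_integral k (f a) p) \<in> borel_measurable (A \<Otimes>\<^sub>M jump_space E k)"
proof -
  have 1: "(\<lambda>z. \<integral>\<^sup>+x. f (fst (fst z)) (extend k (snd (fst z)) (snd z, x)) \<partial>\<eta> (Suc k) (fst (snd (fst z))) (snd (snd (fst z))))
      \<in> borel_measurable ((A \<Otimes>\<^sub>M jump_space E k) \<Otimes>\<^sub>M lborel)"
    using measurable_mark_integral[OF k f] by (simp add: split_beta' cong: measurable_cong_sets)
  have "(\<lambda>z. if last_time k (fst (snd (fst z))) \<le> snd z then
      (\<integral>\<^sup>+x. f (fst (fst z)) (extend k (snd (fst z)) (snd z, x)) \<partial>\<eta> (Suc k) (fst (snd (fst z))) (snd (snd (fst z)))) else 0)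
      \<in> borel_measurable ((A \<Otimes>\<^sub>M jump_space E k) \<Otimes>\<^sub>M lborel)"
    by (rule measurable_If[OF 1]) measurable
  then have "(\<lambda>z. \<integral>\<^sup>+u. (if last_time k (fst (snd z)) \<le> u then
      (\<integral>\<^sup>+x. f (fst z) (extend k (snd z) (u, x)) \<partial>\<eta> (Suc k) (fst (snd z)) (snd (snd z))) else 0) \<partial>lborel)
      \<in> borel_measurable (A \<Otimes>\<^sub>M jump_space E k)"
    by (intro lborel.borel_measurable_nn_integral) (simp add: split_beta')
  then show ?thesis
    by (rule measurable_cong[THEN iffD1, rotated])
       (auto simp: next_jump_integral_extend intro!: nn_integral_cong split: split_indicator)
qed

lemma measurable_ref_integral:
  assumes "k + m \<le> n" and "(\<lambda>(a, (\<theta>, e)). f a \<theta> e) \<in> borel_measurable (A \<Otimes>\<^sub>M jump_space E (k + m))"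
  shows "(\<lambda>(a, (\<theta>, e)). ref_integral \<eta> (f a) m k \<theta> e) \<in> borel_measurable (A \<Otimes>\<^sub>M jump_space E k)"
  using assms
proof (induction m arbitrary: k)
  case (Suc m)
  then have "(\<lambda>(a, (\<theta>, e)). ref_integral \<eta> (f a) m (Suc k) \<theta> e) \<in> borel_measurable (A \<Otimes>\<^sub>M jump_space E (Suc k))"
    by simp
  moreover have "k < n" using Suc.prems(1) by simp
  ultimately have "(\<lambda>(a, p). next_jump_integral k (\<lambda>p. ref_integral \<eta> (f a) m (Suc k) (fst p) (snd p)) p) \<in> borel_measurable (A \<Otimes>\<^sub>M jump_space E k)"
    by (intro measurable_next_jump_integral) (simp_all add: split_beta')
  then show ?case by (simp add: next_jump_integral_def case_prod_beta)
qed (simp add: split_beta')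

lemma measurable_ref_integral_section:
  assumes "k + m \<le> n" and f: "f \<in> borel_measurable (jump_space E (k + m))"
  shows "(\<lambda>p. ref_integral \<eta> (\<lambda>\<theta> e. f (\<theta>, e)) m k (fst p) (snd p)) \<in> borel_measurable (jump_space E k)"
proof (rule measurable_unit_parameter)
  have "(\<lambda>(a, (\<theta>, e)). f (\<theta>, e)) \<in> borel_measurable (count_space (UNIV :: unit set) \<Otimes>\<^sub>M jump_space E (k + m))"
    using measurable_compose[OF measurable_snd f] by (simp add: split_beta')
  from measurable_ref_integral[OF assms(1) this]
  show "(\<lambda>(a, p). ref_integral \<eta> (\<lambda>\<theta> e. f (\<theta>, e)) m k (fst p) (snd p))
      \<in> borel_measurable (count_space (UNIV :: unit set) \<Otimes>\<^sub>M jump_space E k)"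
    by (simp add: split_beta')
qed

text \<open>Waiting times are exponential because \<open>\<bind>\<close> composes probability
  kernels, which Lebesgue measure on a half line is not; the exponential density is removed again by
  the weight in \<open>ref_measure\<close>.\<close>

definition jump_kernel :: "nat \<Rightarrow> 'e jump_data \<Rightarrow> 'e jump_data measure" where
  "jump_kernel k p = density lborel (exponential_density 1) \<bind> (\<lambda>v. \<eta> (Suc k) (fst p) (snd p) \<bind>
     (\<lambda>x. return (jump_space E (Suc k)) (extend k p (last_time k (fst p) + v, x))))"

text \<open>The reference measure \<open>d\<theta>\<^sub>1 \<dots> d\<theta>\<^sub>k \<eta>(de\<^sub>1) \<dots> \<eta>(de\<^sub>k)\<close> is infinite. It is obtained from the
  probability measure under which the waiting times are exponential: the product of the waiting time
  densities is \<open>exp (- \<theta>\<^sub>k)\<close>.\<close>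

primrec exp_jump_measure :: "nat \<Rightarrow> 'e jump_data measure" where
  "exp_jump_measure 0 = return (jump_space E 0) (\<lambda>_. undefined, \<lambda>_. undefined)"
| "exp_jump_measure (Suc k) = exp_jump_measure k \<bind> jump_kernel k"

definition ref_measure :: "nat \<Rightarrow> 'e jump_data measure" where
  "ref_measure k = density (exp_jump_measure k) (\<lambda>p. ennreal (exp (last_time k (fst p))))"

lemma exp_in_prob_algebra: "density lborel (exponential_density 1) \<in> space (prob_algebra borel)"
  using prob_space_exponential_density[of 1] by (simp add: space_prob_algebra)

lemma measurable_jump_kernel:
  assumes k: "k < n"
  shows "jump_kernel k \<in> jump_space E k \<rightarrow>\<^sub>M prob_algebra (jump_space E (Suc k))"
proof -
  note [measurable] = measurable_kernel[OF k]
  have 1: "(\<lambda>z. extend k (fst (fst z)) (last_time k (fst (fst (fst z))) + snd (fst z), snd z)) \<in>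
      (jump_space E k \<Otimes>\<^sub>M borel) \<Otimes>\<^sub>M restrict_space borel E \<rightarrow>\<^sub>M jump_space E (Suc k)"
    by measurable
  have "(\<lambda>(z, x). return (jump_space E (Suc k)) (extend k (fst z) (last_time k (fst (fst z)) + snd z, x))) \<in>
      (jump_space E k \<Otimes>\<^sub>M borel) \<Otimes>\<^sub>M restrict_space borel E \<rightarrow>\<^sub>M prob_algebra (jump_space E (Suc k))"
    using measurable_compose[OF 1 measurable_return_prob_space] by (simp add: split_beta')
  then have "(\<lambda>z. \<eta> (Suc k) (fst (fst z)) (snd (fst z)) \<bind>
     (\<lambda>x. return (jump_space E (Suc k)) (extend k (fst z) (last_time k (fst (fst z)) + snd z, x)))) \<in>
      jump_space E k \<Otimes>\<^sub>M borel \<rightarrow>\<^sub>M prob_algebra (jump_space E (Suc k))"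
    by (intro measurable_bind_prob_space2[where N = "restrict_space borel E"]) measurable
  then show ?thesis
    unfolding jump_kernel_def[abs_def]
    by (intro measurable_bind_prob_space2[where N = borel] measurable_const exp_in_prob_algebra)
       (simp add: split_beta')
qed

lemma exp_jump_measure_in: "k \<le> n \<Longrightarrow> exp_jump_measure k \<in> space (prob_algebra (jump_space E k))"
proof (induction k)
  case 0
  have "(\<lambda>_. undefined, \<lambda>_. undefined) \<in> space (jump_space E 0)"
    by (auto simp: space_jump_space Delta_def mark_space_def space_PiM)
  from measurable_space[OF measurable_return_prob_space this] show ?case by simp
next
  case (Suc k)
  then have 1: "exp_jump_measure k \<in> space (prob_algebra (jump_space E k))" "k < n" by auto
  from prob_space_bind'[OF 1(1) measurable_jump_kernel[OF 1(2)]] sets_bind'[OF 1(1) measurable_jump_kernel[OF 1(2)]]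
  show ?case by (simp add: space_prob_algebra)
qed

lemma sets_exp_jump_measure: "k \<le> n \<Longrightarrow> sets (exp_jump_measure k) = sets (jump_space E k)"
  using exp_jump_measure_in by (auto simp: space_prob_algebra)

lemma sets_ref_measure: "k \<le> n \<Longrightarrow> sets (ref_measure k) = sets (jump_space E k)"
  by (simp add: ref_measure_def sets_exp_jump_measure)

lemma space_ref_measure: "k \<le> n \<Longrightarrow> space (ref_measure k) = space (jump_space E k)"
  using sets_ref_measure by (rule sets_eq_imp_space_eq)

lemma nn_integral_ref_measure:
  assumes "k \<le> n" "f \<in> borel_measurable (jump_space E k)"
  shows "(\<integral>\<^sup>+p. f p \<partial>ref_measure k) = (\<integral>\<^sup>+p. ennreal (exp (last_time k (fst p))) * f p \<partial>exp_jump_measure k)"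
  unfolding ref_measure_def
  by (rule nn_integral_density) (use assms sets_exp_jump_measure[OF assms(1)] in \<open>auto cong: measurable_cong_sets\<close>)

text \<open>A finite-valued density with respect to a probability measure. This is what permits
  Fubini arguments with \<open>M\<close>.\<close>

lemma sigma_finite_ref_measure: "k \<le> n \<Longrightarrow> sigma_finite_measure (ref_measure k)"
proof -
  assume k: "k \<le> n"
  interpret prob_space "exp_jump_measure k" using exp_jump_measure_in[OF k] by (simp add: space_prob_algebra)
  have "(\<lambda>p. ennreal (exp (last_time k (fst p)))) \<in> borel_measurable (exp_jump_measure k)"
    using sets_exp_jump_measure[OF k] by (simp cong: measurable_cong_sets)
  then show ?thesis unfolding ref_measure_def by (subst sigma_finite_iff_density_finite) auto
qed

text \<open>The weight \<open>exp (l + v)\<close> at the new time times the exponential density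
  \<open>exp (- v)\<close> is \<open>exp l\<close>, the weight at the old time. What remains in
  \<open>v\<close> is Lebesgue measure on the half line, shifted by \<open>l\<close>.\<close>

lemma nn_integral_jump_kernel:
  assumes k: "k < n" and p: "p \<in> space (jump_space E k)" and f [measurable]: "f \<in> borel_measurable (jump_space E (Suc k))"
  shows "(\<integral>\<^sup>+q. ennreal (exp (last_time (Suc k) (fst q))) * f q \<partial>jump_kernel k p) =
    ennreal (exp (last_time k (fst p))) * next_jump_integral k f p"
proof -
  let ?\<eta> = "\<eta> (Suc k) (fst p) (snd p)" and ?l = "last_time k (fst p)"
  let ?g = "\<lambda>q. ennreal (exp (last_time (Suc k) (fst q))) * f q"
  note s [measurable_cong] = kernel_space(1)[OF k p]
  have [measurable]: "(\<lambda>z. extend k p (?l + fst z, snd z)) \<in> borel \<Otimes>\<^sub>M restrict_space borel E \<rightarrow>\<^sub>M jump_space E (Suc k)"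
    using p by measurable
  have [measurable]: "(\<lambda>z. extend k p (fst z, snd z)) \<in> borel \<Otimes>\<^sub>M restrict_space borel E \<rightarrow>\<^sub>M jump_space E (Suc k)"
    using p by measurable
  have ext1: "(\<lambda>x. extend k p (v, x)) \<in> restrict_space borel E \<rightarrow>\<^sub>M jump_space E (Suc k)" for v
    using p by measurable
  have r: "(\<lambda>x. return (jump_space E (Suc k)) (extend k p (v, x))) \<in> ?\<eta> \<rightarrow>\<^sub>M subprob_algebra (jump_space E (Suc k))" for v
    using measurable_compose[OF ext1 return_measurable] by (simp cong: measurable_cong_sets add: s)
  have \<eta>_in: "?\<eta> \<in> space (prob_algebra (restrict_space borel E))"
    using measurable_space[OF measurable_kernel[OF k] p] .
  have b: "(\<lambda>v. ?\<eta> \<bind> (\<lambda>x. return (jump_space E (Suc k)) (extend k p (?l + v, x)))) \<in> borel \<rightarrow>\<^sub>M prob_algebra (jump_space E (Suc k))"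
  proof (rule measurable_bind_prob_space2[where N = "restrict_space borel E"])
    show "(\<lambda>v. ?\<eta>) \<in> borel \<rightarrow>\<^sub>M prob_algebra (restrict_space borel E)" using \<eta>_in by simp
    have "(\<lambda>z. return (jump_space E (Suc k)) (extend k p (?l + fst z, snd z))) \<in> borel \<Otimes>\<^sub>M restrict_space borel E \<rightarrow>\<^sub>M prob_algebra (jump_space E (Suc k))"
      by measurable
    then show "(\<lambda>(v, x). return (jump_space E (Suc k)) (extend k p (?l + v, x))) \<in> borel \<Otimes>\<^sub>M restrict_space borel E \<rightarrow>\<^sub>M prob_algebra (jump_space E (Suc k))"
      by (simp add: split_beta')
  qed
  interpret \<eta>: prob_space ?\<eta> by (rule kernel_space(2)[OF k p])
  have m1 [measurable]: "(\<lambda>u. \<integral>\<^sup>+x. f (extend k p (u, x)) \<partial>?\<eta>) \<in> borel_measurable borel"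
  proof (rule \<eta>.borel_measurable_nn_integral)
    have "(\<lambda>z. f (extend k p (fst z, snd z))) \<in> borel_measurable (borel \<Otimes>\<^sub>M ?\<eta>)"
      by measurable
    then show "(\<lambda>(u, x). f (extend k p (u, x))) \<in> borel_measurable (borel \<Otimes>\<^sub>M ?\<eta>)"
      by (simp add: split_beta')
  qed
  have inner: "(\<integral>\<^sup>+q. ?g q \<partial>(?\<eta> \<bind> (\<lambda>x. return (jump_space E (Suc k)) (extend k p (?l + v, x))))) =
      ennreal (exp (?l + v)) * (\<integral>\<^sup>+x. f (extend k p (?l + v, x)) \<partial>?\<eta>)" if "0 \<le> v" for v
  proof -
    have mm [measurable]: "(\<lambda>x. f (extend k p (?l + v, x))) \<in> borel_measurable ?\<eta>"
      using measurable_compose[OF ext1 f] by (simp cong: measurable_cong_sets add: s)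
    have "(\<integral>\<^sup>+q. ?g q \<partial>(?\<eta> \<bind> (\<lambda>x. return (jump_space E (Suc k)) (extend k p (?l + v, x))))) =
      (\<integral>\<^sup>+x. \<integral>\<^sup>+q. ?g q \<partial>return (jump_space E (Suc k)) (extend k p (?l + v, x)) \<partial>?\<eta>)"
      by (rule nn_integral_bind[OF _ r]) measurable
    also have "\<dots> = (\<integral>\<^sup>+x. ?g (extend k p (?l + v, x)) \<partial>?\<eta>)"
    proof (rule nn_integral_cong)
      fix x assume "x \<in> space ?\<eta>"
      then have "extend k p (?l + v, x) \<in> space (jump_space E (Suc k))"
        using measurable_space[OF ext1[of "?l + v"], of x] kernel_space'[OF k p] by (simp add: space_restrict_space)
      then show "(\<integral>\<^sup>+q. ?g q \<partial>return (jump_space E (Suc k)) (extend k p (?l + v, x))) = ?g (extend k p (?l + v, x))"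
        by (intro nn_integral_return) auto
    qed
    also have "\<dots> = (\<integral>\<^sup>+x. ennreal (exp (?l + v)) * f (extend k p (?l + v, x)) \<partial>?\<eta>)"
      using that by (intro nn_integral_cong) (simp add: extend_def last_time_def)
    also have "\<dots> = ennreal (exp (?l + v)) * (\<integral>\<^sup>+x. f (extend k p (?l + v, x)) \<partial>?\<eta>)"
      by (rule nn_integral_cmult) measurable
    finally show ?thesis .
  qed
  have "(\<integral>\<^sup>+q. ?g q \<partial>jump_kernel k p) = (\<integral>\<^sup>+v. \<integral>\<^sup>+q. ?g q \<partial>(?\<eta> \<bind> (\<lambda>x. return (jump_space E (Suc k)) (extend k p (?l + v, x)))) \<partial>density lborel (exponential_density 1))"
    unfolding jump_kernel_def
    by (rule nn_integral_bind[where B = "jump_space E (Suc k)"]) (use measurable_prob_algebraD[OF b] in simp_all)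
  also have "\<dots> = (\<integral>\<^sup>+v. exponential_density 1 v * (\<integral>\<^sup>+q. ?g q \<partial>(?\<eta> \<bind> (\<lambda>x. return (jump_space E (Suc k)) (extend k p (?l + v, x))))) \<partial>lborel)"
    by (rule nn_integral_density)
       (use measurable_compose[OF measurable_prob_algebraD[OF b] nn_integral_measurable_subprob_algebra] in simp_all)
  \<comment> \<open>The factor 1 before \<open>v\<close> puts the integrand in the form required by
    the affine substitution of the last step.\<close>
  also have "\<dots> = (\<integral>\<^sup>+v. ennreal (exp ?l) * ((\<integral>\<^sup>+x. f (extend k p (?l + 1 * v, x)) \<partial>?\<eta>) * indicator {?l..} (?l + 1 * v)) \<partial>lborel)"
  proof (rule nn_integral_cong)
    fix v :: real
    show "exponential_density 1 v * (\<integral>\<^sup>+q. ?g q \<partial>(?\<eta> \<bind> (\<lambda>x. return (jump_space E (Suc k)) (extend k p (?l + v, x))))) =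
      ennreal (exp ?l) * ((\<integral>\<^sup>+x. f (extend k p (?l + 1 * v, x)) \<partial>?\<eta>) * indicator {?l..} (?l + 1 * v))"
    proof (cases "0 \<le> v")
      case True
      have "ennreal (exp (- v)) * ennreal (exp (?l + v)) = ennreal (exp ?l)"
        by (simp add: ennreal_mult[symmetric] exp_add[symmetric])
      with True show ?thesis
        by (simp add: inner exponential_density_def mult.assoc[symmetric])
    qed (simp add: exponential_density_def)
  qed
  also have "\<dots> = ennreal (exp ?l) * (\<integral>\<^sup>+v. (\<integral>\<^sup>+x. f (extend k p (?l + 1 * v, x)) \<partial>?\<eta>) * indicator {?l..} (?l + 1 * v) \<partial>lborel)"
    by (rule nn_integral_cmult) measurable
  also have "\<dots> = ennreal (exp ?l) * next_jump_integral k f p"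
    unfolding next_jump_integral_extend
    by (subst (2) nn_integral_real_affine[where c = 1 and t = ?l]) simp_all
  finally show ?thesis .
qed

lemma nn_integral_ref_measure_Suc:
  assumes k: "k < n" and f [measurable]: "f \<in> borel_measurable (jump_space E (Suc k))"
  shows "(\<integral>\<^sup>+p. f p \<partial>ref_measure (Suc k)) = (\<integral>\<^sup>+p. next_jump_integral k f p \<partial>ref_measure k)"
proof -
  have sp: "space (exp_jump_measure k) = space (jump_space E k)"
    using sets_exp_jump_measure[of k] k by (intro sets_eq_imp_space_eq) auto
  have m: "next_jump_integral k f \<in> borel_measurable (jump_space E k)"
  proof (rule measurable_unit_parameter)
    have "(\<lambda>(a, p). f p) \<in> borel_measurable (count_space (UNIV :: unit set) \<Otimes>\<^sub>M jump_space E (Suc k))"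
      by measurable
    from measurable_next_jump_integral[OF k this]
    show "(\<lambda>(a, p). next_jump_integral k f p) \<in> borel_measurable (count_space (UNIV :: unit set) \<Otimes>\<^sub>M jump_space E k)" .
  qed
  have "(\<integral>\<^sup>+p. f p \<partial>ref_measure (Suc k)) = (\<integral>\<^sup>+q. ennreal (exp (last_time (Suc k) (fst q))) * f q \<partial>exp_jump_measure (Suc k))"
    using k by (intro nn_integral_ref_measure) auto
  also have "\<dots> = (\<integral>\<^sup>+p. \<integral>\<^sup>+q. ennreal (exp (last_time (Suc k) (fst q))) * f q \<partial>jump_kernel k p \<partial>exp_jump_measure k)"
    unfolding exp_jump_measure.simps
    by (rule nn_integral_bind[where B = "jump_space E (Suc k)"])
       (use measurable_prob_algebraD[OF measurable_jump_kernel[OF k]] sets_exp_jump_measure[of k] k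
         in \<open>auto cong: measurable_cong_sets\<close>)
  also have "\<dots> = (\<integral>\<^sup>+p. ennreal (exp (last_time k (fst p))) * next_jump_integral k f p \<partial>exp_jump_measure k)"
    by (intro nn_integral_cong nn_integral_jump_kernel k f) (simp add: sp)
  also have "\<dots> = (\<integral>\<^sup>+p. next_jump_integral k f p \<partial>ref_measure k)"
    using k m by (intro nn_integral_ref_measure[symmetric]) auto
  finally show ?thesis .
qed

text \<open>The induction raises \<open>k\<close>: the outermost of the \<open>m\<close> integrals
  is absorbed into the measure, one layer at a time.\<close>

lemma nn_integral_ref_measure_add:
  assumes "k + m \<le> n" "f \<in> borel_measurable (jump_space E (k + m))"
  shows "(\<integral>\<^sup>+p. f p \<partial>ref_measure (k + m)) = (\<integral>\<^sup>+p. ref_integral \<eta> (\<lambda>\<theta> e. f (\<theta>, e)) m k (fst p) (snd p) \<partial>ref_measure k)"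
  using assms
proof (induction m arbitrary: k)
  case (Suc m)
  have m: "(\<lambda>p. ref_integral \<eta> (\<lambda>\<theta> e. f (\<theta>, e)) m (Suc k) (fst p) (snd p)) \<in> borel_measurable (jump_space E (Suc k))"
    using measurable_ref_integral_section[of "Suc k" m f] Suc.prems by simp
  have "(\<integral>\<^sup>+p. f p \<partial>ref_measure (k + Suc m)) =
      (\<integral>\<^sup>+p. ref_integral \<eta> (\<lambda>\<theta> e. f (\<theta>, e)) m (Suc k) (fst p) (snd p) \<partial>ref_measure (Suc k))"
    using Suc.IH[of "Suc k"] Suc.prems by simp
  also have "\<dots> = (\<integral>\<^sup>+p. next_jump_integral k (\<lambda>p. ref_integral \<eta> (\<lambda>\<theta> e. f (\<theta>, e)) m (Suc k) (fst p) (snd p)) p \<partial>ref_measure k)"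
    using Suc.prems m by (intro nn_integral_ref_measure_Suc) auto
  finally show ?case by (simp add: next_jump_integral_def)
qed simp

lemma nn_integral_ref_measure_0:
  assumes "f \<in> borel_measurable (jump_space E 0)"
  shows "(\<integral>\<^sup>+p. (f p :: ennreal) \<partial>ref_measure 0) = f (\<lambda>_. undefined, \<lambda>_. undefined)"
proof -
  have "(\<lambda>_. undefined, \<lambda>_. undefined) \<in> space (jump_space E 0)"
    by (auto simp: space_jump_space Delta_def mark_space_def space_PiM)
  then show ?thesis
    using assms by (subst nn_integral_ref_measure) (auto simp: nn_integral_return last_time_def)
qed

lemma nn_integral_ref_measure_eq:
  assumes "m \<le> n" "f \<in> borel_measurable (jump_space E m)"
  shows "(\<integral>\<^sup>+p. f p \<partial>ref_measure m) = ref_integral \<eta> (\<lambda>\<theta> e. f (\<theta>, e)) m 0 (\<lambda>_. undefined) (\<lambda>_. undefined)"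
proof -
  have "(\<lambda>p. ref_integral \<eta> (\<lambda>\<theta> e. f (\<theta>, e)) m 0 (fst p) (snd p)) \<in> borel_measurable (jump_space E 0)"
    using measurable_ref_integral_section[of 0 m f] assms by simp
  with nn_integral_ref_measure_add[of 0 m f] nn_integral_ref_measure_0[OF this] assms show ?thesis by simp
qed

end

section \<open>The joint law of path, jump times and marks\<close>

text \<open>The sets that can be so approximated contain the algebra and are closed under
  complements and countable disjoint unions. One set \<open>A\<close> serves both measures at once,
  as a comparison of the two requires.\<close>

lemma approx_by_algebra:
  fixes M N :: "'a measure"
  assumes fin: "finite_measure M" "finite_measure N"
    and alg: "algebra \<Omega> \<A>" and sets: "sets M = sigma_sets \<Omega> \<A>" "sets N = sigma_sets \<Omega> \<A>"
    and B: "B \<in> sigma_sets \<Omega> \<A>" and "0 < (\<epsilon>::real)"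
  shows "\<exists>A\<in>\<A>. measure M (B - A) < \<epsilon> \<and> measure M (A - B) < \<epsilon> \<and> measure N (B - A) < \<epsilon> \<and> measure N (A - B) < \<epsilon>"
proof -
  interpret M: finite_measure M by fact
  interpret N: finite_measure N by fact
  interpret algebra \<Omega> \<A> by fact
  have Int_stable: "Int_stable \<A>" by (auto intro: Int_stableI)
  have sub: "\<A> \<subseteq> sigma_sets \<Omega> \<A>" by auto
  note [simp] = sets
  have "\<forall>\<epsilon>>0. \<exists>A\<in>\<A>. measure M (B - A) < \<epsilon> \<and> measure M (A - B) < \<epsilon> \<and> measure N (B - A) < \<epsilon> \<and> measure N (A - B) < \<epsilon>"
  proof (induction rule: sigma_sets_induct_disjoint[OF Int_stable space_closed B])
    case (1 A) then show ?case by (auto intro!: bexI[of _ A])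
  next
    case 2 then show ?case by (auto intro!: bexI[of _ "{}"])
  next
    case (3 B)
    have "B \<subseteq> \<Omega>" using 3 sigma_sets_into_sp[OF space_closed] by blast
    show ?case
    proof (intro allI impI)
      fix \<epsilon> :: real assume "0 < \<epsilon>"
      with 3 obtain A where A: "A \<in> \<A>" "measure M (B - A) < \<epsilon>" "measure M (A - B) < \<epsilon>" "measure N (B - A) < \<epsilon>" "measure N (A - B) < \<epsilon>"
        by blast
      have "\<Omega> - B - (\<Omega> - A) = A - B" "\<Omega> - A - (\<Omega> - B) = B - A"
        using \<open>B \<subseteq> \<Omega>\<close> sets_into_space[OF A(1)] by auto
      with A show "\<exists>A\<in>\<A>. measure M (\<Omega> - B - A) < \<epsilon> \<and> measure M (A - (\<Omega> - B)) < \<epsilon> \<and> measure N (\<Omega> - B - A) < \<epsilon> \<and> measure N (A - (\<Omega> - B)) < \<epsilon>"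
        by (intro bexI[of _ "\<Omega> - A"]) auto
    qed
  next
    case (4 B)
    have Bs: "B i \<in> sigma_sets \<Omega> \<A>" for i using 4 by auto
    let ?T = "\<lambda>N. (\<Union>i. B i) - (\<Union>i<N. B i)"
    have Ts: "?T k \<in> sigma_sets \<Omega> \<A>" for k
    proof -
      have [measurable]: "B i \<in> sets M" for i using Bs[of i] by simp
      have "?T k \<in> sets M" by measurable
      then show ?thesis by simp
    qed
    have T0: "(\<Inter>k. ?T k) = {}" by auto
    have dec: "decseq ?T" by (fastforce simp: decseq_def)
    have limM: "(\<lambda>k. measure M (?T k)) \<longlonglongrightarrow> 0"
      using M.finite_Lim_measure_decseq[OF _ dec] Ts unfolding T0 by (simp add: image_subset_iff)
    have limN: "(\<lambda>k. measure N (?T k)) \<longlonglongrightarrow> 0"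
      using N.finite_Lim_measure_decseq[OF _ dec] Ts unfolding T0 by (simp add: image_subset_iff)
    show ?case
    proof (intro allI impI)
      fix \<epsilon> :: real assume \<epsilon>: "0 < \<epsilon>"
      have "eventually (\<lambda>k. measure M (?T k) < \<epsilon>/2 \<and> measure N (?T k) < \<epsilon>/2) sequentially"
        using order_tendstoD(2)[OF limM, of "\<epsilon>/2"] order_tendstoD(2)[OF limN, of "\<epsilon>/2"] \<epsilon> by (auto elim: eventually_elim2)
      then obtain k where k: "measure M (?T k) < \<epsilon>/2" "measure N (?T k) < \<epsilon>/2"
        using eventually_happens'[OF sequentially_bot] by blast
      \<comment> \<open>One half of \<epsilon> is spent on the tail \<open>?T k\<close>, the other
        on \<open>k\<close> approximations with error \<delta> each; \<open>Suc k\<close> avoids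
        division by zero.\<close>
      define \<delta> where "\<delta> = \<epsilon> / (2 * real (Suc k))"
      have \<delta>: "0 < \<delta>" "real k * \<delta> \<le> \<epsilon> / 2" using \<epsilon> by (auto simp: \<delta>_def field_simps)
      have "\<forall>i. \<exists>A\<in>\<A>. measure M (B i - A) < \<delta> \<and> measure M (A - B i) < \<delta> \<and> measure N (B i - A) < \<delta> \<and> measure N (A - B i) < \<delta>"
        using 4(3) \<delta>(1) by blast
      then obtain A where A: "\<And>i. A i \<in> \<A>" "\<And>i. measure M (B i - A i) < \<delta>" "\<And>i. measure M (A i - B i) < \<delta>"
          "\<And>i. measure N (B i - A i) < \<delta>" "\<And>i. measure N (A i - B i) < \<delta>"
        by metis
      have As: "A i \<in> sigma_sets \<Omega> \<A>" for i using A(1) by auto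
      define A' where "A' = (\<Union>i<k. A i)"
      have A': "A' \<in> \<A>" unfolding A'_def using A(1) by auto
      have bound: "measure K ((\<Union>i. B i) - A') < \<epsilon> \<and> measure K (A' - (\<Union>i. B i)) < \<epsilon>"
        if K: "finite_measure K" "sets K = sigma_sets \<Omega> \<A>" "measure K (?T k) < \<epsilon>/2"
          "\<And>i. measure K (B i - A i) < \<delta>" "\<And>i. measure K (A i - B i) < \<delta>" for K :: "'a measure"
      proof -
        interpret K: finite_measure K by fact
        note [measurable] = Bs[folded K(2)] As[folded K(2)] Ts[folded K(2)]
        have "measure K ((\<Union>i. B i) - A') \<le> measure K (?T k \<union> (\<Union>i<k. B i - A i))"
          by (rule K.finite_measure_mono) (auto simp: A'_def)
        also have "\<dots> \<le> measure K (?T k) + measure K (\<Union>i<k. B i - A i)"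
          by (rule measure_Un_le) auto
        also have "measure K (\<Union>i<k. B i - A i) \<le> (\<Sum>i<k. measure K (B i - A i))"
          by (rule K.finite_measure_subadditive_finite) auto
        also have "\<dots> \<le> (\<Sum>i<k. \<delta>)" using K(4) by (intro sum_mono) (auto intro: less_imp_le)
        also have "\<dots> \<le> \<epsilon> / 2" using \<delta>(2) by simp
        finally have 1: "measure K ((\<Union>i. B i) - A') < \<epsilon>" using K(3) by simp
        have "measure K (A' - (\<Union>i. B i)) \<le> measure K (\<Union>i<k. A i - B i)"
          by (rule K.finite_measure_mono) (auto simp: A'_def)
        also have "\<dots> \<le> (\<Sum>i<k. measure K (A i - B i))"
          by (rule K.finite_measure_subadditive_finite) auto
        also have "\<dots> \<le> (\<Sum>i<k. \<delta>)" using K(5) by (intro sum_mono) (auto intro: less_imp_le)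
        also have "\<dots> \<le> \<epsilon> / 2" using \<delta>(2) by simp
        finally show ?thesis using 1 \<epsilon> by simp
      qed
      show "\<exists>A\<in>\<A>. measure M ((\<Union>i. B i) - A) < \<epsilon> \<and> measure M (A - (\<Union>i. B i)) < \<epsilon> \<and> measure N ((\<Union>i. B i) - A) < \<epsilon> \<and> measure N (A - (\<Union>i. B i)) < \<epsilon>"
        using bound[OF fin(1) sets(1) k(1) A(2,3)] bound[OF fin(2) sets(2) k(2) A(4,5)] A' by blast
    qed
  qed
  with \<open>0 < \<epsilon>\<close> show ?thesis by blast
qed

text \<open>The sets on which an inequality between measures holds are not closed under complements,
  so the argument by generators stable under intersection, which settles equality, does not carry
  over. Approximation by sets of the algebra does.\<close>

lemma measure_le_of_le_on_algebra:
  fixes M N :: "'a measure"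
  assumes fin: "finite_measure M" "finite_measure N"
    and alg: "algebra \<Omega> \<A>" and sets: "sets M = sigma_sets \<Omega> \<A>" "sets N = sigma_sets \<Omega> \<A>"
    and le: "\<And>A. A \<in> \<A> \<Longrightarrow> emeasure M A \<le> emeasure N A"
    and B: "B \<in> sigma_sets \<Omega> \<A>"
  shows "emeasure M B \<le> emeasure N B"
proof -
  interpret M: finite_measure M by fact
  interpret N: finite_measure N by fact
  have "measure M B \<le> measure N B + \<epsilon>" if \<epsilon>: "0 < \<epsilon>" for \<epsilon>
  proof -
    from approx_by_algebra[OF fin alg sets B, of "\<epsilon>/2"] \<epsilon> obtain A
      where A: "A \<in> \<A>" "measure M (B - A) < \<epsilon>/2" "measure N (A - B) < \<epsilon>/2" by auto
    have As [measurable]: "A \<in> sets M" "B \<in> sets M" "A \<in> sets N" "B \<in> sets N" using A B by (auto simp: sets)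
    have "measure M B \<le> measure M (A \<union> (B - A))" by (rule M.finite_measure_mono) auto
    also have "\<dots> \<le> measure M A + measure M (B - A)" by (rule measure_Un_le) auto
    also have "measure M A \<le> measure N A"
      using le[OF A(1)] by (simp add: M.emeasure_eq_measure N.emeasure_eq_measure)
    also have "measure N A \<le> measure N (B \<union> (A - B))" by (rule N.finite_measure_mono) auto
    also have "\<dots> \<le> measure N B + measure N (A - B)" by (rule measure_Un_le) auto
    finally show ?thesis using A by simp
  qed
  then have "measure M B \<le> measure N B" by (rule field_le_epsilon)
  then show ?thesis by (simp add: M.emeasure_eq_measure N.emeasure_eq_measure)
qed

lemma finite_measure_eqI_rectangles:
  assumes sets: "sets K = sets (A \<Otimes>\<^sub>M B)" "sets K' = sets (A \<Otimes>\<^sub>M B)"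
    and fin: "emeasure K (space A \<times> space B) \<noteq> \<infinity>"
    and eq: "\<And>a b. a \<in> sets A \<Longrightarrow> b \<in> sets B \<Longrightarrow> emeasure K (a \<times> b) = emeasure K' (a \<times> b)"
  shows "K = K'"
proof (rule measure_eqI_generator_eq[OF Int_stable_pair_measure_generator[of A B], where A = "\<lambda>_. space A \<times> space B"])
  show "{a \<times> b |a b. a \<in> sets A \<and> b \<in> sets B} \<subseteq> Pow (space A \<times> space B)" by (rule pair_measure_closed)
qed (use sets fin eq in \<open>auto simp: sets_pair_measure\<close>)

text \<open>Right continuity says nothing about the index \<open>\<infinity>\<close>.
  \<open>sets_F_infinity\<close> ties the terminal sigma-algebra to the finite times, so that its
  sets can be approximated by those of the \<open>F t\<close>.\<close>

locale jump_model = usual_filtration M F + jump_kernels E n \<eta>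
  for M :: "'a measure" and F :: "ennreal \<Rightarrow> 'a measure" and E :: "'e::euclidean_space set" and n :: nat
    and \<eta> :: "'e mark_kernels" +
  fixes \<zeta> :: "nat \<Rightarrow> 'a \<Rightarrow> real" and L :: "nat \<Rightarrow> 'a \<Rightarrow> 'e"
    and \<alpha> :: "real \<Rightarrow> 'a \<Rightarrow> (nat \<Rightarrow> real) \<Rightarrow> (nat \<Rightarrow> 'e) \<Rightarrow> real"
  assumes jump_times: "jump_times_marks M E n \<zeta> L"
    and density: "jump_density M F E n \<zeta> L \<eta> \<alpha>"
    and sets_F_infinity: "sets (F \<infinity>) = sigma_sets (space M) (\<Union>t\<in>{0..}. sets (F (ennreal t)))"
begin

lemma filtration_F: "filtration (space M) F"
  by unfold_locales (auto simp: sets_F_mono)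

lemma F_prod_sub:
  assumes "s \<le> t" "f \<in> F s \<Otimes>\<^sub>M N \<rightarrow>\<^sub>M K"
  shows "f \<in> F t \<Otimes>\<^sub>M N \<rightarrow>\<^sub>M K"
proof -
  have "(\<lambda>p. (fst p, snd p)) \<in> F t \<Otimes>\<^sub>M N \<rightarrow>\<^sub>M F s \<Otimes>\<^sub>M N"
    by (intro measurable_Pair measurable_snd measurable_compose[OF measurable_fst F_sub_F[OF assms(1), of "\<lambda>x. x"]]) simp
  from measurable_compose[OF this assms(2)] show ?thesis by simp
qed

lemma F_prod_M:
  assumes "f \<in> F t \<Otimes>\<^sub>M N \<rightarrow>\<^sub>M K"
  shows "f \<in> M \<Otimes>\<^sub>M N \<rightarrow>\<^sub>M K"
proof -
  have "(\<lambda>p. (fst p, snd p)) \<in> M \<Otimes>\<^sub>M N \<rightarrow>\<^sub>M F t \<Otimes>\<^sub>M N"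
    by (intro measurable_Pair measurable_snd measurable_compose[OF measurable_fst F_sub_M[of "\<lambda>x. x" t]]) simp
  from measurable_compose[OF this assms] show ?thesis by simp
qed

section \<open>The density and its supremum as jointly measurable functions\<close>

abbreviation S :: "'e jump_data measure" where "S \<equiv> jump_space E n"
abbreviation R :: "'e jump_data measure" where "R \<equiv> ref_measure n"

definition jumps :: "'a \<Rightarrow> 'e jump_data" where
  "jumps \<omega> = (initial n \<zeta> \<omega>, initial n L \<omega>)"

definition alpha_at :: "real \<Rightarrow> 'a \<times> 'e jump_data \<Rightarrow> ennreal" where
  "alpha_at t p = ennreal (\<alpha> t (fst p) (fst (snd p)) (snd (snd p)))"

definition alpha_sup :: "'a \<times> 'e jump_data \<Rightarrow> ennreal" where
  "alpha_sup p = (SUP t\<in>{0..}. alpha_at t p)"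

sublocale R: sigma_finite_measure R by (rule sigma_finite_ref_measure) simp
sublocale MR: pair_sigma_finite M R ..

lemma sets_R [measurable_cong]: "sets R = sets S" by (simp add: sets_ref_measure)
lemma space_R: "space R = space S" by (simp add: space_ref_measure)

lemma measurable_jumps [measurable]: "jumps \<in> M \<rightarrow>\<^sub>M S"
proof -
  have "initial n \<zeta> \<in> M \<rightarrow>\<^sub>M time_space n (Delta n)"
    unfolding time_space_def
  proof (rule measurable_restrict_space2)
    show "initial n \<zeta> \<in> space M \<rightarrow> Delta n" using jump_times by (auto simp: jump_times_marks_def)
    show "initial n \<zeta> \<in> M \<rightarrow>\<^sub>M Pi\<^sub>M {1..n} (\<lambda>i. borel)"
      unfolding initial_def[abs_def] by (rule measurable_restrict) (use jump_times in \<open>auto simp: jump_times_marks_def\<close>)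
  qed
  moreover have "initial n L \<in> M \<rightarrow>\<^sub>M mark_space E n"
    unfolding initial_def[abs_def] mark_space_def
    by (rule measurable_restrict) (use jump_times in \<open>auto simp: jump_times_marks_def\<close>)
  ultimately show ?thesis unfolding jumps_def[abs_def] jump_space_def by (rule measurable_Pair)
qed

lemma alpha_optional: "(\<lambda>((t, \<omega>), (\<theta>, e)). \<alpha> t \<omega> \<theta> e) \<in> borel_measurable (optional_algebra M F \<Otimes>\<^sub>M S)"
  using density by (simp add: jump_density_def indexed_optional_def jump_space_def)


lemma measurable_fst_F: "fst \<in> M \<Otimes>\<^sub>M N \<rightarrow>\<^sub>M F t"
  using measurable_compose[OF measurable_fst F_sub_M[of "\<lambda>x. x" t "F t"]] by simp

lemma measurable_alpha_random_time:
  assumes [measurable]: "\<tau> \<in> borel_measurable (M \<Otimes>\<^sub>M S)"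
  shows "(\<lambda>p. if \<tau> p < \<infinity> then alpha_at (enn2real (\<tau> p)) p else 0) \<in> borel_measurable (M \<Otimes>\<^sub>M S)"
proof -
  have "(\<lambda>p. if \<tau> p < \<infinity> then (\<lambda>((t, \<omega>), (\<theta>, e)). \<alpha> t \<omega> \<theta> e) ((enn2real (\<tau> p), fst p), snd p) else 0)
      \<in> borel_measurable (M \<Otimes>\<^sub>M S)"
    by (rule measurable_optional_at_random_time[OF filtration_F alpha_optional measurable_fst_F]) measurable
  then have "(\<lambda>p. ennreal (if \<tau> p < \<infinity> then (\<lambda>((t, \<omega>), (\<theta>, e)). \<alpha> t \<omega> \<theta> e) ((enn2real (\<tau> p), fst p), snd p) else 0))
      \<in> borel_measurable (M \<Otimes>\<^sub>M S)"
    by measurable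
  then show ?thesis
    by (rule measurable_cong[THEN iffD1, rotated]) (auto simp: alpha_at_def split_beta')
qed

lemma measurable_alpha_at [measurable]: "0 \<le> t \<Longrightarrow> alpha_at t \<in> borel_measurable (M \<Otimes>\<^sub>M S)"
  using measurable_alpha_random_time[of "\<lambda>_. ennreal t"] by simp

lemma alpha_at_right_limit:
  assumes "0 \<le> t" "p \<in> space (M \<Otimes>\<^sub>M S)"
  shows "(\<lambda>m. alpha_at (dyadic_above m t) p) \<longlonglongrightarrow> alpha_at t p"
proof -
  obtain \<omega> \<theta> e where p: "p = (\<omega>, (\<theta>, e))" and \<omega>: "\<omega> \<in> space M" "\<theta> \<in> Delta n" "e \<in> space (mark_space E n)"
    using assms(2) by (cases p) (auto simp: space_pair_measure space_jump_space)
  have "right_continuous_process M (\<lambda>t \<omega>. \<alpha> t \<omega> \<theta> e)"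
    using density \<omega> by (simp add: jump_density_def)
  then have "((\<lambda>s. \<alpha> s \<omega> \<theta> e) \<longlongrightarrow> \<alpha> t \<omega> \<theta> e) (at_right t)"
    using assms \<omega> by (auto simp: right_continuous_process_def continuous_within)
  moreover have "filterlim (\<lambda>m. dyadic_above m t) (at_right t) sequentially"
    unfolding filterlim_at using dyadic_above_tendsto
    by (auto simp: dyadic_above_gt less_imp_neq[OF dyadic_above_gt, symmetric])
  ultimately have "(\<lambda>m. \<alpha> (dyadic_above m t) \<omega> \<theta> e) \<longlonglongrightarrow> \<alpha> t \<omega> \<theta> e" by (rule filterlim_compose)
  then show ?thesis unfolding alpha_at_def p by (auto intro!: tendsto_ennrealI)
qed

lemma dyadic_above_nonneg: "0 \<le> t \<Longrightarrow> 0 \<le> dyadic_above m t"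
  using dyadic_above_gt[of t m] by linarith

text \<open>The supremum runs over uncountably many times. By right continuity each value is a limit
  of values at dyadic times, so rational times suffice.\<close>

lemma measurable_alpha_sup [measurable]: "alpha_sup \<in> borel_measurable (M \<Otimes>\<^sub>M S)"
proof -
  have "(\<lambda>p. SUP t\<in>\<rat> \<inter> {0..}. alpha_at t p) \<in> borel_measurable (M \<Otimes>\<^sub>M S)"
    by (intro borel_measurable_SUP) (auto intro: countable_rat countable_Int1)
  then show ?thesis
  proof (rule measurable_cong[THEN iffD1, rotated])
    fix p assume p: "p \<in> space (M \<Otimes>\<^sub>M S)"
    show "(SUP t\<in>\<rat> \<inter> {0..}. alpha_at t p) = alpha_sup p"
      unfolding alpha_sup_def
    proof (rule antisym)
      show "(SUP t\<in>\<rat> \<inter> {0..}. alpha_at t p) \<le> (SUP t\<in>{0..}. alpha_at t p)"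
        by (intro SUP_subset_mono) auto
      show "(SUP t\<in>{0..}. alpha_at t p) \<le> (SUP t\<in>\<rat> \<inter> {0..}. alpha_at t p)"
      proof (rule SUP_least)
        fix t :: real assume t: "t \<in> {0..}"
        have "dyadic_above m t \<in> \<rat> \<inter> {0..}" for m
          using dyadic_above_nonneg[of t m] t by (auto simp: dyadic_above_def)
        then show "alpha_at t p \<le> (SUP t\<in>\<rat> \<inter> {0..}. alpha_at t p)"
          using t by (intro LIMSEQ_le_const2[OF alpha_at_right_limit[OF _ p]]) (auto intro!: exI[of _ 0] SUP_upper2[OF _ order_refl])
      qed
    qed
  qed
qed

lemma alpha_at_le_sup: "0 \<le> t \<Longrightarrow> alpha_at t p \<le> alpha_sup p"
  unfolding alpha_sup_def by (rule SUP_upper) auto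

lemma nn_integral_alpha_sup: "(\<integral>\<^sup>+p. alpha_sup p \<partial>(M \<Otimes>\<^sub>M R)) < \<infinity>"
proof -
  have "(\<integral>\<^sup>+p. alpha_sup p \<partial>(M \<Otimes>\<^sub>M R)) = (\<integral>\<^sup>+\<omega>. \<integral>\<^sup>+y. alpha_sup (\<omega>, y) \<partial>R \<partial>M)"
    by (intro R.nn_integral_fst[symmetric]) measurable
  also have "\<dots> = (\<integral>\<^sup>+\<omega>. ref_integral \<eta> (\<lambda>\<theta> e. alpha_sup (\<omega>, (\<theta>, e))) n 0 (\<lambda>_. undefined) (\<lambda>_. undefined) \<partial>M)"
    by (intro nn_integral_cong nn_integral_ref_measure_eq) auto
  also have "\<dots> < \<infinity>"
    using density by (simp add: jump_density_def alpha_sup_def alpha_at_def)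
  finally show ?thesis .
qed

text \<open>The conditional law gives the measure of each rectangle \<open>a \<times> b\<close> with
  \<open>a\<close> in \<open>F t\<close>, and rectangles determine a finite measure. The law given
  \<open>F t\<close> says nothing about the path after \<open>t\<close>, hence the measurability
  demanded of \<open>f\<close>.\<close>

lemma law_at_fixed_time:
  assumes t: "0 \<le> t" and f [measurable]: "f \<in> borel_measurable (F (ennreal t) \<Otimes>\<^sub>M S)"
  shows "(\<integral>\<^sup>+\<omega>. f (\<omega>, jumps \<omega>) \<partial>M) = (\<integral>\<^sup>+p. alpha_at t p * f p \<partial>(M \<Otimes>\<^sub>M R))"
proof -
  let ?H = "F (ennreal t) \<Otimes>\<^sub>M S"
  interpret sigma_finite_subalgebra M "F (ennreal t)" by (rule sigma_finite_subalgebra_F)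
  have id1: "(\<lambda>\<omega>. (\<omega>, jumps \<omega>)) \<in> M \<rightarrow>\<^sub>M ?H"
    by (intro measurable_Pair measurable_jumps F_sub_M[of "\<lambda>x. x" "ennreal t"]) simp
  have [measurable]: "alpha_at t \<in> borel_measurable (M \<Otimes>\<^sub>M S)" using t by simp
  have id2: "(\<lambda>p. p) \<in> M \<Otimes>\<^sub>M S \<rightarrow>\<^sub>M ?H" by (rule F_prod_M[of _ "ennreal t"]) simp
  then have id3 [measurable]: "(\<lambda>p. p) \<in> density (M \<Otimes>\<^sub>M R) (alpha_at t) \<rightarrow>\<^sub>M ?H"
    by (simp cong: measurable_cong_sets add: sets_R)
  have eq: "distr M ?H (\<lambda>\<omega>. (\<omega>, jumps \<omega>)) = distr (density (M \<Otimes>\<^sub>M R) (alpha_at t)) ?H (\<lambda>p. p)"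
  proof (rule finite_measure_eqI_rectangles[where A = "F (ennreal t)" and B = S])
    show "emeasure (distr M ?H (\<lambda>\<omega>. (\<omega>, jumps \<omega>))) (space (F (ennreal t)) \<times> space S) \<noteq> \<infinity>"
    proof -
      interpret Q: finite_measure "distr M ?H (\<lambda>\<omega>. (\<omega>, jumps \<omega>))" by (intro finite_measure_distr id1)
      show ?thesis by simp
    qed
    fix a b assume a [measurable]: "a \<in> sets (F (ennreal t))" and b [measurable]: "b \<in> sets S"
    have aM [measurable]: "a \<in> sets M" using a sets_F_le by blast
    have [measurable]: "a \<times> b \<in> sets ?H" "a \<times> b \<in> sets (M \<Otimes>\<^sub>M R)" by (auto simp: sets_R)
    have b': "b \<in> sets (time_space n (Delta n) \<Otimes>\<^sub>M mark_space E n)" using b by (simp add: jump_space_def)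
    have "emeasure (distr M ?H (\<lambda>\<omega>. (\<omega>, jumps \<omega>))) (a \<times> b) = (\<integral>\<^sup>+x. indicator (a \<times> b) x \<partial>distr M ?H (\<lambda>\<omega>. (\<omega>, jumps \<omega>)))"
      by simp
    also have "\<dots> = (\<integral>\<^sup>+\<omega>. indicator (a \<times> b) (\<omega>, jumps \<omega>) \<partial>M)"
      by (rule nn_integral_distr[OF id1]) simp
    also have "\<dots> = (\<integral>\<^sup>+\<omega>. indicator a \<omega> * indicator b (jumps \<omega>) \<partial>M)"
      by (intro nn_integral_cong) (simp add: indicator_times)
    also have "\<dots> = (\<integral>\<^sup>+\<omega>. indicator a \<omega> * nn_cond_exp M (F (ennreal t)) (\<lambda>\<omega>. indicator b (jumps \<omega>)) \<omega> \<partial>M)"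
      by (rule nn_cond_exp_intg[symmetric]) measurable
    also have "\<dots> = (\<integral>\<^sup>+\<omega>. indicator a \<omega> * ref_integral \<eta> (\<lambda>\<theta> e. indicator b (\<theta>, e) * alpha_at t (\<omega>, (\<theta>, e))) n 0
          (\<lambda>_. undefined) (\<lambda>_. undefined) \<partial>M)"
    proof (rule nn_integral_cong_AE)
      have "AE \<omega> in M. nn_cond_exp M (F (ennreal t)) (\<lambda>\<omega>. indicator b (initial n \<zeta> \<omega>, initial n L \<omega>)) \<omega> =
        ref_integral \<eta> (\<lambda>\<theta> e. indicator b (\<theta>, e) * ennreal (\<alpha> t \<omega> \<theta> e)) n 0 (\<lambda>_. undefined) (\<lambda>_. undefined)"
        using density t b' unfolding jump_density_def by blast
      then show "AE \<omega> in M. indicator a \<omega> * nn_cond_exp M (F (ennreal t)) (\<lambda>\<omega>. indicator b (jumps \<omega>)) \<omega> =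
        indicator a \<omega> * ref_integral \<eta> (\<lambda>\<theta> e. indicator b (\<theta>, e) * alpha_at t (\<omega>, (\<theta>, e))) n 0 (\<lambda>_. undefined) (\<lambda>_. undefined)"
        by eventually_elim (simp add: jumps_def alpha_at_def)
    qed
    also have "\<dots> = (\<integral>\<^sup>+\<omega>. indicator a \<omega> * (\<integral>\<^sup>+y. indicator b y * alpha_at t (\<omega>, y) \<partial>R) \<partial>M)"
      by (intro nn_integral_cong arg_cong2[where f = "(*)"] refl nn_integral_ref_measure_eq[symmetric]) auto
    also have "\<dots> = (\<integral>\<^sup>+\<omega>. \<integral>\<^sup>+y. indicator a \<omega> * (indicator b y * alpha_at t (\<omega>, y)) \<partial>R \<partial>M)"
      by (intro nn_integral_cong nn_integral_cmult[symmetric]) auto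
    also have "\<dots> = (\<integral>\<^sup>+\<omega>. \<integral>\<^sup>+y. alpha_at t (\<omega>, y) * indicator (a \<times> b) (\<omega>, y) \<partial>R \<partial>M)"
      by (intro nn_integral_cong) (simp add: indicator_times mult_ac)
    also have "\<dots> = (\<integral>\<^sup>+p. alpha_at t p * indicator (a \<times> b) p \<partial>(M \<Otimes>\<^sub>M R))"
      by (rule R.nn_integral_fst) measurable
    also have "\<dots> = emeasure (density (M \<Otimes>\<^sub>M R) (alpha_at t)) (a \<times> b)"
      by (intro emeasure_density[symmetric]) measurable
    also have "\<dots> = emeasure (distr (density (M \<Otimes>\<^sub>M R) (alpha_at t)) ?H (\<lambda>p. p)) (a \<times> b)"
    proof -
      have "a \<times> b \<subseteq> space (M \<Otimes>\<^sub>M R)" by (rule sets.sets_into_space) measurable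
      then show ?thesis by (subst emeasure_distr[OF id3]) (auto simp: Int_absorb2)
    qed
    finally show "emeasure (distr M ?H (\<lambda>\<omega>. (\<omega>, jumps \<omega>))) (a \<times> b) =
        emeasure (distr (density (M \<Otimes>\<^sub>M R) (alpha_at t)) ?H (\<lambda>p. p)) (a \<times> b)" .
  qed auto
  have [measurable]: "f \<in> borel_measurable (M \<Otimes>\<^sub>M S)" using F_prod_M[OF f] .
  have "(\<integral>\<^sup>+\<omega>. f (\<omega>, jumps \<omega>) \<partial>M) = (\<integral>\<^sup>+p. f p \<partial>distr M ?H (\<lambda>\<omega>. (\<omega>, jumps \<omega>)))"
    by (rule nn_integral_distr[OF id1, symmetric]) simp
  also have "\<dots> = (\<integral>\<^sup>+p. f p \<partial>density (M \<Otimes>\<^sub>M R) (alpha_at t))"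
    unfolding eq by (rule nn_integral_distr[OF id3]) simp
  also have "\<dots> = (\<integral>\<^sup>+p. alpha_at t p * f p \<partial>(M \<Otimes>\<^sub>M R))"
    by (rule nn_integral_density) measurable
  finally show ?thesis .
qed

text \<open>For the harder inclusion both projections are shown measurable for the sigma-algebra
  generated by the union, the first one by \<open>sets_F_infinity\<close>.\<close>

lemma sets_F_infinity_prod:
  "sets (F \<infinity> \<Otimes>\<^sub>M S) = sigma_sets (space M \<times> space S) (\<Union>t\<in>{0..}. sets (F (ennreal t) \<Otimes>\<^sub>M S))"
  (is "_ = sigma_sets ?\<Omega> ?A")
proof (rule antisym)
  have A_sub: "?A \<subseteq> sets (F \<infinity> \<Otimes>\<^sub>M S)"
  proof
    fix A assume "A \<in> ?A"
    then obtain t where t: "0 \<le> t" "A \<in> sets (F (ennreal t) \<Otimes>\<^sub>M S)" by auto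
    then have A: "A \<subseteq> space M \<times> space S" using sets.sets_into_space[OF t(2)] by (auto simp: space_pair_measure)
    have "(\<lambda>p. p) \<in> F \<infinity> \<Otimes>\<^sub>M S \<rightarrow>\<^sub>M F (ennreal t) \<Otimes>\<^sub>M S"
      by (rule F_prod_sub[of "ennreal t"]) auto
    from measurable_sets[OF this t(2)] A show "A \<in> sets (F \<infinity> \<Otimes>\<^sub>M S)"
      by (auto simp: space_pair_measure Int_absorb2)
  qed
  then show "sigma_sets ?\<Omega> ?A \<subseteq> sets (F \<infinity> \<Otimes>\<^sub>M S)"
    using sets.sigma_sets_subset[OF A_sub] by (simp add: space_pair_measure)
  have A_pow: "?A \<subseteq> Pow ?\<Omega>"
    using sets.sets_into_space by (fastforce simp: space_pair_measure)
  let ?H = "sigma ?\<Omega> ?A"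
  have "fst \<in> ?H \<rightarrow>\<^sub>M F \<infinity>"
  proof (rule measurable_sigma_sets[OF sets_F_infinity])
    show "(\<Union>t\<in>{0..}. sets (F (ennreal t))) \<subseteq> Pow (space M)"
      using sets.sets_into_space by fastforce
    fix a assume "a \<in> (\<Union>t\<in>{0..}. sets (F (ennreal t)))"
    then obtain t where t: "0 \<le> t" "a \<in> sets (F (ennreal t))" by auto
    have "fst -` a \<inter> space ?H = a \<times> space S"
      using A_pow sets.sets_into_space[OF t(2)] by (auto simp: space_measure_of)
    also have "\<dots> \<in> sets (F (ennreal t) \<Otimes>\<^sub>M S)" using t by auto
    finally show "fst -` a \<inter> space ?H \<in> sets ?H" using t(1) A_pow by auto
  qed (use A_pow in \<open>auto simp: space_measure_of\<close>)
  moreover have "snd \<in> ?H \<rightarrow>\<^sub>M S"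
  proof (rule measurableI)
    fix b assume b: "b \<in> sets S"
    have "snd -` b \<inter> space ?H = space (F (ennreal 0)) \<times> b"
      using A_pow sets.sets_into_space[OF b] by (auto simp: space_measure_of)
    also have "\<dots> \<in> sets (F (ennreal 0) \<Otimes>\<^sub>M S)" using b by blast
    finally show "snd -` b \<inter> space ?H \<in> sets ?H"
      unfolding sets_measure_of[OF A_pow] by (intro sigma_sets.Basic UN_I[of 0]) auto
  qed (use A_pow in \<open>auto simp: space_measure_of\<close>)
  ultimately have id: "(\<lambda>p. (fst p, snd p)) \<in> ?H \<rightarrow>\<^sub>M F \<infinity> \<Otimes>\<^sub>M S" by (rule measurable_Pair)
  show "sets (F \<infinity> \<Otimes>\<^sub>M S) \<subseteq> sigma_sets ?\<Omega> ?A"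
  proof
    fix B assume B: "B \<in> sets (F \<infinity> \<Otimes>\<^sub>M S)"
    have "B \<subseteq> ?\<Omega>" using sets.sets_into_space[OF B] by (simp add: space_pair_measure)
    with measurable_sets[OF id B] A_pow show "B \<in> sigma_sets ?\<Omega> ?A" by (simp add: space_measure_of Int_absorb2)
  qed
qed

text \<open>An increasing union of sigma-algebras: any two members lie in a common one, at the later
  of their times.\<close>

lemma algebra_F_prod: "algebra (space M \<times> space S) (\<Union>t\<in>{0..}. sets (F (ennreal t) \<Otimes>\<^sub>M S))"
proof -
  have mono: "sets (F (ennreal s) \<Otimes>\<^sub>M S) \<subseteq> sets (F (ennreal t) \<Otimes>\<^sub>M S)" if "s \<le> t" for s t
  proof
    fix A assume A: "A \<in> sets (F (ennreal s) \<Otimes>\<^sub>M S)"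
    have "(\<lambda>p. p) \<in> F (ennreal t) \<Otimes>\<^sub>M S \<rightarrow>\<^sub>M F (ennreal s) \<Otimes>\<^sub>M S"
      by (rule F_prod_sub[of "ennreal s"]) (auto simp: that ennreal_leI)
    from measurable_sets[OF this A] sets.sets_into_space[OF A] show "A \<in> sets (F (ennreal t) \<Otimes>\<^sub>M S)"
      by (auto simp: space_pair_measure Int_absorb2)
  qed
  show ?thesis
    unfolding algebra_iff_Un
  proof (intro conjI ballI)
    show "(\<Union>t\<in>{0..}. sets (F (ennreal t) \<Otimes>\<^sub>M S)) \<subseteq> Pow (space M \<times> space S)"
      using sets.sets_into_space by (fastforce simp: space_pair_measure)
    show "{} \<in> (\<Union>t\<in>{0..}. sets (F (ennreal t) \<Otimes>\<^sub>M S))" by auto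
    fix a assume "a \<in> (\<Union>t\<in>{0..}. sets (F (ennreal t) \<Otimes>\<^sub>M S))"
    then obtain s where s: "0 \<le> s" "a \<in> sets (F (ennreal s) \<Otimes>\<^sub>M S)" by auto
    from sets.compl_sets[OF s(2)] s(1) show "space M \<times> space S - a \<in> (\<Union>t\<in>{0..}. sets (F (ennreal t) \<Otimes>\<^sub>M S))"
      by (auto simp: space_pair_measure)
    fix b assume "b \<in> (\<Union>t\<in>{0..}. sets (F (ennreal t) \<Otimes>\<^sub>M S))"
    then obtain t where t: "0 \<le> t" "b \<in> sets (F (ennreal t) \<Otimes>\<^sub>M S)" by auto
    have "a \<union> b \<in> sets (F (ennreal (max s t)) \<Otimes>\<^sub>M S)"
      using mono[of s "max s t"] mono[of t "max s t"] s t by (intro sets.Un) auto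
    then show "a \<union> b \<in> (\<Union>t\<in>{0..}. sets (F (ennreal t) \<Otimes>\<^sub>M S))"
      using s(1) by (intro UN_I[of "max s t"]) auto
  qed
qed

text \<open>The integrable bound on the density extends the density from the sigma-algebras \<open>F\<^sub>t\<close>, \<open>t < \<infinity>\<close>, to
  absolute continuity of the joint law on \<open>F\<^sub>\<infinity>\<close>.\<close>

lemma AE_jumps:
  assumes P: "{p \<in> space (F \<infinity> \<Otimes>\<^sub>M S). \<not> P p} \<in> sets (F \<infinity> \<Otimes>\<^sub>M S)"
    and AE: "AE p in M \<Otimes>\<^sub>M R. P p"
  shows "AE \<omega> in M. P (\<omega>, jumps \<omega>)"
proof -
  let ?H = "F \<infinity> \<Otimes>\<^sub>M S" let ?B = "{p \<in> space ?H. \<not> P p}"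
  let ?Q = "distr M ?H (\<lambda>\<omega>. (\<omega>, jumps \<omega>))" and ?N = "distr (density (M \<Otimes>\<^sub>M R) alpha_sup) ?H (\<lambda>p. p)"
  have id1: "(\<lambda>\<omega>. (\<omega>, jumps \<omega>)) \<in> M \<rightarrow>\<^sub>M ?H"
    by (intro measurable_Pair measurable_jumps F_sub_M[of "\<lambda>x. x" \<infinity>]) simp
  have id2: "(\<lambda>p. p) \<in> M \<Otimes>\<^sub>M S \<rightarrow>\<^sub>M ?H" by (rule F_prod_M[of _ \<infinity>]) simp
  then have id3 [measurable]: "(\<lambda>p. p) \<in> density (M \<Otimes>\<^sub>M R) alpha_sup \<rightarrow>\<^sub>M ?H"
    by (simp cong: measurable_cong_sets add: sets_R)
  have N: "emeasure ?N A = (\<integral>\<^sup>+p. alpha_sup p * indicator A p \<partial>(M \<Otimes>\<^sub>M R))" if A: "A \<in> sets ?H" for A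
  proof -
    have sub: "A \<subseteq> space (M \<Otimes>\<^sub>M R)" using sets.sets_into_space[OF A] by (simp add: space_pair_measure space_R)
    then have "A \<in> sets (M \<Otimes>\<^sub>M S)" using measurable_sets[OF id2 A] by (auto simp: Int_absorb2 space_pair_measure space_R)
    then have [measurable]: "A \<in> sets (M \<Otimes>\<^sub>M R)" by (simp add: sets_R cong: sets_pair_measure_cong)
    have "emeasure ?N A = emeasure (density (M \<Otimes>\<^sub>M R) alpha_sup) A"
      using sub by (subst emeasure_distr[OF id3 A]) (auto simp: Int_absorb2)
    also have "\<dots> = (\<integral>\<^sup>+p. alpha_sup p * indicator A p \<partial>(M \<Otimes>\<^sub>M R))"
      by (rule emeasure_density) measurable
    finally show ?thesis .
  qed
  \<comment> \<open>At each finite \<open>t\<close> the joint law has the density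
    \<open>alpha_at t\<close>, which is at most \<open>alpha_sup\<close>. The finite measure
    \<open>?N\<close> thus dominates it on the generating algebra, and therefore on
    \<open>F \<infinity>\<close>.\<close>
  have "emeasure ?Q ?B \<le> emeasure ?N ?B"
  proof (rule measure_le_of_le_on_algebra[OF _ _ algebra_F_prod])
    show "finite_measure ?Q" by (intro finite_measure_distr id1)
    show "finite_measure ?N"
    proof (rule finite_measureI)
      have "emeasure ?N (space ?N) \<le> (\<integral>\<^sup>+p. alpha_sup p \<partial>(M \<Otimes>\<^sub>M R))"
        by (subst N) (auto intro!: nn_integral_mono split: split_indicator)
      also have "\<dots> < \<infinity>" by (rule nn_integral_alpha_sup)
      finally show "emeasure ?N (space ?N) \<noteq> \<infinity>" by simp
    qed
    show "?B \<in> sigma_sets (space M \<times> space S) (\<Union>t\<in>{0..}. sets (F (ennreal t) \<Otimes>\<^sub>M S))"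
      using P unfolding sets_F_infinity_prod .
    fix A assume A: "A \<in> (\<Union>t\<in>{0..}. sets (F (ennreal t) \<Otimes>\<^sub>M S))"
    then obtain t where t: "0 \<le> t" and [measurable]: "A \<in> sets (F (ennreal t) \<Otimes>\<^sub>M S)" by auto
    have A' [measurable]: "A \<in> sets ?H" using A unfolding sets_F_infinity_prod by (rule sigma_sets.Basic)
    have "emeasure ?Q A = (\<integral>\<^sup>+x. indicator A x \<partial>?Q)" by (subst nn_integral_indicator) (use A' in \<open>auto\<close>)
    also have "\<dots> = (\<integral>\<^sup>+\<omega>. indicator A (\<omega>, jumps \<omega>) \<partial>M)"
      by (subst nn_integral_distr[OF id1]) (unfold measurable_distr_eq1, rule borel_measurable_indicator[OF A'], rule refl)
    also have "\<dots> = (\<integral>\<^sup>+p. alpha_at t p * indicator A p \<partial>(M \<Otimes>\<^sub>M R))" by (rule law_at_fixed_time[OF t]) measurable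
    also have "\<dots> \<le> emeasure ?N A"
      unfolding N[OF A'] using t by (intro nn_integral_mono mult_right_mono alpha_at_le_sup) auto
    finally show "emeasure ?Q A \<le> emeasure ?N A" .
  qed (simp_all only: sets_distr sets_F_infinity_prod)
  also have "emeasure ?N ?B = 0"
  proof -
    have "(\<integral>\<^sup>+p. alpha_sup p * indicator ?B p \<partial>(M \<Otimes>\<^sub>M R)) = (\<integral>\<^sup>+p. 0 \<partial>(M \<Otimes>\<^sub>M R))"
      by (rule nn_integral_cong_AE) (use AE in eventually_elim, simp)
    then show ?thesis unfolding N[OF P] by simp
  qed
  finally have "?B \<in> null_sets ?Q" using P by (auto simp: null_sets_def)
  then have "AE p in ?Q. P p" by (rule AE_I') auto
  moreover have "{p \<in> space ?H. P p} \<in> sets ?H" using sets.sets_Collect_neg[OF P] by simp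
  ultimately show ?thesis by (subst (asm) AE_distr_iff[OF id1])
qed

text \<open>The exceptional null set may depend on \<open>y\<close>; since \<open>f\<close> and
  \<open>g\<close> are jointly measurable, Fubini still yields a null set of the product.\<close>

lemma AE_pair_sections:
  assumes f [measurable]: "f \<in> borel_measurable (M \<Otimes>\<^sub>M S)" "g \<in> borel_measurable (M \<Otimes>\<^sub>M S)"
    and eq: "\<And>y. y \<in> space S \<Longrightarrow> AE \<omega> in M. f (\<omega>, y) = (g (\<omega>, y) :: ennreal)"
  shows "AE p in M \<Otimes>\<^sub>M R. f p = g p"
proof -
  have "AE \<omega> in M. AE y in R. f (\<omega>, y) = g (\<omega>, y)"
    by (subst MR.AE_commute) (use eq space_R in \<open>auto simp: AE_I2\<close>)
  then show ?thesis by (intro MR.AE_pair_measure) auto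
qed

text \<open>Split according to the dyadic interval of mesh \<open>2^-m\<close> that contains \<tau>.
  On the \<open>i\<close>-th piece everything is known at its right end point \<open>r m i\<close>,
  so the law at that fixed time applies and produces \<alpha> at \<open>r m i\<close>. As
  \<open>m\<close> grows, right continuity moves \<alpha> back to the time \<tau>.\<close>

lemma law_at_stopping_time_bounded:
  fixes X \<tau> :: "'a \<times> 'e jump_data \<Rightarrow> ennreal"
  assumes X [measurable]: "X \<in> borel_measurable (F \<infinity> \<Otimes>\<^sub>M S)" and \<tau> [measurable]: "\<tau> \<in> borel_measurable (F \<infinity> \<Otimes>\<^sub>M S)"
    and st: "\<And>y. y \<in> space S \<Longrightarrow> stopping_time F (\<lambda>\<omega>. \<tau> (\<omega>, y))"
    and ad: "\<And>y q. y \<in> space S \<Longrightarrow> 0 \<le> q \<Longrightarrow>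
      (\<lambda>\<omega>. if \<tau> (\<omega>, y) < ennreal q then X (\<omega>, y) else 0) \<in> borel_measurable (F (ennreal q))"
    and bound: "\<And>p. X p \<le> c" and c: "c < \<infinity>"
  shows "(\<integral>\<^sup>+\<omega>. (if \<tau> (\<omega>, jumps \<omega>) < \<infinity> then X (\<omega>, jumps \<omega>) else 0) \<partial>M) =
    (\<integral>\<^sup>+p. X p * (if \<tau> p < \<infinity> then alpha_at (enn2real (\<tau> p)) p else 0) \<partial>(M \<Otimes>\<^sub>M R))" (is "?lhs = ?rhs")
proof -
  have [measurable]: "X \<in> borel_measurable (M \<Otimes>\<^sub>M S)" "\<tau> \<in> borel_measurable (M \<Otimes>\<^sub>M S)"
    using F_prod_M[OF X] F_prod_M[OF \<tau>] .
  have MRS: "f \<in> borel_measurable (M \<Otimes>\<^sub>M R) \<longleftrightarrow> f \<in> borel_measurable (M \<Otimes>\<^sub>M S)" for f :: "_ \<Rightarrow> ennreal"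
    using measurable_cong_sets[OF sets_pair_measure_cong[OF refl sets_R] refl] by blast
  have jm: "(\<lambda>\<omega>. (\<omega>, jumps \<omega>)) \<in> M \<rightarrow>\<^sub>M M \<Otimes>\<^sub>M S" by measurable
  note comp = measurable_compose[OF jm]
  \<comment> \<open>The event that \<tau> lies in \<open>[i / 2^m, r m i)\<close>. The strict upper
    end matches \<open>ad\<close>, which describes \<open>X\<close> only where \<tau> is strictly
    before the time in question.\<close>
  define D where "D m i p \<longleftrightarrow> \<tau> p < \<infinity> \<and> i = nat \<lfloor>2 ^ m * enn2real (\<tau> p)\<rfloor>" for m i p
  define r where "r m i = (real i + 1) / 2 ^ m" for m i :: nat
  define Xi where "Xi m i p = (if D m i p then X p else 0)" for m i p
  have r0: "0 \<le> r m i" for m i by (simp add: r_def)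
  have D_r: "dyadic_above m (enn2real (\<tau> p)) = r m i" if "D m i p" for m i p
    using that by (simp add: D_def dyadic_above_def r_def)
  have D_iff: "D m i p \<longleftrightarrow> \<not> \<tau> p < ennreal (real i / 2 ^ m) \<and> \<tau> p < ennreal (r m i)" for m i p
  proof (cases "\<tau> p")
    case (real t)
    have "i = nat \<lfloor>2 ^ m * t\<rfloor> \<longleftrightarrow> \<lfloor>2 ^ m * t\<rfloor> = int i" using real(1) by auto
    also have "\<dots> \<longleftrightarrow> real i \<le> 2 ^ m * t \<and> 2 ^ m * t < real i + 1" by (simp add: floor_eq_iff)
    also have "\<dots> \<longleftrightarrow> \<not> t < real i / 2 ^ m \<and> t < r m i" by (auto simp: r_def field_simps)
    finally show ?thesis using real by (simp add: D_def ennreal_less_iff)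
  qed (simp add: D_def)
  have Xi_F [measurable]: "Xi m i \<in> borel_measurable (F \<infinity> \<Otimes>\<^sub>M S)" for m i
    unfolding Xi_def[abs_def] D_iff by measurable
  have Xi_M [measurable]: "Xi m i \<in> borel_measurable (M \<Otimes>\<^sub>M S)" for m i using F_prod_M[OF Xi_F] .
  have Xi_section: "(\<lambda>\<omega>. Xi m i (\<omega>, y)) \<in> borel_measurable (F (ennreal (r m i)))" if y: "y \<in> space S" for m i y
  proof -
    have le: "ennreal (real i / 2 ^ m) \<le> ennreal (r m i)" by (intro ennreal_leI) (simp add: r_def divide_right_mono)
    have "{\<omega>\<in>space M. \<tau> (\<omega>, y) < ennreal (real i / 2 ^ m)} \<in> sets (F (ennreal (r m i)))"
      using measurable_stopping_time_before(1)[OF filtration_F st[OF y]] sets_F_mono[OF le] by blast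
    then have "(\<lambda>\<omega>. if \<tau> (\<omega>, y) < ennreal (real i / 2 ^ m) then 0 else
        if \<tau> (\<omega>, y) < ennreal (r m i) then X (\<omega>, y) else 0) \<in> borel_measurable (F (ennreal (r m i)))"
      by (intro measurable_If ad[OF y r0]) auto
    then show ?thesis
      by (rule measurable_cong[THEN iffD1, rotated]) (auto simp: Xi_def D_iff)
  qed
  \<comment> \<open>\<open>Xi m i\<close> has \<open>F (r m i)\<close>-measurable sections but is
    jointly measurable only for \<open>F \<infinity>\<close>. A jointly measurable version
    \<open>X'\<close> repairs this, and \<open>AE_jumps\<close> transfers the equality from the
    product measure to the actual jumps.\<close>
  have step: "(\<integral>\<^sup>+\<omega>. Xi m i (\<omega>, jumps \<omega>) \<partial>M) = (\<integral>\<^sup>+p. alpha_at (r m i) p * Xi m i p \<partial>(M \<Otimes>\<^sub>M R))" for m i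
  proof -
    interpret sigma_finite_subalgebra M "F (ennreal (r m i))" by (rule sigma_finite_subalgebra_F)
    from nn_cond_exp_version_at_fixed_time[OF Xi_M, of "ennreal (r m i)"] obtain X'
      where X': "X' \<in> borel_measurable (F (ennreal (r m i)) \<Otimes>\<^sub>M S)"
        and eq: "\<And>y. y \<in> space S \<Longrightarrow> AE \<omega> in M. X' (\<omega>, y) = nn_cond_exp M (F (ennreal (r m i))) (\<lambda>\<omega>. Xi m i (\<omega>, y)) \<omega>"
      by blast
    have [measurable]: "X' \<in> borel_measurable (M \<Otimes>\<^sub>M S)" using F_prod_M[OF X'] .
    have [measurable]: "X' \<in> borel_measurable (F \<infinity> \<Otimes>\<^sub>M S)" using F_prod_sub[OF _ X', of \<infinity>] by simp
    have AE: "AE p in M \<Otimes>\<^sub>M R. Xi m i p = X' p"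
    proof (rule AE_pair_sections)
      fix y assume y: "y \<in> space S"
      show "AE \<omega> in M. Xi m i (\<omega>, y) = X' (\<omega>, y)"
        using eq[OF y] nn_cond_exp_F_meas[OF Xi_section[OF y, of m i]] by eventually_elim simp
    qed measurable
    have "AE \<omega> in M. Xi m i (\<omega>, jumps \<omega>) = X' (\<omega>, jumps \<omega>)"
      by (rule AE_jumps[OF _ AE]) measurable
    then have "(\<integral>\<^sup>+\<omega>. Xi m i (\<omega>, jumps \<omega>) \<partial>M) = (\<integral>\<^sup>+\<omega>. X' (\<omega>, jumps \<omega>) \<partial>M)"
      by (rule nn_integral_cong_AE)
    also have "\<dots> = (\<integral>\<^sup>+p. alpha_at (r m i) p * X' p \<partial>(M \<Otimes>\<^sub>M R))"
      by (rule law_at_fixed_time[OF r0 X'])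
    also have "\<dots> = (\<integral>\<^sup>+p. alpha_at (r m i) p * Xi m i p \<partial>(M \<Otimes>\<^sub>M R))"
      by (rule nn_integral_cong_AE) (use AE in eventually_elim, simp)
    finally show ?thesis .
  qed
  have Xi_sum: "(\<Sum>i. f i * Xi m i p) = (if \<tau> p < \<infinity> then f (nat \<lfloor>2 ^ m * enn2real (\<tau> p)\<rfloor>) * X p else 0)" for m p and f :: "nat \<Rightarrow> ennreal"
  proof -
    have "(\<lambda>i. f i * Xi m i p) = (\<lambda>i. if i = nat \<lfloor>2 ^ m * enn2real (\<tau> p)\<rfloor> then (if \<tau> p < \<infinity> then f i * X p else 0) else 0)"
      by (auto simp: fun_eq_iff Xi_def D_def)
    then show ?thesis
      using sums_unique[OF sums_single[of "nat \<lfloor>2 ^ m * enn2real (\<tau> p)\<rfloor>" "\<lambda>i. if \<tau> p < \<infinity> then f i * X p else 0"]] by simp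
  qed
  define u where "u m p = X p * (if \<tau> p < \<infinity> then alpha_at (dyadic_above m (enn2real (\<tau> p))) p else 0)" for m p
  define u' where "u' p = X p * (if \<tau> p < \<infinity> then alpha_at (enn2real (\<tau> p)) p else 0)" for p
  have [measurable]: "alpha_at (r m i) \<in> borel_measurable (M \<Otimes>\<^sub>M S)" for m i using r0 by simp
  have u_sum: "u m p = (\<Sum>i. alpha_at (r m i) p * Xi m i p)" for m p
    unfolding Xi_sum by (auto simp: u_def dyadic_above_def r_def mult.commute)
  have [measurable]: "u m \<in> borel_measurable (M \<Otimes>\<^sub>M S)" for m unfolding u_sum[abs_def] by measurable
  have [measurable]: "u' \<in> borel_measurable (M \<Otimes>\<^sub>M S)"
    unfolding u'_def[abs_def] by (intro borel_measurable_times_ennreal measurable_alpha_random_time) measurable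
  \<comment> \<open>The left-hand side does not depend on \<open>m\<close>; on the right only the
    density is evaluated at the dyadic time, while \<open>X\<close> is unchanged.\<close>
  have lhs: "?lhs = (\<integral>\<^sup>+p. u m p \<partial>(M \<Otimes>\<^sub>M R))" for m
  proof -
    have "?lhs = (\<integral>\<^sup>+\<omega>. (\<Sum>i. Xi m i (\<omega>, jumps \<omega>)) \<partial>M)"
      using Xi_sum[of "\<lambda>_. 1"] by (intro nn_integral_cong) simp
    also have "\<dots> = (\<Sum>i. \<integral>\<^sup>+\<omega>. Xi m i (\<omega>, jumps \<omega>) \<partial>M)"
      by (intro nn_integral_suminf comp) measurable
    also have "\<dots> = (\<Sum>i. \<integral>\<^sup>+p. alpha_at (r m i) p * Xi m i p \<partial>(M \<Otimes>\<^sub>M R))" by (simp add: step)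
    also have "\<dots> = (\<integral>\<^sup>+p. u m p \<partial>(M \<Otimes>\<^sub>M R))"
      unfolding u_sum by (intro nn_integral_suminf[symmetric]) (simp add: MRS)
    finally show ?thesis .
  qed
  \<comment> \<open>The integrable supremum of the density is used here:
    \<open>c * alpha_sup\<close> dominates all \<open>u m\<close>.\<close>
  have "(\<lambda>m. \<integral>\<^sup>+p. u m p \<partial>(M \<Otimes>\<^sub>M R)) \<longlonglongrightarrow> (\<integral>\<^sup>+p. u' p \<partial>(M \<Otimes>\<^sub>M R))"
  proof (rule nn_integral_dominated_convergence[where w = "\<lambda>p. c * alpha_sup p"])
    have "(\<integral>\<^sup>+p. c * alpha_sup p \<partial>(M \<Otimes>\<^sub>M R)) = c * (\<integral>\<^sup>+p. alpha_sup p \<partial>(M \<Otimes>\<^sub>M R))"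
      by (rule nn_integral_cmult) (simp add: MRS)
    then show "(\<integral>\<^sup>+p. c * alpha_sup p \<partial>(M \<Otimes>\<^sub>M R)) < \<infinity>"
      using nn_integral_alpha_sup c by (simp add: ennreal_mult_less_top)
    show "AE p in M \<Otimes>\<^sub>M R. u m p \<le> c * alpha_sup p" for m
      by (rule AE_I2) (auto simp: u_def intro!: mult_mono bound alpha_at_le_sup dyadic_above_nonneg)
    show "AE p in M \<Otimes>\<^sub>M R. (\<lambda>m. u m p) \<longlonglongrightarrow> u' p"
    proof (rule AE_I2)
      fix p assume "p \<in> space (M \<Otimes>\<^sub>M R)"
      then have p: "p \<in> space (M \<Otimes>\<^sub>M S)" by (simp add: space_pair_measure space_R)
      have "X p < top" using le_less_trans[OF bound c, of p] by simp
      then show "(\<lambda>m. u m p) \<longlonglongrightarrow> u' p"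
        using alpha_at_right_limit[OF _ p, of "enn2real (\<tau> p)"]
        by (cases "\<tau> p < \<infinity>") (auto simp: u_def u'_def intro!: ennreal_tendsto_cmult)
    qed
  qed (simp_all add: MRS)
  then have "(\<lambda>m. ?lhs) \<longlonglongrightarrow> (\<integral>\<^sup>+p. u' p \<partial>(M \<Otimes>\<^sub>M R))" unfolding lhs[symmetric] .
  then have "?lhs = (\<integral>\<^sup>+p. u' p \<partial>(M \<Otimes>\<^sub>M R))" by (rule LIMSEQ_unique[OF tendsto_const])
  then show ?thesis by (simp add: u'_def)
qed

text \<open>Truncation of \<open>X\<close> at the natural numbers and monotone convergence on both
  sides.\<close>

lemma law_at_stopping_time:
  fixes X \<tau> :: "'a \<times> 'e jump_data \<Rightarrow> ennreal"
  assumes X [measurable]: "X \<in> borel_measurable (F \<infinity> \<Otimes>\<^sub>M S)" and \<tau> [measurable]: "\<tau> \<in> borel_measurable (F \<infinity> \<Otimes>\<^sub>M S)"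
    and st: "\<And>y. y \<in> space S \<Longrightarrow> stopping_time F (\<lambda>\<omega>. \<tau> (\<omega>, y))"
    and ad: "\<And>y q. y \<in> space S \<Longrightarrow> 0 \<le> q \<Longrightarrow>
      (\<lambda>\<omega>. if \<tau> (\<omega>, y) < ennreal q then X (\<omega>, y) else 0) \<in> borel_measurable (F (ennreal q))"
  shows "(\<integral>\<^sup>+\<omega>. (if \<tau> (\<omega>, jumps \<omega>) < \<infinity> then X (\<omega>, jumps \<omega>) else 0) \<partial>M) =
    (\<integral>\<^sup>+p. X p * (if \<tau> p < \<infinity> then alpha_at (enn2real (\<tau> p)) p else 0) \<partial>(M \<Otimes>\<^sub>M R))" (is "?lhs = ?rhs")
proof -
  have [measurable]: "X \<in> borel_measurable (M \<Otimes>\<^sub>M S)" "\<tau> \<in> borel_measurable (M \<Otimes>\<^sub>M S)"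
    using F_prod_M[OF X] F_prod_M[OF \<tau>] .
  have MRS: "f \<in> borel_measurable (M \<Otimes>\<^sub>M R) \<longleftrightarrow> f \<in> borel_measurable (M \<Otimes>\<^sub>M S)" for f :: "_ \<Rightarrow> ennreal"
    using measurable_cong_sets[OF sets_pair_measure_cong[OF refl sets_R] refl] by blast
  have jm: "(\<lambda>\<omega>. (\<omega>, jumps \<omega>)) \<in> M \<rightarrow>\<^sub>M M \<Otimes>\<^sub>M S" by measurable
  note comp = measurable_compose[OF jm]
  define A where "A p = (if \<tau> p < \<infinity> then alpha_at (enn2real (\<tau> p)) p else 0)" for p
  have [measurable]: "A \<in> borel_measurable (M \<Otimes>\<^sub>M S)"
    unfolding A_def[abs_def] by (rule measurable_alpha_random_time) measurable
  have sup: "(SUP i. min x (of_nat i)) = x" for x :: ennreal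
  proof (rule antisym)
    show "x \<le> (SUP i. min x (of_nat i))"
    proof (cases x)
      case (real r)
      then obtain i :: nat where "r \<le> real i" using real_arch_simple by blast
      then have "x \<le> min x (of_nat i)" using real by (simp add: ennreal_of_nat_eq_real_of_nat ennreal_leI)
      then show ?thesis by (rule order_trans) (auto intro: SUP_upper)
    next
      case top
      then show ?thesis by (simp add: ennreal_SUP_of_nat_eq_top)
    qed
  qed (auto intro: SUP_least)
  have inc: "incseq (\<lambda>i. min x (of_nat i :: ennreal))" for x
    unfolding incseq_def using min.mono[OF order_refl of_nat_mono] by blast
  have "?lhs = (\<integral>\<^sup>+\<omega>. (SUP i. (if \<tau> (\<omega>, jumps \<omega>) < \<infinity> then min (X (\<omega>, jumps \<omega>)) (of_nat i) else 0)) \<partial>M)"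
    by (intro nn_integral_cong) (simp add: sup)
  also have "\<dots> = (SUP i. \<integral>\<^sup>+\<omega>. (if \<tau> (\<omega>, jumps \<omega>) < \<infinity> then min (X (\<omega>, jumps \<omega>)) (of_nat i) else 0) \<partial>M)"
  proof (rule nn_integral_monotone_convergence_SUP)
    show "(\<lambda>\<omega>. if \<tau> (\<omega>, jumps \<omega>) < \<infinity> then min (X (\<omega>, jumps \<omega>)) (of_nat i) else 0) \<in> borel_measurable M" for i
      by (rule comp[of "\<lambda>p. if \<tau> p < \<infinity> then min (X p) (of_nat i) else 0"]) measurable
    show "incseq (\<lambda>i \<omega>. if \<tau> (\<omega>, jumps \<omega>) < \<infinity> then min (X (\<omega>, jumps \<omega>)) (of_nat i) else 0)"
      using inc by (auto simp: incseq_def le_fun_def)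
  qed
  also have "\<dots> = (SUP i. \<integral>\<^sup>+p. min (X p) (of_nat i) * A p \<partial>(M \<Otimes>\<^sub>M R))"
  proof (intro SUP_cong refl)
    fix i
    show "(\<integral>\<^sup>+\<omega>. (if \<tau> (\<omega>, jumps \<omega>) < \<infinity> then min (X (\<omega>, jumps \<omega>)) (of_nat i) else 0) \<partial>M) =
        (\<integral>\<^sup>+p. min (X p) (of_nat i) * A p \<partial>(M \<Otimes>\<^sub>M R))"
      unfolding A_def
    proof (rule law_at_stopping_time_bounded[where c = "of_nat i"])
      fix y and q :: real assume y: "y \<in> space S" "0 \<le> q"
      have "(\<lambda>\<omega>. min (if \<tau> (\<omega>, y) < ennreal q then X (\<omega>, y) else 0) (of_nat i)) \<in> borel_measurable (F (ennreal q))"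
        using ad[OF y] by measurable
      then show "(\<lambda>\<omega>. if \<tau> (\<omega>, y) < ennreal q then min (X (\<omega>, y)) (of_nat i) else 0) \<in> borel_measurable (F (ennreal q))"
        by (rule measurable_cong[THEN iffD1, rotated]) auto
    next
      show "(\<lambda>p. min (X p) (of_nat i)) \<in> borel_measurable (F \<infinity> \<Otimes>\<^sub>M S)" by measurable
      show "\<tau> \<in> borel_measurable (F \<infinity> \<Otimes>\<^sub>M S)" by (rule \<tau>)
    qed (auto simp: of_nat_less_top intro!: st)
  qed
  also have "\<dots> = (\<integral>\<^sup>+p. (SUP i. min (X p) (of_nat i) * A p) \<partial>(M \<Otimes>\<^sub>M R))"
  proof (rule nn_integral_monotone_convergence_SUP[symmetric])
    show "(\<lambda>p. min (X p) (of_nat i) * A p) \<in> borel_measurable (M \<Otimes>\<^sub>M R)" for i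
      unfolding MRS by measurable
    show "incseq (\<lambda>i p. min (X p) (of_nat i) * A p)"
      using inc by (auto simp: incseq_def le_fun_def intro!: mult_right_mono)
  qed
  also have "\<dots> = (\<integral>\<^sup>+p. X p * A p \<partial>(M \<Otimes>\<^sub>M R))"
    by (intro nn_integral_cong) (simp add: SUP_mult_right_ennreal[symmetric] sup)
  finally show ?thesis by (simp add: A_def)
qed

end

section \<open>Conditioning on the first jumps\<close>

definition cut :: "nat \<Rightarrow> 'e jump_data \<Rightarrow> 'e jump_data" where
  "cut k q = (restrict (fst q) {1..k}, restrict (snd q) {1..k})"

lemma cut_cut: "j \<le> k \<Longrightarrow> cut j (cut k q) = cut j q"
  by (auto simp: cut_def fun_eq_iff restrict_def)

lemma cut_same: "p \<in> space (jump_space E k) \<Longrightarrow> cut k p = p"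
  by (cases p) (auto simp: cut_def space_jump_space Delta_def mark_space_def space_PiM PiE_iff extensional_restrict)

lemma cut_extend: "p \<in> space (jump_space E k) \<Longrightarrow> cut k (extend k p q) = p"
proof -
  assume p: "p \<in> space (jump_space E k)"
  have "cut k (extend k p q) = cut k p" by (auto simp: cut_def extend_def fun_eq_iff restrict_def)
  with cut_same[OF p] show ?thesis by simp
qed

lemma cut_in_space:
  assumes "j \<le> k" "q \<in> space (jump_space E k)"
  shows "cut j q \<in> space (jump_space E j)"
  using assms by (auto simp: cut_def space_jump_space Delta_def mark_space_def space_PiM PiE_iff)

lemma measurable_cut:
  assumes "j \<le> k" shows "cut j \<in> jump_space E k \<rightarrow>\<^sub>M jump_space E j"
proof -
  have sub: "{1..j} \<subseteq> {1..k}" using assms by auto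
  have "(\<lambda>q. restrict (fst q) {1..j}) \<in> jump_space E k \<rightarrow>\<^sub>M time_space j (Delta j)"
    unfolding time_space_def[of j]
  proof (rule measurable_restrict_space2)
    show "(\<lambda>q. restrict (fst q) {1..j}) \<in> space (jump_space E k) \<rightarrow> Delta j"
      using cut_in_space[OF assms] by (fastforce simp: cut_def space_jump_space)
    have "(\<lambda>q. fst q) \<in> jump_space E k \<rightarrow>\<^sub>M (\<Pi>\<^sub>M i\<in>{1..k}. borel)"
      unfolding jump_space_def by (rule measurable_compose[OF measurable_fst measurable_time_space_PiM])
    from measurable_compose[OF this measurable_restrict_subset[OF sub]]
    show "(\<lambda>q. restrict (fst q) {1..j}) \<in> jump_space E k \<rightarrow>\<^sub>M (\<Pi>\<^sub>M i\<in>{1..j}. borel)" .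
  qed
  moreover have "(\<lambda>q. restrict (snd q) {1..j}) \<in> jump_space E k \<rightarrow>\<^sub>M mark_space E j"
    unfolding jump_space_def mark_space_def
    by (rule measurable_compose[OF measurable_snd measurable_restrict_subset[OF sub]])
  ultimately show ?thesis unfolding cut_def[abs_def] jump_space_def[of E j] by (rule measurable_Pair)
qed

lemma measurable_cut_compose [measurable (raw)]:
  assumes "f \<in> L \<rightarrow>\<^sub>M jump_space E k" "j \<le> k"
  shows "(\<lambda>x. cut j (f x)) \<in> L \<rightarrow>\<^sub>M jump_space E j"
  using measurable_compose[OF assms(1) measurable_cut[OF assms(2)]] .

lemma extend_in_space:
  assumes "p \<in> space (jump_space E k)" "x \<in> E"
  shows "extend k p (u, x) \<in> space (jump_space E (Suc k))"
proof -
  have "(p, (u, x)) \<in> space (jump_space E k \<Otimes>\<^sub>M (borel \<Otimes>\<^sub>M restrict_space borel E))"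
    using assms by (simp add: space_pair_measure space_restrict_space)
  from measurable_space[OF measurable_extend this] show ?thesis by simp
qed

lemma measurable_time_component:
  assumes "i \<in> {1..k}" shows "(\<lambda>p. fst p i) \<in> borel_measurable (jump_space E k)"
  unfolding jump_space_def by (rule measurable_compose[OF measurable_fst measurable_component_time_space[OF assms]])

context jump_kernels
begin

lemma ref_integral_Suc:
  "ref_integral \<eta> f (Suc m) k (fst p) (snd p) =
    next_jump_integral k (\<lambda>q. ref_integral \<eta> f m (Suc k) (fst q) (snd q)) p"
  by (simp add: next_jump_integral_def)

lemma next_jump_integral_cong:
  assumes "k < n" "p \<in> space (jump_space E k)"
    and "\<And>u x. last_time k (fst p) \<le> u \<Longrightarrow> x \<in> E \<Longrightarrow> f (extend k p (u, x)) = g (extend k p (u, x))"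
  shows "next_jump_integral k f p = next_jump_integral k g p"
  unfolding next_jump_integral_extend using assms
  by (auto intro!: nn_integral_cong simp: kernel_space' split: split_indicator)

text \<open>Only the continuations of \<open>p\<close> enter the integral. A factor that depends on
  the first \<open>k\<close> jumps alone therefore acts as a constant and can be taken out by
  \<open>ref_integral_cmult\<close>.\<close>

lemma ref_integral_cong_cut:
  assumes "k + m \<le> n" "p \<in> space (jump_space E k)"
    and "\<And>q. q \<in> space (jump_space E (k + m)) \<Longrightarrow> cut k q = p \<Longrightarrow> f (fst q) (snd q) = g (fst q) (snd q)"
  shows "ref_integral \<eta> f m k (fst p) (snd p) = ref_integral \<eta> g m k (fst p) (snd p)"
  using assms
proof (induction m arbitrary: k p)
  case 0
  then show ?case using cut_same[OF 0(2)] by simp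
next
  case (Suc m)
  show ?case
    unfolding ref_integral_Suc
  proof (rule next_jump_integral_cong)
    fix u x assume u: "last_time k (fst p) \<le> u" "x \<in> E"
    let ?p = "extend k p (u, x)"
    show "ref_integral \<eta> f m (Suc k) (fst ?p) (snd ?p) = ref_integral \<eta> g m (Suc k) (fst ?p) (snd ?p)"
    proof (rule Suc.IH)
      show "?p \<in> space (jump_space E (Suc k))" using Suc.prems(2) u(2) by (rule extend_in_space)
      fix q assume q: "q \<in> space (jump_space E (Suc k + m))" "cut (Suc k) q = ?p"
      then have "cut k q = p" using cut_cut[of k "Suc k" q] cut_extend[OF Suc.prems(2)] by simp
      with q Suc.prems(3) show "f (fst q) (snd q) = g (fst q) (snd q)" by simp
    qed (use Suc.prems in auto)
  qed (use Suc.prems in auto)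
qed

lemma measurable_mark_integral_section:
  assumes k: "k < n" and p: "p \<in> space (jump_space E k)" and f: "f \<in> borel_measurable (jump_space E (Suc k))"
  shows "(\<lambda>(u, x). f (extend k p (u, x))) \<in> borel_measurable (lborel \<Otimes>\<^sub>M \<eta> (Suc k) (fst p) (snd p))"
    and "(\<lambda>x. f (extend k p (u, x))) \<in> borel_measurable (\<eta> (Suc k) (fst p) (snd p))"
    and "(\<lambda>u. \<integral>\<^sup>+x. f (extend k p (u, x)) \<partial>\<eta> (Suc k) (fst p) (snd p)) \<in> borel_measurable lborel"
proof -
  note [measurable_cong] = kernel_space(1)[OF k p]
  interpret prob_space "\<eta> (Suc k) (fst p) (snd p)" by (rule kernel_space(2)[OF k p])
  have "(\<lambda>z. extend k p (fst z, snd z)) \<in> borel \<Otimes>\<^sub>M restrict_space borel E \<rightarrow>\<^sub>M jump_space E (Suc k)"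
    using p by measurable
  then have "(\<lambda>z. extend k p (fst z, snd z)) \<in> lborel \<Otimes>\<^sub>M \<eta> (Suc k) (fst p) (snd p) \<rightarrow>\<^sub>M jump_space E (Suc k)"
    using measurable_cong_sets[OF sets_pair_measure_cong[OF sets_lborel kernel_space(1)[OF k p]] refl] by blast
  from measurable_compose[OF this f]
  show 1: "(\<lambda>(u, x). f (extend k p (u, x))) \<in> borel_measurable (lborel \<Otimes>\<^sub>M \<eta> (Suc k) (fst p) (snd p))"
    by (simp add: split_beta')
  show "(\<lambda>x. f (extend k p (u, x))) \<in> borel_measurable (\<eta> (Suc k) (fst p) (snd p))"
    using measurable_compose[OF measurable_Pair1'[of u lborel "\<eta> (Suc k) (fst p) (snd p)"] 1] by simp
  show "(\<lambda>u. \<integral>\<^sup>+x. f (extend k p (u, x)) \<partial>\<eta> (Suc k) (fst p) (snd p)) \<in> borel_measurable lborel"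
    by (rule borel_measurable_nn_integral) (use 1 in simp)
qed

lemma next_jump_integral_cmult:
  assumes "k < n" "p \<in> space (jump_space E k)" "f \<in> borel_measurable (jump_space E (Suc k))"
  shows "next_jump_integral k (\<lambda>q. c * f q) p = c * next_jump_integral k f p"
proof -
  note m = measurable_mark_integral_section[OF assms]
  have "next_jump_integral k (\<lambda>q. c * f q) p = (\<integral>\<^sup>+u. c * ((\<integral>\<^sup>+x. f (extend k p (u, x)) \<partial>\<eta> (Suc k) (fst p) (snd p)) *
      indicator {last_time k (fst p)..} u) \<partial>lborel)"
    unfolding next_jump_integral_extend by (simp add: nn_integral_cmult[OF m(2)] mult.assoc)
  also have "\<dots> = c * next_jump_integral k f p"
    unfolding next_jump_integral_extend using m(3) by (intro nn_integral_cmult borel_measurable_times_ennreal) auto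
  finally show ?thesis .
qed

lemma ref_integral_cmult:
  assumes "k + m \<le> n" "p \<in> space (jump_space E k)" "f \<in> borel_measurable (jump_space E (k + m))"
  shows "ref_integral \<eta> (\<lambda>\<theta> e. c * f (\<theta>, e)) m k (fst p) (snd p) = c * ref_integral \<eta> (\<lambda>\<theta> e. f (\<theta>, e)) m k (fst p) (snd p)"
  using assms
proof (induction m arbitrary: k p)
  case (Suc m)
  have k: "k < n" using Suc.prems(1) by simp
  have m: "(\<lambda>q. ref_integral \<eta> (\<lambda>\<theta> e. f (\<theta>, e)) m (Suc k) (fst q) (snd q)) \<in> borel_measurable (jump_space E (Suc k))"
    using Suc.prems by (intro measurable_ref_integral_section) auto
  have "next_jump_integral k (\<lambda>q. ref_integral \<eta> (\<lambda>\<theta> e. c * f (\<theta>, e)) m (Suc k) (fst q) (snd q)) p =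
    next_jump_integral k (\<lambda>q. c * ref_integral \<eta> (\<lambda>\<theta> e. f (\<theta>, e)) m (Suc k) (fst q) (snd q)) p"
    using Suc.prems by (intro next_jump_integral_cong k Suc.IH) (auto intro: extend_in_space)
  also have "\<dots> = c * next_jump_integral k (\<lambda>q. ref_integral \<eta> (\<lambda>\<theta> e. f (\<theta>, e)) m (Suc k) (fst q) (snd q)) p"
    by (rule next_jump_integral_cmult[OF k Suc.prems(2) m])
  finally show ?case unfolding ref_integral_Suc .
qed simp

text \<open>\<open>ref_integral\<close> has the time outside and the mark inside,
  \<open>alpha_rec\<close> the reverse. The kernel depends on the earlier jumps and not on the new
  time, so Tonelli reconciles the two.\<close>

lemma next_jump_integral_swap:
  assumes k: "k < n" and p: "p \<in> space (jump_space E k)" and f: "f \<in> borel_measurable (jump_space E (Suc k))"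
  shows "next_jump_integral k f p =
    (\<integral>\<^sup>+x. (\<integral>\<^sup>+u\<in>{last_time k (fst p)..}. f (extend k p (u, x)) \<partial>lborel) \<partial>\<eta> (Suc k) (fst p) (snd p))"
proof -
  interpret \<eta>: prob_space "\<eta> (Suc k) (fst p) (snd p)" by (rule kernel_space(2)[OF k p])
  interpret pair_sigma_finite lborel "\<eta> (Suc k) (fst p) (snd p)" ..
  note m = measurable_mark_integral_section[OF k p f]
  have "next_jump_integral k f p = (\<integral>\<^sup>+u. (\<integral>\<^sup>+x. f (extend k p (u, x)) * indicator {last_time k (fst p)..} u \<partial>\<eta> (Suc k) (fst p) (snd p)) \<partial>lborel)"
    unfolding next_jump_integral_extend by (simp add: nn_integral_multc[OF m(2)])
  also have "\<dots> = (\<integral>\<^sup>+x. (\<integral>\<^sup>+u. f (extend k p (u, x)) * indicator {last_time k (fst p)..} u \<partial>lborel) \<partial>\<eta> (Suc k) (fst p) (snd p))"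
  proof (rule Fubini'[symmetric])
    have "(\<lambda>z. indicator {last_time k (fst p)..} (fst z) :: ennreal) \<in> borel_measurable (lborel \<Otimes>\<^sub>M \<eta> (Suc k) (fst p) (snd p))"
      by measurable
    from borel_measurable_times_ennreal[OF m(1) this]
    show "(\<lambda>(u, x). f (extend k p (u, x)) * indicator {last_time k (fst p)..} u) \<in> borel_measurable (lborel \<Otimes>\<^sub>M \<eta> (Suc k) (fst p) (snd p))"
      by (simp add: split_beta')
  qed
  finally show ?thesis .
qed

end

section \<open>The densities \<open>\<alpha>\<^sup>k\<close> as integrals over the later
  jumps\<close>

context jump_model
begin

text \<open>Prepares the comparison of lower limits: \<open>alpha_rec\<close> integrates from
  \<open>t\<close> on, \<open>ref_integral\<close> from the last jump time. Where the former range
  is larger, the new time violates the order and \<alpha> is 0.\<close>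

lemma alpha_rec_unordered:
  assumes "k + m = n" "i \<in> {1..k}" "j \<in> {1..k}" "i \<le> j" "\<theta> j < \<theta> i"
  shows "alpha_rec \<eta> \<alpha> m k t \<omega> \<theta> e = 0"
  using assms
proof (induction m arbitrary: k \<theta> e)
  case 0
  then have "\<theta> \<notin> Delta n" by (auto simp: Delta_def not_le[symmetric])
  then show ?case using density by (simp add: jump_density_def)
next
  case (Suc m)
  then have "alpha_rec \<eta> \<alpha> m (Suc k) t \<omega> (\<theta>(Suc k := u)) e' = 0" for u e'
    by (intro Suc.IH) auto
  then show ?case by simp
qed

lemma measurable_alpha_at_section:
  assumes "0 \<le> t" "\<omega> \<in> space M" shows "(\<lambda>q. alpha_at t (\<omega>, q)) \<in> borel_measurable S"
  using measurable_compose[OF measurable_Pair1'[OF assms(2)] measurable_alpha_at[OF assms(1)]] .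

text \<open>When \<open>t\<close> does not exceed the last jump time, every ordered continuation
  stays beyond \<open>t\<close>, and the unordered ones contribute nothing. The lower limits
  \<open>t\<close> thus have no effect.\<close>

lemma alpha_rec_eq_ref_integral:
  assumes "k + m = n" "p \<in> space (jump_space E k)" "\<omega> \<in> space M" "0 \<le> t" "t \<le> last_time k (fst p)"
  shows "alpha_rec \<eta> \<alpha> m k t \<omega> (fst p) (snd p) = ref_integral \<eta> (\<lambda>\<theta> e. alpha_at t (\<omega>, (\<theta>, e))) m k (fst p) (snd p)"
  using assms
proof (induction m arbitrary: k p)
  case 0 then show ?case by (simp add: alpha_at_def)
next
  case (Suc m)
  have k: "k < n" using Suc.prems(1) by simp
  let ?f = "\<lambda>q. ref_integral \<eta> (\<lambda>\<theta> e. alpha_at t (\<omega>, (\<theta>, e))) m (Suc k) (fst q) (snd q)"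
  let ?a = "\<lambda>u x. alpha_rec \<eta> \<alpha> m (Suc k) t \<omega> ((fst p)(Suc k := u)) ((snd p)(Suc k := x))"
  have m: "?f \<in> borel_measurable (jump_space E (Suc k))"
    using Suc.prems measurable_alpha_at_section[OF Suc.prems(4,3)] by (intro measurable_ref_integral_section) auto
  have eq: "?a u x * indicator {t..} u = ?f (extend k p (u, x)) * indicator {last_time k (fst p)..} u" if x: "x \<in> E" for u x
  proof (cases "last_time k (fst p) \<le> u")
    case True
    have "alpha_rec \<eta> \<alpha> m (Suc k) t \<omega> (fst (extend k p (u, x))) (snd (extend k p (u, x))) = ?f (extend k p (u, x))"
      using Suc.prems True x by (intro Suc.IH extend_in_space) (auto simp: extend_def last_time_def)
    with True Suc.prems(5) show ?thesis by (simp add: extend_def)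
  next
    case False
    show ?thesis
    proof (cases "k = 0")
      case True
      with False Suc.prems(4) show ?thesis by (simp add: last_time_def)
    next
      case k0: False
      have "?a u x = 0"
        using Suc.prems(1) False k0 by (intro alpha_rec_unordered[of _ _ k "Suc k"]) (auto simp: last_time_def)
      with False show ?thesis by simp
    qed
  qed
  have "alpha_rec \<eta> \<alpha> (Suc m) k t \<omega> (fst p) (snd p) = (\<integral>\<^sup>+x. (\<integral>\<^sup>+u. ?a u x * indicator {t..} u \<partial>lborel) \<partial>\<eta> (Suc k) (fst p) (snd p))"
    by simp
  also have "\<dots> = (\<integral>\<^sup>+x. (\<integral>\<^sup>+u. ?f (extend k p (u, x)) * indicator {last_time k (fst p)..} u \<partial>lborel) \<partial>\<eta> (Suc k) (fst p) (snd p))"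
    by (intro nn_integral_cong eq) (simp add: kernel_space'[OF k Suc.prems(2)])
  also have "\<dots> = next_jump_integral k ?f p"
    by (rule next_jump_integral_swap[OF k Suc.prems(2) m, symmetric])
  finally show ?case unfolding ref_integral_Suc .
qed

text \<open>Now \<open>t\<close> lies at or after the last given jump. Only the next jump time has
  to be compared with \<open>t\<close>; once it is later, the remaining ones are later as well, and
  the preceding lemma removes their lower limits. For \<open>k = n\<close> there is no next jump and
  the condition is void.\<close>

lemma alpha_k_eq_ref_integral:
  assumes k: "k \<le> n" and p: "p \<in> space (jump_space E k)" and \<omega>: "\<omega> \<in> space M" and t: "last_time k (fst p) \<le> t"
  shows "alpha_k n \<eta> \<alpha> k t \<omega> (fst p) (snd p) =
    ref_integral \<eta> (\<lambda>\<theta> e. of_bool (k < n \<longrightarrow> t < \<theta> (Suc k)) * alpha_at t (\<omega>, (\<theta>, e))) (n - k) k (fst p) (snd p)"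
proof (cases "k = n")
  case True then show ?thesis by (simp add: alpha_k_def alpha_at_def)
next
  case False
  with k have kn: "k < n" by simp
  then obtain m where m: "n - k = Suc m" by (metis Suc_diff_Suc)
  then have nm: "n = Suc k + m" using kn by simp
  have t0: "0 \<le> t" using t p last_time_nonneg[of "fst p" k] by (auto simp: space_jump_space)
  let ?f = "\<lambda>q. ref_integral \<eta> (\<lambda>\<theta> e. alpha_at t (\<omega>, (\<theta>, e))) m (Suc k) (fst q) (snd q)"
  let ?g = "\<lambda>q. of_bool (t < fst q (Suc k)) * ?f q"
  let ?a = "\<lambda>u x. alpha_rec \<eta> \<alpha> m (Suc k) t \<omega> ((fst p)(Suc k := u)) ((snd p)(Suc k := x))"
  have mf [measurable]: "?f \<in> borel_measurable (jump_space E (Suc k))"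
    using nm measurable_alpha_at_section[OF t0 \<omega>] by (intro measurable_ref_integral_section) auto
  have [measurable]: "(\<lambda>q. fst q (Suc k)) \<in> borel_measurable (jump_space E (Suc k))"
    by (rule measurable_time_component) auto
  have mg: "?g \<in> borel_measurable (jump_space E (Suc k))" by measurable
  \<comment> \<open>The range \<open>{t..}\<close> is closed while the event that the next jump
    comes after \<open>t\<close> is strict; they differ at the single point \<open>u = t\<close>, a
    Lebesgue null set.\<close>
  have eq: "?a u x * indicator {t..} u = ?g (extend k p (u, x)) * indicator {last_time k (fst p)..} u"
    if x: "x \<in> E" and u: "u \<noteq> t" for u x
  proof (cases "t \<le> u")
    case True
    then have "last_time k (fst p) \<le> u" using t by simp
    moreover have "alpha_rec \<eta> \<alpha> m (Suc k) t \<omega> (fst (extend k p (u, x))) (snd (extend k p (u, x))) = ?f (extend k p (u, x))"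
      using True t t0 x p \<omega> nm by (intro alpha_rec_eq_ref_integral extend_in_space) (auto simp: extend_def last_time_def)
    ultimately show ?thesis using True u by (auto simp: extend_def)
  next
    case False
    with t show ?thesis by (auto simp: extend_def split: split_indicator)
  qed
  have "alpha_k n \<eta> \<alpha> k t \<omega> (fst p) (snd p) = (\<integral>\<^sup>+x. (\<integral>\<^sup>+u. ?a u x * indicator {t..} u \<partial>lborel) \<partial>\<eta> (Suc k) (fst p) (snd p))"
    by (simp add: alpha_k_def m)
  also have "\<dots> = (\<integral>\<^sup>+x. (\<integral>\<^sup>+u. ?g (extend k p (u, x)) * indicator {last_time k (fst p)..} u \<partial>lborel) \<partial>\<eta> (Suc k) (fst p) (snd p))"
  proof (rule nn_integral_cong)
    fix x assume "x \<in> space (\<eta> (Suc k) (fst p) (snd p))"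
    then have x: "x \<in> E" by (simp add: kernel_space'[OF kn p])
    show "(\<integral>\<^sup>+u. ?a u x * indicator {t..} u \<partial>lborel) = (\<integral>\<^sup>+u. ?g (extend k p (u, x)) * indicator {last_time k (fst p)..} u \<partial>lborel)"
      by (rule nn_integral_cong_AE) (use AE_lborel_singleton[of t] in eventually_elim, rule eq[OF x])
  qed
  also have "\<dots> = next_jump_integral k ?g p"
    by (rule next_jump_integral_swap[OF kn p mg, symmetric])
  also have "\<dots> = next_jump_integral k (\<lambda>q. ref_integral \<eta> (\<lambda>\<theta> e. of_bool (k < n \<longrightarrow> t < \<theta> (Suc k)) * alpha_at t (\<omega>, (\<theta>, e))) m (Suc k) (fst q) (snd q)) p"
  proof (rule next_jump_integral_cong[OF kn p])
    fix u x assume "x \<in> E"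
    then have q: "extend k p (u, x) \<in> space (jump_space E (Suc k))" by (rule extend_in_space[OF p])
    let ?q = "extend k p (u, x)"
    have "ref_integral \<eta> (\<lambda>\<theta> e. of_bool (k < n \<longrightarrow> t < \<theta> (Suc k)) * alpha_at t (\<omega>, (\<theta>, e))) m (Suc k) (fst ?q) (snd ?q) =
      ref_integral \<eta> (\<lambda>\<theta> e. of_bool (t < fst ?q (Suc k)) * alpha_at t (\<omega>, (\<theta>, e))) m (Suc k) (fst ?q) (snd ?q)"
    proof (rule ref_integral_cong_cut[OF _ q])
      fix q' assume "cut (Suc k) q' = ?q"
      then have "fst q' (Suc k) = fst ?q (Suc k)" by (metis cut_def fst_conv restrict_apply' atLeastAtMost_iff le_refl One_nat_def Suc_le_mono zero_le)
      then show "of_bool (k < n \<longrightarrow> t < fst q' (Suc k)) * alpha_at t (\<omega>, (fst q', snd q')) =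
          of_bool (t < fst ?q (Suc k)) * alpha_at t (\<omega>, (fst q', snd q'))" using kn by simp
    qed (use nm in simp)
    also have "\<dots> = of_bool (t < fst ?q (Suc k)) * ?f ?q"
      using nm measurable_alpha_at_section[OF t0 \<omega>] by (intro ref_integral_cmult q) auto
    finally show "?g ?q = ref_integral \<eta> (\<lambda>\<theta> e. of_bool (k < n \<longrightarrow> t < \<theta> (Suc k)) * alpha_at t (\<omega>, (\<theta>, e))) m (Suc k) (fst ?q) (snd ?q)" ..
  qed
  finally show ?thesis unfolding m ref_integral_Suc .
qed

definition alpha_k_at :: "nat \<Rightarrow> ('a \<times> 'e jump_data \<Rightarrow> ennreal) \<Rightarrow> 'a \<times> 'e jump_data \<Rightarrow> ennreal" where
  "alpha_k_at k \<tau> p = (if \<tau> p < \<infinity> then alpha_k n \<eta> \<alpha> k (enn2real (\<tau> p)) (fst p) (fst (snd p)) (snd (snd p)) else 0)"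

text \<open>The counterpart of \<open>alpha_k_at\<close> on all \<open>n\<close> jumps: integrating
  it over the jumps after the \<open>k\<close>-th returns \<open>alpha_k_at\<close>.\<close>

definition alpha_before_next :: "nat \<Rightarrow> ('a \<times> 'e jump_data \<Rightarrow> ennreal) \<Rightarrow> 'a \<times> 'e jump_data \<Rightarrow> ennreal" where
  "alpha_before_next k \<tau> q =
    (if k < n \<longrightarrow> \<tau> (fst q, cut k (snd q)) < ennreal (fst (snd q) (Suc k)) then
      (if \<tau> (fst q, cut k (snd q)) < \<infinity> then alpha_at (enn2real (\<tau> (fst q, cut k (snd q)))) q else 0) else 0)"

lemma measurable_prod_cut:
  assumes "k \<le> n" shows "(\<lambda>q. (fst q, cut k (snd q))) \<in> N \<Otimes>\<^sub>M S \<rightarrow>\<^sub>M N \<Otimes>\<^sub>M jump_space E k"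
  using assms by measurable

lemma measurable_next_time:
  assumes "k < n" shows "(\<lambda>q. fst (snd q) (Suc k)) \<in> borel_measurable (N \<Otimes>\<^sub>M S)"
  using assms by (intro measurable_compose[OF measurable_snd measurable_time_component]) auto

lemma pred_before_next_time:
  assumes k: "k \<le> n" and \<tau>: "\<tau> \<in> borel_measurable (N \<Otimes>\<^sub>M jump_space E k)"
  shows "Measurable.pred (N \<Otimes>\<^sub>M S) (\<lambda>q. k < n \<longrightarrow> \<tau> (fst q, cut k (snd q)) < ennreal (fst (snd q) (Suc k)))"
proof (cases "k < n")
  case True
  note [measurable] = measurable_compose[OF measurable_prod_cut[OF k] \<tau>] measurable_next_time[OF True]
  show ?thesis using True by measurable
qed simp

lemma measurable_alpha_before_next:
  assumes k: "k \<le> n" and \<tau>: "\<tau> \<in> borel_measurable (M \<Otimes>\<^sub>M jump_space E k)"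
  shows "alpha_before_next k \<tau> \<in> borel_measurable (M \<Otimes>\<^sub>M S)"
proof -
  have "(\<lambda>q. if \<tau> (fst q, cut k (snd q)) < \<infinity> then alpha_at (enn2real (\<tau> (fst q, cut k (snd q)))) q else 0)
      \<in> borel_measurable (M \<Otimes>\<^sub>M S)"
    by (rule measurable_alpha_random_time[OF measurable_compose[OF measurable_prod_cut[OF k] \<tau>]])
  then show ?thesis
    unfolding alpha_before_next_def[abs_def]
    by (rule measurable_If[OF _ measurable_const predE[OF pred_before_next_time[OF k \<tau>]]]) simp
qed

lemma alpha_k_at_eq:
  assumes k: "k \<le> n" and p: "p \<in> space (M \<Otimes>\<^sub>M jump_space E k)"
    and ge: "ennreal (last_time k (fst (snd p))) \<le> \<tau> p"
  shows "alpha_k_at k \<tau> p = ref_integral \<eta> (\<lambda>\<theta> e. alpha_before_next k \<tau> (fst p, (\<theta>, e))) (n - k) k (fst (snd p)) (snd (snd p))"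
proof -
  obtain \<omega> y where p_eq: "p = (\<omega>, y)" and \<omega>: "\<omega> \<in> space M" and y: "y \<in> space (jump_space E k)"
    using p by (cases p) (auto simp: space_pair_measure)
  show ?thesis
  proof (cases "\<tau> p < \<infinity>")
    case True
    then have t: "last_time k (fst y) \<le> enn2real (\<tau> p)"
      using enn2real_mono[OF ge] y by (simp add: p_eq last_time_nonneg space_jump_space mem_Times_iff)
    have "alpha_k_at k \<tau> p = ref_integral \<eta> (\<lambda>\<theta> e. of_bool (k < n \<longrightarrow> enn2real (\<tau> p) < \<theta> (Suc k)) *
        alpha_at (enn2real (\<tau> p)) (\<omega>, (\<theta>, e))) (n - k) k (fst y) (snd y)"
      using True alpha_k_eq_ref_integral[OF k y \<omega> t] by (simp add: alpha_k_at_def p_eq)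
    also have "\<dots> = ref_integral \<eta> (\<lambda>\<theta> e. alpha_before_next k \<tau> (\<omega>, (\<theta>, e))) (n - k) k (fst y) (snd y)"
    proof (rule ref_integral_cong_cut[OF _ y])
      fix q assume q: "cut k q = y"
      have "\<tau> p < ennreal (fst q (Suc k)) \<longleftrightarrow> enn2real (\<tau> p) < fst q (Suc k)"
        using True by (cases "\<tau> p") (auto simp: ennreal_less_iff)
      then show "of_bool (k < n \<longrightarrow> enn2real (\<tau> p) < fst q (Suc k)) * alpha_at (enn2real (\<tau> p)) (\<omega>, (fst q, snd q)) =
          alpha_before_next k \<tau> (\<omega>, (fst q, snd q))"
        using True q by (auto simp: alpha_before_next_def p_eq)
    qed (use k in simp)
    finally show ?thesis by (simp add: p_eq)
  next
    case False
    have "ref_integral \<eta> (\<lambda>\<theta> e. alpha_before_next k \<tau> (\<omega>, (\<theta>, e))) (n - k) k (fst y) (snd y) =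
        ref_integral \<eta> (\<lambda>\<theta> e. 0 * (\<lambda>_. 0) (\<theta>, e)) (n - k) k (fst y) (snd y)"
      by (rule ref_integral_cong_cut[OF _ y]) (use k False in \<open>auto simp: alpha_before_next_def p_eq\<close>)
    also have "\<dots> = 0"
      by (subst ref_integral_cmult[OF _ y]) (use k in auto)
    finally show ?thesis using False by (simp add: alpha_k_at_def p_eq)
  qed
qed

text \<open>In the definition a random time enters every one of the nested integrals. The
  representation by \<open>alpha_before_next\<close> leaves it in the integrand only, where
  measurability at random times is known.\<close>

lemma measurable_alpha_k_at:
  assumes k: "k \<le> n" and \<tau>: "\<tau> \<in> borel_measurable (M \<Otimes>\<^sub>M jump_space E k)"
    and ge: "\<And>p. p \<in> space (M \<Otimes>\<^sub>M jump_space E k) \<Longrightarrow> ennreal (last_time k (fst (snd p))) \<le> \<tau> p"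
  shows "alpha_k_at k \<tau> \<in> borel_measurable (M \<Otimes>\<^sub>M jump_space E k)"
proof -
  have "(\<lambda>(\<omega>, (\<theta>, e)). alpha_before_next k \<tau> (\<omega>, (\<theta>, e))) \<in> borel_measurable (M \<Otimes>\<^sub>M jump_space E (k + (n - k)))"
    using measurable_alpha_before_next[OF k \<tau>] k by (simp add: split_beta')
  from measurable_ref_integral[OF _ this] k
  have "(\<lambda>p. ref_integral \<eta> (\<lambda>\<theta> e. alpha_before_next k \<tau> (fst p, (\<theta>, e))) (n - k) k (fst (snd p)) (snd (snd p)))
      \<in> borel_measurable (M \<Otimes>\<^sub>M jump_space E k)"
    by (simp add: split_beta')
  then show ?thesis
    by (rule measurable_cong[THEN iffD1, rotated]) (rule alpha_k_at_eq[OF k _ ge, symmetric])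
qed

lemma pair_sigma_finite_ref: "k \<le> n \<Longrightarrow> pair_sigma_finite M (ref_measure k)"
  using sigma_finite_ref_measure[of k] by (simp add: pair_sigma_finite_def sigma_finite_measure_axioms)

lemma measurable_ref_measure_iff:
  "k \<le> n \<Longrightarrow> f \<in> N \<Otimes>\<^sub>M ref_measure k \<rightarrow>\<^sub>M K \<longleftrightarrow> f \<in> N \<Otimes>\<^sub>M jump_space E k \<rightarrow>\<^sub>M K"
  using measurable_cong_sets[OF sets_pair_measure_cong[OF refl sets_ref_measure] refl] by blast

text \<open>The law at a stopping time is applied to an integrand that vanishes unless \<tau>
  precedes the next jump. Since \<open>X\<close> and \<tau> depend on the first \<open>k\<close>
  jumps only, integrating out the others affects the density alone and turns it into
  \<open>alpha_k_at\<close>.\<close>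

lemma law_at_level:
  fixes X \<tau> :: "'a \<times> 'e jump_data \<Rightarrow> ennreal"
  assumes k: "k \<le> n"
    and X: "X \<in> borel_measurable (F \<infinity> \<Otimes>\<^sub>M jump_space E k)" and \<tau>: "\<tau> \<in> borel_measurable (F \<infinity> \<Otimes>\<^sub>M jump_space E k)"
    and st: "\<And>y. y \<in> space (jump_space E k) \<Longrightarrow> stopping_time F (\<lambda>\<omega>. \<tau> (\<omega>, y))"
    and ad: "\<And>y q. y \<in> space (jump_space E k) \<Longrightarrow> 0 \<le> q \<Longrightarrow>
      (\<lambda>\<omega>. if \<tau> (\<omega>, y) < ennreal q then X (\<omega>, y) else 0) \<in> borel_measurable (F (ennreal q))"
    and ge: "\<And>p. p \<in> space (M \<Otimes>\<^sub>M jump_space E k) \<Longrightarrow> ennreal (last_time k (fst (snd p))) \<le> \<tau> p"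
  shows "(\<integral>\<^sup>+\<omega>. (if \<tau> (\<omega>, cut k (jumps \<omega>)) < \<infinity> \<and> (k < n \<longrightarrow> \<tau> (\<omega>, cut k (jumps \<omega>)) < ennreal (\<zeta> (Suc k) \<omega>))
      then X (\<omega>, cut k (jumps \<omega>)) else 0) \<partial>M) =
    (\<integral>\<^sup>+p. X p * alpha_k_at k \<tau> p \<partial>(M \<Otimes>\<^sub>M ref_measure k))"
proof -
  interpret k: pair_sigma_finite M "ref_measure k" by (rule pair_sigma_finite_ref[OF k])
  define c where "c q = (fst q, cut k (snd q))" for q :: "'a \<times> 'e jump_data"
  have c: "c \<in> N \<Otimes>\<^sub>M S \<rightarrow>\<^sub>M N \<Otimes>\<^sub>M jump_space E k" for N
    unfolding c_def[abs_def] by (rule measurable_prod_cut[OF k])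
  define X' where "X' q = (if k < n \<longrightarrow> \<tau> (c q) < ennreal (fst (snd q) (Suc k)) then X (c q) else 0)" for q
  note MX = F_prod_M[OF X] and M\<tau> = F_prod_M[OF \<tau>]
  have X'_meas: "X' \<in> borel_measurable (F \<infinity> \<Otimes>\<^sub>M S)"
    unfolding X'_def[abs_def] c_def
    by (rule measurable_If[OF measurable_compose[OF measurable_prod_cut[OF k] X] measurable_const
          predE[OF pred_before_next_time[OF k \<tau>]]]) simp
  note ABN = measurable_alpha_before_next[OF k M\<tau>]
  have AK: "alpha_k_at k \<tau> \<in> borel_measurable (M \<Otimes>\<^sub>M jump_space E k)"
    by (rule measurable_alpha_k_at[OF k M\<tau> ge])
  have "(\<integral>\<^sup>+\<omega>. (if \<tau> (\<omega>, cut k (jumps \<omega>)) < \<infinity> \<and> (k < n \<longrightarrow> \<tau> (\<omega>, cut k (jumps \<omega>)) < ennreal (\<zeta> (Suc k) \<omega>))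
      then X (\<omega>, cut k (jumps \<omega>)) else 0) \<partial>M) =
    (\<integral>\<^sup>+\<omega>. (if \<tau> (c (\<omega>, jumps \<omega>)) < \<infinity> then X' (\<omega>, jumps \<omega>) else 0) \<partial>M)"
    by (intro nn_integral_cong) (auto simp: X'_def c_def jumps_def initial_def)
  also have "\<dots> = (\<integral>\<^sup>+q. X' q * (if \<tau> (c q) < \<infinity> then alpha_at (enn2real (\<tau> (c q))) q else 0) \<partial>(M \<Otimes>\<^sub>M R))"
  proof (rule law_at_stopping_time[OF X'_meas])
    show "(\<lambda>q. \<tau> (c q)) \<in> borel_measurable (F \<infinity> \<Otimes>\<^sub>M S)" by (rule measurable_compose[OF c \<tau>])
    fix y assume y: "y \<in> space S"
    then have cy: "cut k y \<in> space (jump_space E k)" by (rule cut_in_space[OF k])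
    show "stopping_time F (\<lambda>\<omega>. \<tau> (c (\<omega>, y)))" using st[OF cy] by (simp add: c_def)
    fix q :: real assume q: "0 \<le> q"
    \<comment> \<open>For fixed jumps, being before \<open>q\<close> and before the next jump is the
      same as being before the earlier of the two times. This reduces adaptedness of
      \<open>X'\<close> to that of \<open>X\<close> at \<open>b\<close>.\<close>
    define b where "b = (if k < n then min q (fst y (Suc k)) else q)"
    have b: "0 \<le> b" "b \<le> q"
      using q y by (auto simp: b_def space_jump_space Delta_def)
    have "\<tau> (c (\<omega>, y)) < ennreal b \<longleftrightarrow> \<tau> (c (\<omega>, y)) < ennreal q \<and> (k < n \<longrightarrow> \<tau> (c (\<omega>, y)) < ennreal (fst y (Suc k)))" for \<omega>
      by (auto simp: b_def min_def ennreal_leI intro: less_le_trans)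
    then have "(\<lambda>\<omega>. if \<tau> (c (\<omega>, y)) < ennreal q then X' (\<omega>, y) else 0) = (\<lambda>\<omega>. if \<tau> (\<omega>, cut k y) < ennreal b then X (\<omega>, cut k y) else 0)"
      by (auto simp: fun_eq_iff X'_def c_def)
    then show "(\<lambda>\<omega>. if \<tau> (c (\<omega>, y)) < ennreal q then X' (\<omega>, y) else 0) \<in> borel_measurable (F (ennreal q))"
      using F_sub_F[OF ennreal_leI[OF b(2)] ad[OF cy b(1)]] by simp
  qed
  also have "\<dots> = (\<integral>\<^sup>+q. X (c q) * alpha_before_next k \<tau> q \<partial>(M \<Otimes>\<^sub>M R))"
    by (intro nn_integral_cong) (simp add: X'_def alpha_before_next_def c_def)
  also have "\<dots> = (\<integral>\<^sup>+\<omega>. \<integral>\<^sup>+y. X (c (\<omega>, y)) * alpha_before_next k \<tau> (\<omega>, y) \<partial>R \<partial>M)"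
    using measurable_compose[OF c MX] ABN
    by (intro R.nn_integral_fst[symmetric]) (simp add: measurable_ref_measure_iff)
  also have "\<dots> = (\<integral>\<^sup>+\<omega>. \<integral>\<^sup>+y. X (\<omega>, y) * alpha_k_at k \<tau> (\<omega>, y) \<partial>ref_measure k \<partial>M)"
  proof (rule nn_integral_cong)
    fix \<omega> assume \<omega>: "\<omega> \<in> space M"
    let ?G = "\<lambda>y. X (c (\<omega>, y)) * alpha_before_next k \<tau> (\<omega>, y)"
    have Gm: "?G \<in> borel_measurable S" "(\<lambda>y. alpha_before_next k \<tau> (\<omega>, y)) \<in> borel_measurable S"
      using measurable_compose[OF measurable_Pair1'[OF \<omega>] measurable_compose[OF c MX]]
        measurable_compose[OF measurable_Pair1'[OF \<omega>] ABN] by (auto intro!: borel_measurable_times_ennreal)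
    have "(\<integral>\<^sup>+y. ?G y \<partial>R) = (\<integral>\<^sup>+y. ref_integral \<eta> (\<lambda>\<theta> e. ?G (\<theta>, e)) (n - k) k (fst y) (snd y) \<partial>ref_measure k)"
      using nn_integral_ref_measure_add[of k "n - k" ?G] Gm k by simp
    also have "\<dots> = (\<integral>\<^sup>+y. X (\<omega>, y) * alpha_k_at k \<tau> (\<omega>, y) \<partial>ref_measure k)"
    proof (rule nn_integral_cong)
      fix y assume "y \<in> space (ref_measure k)"
      then have y: "y \<in> space (jump_space E k)" using k by (simp add: space_ref_measure)
      have "ref_integral \<eta> (\<lambda>\<theta> e. ?G (\<theta>, e)) (n - k) k (fst y) (snd y) =
          ref_integral \<eta> (\<lambda>\<theta> e. X (\<omega>, y) * alpha_before_next k \<tau> (\<omega>, (\<theta>, e))) (n - k) k (fst y) (snd y)"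
        by (rule ref_integral_cong_cut[OF _ y]) (use k in \<open>auto simp: c_def\<close>)
      also have "\<dots> = X (\<omega>, y) * ref_integral \<eta> (\<lambda>\<theta> e. alpha_before_next k \<tau> (\<omega>, (\<theta>, e))) (n - k) k (fst y) (snd y)"
        by (rule ref_integral_cmult[OF _ y]) (use k Gm in auto)
      also have "ref_integral \<eta> (\<lambda>\<theta> e. alpha_before_next k \<tau> (\<omega>, (\<theta>, e))) (n - k) k (fst y) (snd y) = alpha_k_at k \<tau> (\<omega>, y)"
        using alpha_k_at_eq[OF k, of "(\<omega>, y)" \<tau>] ge[of "(\<omega>, y)"] \<omega> y by (simp add: space_pair_measure)
      finally show "ref_integral \<eta> (\<lambda>\<theta> e. ?G (\<theta>, e)) (n - k) k (fst y) (snd y) = X (\<omega>, y) * alpha_k_at k \<tau> (\<omega>, y)" .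
    qed
    finally show "(\<integral>\<^sup>+y. ?G y \<partial>R) = (\<integral>\<^sup>+y. X (\<omega>, y) * alpha_k_at k \<tau> (\<omega>, y) \<partial>ref_measure k)" .
  qed
  also have "\<dots> = (\<integral>\<^sup>+p. X p * alpha_k_at k \<tau> p \<partial>(M \<Otimes>\<^sub>M ref_measure k))"
    using MX AK k by (intro k.M2.nn_integral_fst) (simp add: measurable_ref_measure_iff)
  finally show ?thesis .
qed

end

section \<open>Stages of the stopping time\<close>

lemma sum_ends:
  fixes f :: "nat \<Rightarrow> 'b::comm_monoid_add"
  assumes "1 \<le> n" shows "f 0 + (\<Sum>k=1..n - 1. f k) + f n = (\<Sum>k\<le>n. f k)"
proof -
  obtain m where n: "n = Suc m" using assms by (cases n) auto
  have "(\<Sum>k\<le>n. f k) = (\<Sum>k\<le>m. f k) + f n" by (simp add: n)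
  also have "(\<Sum>k\<le>m. f k) = f 0 + (\<Sum>k=1..m. f k)"
    by (simp add: atMost_atLeast0 sum.atLeast_Suc_atMost)
  finally show ?thesis by (simp add: n)
qed

lemma sum_of_bool_unique:
  fixes f :: "nat \<Rightarrow> 'b::semiring_1"
  assumes "k0 \<le> n" "\<And>k. k \<le> n \<Longrightarrow> P k \<longleftrightarrow> k = k0"
  shows "(\<Sum>k\<le>n. f k * of_bool (P k)) = f k0"
proof -
  have "(\<Sum>k\<le>n. f k * of_bool (P k)) = (\<Sum>k\<le>n. if k = k0 then f k else 0)"
    using assms(2) by (intro sum.cong) auto
  then show ?thesis using assms(1) by simp
qed

text \<open>Dependent choice running downwards from \<open>n\<close>: \<open>g (Suc m)\<close> is
  the object at stage \<open>n - m\<close>. The start \<open>g 0 = undefined\<close> fills the place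
  above \<open>n\<close>, where \<open>step\<close> puts no condition on \<open>J'\<close>.\<close>

lemma backward_choice:
  fixes Q :: "nat \<Rightarrow> 'b \<Rightarrow> bool" and P :: "nat \<Rightarrow> 'b \<Rightarrow> 'b \<Rightarrow> bool"
  assumes step: "\<And>k J'. k \<le> n \<Longrightarrow> (k < n \<Longrightarrow> Q (Suc k) J') \<Longrightarrow> \<exists>J. Q k J \<and> P k J J'"
  shows "\<exists>J. \<forall>k\<le>n. Q k (J k) \<and> P k (J k) (J (Suc k))"
proof -
  define g where "g = rec_nat undefined (\<lambda>m J'. SOME J. Q (n - m) J \<and> P (n - m) J J')"
  have g_Suc: "g (Suc m) = (SOME J. Q (n - m) J \<and> P (n - m) J (g m))" for m by (simp add: g_def)
  have Qg: "Q (n - m) (g (Suc m)) \<and> P (n - m) (g (Suc m)) (g m)" if "m \<le> n" for m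
    using that
  proof (induction m)
    case 0
    show ?case unfolding g_Suc by (rule someI_ex) (use step[of n] in simp)
  next
    case (Suc m)
    then have Q: "Q (Suc (n - Suc m)) (g (Suc m))" by (simp add: Suc_diff_Suc)
    have "\<exists>J. Q (n - Suc m) J \<and> P (n - Suc m) J (g (Suc m))" by (rule step) (use Q in simp_all)
    then show ?case unfolding g_Suc[of "Suc m"] by (rule someI_ex)
  qed
  show ?thesis
  proof (intro exI[of _ "\<lambda>k. g (Suc n - k)"] allI impI)
    fix k assume "k \<le> n"
    then show "Q k (g (Suc n - k)) \<and> P k (g (Suc n - k)) (g (Suc n - Suc k))"
      using Qg[of "n - k"] by (simp add: Suc_diff_le)
  qed
qed

lemma measurable_time_space_subset:
  assumes "D \<subseteq> D'" shows "(\<lambda>\<theta>. \<theta>) \<in> time_space k D \<rightarrow>\<^sub>M time_space k D'"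
  unfolding time_space_def[of k D']
  by (rule measurable_restrict_space2[OF _ measurable_time_space_PiM]) (use assms in \<open>auto simp: space_time_space\<close>)

lemma Delta_upto_subset: "Delta_upto k T \<subseteq> Delta k" by (auto simp: Delta_upto_def)

lemma Delta_upto_iff: "\<theta> \<in> Delta k \<Longrightarrow> \<theta> \<in> Delta_upto k T \<longleftrightarrow> ennreal (last_time k \<theta>) \<le> T"
proof
  assume \<theta>: "\<theta> \<in> Delta k" and le: "ennreal (last_time k \<theta>) \<le> T"
  have "ennreal (\<theta> i) \<le> T" if i: "i \<in> {1..k}" for i
  proof -
    have "\<theta> i \<le> last_time k \<theta>" using \<theta> i by (auto simp: Delta_def last_time_def)
    then show ?thesis using le by (meson ennreal_leI order_trans)
  qed
  with \<theta> show "\<theta> \<in> Delta_upto k T" by (auto simp: Delta_upto_def)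
qed (auto simp: Delta_upto_def last_time_def)

lemma measurable_restrict_upto:
  assumes "f \<in> M \<Otimes>\<^sub>M jump_space E k \<rightarrow>\<^sub>M N"
  shows "f \<in> M \<Otimes>\<^sub>M (time_space k (Delta_upto k T) \<Otimes>\<^sub>M mark_space E k) \<rightarrow>\<^sub>M N"
proof -
  have "(\<lambda>p. fst (snd p)) \<in> M \<Otimes>\<^sub>M (time_space k (Delta_upto k T) \<Otimes>\<^sub>M mark_space E k) \<rightarrow>\<^sub>M time_space k (Delta_upto k T)"
    by measurable
  from measurable_compose[OF this measurable_time_space_subset[OF Delta_upto_subset]]
  have "(\<lambda>p. (fst p, (fst (snd p), snd (snd p)))) \<in>
      M \<Otimes>\<^sub>M (time_space k (Delta_upto k T) \<Otimes>\<^sub>M mark_space E k) \<rightarrow>\<^sub>M M \<Otimes>\<^sub>M jump_space E k"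
    unfolding jump_space_def by measurable
  from measurable_compose[OF this assms] show ?thesis by simp
qed

text \<open>A given \<open>J\<close> is measurable on the times up to \<open>T\<close> only; the
  extension by 0 moves it to the full jump space, on which the reference measure lives.\<close>

lemma measurable_extend_upto:
  fixes f :: "_ \<Rightarrow> 'b::{topological_space, zero}"
  assumes f: "f \<in> borel_measurable (M \<Otimes>\<^sub>M (time_space k (Delta_upto k T) \<Otimes>\<^sub>M mark_space E k))"
  shows "(\<lambda>p. if ennreal (last_time k (fst (snd p))) \<le> T then f p else 0) \<in> borel_measurable (M \<Otimes>\<^sub>M jump_space E k)"
proof (subst measurable_If_restrict_space_iff, goal_cases)
  case 1 show ?case by measurable
next
  case 2
  let ?A = "{p. ennreal (last_time k (fst (snd p))) \<le> T}"
  let ?L = "restrict_space (M \<Otimes>\<^sub>M jump_space E k) ?A"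
  have m: "(\<lambda>p. p) \<in> ?L \<rightarrow>\<^sub>M M \<Otimes>\<^sub>M jump_space E k" by (rule measurable_restrict_space1) simp
  have s: "fst (snd p) \<in> Delta_upto k T" if "p \<in> space ?L" for p
    using that Delta_upto_iff[of "fst (snd p)" k T] by (auto simp: space_restrict_space space_pair_measure space_jump_space)
  have 1: "(\<lambda>p. fst p) \<in> ?L \<rightarrow>\<^sub>M M" by (rule measurable_restrict_space1) simp
  have 2: "(\<lambda>p. fst (snd p)) \<in> ?L \<rightarrow>\<^sub>M time_space k (Delta_upto k T)"
    unfolding time_space_def
  proof (rule measurable_restrict_space2)
    have "(\<lambda>p. fst (snd p)) \<in> M \<Otimes>\<^sub>M jump_space E k \<rightarrow>\<^sub>M time_space k (Delta k)"
      unfolding jump_space_def by measurable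
    from measurable_compose[OF m measurable_compose[OF this measurable_time_space_PiM]]
    show "(\<lambda>p. fst (snd p)) \<in> ?L \<rightarrow>\<^sub>M Pi\<^sub>M {1..k} (\<lambda>i. borel)" .
  qed (use s in auto)
  have 3: "(\<lambda>p. snd (snd p)) \<in> ?L \<rightarrow>\<^sub>M mark_space E k"
    by (rule measurable_restrict_space1) (simp add: jump_space_def)
  from measurable_compose[OF measurable_Pair[OF 1 measurable_Pair[OF 2 3]] f] show ?case by simp
qed

lemma indexed_optional_measurable:
  "indexed_optional M F E k Z \<longleftrightarrow> (\<lambda>((t, \<omega>), (\<theta>, e)). Z t \<omega> \<theta> e) \<in> borel_measurable (optional_algebra M F \<Otimes>\<^sub>M jump_space E k)"
  by (simp add: indexed_optional_def jump_space_def)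

section \<open>Stages that are reached, and their share in the expectation\<close>

locale stopped_model = jump_model M F E n \<eta> \<zeta> L \<alpha>
  for M :: "'a measure" and F :: "ennreal \<Rightarrow> 'a measure" and E :: "'e::euclidean_space set" and n :: nat
    and \<eta> :: "'e mark_kernels" and \<zeta> L \<alpha> +
  fixes \<tau> :: "'a \<Rightarrow> ennreal" and \<tau>s :: "nat \<Rightarrow> 'a \<Rightarrow> (nat \<Rightarrow> real) \<Rightarrow> (nat \<Rightarrow> 'e) \<Rightarrow> ennreal" and T :: ennreal
  assumes n_pos: "1 \<le> n"
    and \<tau>_finite: "AE \<omega> in M. \<tau> \<omega> < \<infinity>" and \<tau>_le: "AE \<omega> in M. \<tau> \<omega> \<le> T"
    and \<tau>_decomp: "stopping_decomposition M F E n \<zeta> L \<tau> \<tau>s"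
    and F0_trivial: "A \<in> sets (F 0) \<Longrightarrow> prob A = 0 \<or> prob A = 1"
begin

definition st :: "nat \<Rightarrow> 'a \<times> 'e jump_data \<Rightarrow> ennreal" where
  "st k p = \<tau>s k (fst p) (fst (snd p)) (snd (snd p))"

lemma st_measurable: "k \<le> n \<Longrightarrow> st k \<in> borel_measurable (F \<infinity> \<Otimes>\<^sub>M jump_space E k)"
  using \<tau>_decomp by (simp add: stopping_decomposition_def jump_space_def st_def[abs_def] split_beta')

lemma st_stopping: "k \<le> n \<Longrightarrow> y \<in> space (jump_space E k) \<Longrightarrow> stopping_time F (\<lambda>\<omega>. st k (\<omega>, y))"
  using \<tau>_decomp by (auto simp: stopping_decomposition_def space_jump_space st_def)

lemma st_ge:
  assumes "k \<le> n" "p \<in> space (M \<Otimes>\<^sub>M jump_space E k)"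
  shows "ennreal (last_time k (fst (snd p))) \<le> st k p"
proof (cases "k = 0")
  case False
  then have "k \<in> {1..n}" using assms(1) by auto
  moreover have "fst p \<in> space M" "fst (snd p) \<in> Delta k" "snd (snd p) \<in> space (mark_space E k)"
    using assms(2) by (auto simp: space_pair_measure space_jump_space)
  ultimately have "ennreal (fst (snd p) k) \<le> \<tau>s k (fst p) (fst (snd p)) (snd (snd p))"
    using \<tau>_decomp unfolding stopping_decomposition_def by blast
  then show ?thesis using False by (simp add: st_def last_time_def)
qed (simp add: last_time_def)

text \<open>The restriction to \<open>T\<close> costs nothing: since \<open>\<tau> \<le> T\<close>, a jump after \<open>T\<close> comes after stopping.\<close>

definition reached :: "nat \<Rightarrow> 'a \<times> 'e jump_data \<Rightarrow> bool" where
  "reached k p \<longleftrightarrow> (\<forall>j<k. ennreal (fst (snd p) (Suc j)) \<le> st j (fst p, cut j (snd p))) \<and>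
     ennreal (last_time k (fst (snd p))) \<le> T"

lemma reached_measurable:
  assumes "k \<le> n" shows "Measurable.pred (F \<infinity> \<Otimes>\<^sub>M jump_space E k) (reached k)"
proof -
  have a: "(\<lambda>p. st j (fst p, cut j (snd p))) \<in> borel_measurable (F \<infinity> \<Otimes>\<^sub>M jump_space E k)"
    and b: "(\<lambda>p. fst (snd p) (Suc j)) \<in> borel_measurable (F \<infinity> \<Otimes>\<^sub>M jump_space E k)" if "j < k" for j
  proof -
    have "(\<lambda>p. (fst p, cut j (snd p))) \<in> F \<infinity> \<Otimes>\<^sub>M jump_space E k \<rightarrow>\<^sub>M F \<infinity> \<Otimes>\<^sub>M jump_space E j"
      using that by (intro measurable_Pair measurable_fst measurable_cut_compose[OF measurable_snd]) simp
    from measurable_compose[OF this st_measurable] that assms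
    show "(\<lambda>p. st j (fst p, cut j (snd p))) \<in> borel_measurable (F \<infinity> \<Otimes>\<^sub>M jump_space E k)" by simp
    show "(\<lambda>p. fst (snd p) (Suc j)) \<in> borel_measurable (F \<infinity> \<Otimes>\<^sub>M jump_space E k)"
      using that by (intro measurable_compose[OF measurable_snd measurable_time_component]) auto
  qed
  have "Measurable.pred (F \<infinity> \<Otimes>\<^sub>M jump_space E k) (\<lambda>p. (\<forall>j\<in>{..<k}. ennreal (fst (snd p) (Suc j)) \<le> st j (fst p, cut j (snd p))))"
  proof (rule pred_intros_finite(3))
    fix j assume "j \<in> {..<k}"
    then have "j < k" by simp
    note [measurable] = a[OF this] b[OF this]
    show "Measurable.pred (F \<infinity> \<Otimes>\<^sub>M jump_space E k) (\<lambda>p. ennreal (fst (snd p) (Suc j)) \<le> st j (fst p, cut j (snd p)))"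
      by measurable
  qed simp
  moreover have "Measurable.pred (F \<infinity> \<Otimes>\<^sub>M jump_space E k) (\<lambda>p. ennreal (last_time k (fst (snd p))) \<le> T)"
    by measurable
  ultimately have "Measurable.pred (F \<infinity> \<Otimes>\<^sub>M jump_space E k) (\<lambda>p.
      (\<forall>j\<in>{..<k}. ennreal (fst (snd p) (Suc j)) \<le> st j (fst p, cut j (snd p))) \<and> ennreal (last_time k (fst (snd p))) \<le> T)"
    by (rule pred_intros_logic)
  then show ?thesis unfolding reached_def[abs_def] Ball_def lessThan_iff .
qed

text \<open>Each condition is the complement of the event that a stopping time comes before a fixed
  jump time. That event is known at this jump time, and none of these times exceeds the last
  one.\<close>

lemma reached_section:
  assumes k: "k \<le> n" and y: "y \<in> space (jump_space E k)"
  shows "{\<omega>\<in>space M. reached k (\<omega>, y)} \<in> sets (F (ennreal (last_time k (fst y))))" (is "_ \<in> sets ?F")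
proof -
  have "{\<omega>\<in>space M. ennreal (fst y (Suc j)) \<le> st j (\<omega>, cut j y)} \<in> sets ?F" if j: "j \<in> {..<k}" for j
  proof -
    have "fst y (Suc j) \<le> last_time k (fst y)"
      using y j by (auto simp: space_jump_space Delta_def last_time_def)
    then have "sets (F (ennreal (fst y (Suc j)))) \<subseteq> sets ?F" by (intro sets_F_mono ennreal_leI)
    moreover have "cut j y \<in> space (jump_space E j)" using y j by (intro cut_in_space[of j k]) auto
    then have "{\<omega>\<in>space M. st j (\<omega>, cut j y) < ennreal (fst y (Suc j))} \<in> sets (F (ennreal (fst y (Suc j))))"
      using j k by (intro measurable_stopping_time_before(1)[OF filtration_F] st_stopping) auto
    ultimately have "space M - {\<omega>\<in>space M. st j (\<omega>, cut j y) < ennreal (fst y (Suc j))} \<in> sets ?F"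
      using sets.compl_sets[of _ ?F] by auto
    moreover have "space M - {\<omega>\<in>space M. st j (\<omega>, cut j y) < ennreal (fst y (Suc j))} =
        {\<omega>\<in>space M. ennreal (fst y (Suc j)) \<le> st j (\<omega>, cut j y)}" by (auto simp: not_less)
    ultimately show ?thesis by simp
  qed
  then have "{\<omega>\<in>space ?F. \<forall>j\<in>{..<k}. ennreal (fst y (Suc j)) \<le> st j (\<omega>, cut j y)} \<in> sets ?F"
    by (intro sets.sets_Collect_finite_All) simp_all
  note all = this
  show ?thesis
  proof (cases "ennreal (last_time k (fst y)) \<le> T")
    case True
    then have "{\<omega>\<in>space M. reached k (\<omega>, y)} =
        {\<omega>\<in>space ?F. \<forall>j\<in>{..<k}. ennreal (fst y (Suc j)) \<le> st j (\<omega>, cut j y)}"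
      unfolding reached_def space_F fst_conv snd_conv by blast
    with all show ?thesis by (simp only:)
  next
    case False
    then have "{\<omega>\<in>space M. reached k (\<omega>, y)} = {}"
      unfolding reached_def fst_conv snd_conv by blast
    then show ?thesis by (simp only: sets.empty_sets)
  qed
qed

lemma reached_upto:
  "p \<in> space (M \<Otimes>\<^sub>M jump_space E k) \<Longrightarrow> reached k p \<Longrightarrow> fst (snd p) \<in> Delta_upto k T"
  by (auto simp: reached_def space_pair_measure space_jump_space Delta_upto_iff)

text \<open>The bound \<open>T\<close> on the earlier times follows from the one on
  \<open>u\<close>, because times ascend.\<close>

lemma reached_extend:
  assumes "y \<in> space (jump_space E k)" "last_time k (fst y) \<le> u"
  shows "reached (Suc k) (\<omega>, extend k y (u, x)) \<longleftrightarrow>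
    reached k (\<omega>, y) \<and> ennreal u \<le> st k (\<omega>, y) \<and> ennreal u \<le> T"
proof -
  have c: "cut j (extend k y (u, x)) = cut j y" if "j \<le> k" for j
    using cut_cut[OF that, of "extend k y (u, x)"] by (simp add: cut_extend[OF assms(1)])
  have le: "ennreal (last_time k (fst y)) \<le> ennreal u" using assms(2) by (rule ennreal_leI)
  let ?q = "extend k y (u, x)"
  have new: "fst ?q (Suc k) = u" "last_time (Suc k) (fst ?q) = u"
    using assms(2) by (auto simp: extend_def last_time_def)
  have old: "fst ?q (Suc j) = fst y (Suc j)" if "j < k" for j
    using that by (simp add: extend_def)
  have "(\<forall>j<k. ennreal (fst ?q (Suc j)) \<le> st j (\<omega>, cut j ?q)) \<longleftrightarrow> (\<forall>j<k. ennreal (fst y (Suc j)) \<le> st j (\<omega>, cut j y))"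
    using old c by simp
  moreover have "st k (\<omega>, cut k ?q) = st k (\<omega>, y)" using c cut_same[OF assms(1)] by simp
  moreover have "ennreal u \<le> T \<Longrightarrow> ennreal (last_time k (fst y)) \<le> T" using le by (rule order_trans)
  ultimately show ?thesis
    unfolding reached_def fst_conv snd_conv All_less_Suc new by metis
qed

definition payoff :: "('a, 'e) stage_processes \<Rightarrow> nat \<Rightarrow> 'a \<times> 'e jump_data \<Rightarrow> real" where
  "payoff Zs k p = (if st k p < \<infinity> then Zs k (enn2real (st k p)) (fst p) (fst (snd p)) (snd (snd p)) else 0)"

lemma payoff_measurable:
  assumes k: "k \<le> n" and Z: "indexed_optional M F E k (Zs k)"
  shows "payoff Zs k \<in> borel_measurable (F \<infinity> \<Otimes>\<^sub>M jump_space E k)"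
proof -
  note [measurable] = st_measurable[OF k]
  have "(\<lambda>p. if st k p < \<infinity> then (\<lambda>((t, \<omega>), (\<theta>, e)). Zs k t \<omega> \<theta> e) ((enn2real (st k p), fst p), snd p) else 0)
      \<in> borel_measurable (F \<infinity> \<Otimes>\<^sub>M jump_space E k)"
    by (rule measurable_optional_at_random_time[OF filtration_F Z[unfolded indexed_optional_measurable]]) measurable
  then show ?thesis
    by (rule measurable_cong[THEN iffD1, rotated]) (simp add: payoff_def split_beta')
qed

lemma payoff_section:
  assumes k: "k \<le> n" and Z: "indexed_optional M F E k (Zs k)" and y: "y \<in> space (jump_space E k)"
  shows "(\<lambda>\<omega>. if st k (\<omega>, y) < q then payoff Zs k (\<omega>, y) else 0) \<in> borel_measurable (F q)"
proof -
  note st = measurable_stopping_time_before[OF filtration_F st_stopping[OF k y], of q]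
  have "(\<lambda>\<omega>. if st k (\<omega>, y) < q then (\<lambda>((t, \<omega>), (\<theta>, e)). Zs k t \<omega> \<theta> e) ((enn2real (st k (\<omega>, y)), \<omega>), y) else 0)
      \<in> borel_measurable (F q)"
    by (rule measurable_optional_at_random_time[OF filtration_F Z[unfolded indexed_optional_measurable]])
       (use st y in auto)
  moreover have "(\<lambda>\<omega>. if st k (\<omega>, y) < q then (\<lambda>((t, \<omega>), (\<theta>, e)). Zs k t \<omega> \<theta> e) ((enn2real (st k (\<omega>, y)), \<omega>), y) else 0) =
      (\<lambda>\<omega>. if st k (\<omega>, y) < q then payoff Zs k (\<omega>, y) else 0)"
    by (auto simp: fun_eq_iff payoff_def split_beta' dest: less_le_trans[OF _ top_greatest])
  ultimately show ?thesis by simp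
qed

definition snn :: "('a, 'e) stage_processes \<Rightarrow> nat \<Rightarrow> 'a \<times> 'e jump_data \<Rightarrow> ennreal" where
  "snn Zs k p = stopped_nn n \<eta> \<alpha> Zs \<tau>s k (fst p) (fst (snd p)) (snd (snd p))"

lemma snn_eq: "snn Zs k p = ennreal (payoff Zs k p) * alpha_k_at k (st k) p"
  by (auto simp: snn_def stopped_nn_def payoff_def alpha_k_at_def st_def Let_def less_top[symmetric])

lemma alpha_k_at_st_measurable: "k \<le> n \<Longrightarrow> alpha_k_at k (st k) \<in> borel_measurable (M \<Otimes>\<^sub>M jump_space E k)"
  by (intro measurable_alpha_k_at F_prod_M[OF st_measurable] st_ge)

lemma snn_measurable:
  assumes "k \<le> n" "indexed_optional M F E k (Zs k)"
  shows "snn Zs k \<in> borel_measurable (M \<Otimes>\<^sub>M jump_space E k)"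
  using alpha_k_at_st_measurable[OF assms(1)] F_prod_M[OF payoff_measurable[where Zs = Zs, OF assms]]
  unfolding snn_eq[abs_def] by measurable

definition stage :: "('a, 'e) stage_processes \<Rightarrow> nat \<Rightarrow> ennreal" where
  "stage Zs k = (\<integral>\<^sup>+p. of_bool (reached k p) * snn Zs k p \<partial>(M \<Otimes>\<^sub>M ref_measure k))"

lemma stage_eq_law:
  assumes k: "k \<le> n" and Z: "indexed_optional M F E k (Zs k)"
  shows "stage Zs k = (\<integral>\<^sup>+\<omega>. (if st k (\<omega>, cut k (jumps \<omega>)) < \<infinity> \<and>
      (k < n \<longrightarrow> st k (\<omega>, cut k (jumps \<omega>)) < ennreal (\<zeta> (Suc k) \<omega>)) then
      of_bool (reached k (\<omega>, cut k (jumps \<omega>))) * ennreal (payoff Zs k (\<omega>, cut k (jumps \<omega>))) else 0) \<partial>M)"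
proof -
  note [measurable] = reached_measurable[OF k] payoff_measurable[where Zs = Zs, OF k Z]
  have "(\<integral>\<^sup>+\<omega>. (if st k (\<omega>, cut k (jumps \<omega>)) < \<infinity> \<and>
      (k < n \<longrightarrow> st k (\<omega>, cut k (jumps \<omega>)) < ennreal (\<zeta> (Suc k) \<omega>)) then
      of_bool (reached k (\<omega>, cut k (jumps \<omega>))) * ennreal (payoff Zs k (\<omega>, cut k (jumps \<omega>))) else 0) \<partial>M) =
    (\<integral>\<^sup>+p. (of_bool (reached k p) * ennreal (payoff Zs k p)) * alpha_k_at k (st k) p \<partial>(M \<Otimes>\<^sub>M ref_measure k))"
  proof (rule law_at_level[OF k _ st_measurable[OF k] st_stopping[OF k] _ st_ge[OF k]])
    show "(\<lambda>p. of_bool (reached k p) * ennreal (payoff Zs k p)) \<in> borel_measurable (F \<infinity> \<Otimes>\<^sub>M jump_space E k)"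
      by measurable
    fix y and q :: real assume y: "y \<in> space (jump_space E k)" "0 \<le> q"
    show "(\<lambda>\<omega>. if st k (\<omega>, y) < ennreal q then of_bool (reached k (\<omega>, y)) * ennreal (payoff Zs k (\<omega>, y)) else 0)
        \<in> borel_measurable (F (ennreal q))"
    \<comment> \<open>Whether the stage is reached is known only from the last jump time on; at an
      earlier \<open>q\<close> the event \<open>st k < q\<close> is empty by
      \<open>st_ge\<close>.\<close>
    proof (cases "last_time k (fst y) \<le> q")
      case True
      have [measurable]: "{\<omega>\<in>space (F (ennreal q)). reached k (\<omega>, y)} \<in> sets (F (ennreal q))"
        using reached_section[OF k y(1)] sets_F_mono[OF ennreal_leI[OF True]] by auto
      note [measurable] = payoff_section[where Zs = Zs and q = "ennreal q", OF k Z y(1)]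
      have "(\<lambda>\<omega>. of_bool (reached k (\<omega>, y)) * ennreal (if st k (\<omega>, y) < ennreal q then payoff Zs k (\<omega>, y) else 0))
          \<in> borel_measurable (F (ennreal q))" by measurable
      then show ?thesis by (rule measurable_cong[THEN iffD1, rotated]) auto
    next
      case False
      have "\<not> st k (\<omega>, y) < ennreal q" if "\<omega> \<in> space M" for \<omega>
      proof -
        have "ennreal q \<le> ennreal (last_time k (fst y))" using False by (intro ennreal_leI) simp
        also have "\<dots> \<le> st k (\<omega>, y)" using st_ge[OF k, of "(\<omega>, y)"] that y by (simp add: space_pair_measure)
        finally show ?thesis by simp
      qed
      then show ?thesis by (subst measurable_cong[of _ _ "\<lambda>_. 0"]) auto
    qed
  qed
  then show ?thesis by (simp add: stage_def snn_eq mult.assoc)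
qed

definition stage_value :: "('a, 'e) stage_processes \<Rightarrow> nat \<Rightarrow> 'a \<Rightarrow> ennreal" where
  "stage_value Zs k \<omega> = (if st k (\<omega>, cut k (jumps \<omega>)) < \<infinity> \<and>
      (k < n \<longrightarrow> st k (\<omega>, cut k (jumps \<omega>)) < ennreal (\<zeta> (Suc k) \<omega>)) then
      of_bool (reached k (\<omega>, cut k (jumps \<omega>))) * ennreal (payoff Zs k (\<omega>, cut k (jumps \<omega>))) else 0)"

lemma stage_value_measurable:
  assumes k: "k \<le> n" and Z: "indexed_optional M F E k (Zs k)"
  shows "stage_value Zs k \<in> borel_measurable M"
proof -
  have m: "(\<lambda>\<omega>. (\<omega>, cut k (jumps \<omega>))) \<in> M \<rightarrow>\<^sub>M M \<Otimes>\<^sub>M jump_space E k"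
    using k by measurable
  have z: "k < n \<Longrightarrow> \<zeta> (Suc k) \<in> borel_measurable M" using jump_times by (auto simp: jump_times_marks_def)
  note [measurable] = measurable_compose[OF m F_prod_M[OF st_measurable[OF k]]]
    measurable_compose[OF m F_prod_M[OF reached_measurable[OF k]]]
    measurable_compose[OF m F_prod_M[OF payoff_measurable[where Zs = Zs, OF k Z]]]
  show ?thesis
  proof (cases "k < n")
    case True
    note [measurable] = z[OF True]
    show ?thesis unfolding stage_value_def[abs_def] by measurable
  next
    case False
    then show ?thesis unfolding stage_value_def[abs_def] by simp
  qed
qed

text \<open>The first stage \<open>k0\<close> that stops before its next jump is the only one whose
  condition in the decomposition of \<tau> holds. There \<tau> is the stage time, at or after the
  \<open>k0\<close>-th jump and before the next, so the decomposition of \<open>Z\<close> at time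
  \<tau> selects the same index.\<close>

lemma AE_value_eq_sum:
  assumes Z: "process_decomposition M F E n \<zeta> L Z Zs"
  shows "AE \<omega> in M. ennreal (Z (enn2real (\<tau> \<omega>)) \<omega>) = (\<Sum>k\<le>n. stage_value Zs k \<omega>)"
proof -
  \<comment> \<open>The first and the last term are brought into the form of the middle ones:
    conditions on the nonexistent jumps 0 and \<open>Suc n\<close> become void implications, and a
    single sum results.\<close>
  have Zt: "AE \<omega> in M. \<forall>t\<ge>0. Z t \<omega> = (\<Sum>k\<le>n. Zs k t \<omega> (initial k \<zeta> \<omega>) (initial k L \<omega>) *
      of_bool ((1 \<le> k \<longrightarrow> \<zeta> k \<omega> \<le> t) \<and> (k < n \<longrightarrow> t < \<zeta> (Suc k) \<omega>)))"
  proof -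
    have "AE \<omega> in M. \<forall>t\<ge>0.
        (let z = (\<lambda>k. Zs k t \<omega> (initial k \<zeta> \<omega>) (initial k L \<omega>))
         in Z t \<omega> = z 0 * of_bool (t < \<zeta> 1 \<omega>)
              + (\<Sum>k=1..n - 1. z k * of_bool (\<zeta> k \<omega> \<le> t \<and> t < \<zeta> (Suc k) \<omega>))
              + z n * of_bool (\<zeta> n \<omega> \<le> t))"
      using Z by (simp add: process_decomposition_def)
    then show ?thesis
    proof eventually_elim
      case (elim \<omega>)
      show ?case
      proof (intro allI impI)
        fix t :: real assume "0 \<le> t"
        with elim have "Z t \<omega> = Zs 0 t \<omega> (initial 0 \<zeta> \<omega>) (initial 0 L \<omega>) * of_bool (t < \<zeta> 1 \<omega>)
              + (\<Sum>k=1..n - 1. Zs k t \<omega> (initial k \<zeta> \<omega>) (initial k L \<omega>) * of_bool (\<zeta> k \<omega> \<le> t \<and> t < \<zeta> (Suc k) \<omega>))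
              + Zs n t \<omega> (initial n \<zeta> \<omega>) (initial n L \<omega>) * of_bool (\<zeta> n \<omega> \<le> t)"
          by (simp add: Let_def)
        also have "\<dots> = Zs 0 t \<omega> (initial 0 \<zeta> \<omega>) (initial 0 L \<omega>) * of_bool ((1 \<le> (0::nat) \<longrightarrow> \<zeta> 0 \<omega> \<le> t) \<and> (0 < n \<longrightarrow> t < \<zeta> (Suc 0) \<omega>))
              + (\<Sum>k=1..n - 1. Zs k t \<omega> (initial k \<zeta> \<omega>) (initial k L \<omega>) * of_bool ((1 \<le> k \<longrightarrow> \<zeta> k \<omega> \<le> t) \<and> (k < n \<longrightarrow> t < \<zeta> (Suc k) \<omega>)))
              + Zs n t \<omega> (initial n \<zeta> \<omega>) (initial n L \<omega>) * of_bool ((1 \<le> n \<longrightarrow> \<zeta> n \<omega> \<le> t) \<and> (n < n \<longrightarrow> t < \<zeta> (Suc n) \<omega>))"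
          using n_pos by (intro arg_cong2[where f = "(+)"] sum.cong refl) auto
        also have "\<dots> = (\<Sum>k\<le>n. Zs k t \<omega> (initial k \<zeta> \<omega>) (initial k L \<omega>) *
            of_bool ((1 \<le> k \<longrightarrow> \<zeta> k \<omega> \<le> t) \<and> (k < n \<longrightarrow> t < \<zeta> (Suc k) \<omega>)))"
          by (rule sum_ends[OF n_pos, of "\<lambda>k. Zs k t \<omega> (initial k \<zeta> \<omega>) (initial k L \<omega>) *
            of_bool ((1 \<le> k \<longrightarrow> \<zeta> k \<omega> \<le> t) \<and> (k < n \<longrightarrow> t < \<zeta> (Suc k) \<omega>))"])
        finally show "Z t \<omega> = (\<Sum>k\<le>n. Zs k t \<omega> (initial k \<zeta> \<omega>) (initial k L \<omega>) *
            of_bool ((1 \<le> k \<longrightarrow> \<zeta> k \<omega> \<le> t) \<and> (k < n \<longrightarrow> t < \<zeta> (Suc k) \<omega>)))" .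
      qed
    qed
  qed
  have \<tau>t: "AE \<omega> in M. \<tau> \<omega> = (\<Sum>k\<le>n. \<tau>s k \<omega> (initial k \<zeta> \<omega>) (initial k L \<omega>) *
      of_bool ((\<forall>j<k. \<tau>s j \<omega> (initial j \<zeta> \<omega>) (initial j L \<omega>) \<ge> ennreal (\<zeta> (Suc j) \<omega>)) \<and>
        (k < n \<longrightarrow> \<tau>s k \<omega> (initial k \<zeta> \<omega>) (initial k L \<omega>) < ennreal (\<zeta> (Suc k) \<omega>))))"
  proof -
    have "AE \<omega> in M.
        (let r = (\<lambda>k. \<tau>s k \<omega> (initial k \<zeta> \<omega>) (initial k L \<omega>));
             s = (\<lambda>k. ennreal (\<zeta> k \<omega>))
         in \<tau> \<omega> = r 0 * of_bool (r 0 < s 1)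
              + (\<Sum>k=1..n - 1. r k * of_bool ((\<forall>j<k. r j \<ge> s (Suc j)) \<and> r k < s (Suc k)))
              + r n * of_bool (\<forall>j<n. r j \<ge> s (Suc j)))"
      using \<tau>_decomp by (simp add: stopping_decomposition_def)
    then show ?thesis
    proof eventually_elim
      case (elim \<omega>)
      define r where "r k = \<tau>s k \<omega> (initial k \<zeta> \<omega>) (initial k L \<omega>)" for k
      have "\<tau> \<omega> = r 0 * of_bool (r 0 < ennreal (\<zeta> 1 \<omega>))
              + (\<Sum>k=1..n - 1. r k * of_bool ((\<forall>j<k. r j \<ge> ennreal (\<zeta> (Suc j) \<omega>)) \<and> r k < ennreal (\<zeta> (Suc k) \<omega>)))
              + r n * of_bool (\<forall>j<n. r j \<ge> ennreal (\<zeta> (Suc j) \<omega>))"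
        using elim by (simp add: Let_def r_def)
      also have "\<dots> = r 0 * of_bool ((\<forall>j<0. r j \<ge> ennreal (\<zeta> (Suc j) \<omega>)) \<and> (0 < n \<longrightarrow> r 0 < ennreal (\<zeta> (Suc 0) \<omega>)))
              + (\<Sum>k=1..n - 1. r k * of_bool ((\<forall>j<k. r j \<ge> ennreal (\<zeta> (Suc j) \<omega>)) \<and> (k < n \<longrightarrow> r k < ennreal (\<zeta> (Suc k) \<omega>))))
              + r n * of_bool ((\<forall>j<n. r j \<ge> ennreal (\<zeta> (Suc j) \<omega>)) \<and> (n < n \<longrightarrow> r n < ennreal (\<zeta> (Suc n) \<omega>)))"
        using n_pos by (intro arg_cong2[where f = "(+)"] sum.cong refl) auto
      also have "\<dots> = (\<Sum>k\<le>n. r k * of_bool ((\<forall>j<k. r j \<ge> ennreal (\<zeta> (Suc j) \<omega>)) \<and> (k < n \<longrightarrow> r k < ennreal (\<zeta> (Suc k) \<omega>))))"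
        by (rule sum_ends[OF n_pos, of "\<lambda>k. r k * of_bool ((\<forall>j<k. r j \<ge> ennreal (\<zeta> (Suc j) \<omega>)) \<and> (k < n \<longrightarrow> r k < ennreal (\<zeta> (Suc k) \<omega>)))"])
      finally show ?case unfolding r_def .
    qed
  qed
  show ?thesis
    using Zt \<tau>t \<tau>_finite \<tau>_le AE_space
  proof eventually_elim
    case (elim \<omega>)
    define r where "r k = \<tau>s k \<omega> (initial k \<zeta> \<omega>) (initial k L \<omega>)" for k
    have init: "fst (cut k (jumps \<omega>)) = initial k \<zeta> \<omega>" "snd (cut k (jumps \<omega>)) = initial k L \<omega>" if "k \<le> n" for k
      using that by (auto simp: cut_def jumps_def initial_def fun_eq_iff restrict_def)
    have st_r: "st k (\<omega>, cut k (jumps \<omega>)) = r k" if "k \<le> n" for k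
      using init[OF that] by (simp add: st_def r_def)
    have jumps_space: "jumps \<omega> \<in> space S" using measurable_space[OF measurable_jumps] elim(5) .
    have \<zeta>_mono: "\<zeta> i \<omega> \<le> \<zeta> j \<omega>" if "1 \<le> i" "i \<le> j" "j \<le> n" for i j
      using jumps_space that by (auto simp: space_jump_space jumps_def Delta_def initial_def)
    \<comment> \<open>The alternative \<open>k = n\<close> makes a least index exist: the last stage
      has no further jump to precede.\<close>
    define k0 where "k0 = (LEAST k. k = n \<or> r k < ennreal (\<zeta> (Suc k) \<omega>))"
    have k0: "k0 = n \<or> r k0 < ennreal (\<zeta> (Suc k0) \<omega>)" unfolding k0_def by (rule LeastI[of _ n]) simp
    have k0n: "k0 \<le> n" unfolding k0_def by (rule Least_le) simp
    have below: "ennreal (\<zeta> (Suc j) \<omega>) \<le> r j" if "j < k0" for j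
      using not_less_Least[of j "\<lambda>k. k = n \<or> r k < ennreal (\<zeta> (Suc k) \<omega>)"] that by (auto simp: k0_def[symmetric] not_less)
    have uniq: "(\<forall>j<k. r j \<ge> ennreal (\<zeta> (Suc j) \<omega>)) \<and> (k < n \<longrightarrow> r k < ennreal (\<zeta> (Suc k) \<omega>)) \<longleftrightarrow> k = k0" if "k \<le> n" for k
    proof
      assume P: "(\<forall>j<k. r j \<ge> ennreal (\<zeta> (Suc j) \<omega>)) \<and> (k < n \<longrightarrow> r k < ennreal (\<zeta> (Suc k) \<omega>))"
      have "\<not> k < k0" using P below[of k] k0n by (auto simp: not_le[symmetric])
      moreover have "\<not> k0 < k" using P k0 that by (auto simp: not_le[symmetric])
      ultimately show "k = k0" by simp
    qed (use below k0 in auto)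
    have \<tau>_eq: "\<tau> \<omega> = r k0"
      unfolding elim(2) r_def[symmetric] by (rule sum_of_bool_unique[OF k0n uniq])
    define t where "t = enn2real (\<tau> \<omega>)"
    have t: "\<tau> \<omega> = ennreal t" "0 \<le> t" using elim(3) by (auto simp: t_def)
    have last: "ennreal (last_time k0 (initial k0 \<zeta> \<omega>)) \<le> r k0"
      using st_ge[OF k0n, of "(\<omega>, cut k0 (jumps \<omega>))"] elim(5) cut_in_space[OF k0n jumps_space] init[OF k0n] st_r[OF k0n]
      by (simp add: space_pair_measure)
    have last_eq: "last_time k0 (initial k0 \<zeta> \<omega>) = (if k0 = 0 then 0 else \<zeta> k0 \<omega>)"
      by (simp add: last_time_def initial_def)
    have t1: "\<zeta> k0 \<omega> \<le> t" if "1 \<le> k0"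
      using last that t unfolding last_eq \<tau>_eq[symmetric] by (simp add: t)
    have t2: "t < \<zeta> (Suc k0) \<omega>" if "k0 < n"
      using k0 that t by (auto simp: \<tau>_eq[symmetric] ennreal_less_iff)
    have "Z t \<omega> = Zs k0 t \<omega> (initial k0 \<zeta> \<omega>) (initial k0 L \<omega>)"
    proof -
      have "(1 \<le> k \<longrightarrow> \<zeta> k \<omega> \<le> t) \<and> (k < n \<longrightarrow> t < \<zeta> (Suc k) \<omega>) \<longleftrightarrow> k = k0" if kn: "k \<le> n" for k
      proof
        assume P: "(1 \<le> k \<longrightarrow> \<zeta> k \<omega> \<le> t) \<and> (k < n \<longrightarrow> t < \<zeta> (Suc k) \<omega>)"
        show "k = k0"
        proof (rule linorder_cases[of k k0])
          assume less: "k < k0"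
          then have "t < \<zeta> (Suc k) \<omega>" using P k0n by simp
          also have "\<dots> \<le> \<zeta> k0 \<omega>" using less k0n by (intro \<zeta>_mono) auto
          also have "\<dots> \<le> t" using t1 less by simp
          finally show ?thesis by simp
        next
          assume less: "k0 < k"
          then have "t < \<zeta> (Suc k0) \<omega>" using t2 kn by simp
          also have "\<dots> \<le> \<zeta> k \<omega>" using less kn by (intro \<zeta>_mono) auto
          also have "\<dots> \<le> t" using P less by simp
          finally show ?thesis by simp
        qed
      qed (use t1 t2 in auto)
      then show ?thesis
        unfolding elim(1)[rule_format, OF t(2)] by (rule sum_of_bool_unique[OF k0n])
    qed
    moreover have "stage_value Zs k \<omega> = (if k = k0 then ennreal (Zs k0 t \<omega> (initial k0 \<zeta> \<omega>) (initial k0 L \<omega>)) else 0)" if kn: "k \<le> n" for k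
    proof -
      have comp: "initial k \<zeta> \<omega> (Suc j) = \<zeta> (Suc j) \<omega>" if "j < k" for j
        using that by (simp add: initial_def)
      have reached: "reached k (\<omega>, cut k (jumps \<omega>)) \<longleftrightarrow> (\<forall>j<k. ennreal (\<zeta> (Suc j) \<omega>) \<le> r j) \<and> ennreal (last_time k (initial k \<zeta> \<omega>)) \<le> T"
        using kn by (auto simp: reached_def cut_cut comp st_r init)
      show ?thesis
      proof (cases "k = k0")
        case True
        have "ennreal (last_time k0 (initial k0 \<zeta> \<omega>)) \<le> T" using last elim(4) \<tau>_eq by simp
        then have "reached k0 (\<omega>, cut k0 (jumps \<omega>))" using reached below True by auto
        then show ?thesis
          using True k0 elim(3) k0n st_r[OF k0n] by (auto simp: stage_value_def payoff_def \<tau>_eq[symmetric] t_def[symmetric] init)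
      next
        case False
        with uniq[OF kn] reached show ?thesis by (auto simp: stage_value_def st_r[OF kn])
      qed
    qed
    then have "(\<Sum>k\<le>n. stage_value Zs k \<omega>) = (\<Sum>k\<le>n. if k = k0 then ennreal (Zs k0 t \<omega> (initial k0 \<zeta> \<omega>) (initial k0 L \<omega>)) else 0)"
      by (intro sum.cong) auto
    then have "(\<Sum>k\<le>n. stage_value Zs k \<omega>) = ennreal (Zs k0 t \<omega> (initial k0 \<zeta> \<omega>) (initial k0 L \<omega>))"
      using k0n by simp
    ultimately show ?case by (simp add: t_def)
  qed
qed

text \<open>\<open>ennreal\<close> cuts off negative values, so for a process of any sign this is
  the expectation of the positive part; the negative part is obtained from the negated
  process.\<close>

lemma expectation_eq_stages:
  assumes Z: "process_decomposition M F E n \<zeta> L Z Zs"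
  shows "(\<integral>\<^sup>+\<omega>. ennreal (Z (enn2real (\<tau> \<omega>)) \<omega>) \<partial>M) = (\<Sum>k\<le>n. stage Zs k)"
proof -
  have Zi: "indexed_optional M F E k (Zs k)" if "k \<le> n" for k
    using Z that by (auto simp: process_decomposition_def)
  have "(\<integral>\<^sup>+\<omega>. ennreal (Z (enn2real (\<tau> \<omega>)) \<omega>) \<partial>M) = (\<integral>\<^sup>+\<omega>. (\<Sum>k\<le>n. stage_value Zs k \<omega>) \<partial>M)"
    by (rule nn_integral_cong_AE[OF AE_value_eq_sum[OF Z]])
  also have "\<dots> = (\<Sum>k\<le>n. \<integral>\<^sup>+\<omega>. stage_value Zs k \<omega> \<partial>M)"
    by (intro nn_integral_sum stage_value_measurable Zi) simp_all
  also have "\<dots> = (\<Sum>k\<le>n. stage Zs k)"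
    unfolding stage_value_def by (intro sum.cong refl stage_eq_law[symmetric] Zi) auto
  finally show ?thesis .
qed

end

section \<open>The recursion for nonnegative processes\<close>

context stopped_model
begin

abbreviation J_measurable :: "nat \<Rightarrow> ('a \<times> 'e jump_data \<Rightarrow> ennreal) \<Rightarrow> bool" where
  "J_measurable k J \<equiv> J \<in> borel_measurable (M \<Otimes>\<^sub>M jump_space E k)"

text \<open>\<open>cont k J\<close> is the integral term of \<open>J\<^sub>k\<close>, for \<open>J = J\<^sub>k\<^sub>+\<^sub>1\<close>.\<close>

definition cont :: "nat \<Rightarrow> ('a \<times> 'e jump_data \<Rightarrow> ennreal) \<Rightarrow> 'a \<times> 'e jump_data \<Rightarrow> ennreal" where
  "cont k J p = next_jump_integral k
     (\<lambda>q. if ennreal (fst q (Suc k)) \<le> min (st k (fst p, cut k q)) T then J (fst p, q) else 0) (snd p)"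

definition recursion_rhs :: "('a, 'e) stage_processes \<Rightarrow> nat
    \<Rightarrow> ('a \<times> 'e jump_data \<Rightarrow> ennreal) \<Rightarrow> 'a \<times> 'e jump_data \<Rightarrow> ennreal" where
  "recursion_rhs Zs k J p = snn Zs k p + (if k < n then cont k J p else 0)"

text \<open>A relation for a single index, with \<open>J'\<close> in the place of
  \<open>J (Suc k)\<close>: the shape that \<open>backward_choice\<close> works with.\<close>

definition solves_at :: "('a, 'e) stage_processes \<Rightarrow> nat
    \<Rightarrow> ('a \<times> 'e jump_data \<Rightarrow> ennreal) \<Rightarrow> ('a \<times> 'e jump_data \<Rightarrow> ennreal) \<Rightarrow> bool" where
  "solves_at Zs k J J' \<longleftrightarrow> (\<forall>y\<in>space (jump_space E k). fst y \<in> Delta_upto k T \<longrightarrow>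
     (AE \<omega> in M. J (\<omega>, y) = nn_cond_exp M (F (ennreal (last_time k (fst y)))) (\<lambda>\<omega>. recursion_rhs Zs k J' (\<omega>, y)) \<omega>))"

lemma cont_eq:
  assumes y: "(\<theta>, e) \<in> space (jump_space E k)" and k: "k < n"
  shows "cont k J (\<omega>, (\<theta>, e)) =
    (\<integral>\<^sup>+u\<in>{u. last_time k \<theta> \<le> u \<and> ennreal u \<le> min (\<tau>s k \<omega> \<theta> e) T}.
       (\<integral>\<^sup>+x. J (\<omega>, (\<theta>(Suc k := u), e(Suc k := x))) \<partial>\<eta> (Suc k) \<theta> e) \<partial>lborel)"
  unfolding cont_def next_jump_integral_extend
proof (rule nn_integral_cong)
  fix u
  have c: "cut k (extend k (\<theta>, e) (u, x)) = (\<theta>, e)" for x by (rule cut_extend[OF y])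
  show "(\<integral>\<^sup>+x. (if ennreal (fst (extend k (snd (\<omega>, \<theta>, e)) (u, x)) (Suc k)) \<le>
        min (st k (fst (\<omega>, \<theta>, e), cut k (extend k (snd (\<omega>, \<theta>, e)) (u, x)))) T
      then J (fst (\<omega>, \<theta>, e), extend k (snd (\<omega>, \<theta>, e)) (u, x)) else 0) \<partial>\<eta> (Suc k) (fst (snd (\<omega>, \<theta>, e))) (snd (snd (\<omega>, \<theta>, e)))) *
      indicator {last_time k (fst (snd (\<omega>, \<theta>, e)))..} u =
    (\<integral>\<^sup>+x. J (\<omega>, (\<theta>(Suc k := u), e(Suc k := x))) \<partial>\<eta> (Suc k) \<theta> e) *
      indicator {u. last_time k \<theta> \<le> u \<and> ennreal u \<le> min (\<tau>s k \<omega> \<theta> e) T} u"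
  proof (cases "last_time k \<theta> \<le> u")
    case True
    then show ?thesis
      unfolding fst_conv snd_conv c
      by (cases "ennreal u \<le> \<tau>s k \<omega> \<theta> e"; cases "ennreal u \<le> T") (simp_all add: extend_def st_def)
  qed simp
qed

lemma cont_cong:
  assumes "k < n" "snd p \<in> space (jump_space E k)"
    and "\<And>q. q \<in> space (jump_space E (Suc k)) \<Longrightarrow> ennreal (last_time (Suc k) (fst q)) \<le> T \<Longrightarrow> J (fst p, q) = J' (fst p, q)"
  shows "cont k J p = cont k J' p"
  unfolding cont_def using assms
  by (intro next_jump_integral_cong) (auto intro!: assms(3) extend_in_space simp: last_time_def)

lemma cont_measurable:
  assumes k: "k < n" and J: "J_measurable (Suc k) J"
  shows "J_measurable k (cont k J)"
proof -
  have [measurable]: "(\<lambda>p. st k (fst p, cut k (snd p))) \<in> borel_measurable (M \<Otimes>\<^sub>M jump_space E (Suc k))"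
  proof -
    have "(\<lambda>p. (fst p, cut k (snd p))) \<in> M \<Otimes>\<^sub>M jump_space E (Suc k) \<rightarrow>\<^sub>M M \<Otimes>\<^sub>M jump_space E k"
      by (intro measurable_Pair measurable_fst measurable_cut_compose[OF measurable_snd]) simp
    from measurable_compose[OF this F_prod_M[OF st_measurable]] k show ?thesis by simp
  qed
  have [measurable]: "(\<lambda>p. fst (snd p) (Suc k)) \<in> borel_measurable (M \<Otimes>\<^sub>M jump_space E (Suc k))"
    by (intro measurable_compose[OF measurable_snd measurable_time_component]) auto
  note [measurable] = J
  have "(\<lambda>p. if ennreal (fst (snd p) (Suc k)) \<le> min (st k (fst p, cut k (snd p))) T then J p else 0)
      \<in> borel_measurable (M \<Otimes>\<^sub>M jump_space E (Suc k))" by measurable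
  then have "(\<lambda>(\<omega>, q). if ennreal (fst q (Suc k)) \<le> min (st k (\<omega>, cut k q)) T then J (\<omega>, q) else 0)
      \<in> borel_measurable (M \<Otimes>\<^sub>M jump_space E (Suc k))" by (simp add: split_beta')
  from measurable_next_jump_integral[OF k this] show ?thesis
    by (simp add: cont_def[abs_def] split_beta')
qed

lemma recursion_rhs_measurable:
  assumes k: "k \<le> n" and Z: "indexed_optional M F E k (Zs k)" and J: "k < n \<Longrightarrow> J_measurable (Suc k) J"
  shows "J_measurable k (recursion_rhs Zs k J)"
proof -
  note [measurable] = snn_measurable[where Zs = Zs, OF k Z]
  show ?thesis
  proof (cases "k < n")
    case True
    note [measurable] = cont_measurable[OF True J[OF True]]
    show ?thesis unfolding recursion_rhs_def[abs_def] using True by simp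
  next
    case False
    then show ?thesis unfolding recursion_rhs_def[abs_def] by simp
  qed
qed

lemma measurable_section: "J_measurable k J \<Longrightarrow> y \<in> space (jump_space E k) \<Longrightarrow> (\<lambda>\<omega>. J (\<omega>, y)) \<in> borel_measurable M"
  by (rule measurable_compose[OF measurable_Pair2'])

text \<open>For fixed \<open>y\<close> the indicator of the reached set is measurable for the
  sigma-algebra of the conditioning, so the conditional expectation may be replaced by its argument
  under the integral. Outside \<open>Delta_upto k T\<close>, where \<open>J\<close> is
  unconstrained, the reached set is empty.\<close>

lemma integral_reached_cond_exp:
  assumes k: "k \<le> n" and J: "J_measurable k J" and X: "J_measurable k X"
    and eq: "\<And>y. y \<in> space (jump_space E k) \<Longrightarrow> fst y \<in> Delta_upto k T \<Longrightarrow>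
      AE \<omega> in M. J (\<omega>, y) = nn_cond_exp M (F (ennreal (last_time k (fst y)))) (\<lambda>\<omega>. X (\<omega>, y)) \<omega>"
  shows "(\<integral>\<^sup>+p. of_bool (reached k p) * J p \<partial>(M \<Otimes>\<^sub>M ref_measure k)) =
    (\<integral>\<^sup>+p. of_bool (reached k p) * X p \<partial>(M \<Otimes>\<^sub>M ref_measure k))"
proof -
  interpret k: pair_sigma_finite M "ref_measure k" by (rule pair_sigma_finite_ref[OF k])
  note [measurable] = F_prod_M[OF reached_measurable[OF k]] J X
  have 1: "J_measurable k (\<lambda>p. of_bool (reached k p) * J p)" "J_measurable k (\<lambda>p. of_bool (reached k p) * X p)"
    by measurable
  have "(\<integral>\<^sup>+p. of_bool (reached k p) * J p \<partial>(M \<Otimes>\<^sub>M ref_measure k)) =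
      (\<integral>\<^sup>+y. \<integral>\<^sup>+\<omega>. of_bool (reached k (\<omega>, y)) * J (\<omega>, y) \<partial>M \<partial>ref_measure k)"
    using 1(1) by (intro k.nn_integral_snd[symmetric]) (simp add: measurable_ref_measure_iff[OF k])
  also have "\<dots> = (\<integral>\<^sup>+y. \<integral>\<^sup>+\<omega>. of_bool (reached k (\<omega>, y)) * X (\<omega>, y) \<partial>M \<partial>ref_measure k)"
  proof (rule nn_integral_cong)
    fix y assume "y \<in> space (ref_measure k)"
    then have y: "y \<in> space (jump_space E k)" by (simp add: space_ref_measure[OF k])
    let ?F = "F (ennreal (last_time k (fst y)))"
    interpret sigma_finite_subalgebra M ?F by (rule sigma_finite_subalgebra_F)
    show "(\<integral>\<^sup>+\<omega>. of_bool (reached k (\<omega>, y)) * J (\<omega>, y) \<partial>M) = (\<integral>\<^sup>+\<omega>. of_bool (reached k (\<omega>, y)) * X (\<omega>, y) \<partial>M)"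
    proof (cases "fst y \<in> Delta_upto k T")
      case True
      have "{\<omega>\<in>space ?F. reached k (\<omega>, y)} \<in> sets ?F" using reached_section[OF k y] by simp
      then have m: "(\<lambda>\<omega>. of_bool (reached k (\<omega>, y)) :: ennreal) \<in> borel_measurable ?F" by measurable
      have "(\<integral>\<^sup>+\<omega>. of_bool (reached k (\<omega>, y)) * J (\<omega>, y) \<partial>M) =
          (\<integral>\<^sup>+\<omega>. of_bool (reached k (\<omega>, y)) * nn_cond_exp M ?F (\<lambda>\<omega>. X (\<omega>, y)) \<omega> \<partial>M)"
        by (rule nn_integral_cong_AE) (use eq[OF y True] in eventually_elim, simp)
      also have "\<dots> = (\<integral>\<^sup>+\<omega>. of_bool (reached k (\<omega>, y)) * X (\<omega>, y) \<partial>M)"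
        by (rule nn_cond_exp_intg[OF m measurable_section[OF X y]])
      finally show ?thesis .
    next
      case False
      then have "\<not> reached k (\<omega>, y)" if "\<omega> \<in> space M" for \<omega>
        using reached_upto[of "(\<omega>, y)" k] that y by (auto simp: space_pair_measure)
      then show ?thesis by (intro nn_integral_cong) simp
    qed
  qed
  also have "\<dots> = (\<integral>\<^sup>+p. of_bool (reached k p) * X p \<partial>(M \<Otimes>\<^sub>M ref_measure k))"
    using 1(2) by (intro k.nn_integral_snd) (simp add: measurable_ref_measure_iff[OF k])
  finally show ?thesis .
qed

text \<open>Reaching stage \<open>Suc k\<close> means reaching stage \<open>k\<close> and having the
  next jump in the range of integration; the indicator therefore moves inside as that of the next
  stage.\<close>

lemma reached_cont:
  assumes k: "k < n" and y: "y \<in> space (jump_space E k)"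
  shows "of_bool (reached k (\<omega>, y)) * cont k J (\<omega>, y) =
    next_jump_integral k (\<lambda>q. of_bool (reached (Suc k) (\<omega>, q)) * J (\<omega>, q)) y"
proof (cases "reached k (\<omega>, y)")
  case True
  have "fst (extend k y (u, x)) (Suc k) = u" if "last_time k (fst y) \<le> u" for u x
    using that by (simp add: extend_def)
  then have "next_jump_integral k (\<lambda>q. if ennreal (fst q (Suc k)) \<le> min (st k (\<omega>, cut k q)) T then J (\<omega>, q) else 0) y =
      next_jump_integral k (\<lambda>q. of_bool (reached (Suc k) (\<omega>, q)) * J (\<omega>, q)) y"
    using True by (intro next_jump_integral_cong k y) (simp add: reached_extend[OF y] cut_extend[OF y])
  then show ?thesis using True unfolding cont_def fst_conv snd_conv by simp
next
  case False
  then have "next_jump_integral k (\<lambda>q. of_bool (reached (Suc k) (\<omega>, q)) * J (\<omega>, q)) y = next_jump_integral k (\<lambda>_. 0) y"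
    by (intro next_jump_integral_cong k y) (simp add: reached_extend[OF y])
  then show ?thesis using False by (simp add: next_jump_integral_def)
qed

lemma integral_reached_cont:
  assumes k: "k < n" and J: "J_measurable (Suc k) J"
  shows "(\<integral>\<^sup>+p. of_bool (reached k p) * cont k J p \<partial>(M \<Otimes>\<^sub>M ref_measure k)) =
    (\<integral>\<^sup>+p. of_bool (reached (Suc k) p) * J p \<partial>(M \<Otimes>\<^sub>M ref_measure (Suc k)))"
proof -
  have kn: "k \<le> n" "Suc k \<le> n" using k by auto
  interpret k: pair_sigma_finite M "ref_measure k" by (rule pair_sigma_finite_ref[OF kn(1)])
  interpret Sk: pair_sigma_finite M "ref_measure (Suc k)" by (rule pair_sigma_finite_ref[OF kn(2)])
  note [measurable] = F_prod_M[OF reached_measurable[OF kn(1)]] F_prod_M[OF reached_measurable[OF kn(2)]] J cont_measurable[OF k J]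
  have 1: "J_measurable (Suc k) (\<lambda>p. of_bool (reached (Suc k) p) * J p)"
    and 2: "J_measurable k (\<lambda>p. of_bool (reached k p) * cont k J p)" by measurable
  have "(\<integral>\<^sup>+p. of_bool (reached (Suc k) p) * J p \<partial>(M \<Otimes>\<^sub>M ref_measure (Suc k))) =
      (\<integral>\<^sup>+\<omega>. \<integral>\<^sup>+q. of_bool (reached (Suc k) (\<omega>, q)) * J (\<omega>, q) \<partial>ref_measure (Suc k) \<partial>M)"
    using 1 by (intro Sk.M2.nn_integral_fst[symmetric]) (simp add: measurable_ref_measure_iff[OF kn(2)])
  also have "\<dots> = (\<integral>\<^sup>+\<omega>. \<integral>\<^sup>+y. of_bool (reached k (\<omega>, y)) * cont k J (\<omega>, y) \<partial>ref_measure k \<partial>M)"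
  proof (rule nn_integral_cong)
    fix \<omega> assume \<omega>: "\<omega> \<in> space M"
    have "(\<integral>\<^sup>+q. of_bool (reached (Suc k) (\<omega>, q)) * J (\<omega>, q) \<partial>ref_measure (Suc k)) =
        (\<integral>\<^sup>+y. next_jump_integral k (\<lambda>q. of_bool (reached (Suc k) (\<omega>, q)) * J (\<omega>, q)) y \<partial>ref_measure k)"
      using measurable_compose[OF measurable_Pair1'[OF \<omega>] 1] by (intro nn_integral_ref_measure_Suc[OF k])
    also have "\<dots> = (\<integral>\<^sup>+y. of_bool (reached k (\<omega>, y)) * cont k J (\<omega>, y) \<partial>ref_measure k)"
      by (intro nn_integral_cong reached_cont[OF k, symmetric]) (simp add: space_ref_measure[OF kn(1)])
    finally show "(\<integral>\<^sup>+q. of_bool (reached (Suc k) (\<omega>, q)) * J (\<omega>, q) \<partial>ref_measure (Suc k)) =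
        (\<integral>\<^sup>+y. of_bool (reached k (\<omega>, y)) * cont k J (\<omega>, y) \<partial>ref_measure k)" .
  qed
  also have "\<dots> = (\<integral>\<^sup>+p. of_bool (reached k p) * cont k J p \<partial>(M \<Otimes>\<^sub>M ref_measure k))"
    using 2 by (intro k.M2.nn_integral_fst) (simp add: measurable_ref_measure_iff[OF kn(1)])
  finally show ?thesis ..
qed

text \<open>Downward induction on the mass of \<open>J k\<close> over the reached set. Conditioning
  disappears there; \<open>snn\<close> contributes stage \<open>k\<close>, and the integral term is
  the mass of \<open>J (Suc k)\<close> over the next reached set.\<close>

lemma integral_reached_solution:
  assumes Z: "\<And>k. k \<le> n \<Longrightarrow> indexed_optional M F E k (Zs k)"
    and J: "\<And>k. k \<le> n \<Longrightarrow> J_measurable k (J k)" "\<And>k. k \<le> n \<Longrightarrow> solves_at Zs k (J k) (J (Suc k))"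
    and k: "k \<le> n"
  shows "(\<integral>\<^sup>+p. of_bool (reached k p) * J k p \<partial>(M \<Otimes>\<^sub>M ref_measure k)) = (\<Sum>i=k..n. stage Zs i)"
  using k
proof (induction rule: inc_induct)
  case base
  have "(\<integral>\<^sup>+p. of_bool (reached n p) * J n p \<partial>(M \<Otimes>\<^sub>M ref_measure n)) =
      (\<integral>\<^sup>+p. of_bool (reached n p) * recursion_rhs Zs n (J (Suc n)) p \<partial>(M \<Otimes>\<^sub>M ref_measure n))"
    using J(2)[of n] by (intro integral_reached_cond_exp J(1) recursion_rhs_measurable Z) (auto simp: solves_at_def)
  then show ?case by (simp add: stage_def recursion_rhs_def)
next
  case (step k)
  have kn: "k \<le> n" using step by simp
  note [measurable] = F_prod_M[OF reached_measurable[OF kn]] snn_measurable[where Zs = Zs, OF kn Z[OF kn]]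
    cont_measurable[OF step(2) J(1)[OF Suc_leI[OF step(2)]]]
  have m: "J_measurable k (\<lambda>p. of_bool (reached k p) * snn Zs k p)"
    "J_measurable k (\<lambda>p. of_bool (reached k p) * cont k (J (Suc k)) p)"
    using step(2) by measurable
  have "(\<integral>\<^sup>+p. of_bool (reached k p) * J k p \<partial>(M \<Otimes>\<^sub>M ref_measure k)) =
      (\<integral>\<^sup>+p. of_bool (reached k p) * recursion_rhs Zs k (J (Suc k)) p \<partial>(M \<Otimes>\<^sub>M ref_measure k))"
    using J(2)[of k] step(2) by (intro integral_reached_cond_exp J(1) recursion_rhs_measurable Z) (auto simp: solves_at_def)
  also have "\<dots> = (\<integral>\<^sup>+p. of_bool (reached k p) * snn Zs k p + of_bool (reached k p) * cont k (J (Suc k)) p \<partial>(M \<Otimes>\<^sub>M ref_measure k))"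
    using step(2) by (simp add: recursion_rhs_def distrib_left)
  also have "\<dots> = stage Zs k + (\<integral>\<^sup>+p. of_bool (reached k p) * cont k (J (Suc k)) p \<partial>(M \<Otimes>\<^sub>M ref_measure k))"
    unfolding stage_def using m by (intro nn_integral_add) (simp_all add: measurable_ref_measure_iff[OF kn])
  also have "\<dots> = stage Zs k + (\<Sum>i=Suc k..n. stage Zs i)"
    using step J(1) by (simp add: integral_reached_cont)
  also have "\<dots> = (\<Sum>i=k..n. stage Zs i)" using kn by (simp add: sum.atLeast_Suc_atMost)
  finally show ?case .
qed

section \<open>The value at time zero, and existence of solutions\<close>

lemma nn_cond_exp_F0:
  assumes [measurable]: "f \<in> borel_measurable M"
  shows "AE \<omega> in M. nn_cond_exp M (F 0) f \<omega> = (\<integral>\<^sup>+\<omega>. f \<omega> \<partial>M)"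
proof -
  interpret sigma_finite_subalgebra M "F 0" by (rule sigma_finite_subalgebra_F)
  have "AE \<omega> in M. (\<integral>\<^sup>+\<omega>. f \<omega> \<partial>M) = nn_cond_exp M (F 0) f \<omega>"
  proof (rule nn_cond_exp_charact)
    fix A assume A: "A \<in> sets (F 0)"
    then have AM [measurable]: "A \<in> sets M" using sets_F_le by blast
    from F0_trivial[OF A] show "(\<integral>\<^sup>+\<omega>\<in>A. f \<omega> \<partial>M) = (\<integral>\<^sup>+\<omega>\<in>A. (\<integral>\<^sup>+\<omega>. f \<omega> \<partial>M) \<partial>M)"
    proof
      assume "prob A = 0"
      then have null: "A \<in> null_sets M" by (simp add: null_sets_def emeasure_eq_measure)
      show ?thesis by (simp add: nn_integral_null_set[OF null])
    next
      assume "prob A = 1"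
      then have "AE \<omega> in M. \<omega> \<in> A" by (simp add: AE_in_set_eq_1)
      then have "AE \<omega> in M. g \<omega> * indicator A \<omega> = g \<omega>" for g :: "'a \<Rightarrow> ennreal" by eventually_elim simp
      then have "(\<integral>\<^sup>+\<omega>\<in>A. g \<omega> \<partial>M) = (\<integral>\<^sup>+\<omega>. g \<omega> \<partial>M)" for g :: "'a \<Rightarrow> ennreal" by (rule nn_integral_cong_AE)
      then show ?thesis by (simp add: emeasure_space_1)
    qed
  qed measurable
  then show ?thesis by eventually_elim simp
qed

abbreviation no_jumps :: "'e jump_data" where "no_jumps \<equiv> (\<lambda>_. undefined, \<lambda>_. undefined)"

lemma no_jumps_space: "no_jumps \<in> space (jump_space E 0)"
  by (auto simp: space_jump_space Delta_def mark_space_def space_PiM)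

lemma no_jumps_upto: "(\<lambda>_. undefined) \<in> Delta_upto 0 T"
  by (auto simp: Delta_upto_def Delta_def)

text \<open>\<open>ref_measure 0\<close> is the unit mass at the empty vector, and stage 0 is always
  reached.\<close>

lemma integral_reached_0:
  assumes J: "J_measurable 0 J"
  shows "(\<integral>\<^sup>+p. of_bool (reached 0 p) * J p \<partial>(M \<Otimes>\<^sub>M ref_measure 0)) = (\<integral>\<^sup>+\<omega>. J (\<omega>, no_jumps) \<partial>M)"
proof -
  interpret k: pair_sigma_finite M "ref_measure 0" by (rule pair_sigma_finite_ref) simp
  have 0: "reached 0 p" for p by (simp add: reached_def last_time_def)
  have "(\<integral>\<^sup>+p. J p \<partial>(M \<Otimes>\<^sub>M ref_measure 0)) = (\<integral>\<^sup>+\<omega>. \<integral>\<^sup>+y. J (\<omega>, y) \<partial>ref_measure 0 \<partial>M)"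
    using J by (intro k.M2.nn_integral_fst[symmetric]) (simp add: measurable_ref_measure_iff)
  also have "\<dots> = (\<integral>\<^sup>+\<omega>. J (\<omega>, no_jumps) \<partial>M)"
    by (intro nn_integral_cong nn_integral_ref_measure_0 measurable_compose[OF measurable_Pair1' J])
  finally show ?thesis by (simp add: 0)
qed

lemma solution_at_0:
  assumes Z: "\<And>k. k \<le> n \<Longrightarrow> indexed_optional M F E k (Zs k)"
    and J: "\<And>k. k \<le> n \<Longrightarrow> J_measurable k (J k)" "\<And>k. k \<le> n \<Longrightarrow> solves_at Zs k (J k) (J (Suc k))"
  shows "AE \<omega> in M. J 0 (\<omega>, no_jumps) = (\<Sum>k\<le>n. stage Zs k)"
proof -
  let ?f = "\<lambda>\<omega>. recursion_rhs Zs 0 (J (Suc 0)) (\<omega>, no_jumps)"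
  have f: "?f \<in> borel_measurable M"
    using n_pos by (intro measurable_section[OF _ no_jumps_space] recursion_rhs_measurable Z J(1)) auto
  have "AE \<omega> in M. J 0 (\<omega>, no_jumps) = nn_cond_exp M (F (ennreal (last_time 0 (fst no_jumps)))) ?f \<omega>"
    using J(2)[of 0, unfolded solves_at_def, rule_format, OF _ no_jumps_space] no_jumps_upto by simp
  then have eq: "AE \<omega> in M. J 0 (\<omega>, no_jumps) = (\<integral>\<^sup>+\<omega>. ?f \<omega> \<partial>M)"
    using nn_cond_exp_F0[OF f] by eventually_elim (simp add: last_time_def)
  \<comment> \<open>The constant is found by integrating \<open>J 0\<close>: its integral is its
    mass over the reached set at stage 0, already computed.\<close>
  then have "(\<integral>\<^sup>+\<omega>. J 0 (\<omega>, no_jumps) \<partial>M) = (\<integral>\<^sup>+\<omega>. (\<integral>\<^sup>+\<omega>. ?f \<omega> \<partial>M) \<partial>M)"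
    by (rule nn_integral_cong_AE)
  then have "(\<integral>\<^sup>+\<omega>. ?f \<omega> \<partial>M) = (\<integral>\<^sup>+\<omega>. J 0 (\<omega>, no_jumps) \<partial>M)" by (simp add: emeasure_space_1)
  also have "\<dots> = (\<Sum>i=0..n. stage Zs i)"
    using integral_reached_solution[of Zs J 0, OF Z J] integral_reached_0[OF J(1)] by simp
  finally show ?thesis using eq by (simp add: atMost_atLeast0)
qed

lemma exists_solution:
  assumes Z: "\<And>k. k \<le> n \<Longrightarrow> indexed_optional M F E k (Zs k)"
  shows "\<exists>J. \<forall>k\<le>n. J_measurable k (J k) \<and> solves_at Zs k (J k) (J (Suc k))"
proof (rule backward_choice)
  fix k J' assume k: "k \<le> n" and J': "k < n \<Longrightarrow> J_measurable (Suc k) J'"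
  have "\<exists>Y\<in>borel_measurable (M \<Otimes>\<^sub>M jump_space E k). \<forall>y\<in>space (jump_space E k).
    AE \<omega> in M. Y (\<omega>, y) = nn_cond_exp M (F (ennreal (last_time k (fst y)))) (\<lambda>\<omega>. recursion_rhs Zs k J' (\<omega>, y)) \<omega>"
    by (intro nn_cond_exp_version_at_times recursion_rhs_measurable k Z J')
       (auto simp: space_jump_space last_time_nonneg)
  then show "\<exists>J. J_measurable k J \<and> solves_at Zs k J J'" by (auto simp: solves_at_def)
qed

lemma backward_nn_of_solution:
  assumes J: "\<And>k. k \<le> n \<Longrightarrow> J_measurable k (J k) \<and> solves_at Zs k (J k) (J (Suc k))"
  shows "backward_nn M F E n \<eta> \<alpha> Zs \<tau>s T (\<lambda>k \<omega> \<theta> e. J k (\<omega>, (\<theta>, e)))"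
  unfolding backward_nn_def
proof (intro conjI allI impI ballI)
  fix k assume "k \<le> n"
  then show "(\<lambda>(\<omega>, \<theta>, e). J k (\<omega>, (\<theta>, e))) \<in> borel_measurable (M \<Otimes>\<^sub>M (time_space k (Delta_upto k T) \<Otimes>\<^sub>M mark_space E k))"
    using measurable_restrict_upto[of "J k" M E k borel T] J by (simp add: split_beta')
next
  fix \<theta> e assume \<theta>: "\<theta> \<in> Delta_upto n T" "e \<in> space (mark_space E n)"
  then have "(\<theta>, e) \<in> space S" using Delta_upto_subset by (auto simp: space_jump_space)
  with \<theta>(1) J[of n] show "AE \<omega> in M. J n (\<omega>, (\<theta>, e)) =
      nn_cond_exp M (F (ennreal (last_time n \<theta>))) (\<lambda>\<omega>. stopped_nn n \<eta> \<alpha> Zs \<tau>s n \<omega> \<theta> e) \<omega>"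
    by (fastforce simp: solves_at_def recursion_rhs_def snn_def)
next
  fix k \<theta> e assume k: "k < n" and \<theta>: "\<theta> \<in> Delta_upto k T" "e \<in> space (mark_space E k)"
  then have y: "(\<theta>, e) \<in> space (jump_space E k)" using Delta_upto_subset by (auto simp: space_jump_space)
  have "AE \<omega> in M. J k (\<omega>, (\<theta>, e)) =
      nn_cond_exp M (F (ennreal (last_time k \<theta>))) (\<lambda>\<omega>. recursion_rhs Zs k (J (Suc k)) (\<omega>, (\<theta>, e))) \<omega>"
    using J[of k] k \<theta>(1) y unfolding solves_at_def by fastforce
  then show "AE \<omega> in M. J k (\<omega>, (\<theta>, e)) =
        nn_cond_exp M (F (ennreal (last_time k \<theta>)))
          (\<lambda>\<omega>. stopped_nn n \<eta> \<alpha> Zs \<tau>s k \<omega> \<theta> e +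
             (\<integral>\<^sup>+u\<in>{u. last_time k \<theta> \<le> u \<and> ennreal u \<le> min (\<tau>s k \<omega> \<theta> e) T}.
                (\<integral>\<^sup>+x. J (Suc k) (\<omega>, (\<theta>(Suc k := u), e(Suc k := x))) \<partial>\<eta> (Suc k) \<theta> e) \<partial>lborel)) \<omega>"
    using k by (simp add: recursion_rhs_def snn_def cont_eq[OF y k])
qed

lemma solution_of_backward_nn:
  assumes J: "backward_nn M F E n \<eta> \<alpha> Zs \<tau>s T J" and k: "k \<le> n"
  defines "J' \<equiv> \<lambda>k p. if ennreal (last_time k (fst (snd p))) \<le> T then J k (fst p) (fst (snd p)) (snd (snd p)) else 0"
  shows "J_measurable k (J' k) \<and> solves_at Zs k (J' k) (J' (Suc k))"
proof
  have "(\<lambda>p. J k (fst p) (fst (snd p)) (snd (snd p))) \<in> borel_measurable (M \<Otimes>\<^sub>M (time_space k (Delta_upto k T) \<Otimes>\<^sub>M mark_space E k))"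
    using J k by (simp add: backward_nn_def split_beta')
  from measurable_extend_upto[OF this] show "J_measurable k (J' k)" by (simp add: J'_def)
  show "solves_at Zs k (J' k) (J' (Suc k))"
    unfolding solves_at_def
  proof (intro ballI impI)
    fix y assume y: "y \<in> space (jump_space E k)" and up: "fst y \<in> Delta_upto k T"
    obtain \<theta> e where ye: "y = (\<theta>, e)" by (cases y)
    have e: "e \<in> space (mark_space E k)" and \<theta>: "\<theta> \<in> Delta_upto k T" using y up by (auto simp: space_jump_space ye)
    have le: "ennreal (last_time k \<theta>) \<le> T" using \<theta> Delta_upto_iff[of \<theta> k T] Delta_upto_subset by blast
    show "AE \<omega> in M. J' k (\<omega>, y) = nn_cond_exp M (F (ennreal (last_time k (fst y)))) (\<lambda>\<omega>. recursion_rhs Zs k (J' (Suc k)) (\<omega>, y)) \<omega>"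
    proof (cases "k < n")
      case True
      \<comment> \<open>The integral over the next time stops at \<open>T\<close>, so the recursion
        never sees the zeros by which \<open>J (Suc k)\<close> is extended.\<close>
      have "cont k (J' (Suc k)) (\<omega>, y) = cont k (\<lambda>p. J (Suc k) (fst p) (fst (snd p)) (snd (snd p))) (\<omega>, y)" for \<omega>
        by (rule cont_cong[OF True]) (use y in \<open>auto simp: J'_def\<close>)
      then have "recursion_rhs Zs k (J' (Suc k)) (\<omega>, y) = stopped_nn n \<eta> \<alpha> Zs \<tau>s k \<omega> \<theta> e +
             (\<integral>\<^sup>+u\<in>{u. last_time k \<theta> \<le> u \<and> ennreal u \<le> min (\<tau>s k \<omega> \<theta> e) T}.
                (\<integral>\<^sup>+x. J (Suc k) \<omega> (\<theta>(Suc k := u)) (e(Suc k := x)) \<partial>\<eta> (Suc k) \<theta> e) \<partial>lborel)" for \<omega>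
        using True cont_eq[OF y[unfolded ye] True] by (simp add: recursion_rhs_def snn_def ye)
      then show ?thesis
        using J True \<theta> e le unfolding backward_nn_def by (simp add: J'_def ye)
    next
      case False
      with k have "k = n" by simp
      then show ?thesis
        using J \<theta> e le unfolding backward_nn_def by (simp add: J'_def ye recursion_rhs_def snn_def)
    qed
  qed
qed

lemma nn_case:
  assumes Z: "process_decomposition M F E n \<zeta> L Z Zs"
  shows "\<exists>J. backward_nn M F E n \<eta> \<alpha> Zs \<tau>s T J"
    and "backward_nn M F E n \<eta> \<alpha> Zs \<tau>s T J \<Longrightarrow>
      AE \<omega> in M. (\<integral>\<^sup>+\<omega>'. ennreal (Z (enn2real (\<tau> \<omega>')) \<omega>') \<partial>M) = J 0 \<omega> (\<lambda>_. undefined) (\<lambda>_. undefined)"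
proof -
  have Zi: "\<And>k. k \<le> n \<Longrightarrow> indexed_optional M F E k (Zs k)"
    using Z by (auto simp: process_decomposition_def)
  from exists_solution[of Zs, OF Zi] obtain J where J: "\<forall>k\<le>n. J_measurable k (J k) \<and> solves_at Zs k (J k) (J (Suc k))" by blast
  have "backward_nn M F E n \<eta> \<alpha> Zs \<tau>s T (\<lambda>k \<omega> \<theta> e. J k (\<omega>, (\<theta>, e)))"
    by (rule backward_nn_of_solution) (use J in blast)
  then show "\<exists>J. backward_nn M F E n \<eta> \<alpha> Zs \<tau>s T J" by blast
next
  assume J: "backward_nn M F E n \<eta> \<alpha> Zs \<tau>s T J"
  have Zi: "\<And>k. k \<le> n \<Longrightarrow> indexed_optional M F E k (Zs k)"
    using Z by (auto simp: process_decomposition_def)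
  let ?J = "\<lambda>k p. if ennreal (last_time k (fst (snd p))) \<le> T then J k (fst p) (fst (snd p)) (snd (snd p)) else 0"
  have sol: "J_measurable k (?J k) \<and> solves_at Zs k (?J k) (?J (Suc k))" if "k \<le> n" for k
    by (rule solution_of_backward_nn[OF J that])
  have "AE \<omega> in M. ?J 0 (\<omega>, no_jumps) = (\<Sum>k\<le>n. stage Zs k)"
    by (rule solution_at_0[where J = ?J, OF Zi]) (use sol in blast)+
  then show "AE \<omega> in M. (\<integral>\<^sup>+\<omega>'. ennreal (Z (enn2real (\<tau> \<omega>')) \<omega>') \<partial>M) = J 0 \<omega> (\<lambda>_. undefined) (\<lambda>_. undefined)"
    by eventually_elim (simp add: expectation_eq_stages[OF Z] last_time_def)
qed

end

section \<open>The recursion for bounded processes\<close>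

lemma integral_eq_diff_nn_integral:
  fixes f g :: "'a \<Rightarrow> ennreal" and h :: "'a \<Rightarrow> real"
  assumes f: "f \<in> borel_measurable M" "(\<integral>\<^sup>+x. f x \<partial>M) < \<infinity>" and g: "g \<in> borel_measurable M" "(\<integral>\<^sup>+x. g x \<partial>M) < \<infinity>"
    and h: "h \<in> borel_measurable M" "AE x in M. h x = enn2real (f x) - enn2real (g x)"
  shows "integral\<^sup>L M h = enn2real (\<integral>\<^sup>+x. f x \<partial>M) - enn2real (\<integral>\<^sup>+x. g x \<partial>M)"
proof -
  have *: "integrable M (\<lambda>x. enn2real (f x)) \<and> (\<integral>x. enn2real (f x) \<partial>M) = enn2real (\<integral>\<^sup>+x. f x \<partial>M)"
    if f: "f \<in> borel_measurable M" "(\<integral>\<^sup>+x. f x \<partial>M) < \<infinity>" for f :: "'a \<Rightarrow> ennreal"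
  proof -
    have "AE x in M. f x \<noteq> \<infinity>" using f by (intro nn_integral_PInf_AE) auto
    then have eq: "(\<integral>\<^sup>+x. ennreal (enn2real (f x)) \<partial>M) = (\<integral>\<^sup>+x. f x \<partial>M)"
      by (intro nn_integral_cong_AE) (auto simp: less_top elim!: eventually_mono)
    then show ?thesis using f by (auto intro!: integrableI_nonneg simp: integral_eq_nn_integral)
  qed
  have "integral\<^sup>L M h = (\<integral>x. enn2real (f x) - enn2real (g x) \<partial>M)"
    using f g h by (intro integral_cong_AE) auto
  also have "\<dots> = enn2real (\<integral>\<^sup>+x. f x \<partial>M) - enn2real (\<integral>\<^sup>+x. g x \<partial>M)"
    using *[OF f] *[OF g] by simp
  finally show ?thesis .
qed

text \<open>The Bochner integral as a formula, including its value 0 without integrability. In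
  \<open>mark_mean\<close> the measure itself varies with the jumps, and for nonnegative integrals
  the dependence on such a parameter is under control.\<close>

lemma integral_eq_nn_integral_cases:
  fixes h :: "'a \<Rightarrow> real"
  assumes h: "h \<in> borel_measurable M"
  shows "integral\<^sup>L M h = (if (\<integral>\<^sup>+x. ennreal \<bar>h x\<bar> \<partial>M) < \<infinity>
    then enn2real (\<integral>\<^sup>+x. ennreal (h x) \<partial>M) - enn2real (\<integral>\<^sup>+x. ennreal (- h x) \<partial>M) else 0)"
proof (cases "integrable M h")
  case True
  then show ?thesis by (simp add: real_lebesgue_integral_def integrable_iff_bounded)
next
  case False
  then show ?thesis using h by (simp add: not_integrable_integral_eq integrable_iff_bounded)
qed

text \<open>Completeness of \<open>M\<close> enters here: the decompositions hold almost surely, so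
  \<open>Z\<close> at time \<tau> is known only to agree almost surely with a measurable function,
  the sum of the stage values.\<close>

lemma measurable_of_AE_eq:
  fixes f g :: "'a \<Rightarrow> 'b::topological_space"
  assumes "complete_measure M" and g: "g \<in> borel_measurable M" and eq: "AE x in M. f x = g x"
  shows "f \<in> borel_measurable M"
proof (rule measurableI)
  interpret complete_measure M by fact
  from AE_E[OF eq] obtain N where N: "N \<in> null_sets M" "{x\<in>space M. f x \<noteq> g x} \<subseteq> N" by (metis null_setsI)
  fix B :: "'b set" assume B: "B \<in> sets borel"
  have "f -` B \<inter> space M \<inter> N \<in> sets M" by (rule complete[OF _ N(1)]) auto
  moreover have "g -` B \<inter> space M - N \<in> sets M" using measurable_sets[OF g B] N by auto
  moreover have "f -` B \<inter> space M = (f -` B \<inter> space M \<inter> N) \<union> (g -` B \<inter> space M - N)" using N(2) by auto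
  ultimately show "f -` B \<inter> space M \<in> sets M" by (metis sets.Un)
qed simp

lemma enn2real_add: "a < \<infinity> \<Longrightarrow> b < \<infinity> \<Longrightarrow> enn2real (a + b) = enn2real a + enn2real b"
  by (cases a; cases b) (auto simp: ennreal_plus[symmetric] simp del: ennreal_plus)

text \<open>The identity is local on \<open>G\<close>: off \<open>G\<close> neither \<open>r\<close> nor \<open>a\<close> and \<open>b\<close> need to be integrable.\<close>

lemma (in sigma_finite_subalgebra) real_cond_exp_eq_diff_on:
  fixes r :: "'a \<Rightarrow> real" and a b :: "'a \<Rightarrow> ennreal"
  assumes G: "G \<in> sets F" and [measurable]: "r \<in> borel_measurable M" "a \<in> borel_measurable M" "b \<in> borel_measurable M"
    and fin: "(\<integral>\<^sup>+x. indicator G x * a x \<partial>M) < \<infinity>" "(\<integral>\<^sup>+x. indicator G x * b x \<partial>M) < \<infinity>"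
    and eq: "AE x in M. x \<in> G \<longrightarrow> r x = enn2real (a x) - enn2real (b x)"
  shows "AE x in M. x \<in> G \<longrightarrow> real_cond_exp M F r x = enn2real (nn_cond_exp M F a x) - enn2real (nn_cond_exp M F b x)"
proof -
  note [measurable] = G
  have GM [measurable]: "G \<in> sets M" using G subalg by (auto simp: subalgebra_def)
  let ?c = "nn_cond_exp M F"
  have loc: "AE x in M. x \<in> G \<longrightarrow> ?c (\<lambda>x. indicator G x * f x) x = ?c f x" if [measurable]: "f \<in> borel_measurable M" for f
    using nn_cond_exp_prod[of "indicator G" f] by (auto elim!: eventually_mono)
  have finite: "AE x in M. x \<in> G \<longrightarrow> ?c f x < \<infinity>"
    if [measurable]: "f \<in> borel_measurable M" and "(\<integral>\<^sup>+x. indicator G x * f x \<partial>M) < \<infinity>" for f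
  proof -
    have "(\<integral>\<^sup>+x. indicator G x * ?c f x \<partial>M) < \<infinity>" using that(2) by (subst nn_cond_exp_intg) auto
    then have "AE x in M. indicator G x * ?c f x \<noteq> \<infinity>" by (intro nn_integral_PInf_AE) auto
    then show ?thesis by eventually_elim (auto simp: less_top)
  qed
  have a_fin: "AE x in M. indicator G x * a x \<noteq> \<infinity>"
    by (rule nn_integral_PInf_AE) (use fin(1) in simp_all)
  have b_fin: "AE x in M. indicator G x * b x \<noteq> \<infinity>"
    by (rule nn_integral_PInf_AE) (use fin(2) in simp_all)
  \<comment> \<open>On \<open>G\<close> the positive part of \<open>r\<close> is at most
    \<open>a\<close> and the negative part at most \<open>b\<close>. The identity between the four
    is written with sums only, since \<open>nn_cond_exp\<close> respects sums but not
    differences.\<close>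
  have "AE x in M. indicator G x * ennreal (r x) \<le> indicator G x * a x \<and>
    indicator G x * ennreal (- r x) \<le> indicator G x * b x \<and>
    indicator G x * (ennreal (r x) + b x) = indicator G x * (ennreal (- r x) + a x)"
    using eq a_fin b_fin
  proof eventually_elim
    case (elim x)
    show ?case
    proof (cases "x \<in> G")
      case True
      with elim obtain s t where st: "a x = ennreal s" "0 \<le> s" "b x = ennreal t" "0 \<le> t" by (cases "a x"; cases "b x") auto
      then have r: "r x = s - t" using elim True by simp
      have "ennreal (r x) + b x = ennreal (- r x) + a x"
      proof (cases "t \<le> s")
        case True
        then have "ennreal (- r x) = 0" "ennreal (r x) + b x = ennreal s"
          using st r by (auto simp: ennreal_neg ennreal_plus[symmetric] simp del: ennreal_plus)
        then show ?thesis using st by simp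
      next
        case False
        then have "ennreal (r x) = 0" "ennreal (- r x) + a x = ennreal t"
          using st r by (auto simp: ennreal_neg ennreal_plus[symmetric] simp del: ennreal_plus)
        then show ?thesis using st by simp
      qed
      with True st r show ?thesis by (auto intro: ennreal_leI)
    qed simp
  qed
  then have le: "AE x in M. indicator G x * ennreal (r x) \<le> indicator G x * a x"
    "AE x in M. indicator G x * ennreal (- r x) \<le> indicator G x * b x"
    "AE x in M. indicator G x * (ennreal (r x) + b x) = indicator G x * (ennreal (- r x) + a x)"
    by (auto elim: eventually_mono)
  have r_int: "(\<integral>\<^sup>+x. indicator G x * ennreal (r x) \<partial>M) < \<infinity>" "(\<integral>\<^sup>+x. indicator G x * ennreal (- r x) \<partial>M) < \<infinity>"
    using nn_integral_mono_AE[OF le(1)] nn_integral_mono_AE[OF le(2)] fin by (auto intro: le_less_trans)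
  have r_fin: "AE x in M. x \<in> G \<longrightarrow> ?c (\<lambda>x. ennreal (r x)) x < \<infinity>"
    by (rule finite[OF _ r_int(1)]) measurable
  have r_fin': "AE x in M. x \<in> G \<longrightarrow> ?c (\<lambda>x. ennreal (- r x)) x < \<infinity>"
    by (rule finite[OF _ r_int(2)]) measurable
  have "AE x in M. ?c (\<lambda>x. indicator G x * (ennreal (r x) + b x)) x = ?c (\<lambda>x. indicator G x * (ennreal (- r x) + a x)) x"
    by (rule nn_cond_exp_cong[OF le(3)]) measurable
  with loc[of "\<lambda>x. ennreal (r x) + b x"] loc[of "\<lambda>x. ennreal (- r x) + a x"]
    nn_cond_exp_sum[of "\<lambda>x. ennreal (r x)" b] nn_cond_exp_sum[of "\<lambda>x. ennreal (- r x)" a]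
  have "AE x in M. x \<in> G \<longrightarrow> ?c (\<lambda>x. ennreal (r x)) x + ?c b x = ?c (\<lambda>x. ennreal (- r x)) x + ?c a x"
    by (auto elim!: eventually_rev_mp)
  moreover have "AE x in M. x \<in> G \<longrightarrow> ?c a x < \<infinity>" "AE x in M. x \<in> G \<longrightarrow> ?c b x < \<infinity>"
    by (rule finite[OF _ fin(1)] finite[OF _ fin(2)], measurable)+
  ultimately show ?thesis
    using r_fin r_fin'
  proof eventually_elim
    case (elim x)
    show ?case
    proof
      assume x: "x \<in> G"
      with elim enn2real_add[of "?c (\<lambda>x. ennreal (r x)) x" "?c b x"] enn2real_add[of "?c (\<lambda>x. ennreal (- r x)) x" "?c a x"]
      have "enn2real (?c (\<lambda>x. ennreal (r x)) x) + enn2real (?c b x) = enn2real (?c (\<lambda>x. ennreal (- r x)) x) + enn2real (?c a x)"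
        by simp
      then show "real_cond_exp M F r x = enn2real (?c a x) - enn2real (?c b x)"
        by (simp add: real_cond_exp_def)
    qed
  qed
qed

context usual_filtration
begin

text \<open>\<open>real_cond_exp\<close> is by definition the difference of the
  \<open>enn2real\<close> values of two nonnegative conditional expectations, also where one is
  infinite; versions of these two suffice.\<close>

lemma real_cond_exp_version_at_times:
  assumes p: "p \<in> borel_measurable N" "\<And>y. y \<in> space N \<Longrightarrow> 0 \<le> (p y :: real)"
    and X: "X \<in> borel_measurable (M \<Otimes>\<^sub>M N)"
  shows "\<exists>Y\<in>borel_measurable (M \<Otimes>\<^sub>M N). \<forall>y\<in>space N.
    AE \<omega> in M. Y (\<omega>, y) = real_cond_exp M (F (ennreal (p y))) (\<lambda>\<omega>. X (\<omega>, y)) \<omega>"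
proof -
  have "(\<lambda>p. ennreal (X p)) \<in> borel_measurable (M \<Otimes>\<^sub>M N)" "(\<lambda>p. ennreal (- X p)) \<in> borel_measurable (M \<Otimes>\<^sub>M N)"
    using X by measurable
  from nn_cond_exp_version_at_times[OF p this(1)] nn_cond_exp_version_at_times[OF p this(2)]
  obtain Y Y' where Y: "Y \<in> borel_measurable (M \<Otimes>\<^sub>M N)" "Y' \<in> borel_measurable (M \<Otimes>\<^sub>M N)"
    and eq: "\<And>y. y \<in> space N \<Longrightarrow> AE \<omega> in M. Y (\<omega>, y) = nn_cond_exp M (F (ennreal (p y))) (\<lambda>\<omega>. ennreal (X (\<omega>, y))) \<omega>"
      "\<And>y. y \<in> space N \<Longrightarrow> AE \<omega> in M. Y' (\<omega>, y) = nn_cond_exp M (F (ennreal (p y))) (\<lambda>\<omega>. ennreal (- X (\<omega>, y))) \<omega>"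
    by blast
  show ?thesis
  proof (intro bexI[of _ "\<lambda>p. enn2real (Y p) - enn2real (Y' p)"] ballI)
    fix y assume "y \<in> space N"
    from eq[OF this] show "AE \<omega> in M. enn2real (Y (\<omega>, y)) - enn2real (Y' (\<omega>, y)) =
        real_cond_exp M (F (ennreal (p y))) (\<lambda>\<omega>. X (\<omega>, y)) \<omega>"
      by eventually_elim (simp add: real_cond_exp_def)
  qed (use Y in measurable)
qed

end

section \<open>The recursion with real values\<close>

context stopped_model
begin

abbreviation Jr_measurable :: "nat \<Rightarrow> ('a \<times> 'e jump_data \<Rightarrow> real) \<Rightarrow> bool" where
  "Jr_measurable k J \<equiv> J \<in> borel_measurable (M \<Otimes>\<^sub>M jump_space E k)"

definition mark_mean :: "nat \<Rightarrow> ('a \<times> 'e jump_data \<Rightarrow> real) \<Rightarrow> 'a \<times> 'e jump_data \<Rightarrow> real \<Rightarrow> real" where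
  "mark_mean k J p u = (if last_time k (fst (snd p)) \<le> u \<and> ennreal u \<le> min (st k p) T
     then (LINT x|\<eta> (Suc k) (fst (snd p)) (snd (snd p)). J (fst p, extend k (snd p) (u, x))) else 0)"

definition cont_real :: "nat \<Rightarrow> ('a \<times> 'e jump_data \<Rightarrow> real) \<Rightarrow> 'a \<times> 'e jump_data \<Rightarrow> real" where
  "cont_real k J p = (LINT u|lborel. mark_mean k J p u)"

definition sreal :: "('a, 'e) stage_processes \<Rightarrow> nat \<Rightarrow> 'a \<times> 'e jump_data \<Rightarrow> real" where
  "sreal Zs k p = stopped_real n \<eta> \<alpha> Zs \<tau>s k (fst p) (fst (snd p)) (snd (snd p))"

definition recursion_rhs_real :: "('a, 'e) stage_processes \<Rightarrow> nat
    \<Rightarrow> ('a \<times> 'e jump_data \<Rightarrow> real) \<Rightarrow> 'a \<times> 'e jump_data \<Rightarrow> real" where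
  "recursion_rhs_real Zs k J p = sreal Zs k p + (if k < n then cont_real k J p else 0)"

definition solves_real_at :: "('a, 'e) stage_processes \<Rightarrow> nat
    \<Rightarrow> ('a \<times> 'e jump_data \<Rightarrow> real) \<Rightarrow> ('a \<times> 'e jump_data \<Rightarrow> real) \<Rightarrow> bool" where
  "solves_real_at Zs k J J' \<longleftrightarrow> (\<forall>y\<in>space (jump_space E k). fst y \<in> Delta_upto k T \<longrightarrow>
     (AE \<omega> in M. J (\<omega>, y) = real_cond_exp M (F (ennreal (last_time k (fst y)))) (\<lambda>\<omega>. recursion_rhs_real Zs k J' (\<omega>, y)) \<omega>))"

abbreviation minus :: "('a, 'e) stage_processes \<Rightarrow> ('a, 'e) stage_processes" where
  "minus Zs \<equiv> \<lambda>k t \<omega> \<theta> e. - Zs k t \<omega> \<theta> e"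

lemma indexed_optional_minus: "indexed_optional M F E k (Zs k) \<Longrightarrow> indexed_optional M F E k (minus Zs k)"
proof -
  assume "indexed_optional M F E k (Zs k)"
  then have "(\<lambda>x. - (\<lambda>((t, \<omega>), (\<theta>, e)). Zs k t \<omega> \<theta> e) x) \<in> borel_measurable (optional_algebra M F \<Otimes>\<^sub>M jump_space E k)"
    unfolding indexed_optional_measurable by measurable
  then show ?thesis unfolding indexed_optional_measurable
    by (rule measurable_cong[THEN iffD1, rotated]) auto
qed

lemma process_decomposition_minus:
  assumes "process_decomposition M F E n \<zeta> L Z Zs"
  shows "process_decomposition M F E n \<zeta> L (\<lambda>t \<omega>. - Z t \<omega>) (minus Zs)"
  using assms unfolding process_decomposition_def Let_def
  by (auto simp: indexed_optional_minus sum_negf elim!: eventually_mono)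

text \<open>One of the two terms vanishes, according to the sign of the payoff. An infinite
  \<open>alpha_k_at\<close> becomes 0 under \<open>enn2real\<close> on both sides, so the identity
  holds without exception.\<close>

lemma sreal_eq: "sreal Zs k p = enn2real (snn Zs k p) - enn2real (snn (minus Zs) k p)"
proof -
  have "payoff (minus Zs) k p = - payoff Zs k p" by (simp add: payoff_def)
  moreover have "sreal Zs k p = payoff Zs k p * enn2real (alpha_k_at k (st k) p)"
    by (auto simp: sreal_def stopped_real_def payoff_def alpha_k_at_def st_def Let_def less_top[symmetric])
  ultimately show ?thesis
    by (cases "0 \<le> payoff Zs k p") (auto simp: snn_eq enn2real_mult ennreal_neg)
qed

lemma sreal_measurable:
  assumes "k \<le> n" "indexed_optional M F E k (Zs k)"
  shows "Jr_measurable k (sreal Zs k)"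
proof -
  note [measurable] = snn_measurable[where Zs = Zs, OF assms]
    snn_measurable[where Zs = "minus Zs", OF assms(1) indexed_optional_minus[where Zs = Zs, OF assms(2)]]
  show ?thesis unfolding sreal_eq[abs_def] by measurable
qed

lemma measurable_extend_section:
  assumes k: "k < n" and y: "y \<in> space (jump_space E k)"
  shows "(\<lambda>x. extend k y (u, x)) \<in> \<eta> (Suc k) (fst y) (snd y) \<rightarrow>\<^sub>M jump_space E (Suc k)"
proof -
  have "(\<lambda>x. extend k y (u, x)) \<in> restrict_space borel E \<rightarrow>\<^sub>M jump_space E (Suc k)"
    using y by measurable
  then show ?thesis using measurable_cong_sets[OF kernel_space(1)[OF k y] refl] by blast
qed

lemma measurable_J_section:
  assumes k: "k < n" and y: "y \<in> space (jump_space E k)" and \<omega>: "\<omega> \<in> space M" and J: "J \<in> borel_measurable (M \<Otimes>\<^sub>M jump_space E (Suc k))"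
  shows "(\<lambda>x. J (\<omega>, extend k y (u, x))) \<in> borel_measurable (\<eta> (Suc k) (fst y) (snd y))"
  by (rule measurable_compose[OF measurable_extend_section[OF k y] measurable_compose[OF measurable_Pair1'[OF \<omega>] J]])

text \<open>Integrability over the marks is itself a measurable condition, namely finiteness of the
  integral of the absolute value, so the value 0 in the other case preserves measurability.\<close>

lemma mark_mean_measurable:
  assumes k: "k < n" and J: "Jr_measurable (Suc k) J"
  shows "(\<lambda>(p, u). mark_mean k J p u) \<in> borel_measurable ((M \<Otimes>\<^sub>M jump_space E k) \<Otimes>\<^sub>M lborel)"
proof -
  let ?I = "\<lambda>f z. \<integral>\<^sup>+x. f (fst (fst z), extend k (snd (fst z)) (snd z, x)) \<partial>\<eta> (Suc k) (fst (snd (fst z))) (snd (snd (fst z)))"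
  let ?L = "(M \<Otimes>\<^sub>M jump_space E k) \<Otimes>\<^sub>M (borel :: real measure)"
  have I: "?I f \<in> borel_measurable ?L" if f: "f \<in> borel_measurable (M \<Otimes>\<^sub>M jump_space E (Suc k))" for f
    using measurable_mark_integral[OF k, of "\<lambda>\<omega> q. f (\<omega>, q)" M] f by (simp add: split_beta')
  have [measurable]: "?I (\<lambda>p. ennreal (J p)) \<in> borel_measurable ?L" "?I (\<lambda>p. ennreal (- J p)) \<in> borel_measurable ?L"
    "?I (\<lambda>p. ennreal \<bar>J p\<bar>) \<in> borel_measurable ?L"
    using J by (auto intro!: I)
  note [measurable] = F_prod_M[OF st_measurable[OF less_imp_le[OF k]]]
  have "(\<lambda>z. if last_time k (fst (snd (fst z))) \<le> snd z \<and> ennreal (snd z) \<le> min (st k (fst z)) T then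
      (if ?I (\<lambda>p. ennreal \<bar>J p\<bar>) z < \<infinity> then enn2real (?I (\<lambda>p. ennreal (J p)) z) - enn2real (?I (\<lambda>p. ennreal (- J p)) z) else 0) else 0)
    \<in> borel_measurable ?L"
    by measurable
  then have "(\<lambda>(p, u). mark_mean k J p u) \<in> borel_measurable ?L"
  proof (rule measurable_cong[THEN iffD1, rotated])
    fix z assume "z \<in> space ?L"
    then obtain \<omega> y u where z: "z = ((\<omega>, y), u)" and \<omega>: "\<omega> \<in> space M" and y: "y \<in> space (jump_space E k)"
      by (cases z) (auto simp: space_pair_measure)
    show "(if last_time k (fst (snd (fst z))) \<le> snd z \<and> ennreal (snd z) \<le> min (st k (fst z)) T then
      (if ?I (\<lambda>p. ennreal \<bar>J p\<bar>) z < \<infinity> then enn2real (?I (\<lambda>p. ennreal (J p)) z) - enn2real (?I (\<lambda>p. ennreal (- J p)) z) else 0) else 0) =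
      (case z of (p, u) \<Rightarrow> mark_mean k J p u)"
      unfolding z mark_mean_def by (simp add: integral_eq_nn_integral_cases[OF measurable_J_section[OF k y \<omega> J]])
  qed
  then show ?thesis
    using measurable_cong_sets[OF sets_pair_measure_cong[OF refl sets_lborel] refl] by blast
qed

lemma cont_real_measurable:
  assumes k: "k < n" and J: "Jr_measurable (Suc k) J"
  shows "Jr_measurable k (cont_real k J)"
  unfolding cont_real_def[abs_def] by (rule lborel.borel_measurable_lebesgue_integral[OF mark_mean_measurable[OF k J]])

lemma recursion_rhs_real_measurable:
  assumes k: "k \<le> n" and Z: "indexed_optional M F E k (Zs k)" and J: "k < n \<Longrightarrow> Jr_measurable (Suc k) J"
  shows "Jr_measurable k (recursion_rhs_real Zs k J)"
proof -
  note [measurable] = sreal_measurable[where Zs = Zs, OF k Z]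
  show ?thesis
  proof (cases "k < n")
    case True
    note [measurable] = cont_real_measurable[OF True J[OF True]]
    show ?thesis unfolding recursion_rhs_real_def[abs_def] using True by simp
  next
    case False
    then show ?thesis unfolding recursion_rhs_real_def[abs_def] by simp
  qed
qed

lemma cont_real_eq:
  assumes y: "(\<theta>, e) \<in> space (jump_space E k)"
  shows "cont_real k J (\<omega>, (\<theta>, e)) =
    (LINT u:{u. last_time k \<theta> \<le> u \<and> ennreal u \<le> min (\<tau>s k \<omega> \<theta> e) T}|lborel.
       (LINT x|\<eta> (Suc k) \<theta> e. J (\<omega>, (\<theta>(Suc k := u), e(Suc k := x)))))"
  unfolding cont_real_def set_lebesgue_integral_def
  by (intro Bochner_Integration.integral_cong refl) (auto simp: mark_mean_def st_def extend_eq split: split_indicator)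

lemma cont_real_cong:
  assumes "k < n" "snd p \<in> space (jump_space E k)"
    and "\<And>q. q \<in> space (jump_space E (Suc k)) \<Longrightarrow> ennreal (last_time (Suc k) (fst q)) \<le> T \<Longrightarrow> J (fst p, q) = J' (fst p, q)"
  shows "cont_real k J p = cont_real k J' p"
  unfolding cont_real_def
proof (intro Bochner_Integration.integral_cong refl)
  fix u
  show "mark_mean k J p u = mark_mean k J' p u"
  proof (cases "last_time k (fst (snd p)) \<le> u \<and> ennreal u \<le> min (st k p) T")
    case True
    have "J (fst p, extend k (snd p) (u, x)) = J' (fst p, extend k (snd p) (u, x))"
      if "x \<in> space (\<eta> (Suc k) (fst (snd p)) (snd (snd p)))" for x
    proof (rule assms(3))
      show "extend k (snd p) (u, x) \<in> space (jump_space E (Suc k))"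
        using that assms by (intro extend_in_space) (simp_all add: kernel_space')
      show "ennreal (last_time (Suc k) (fst (extend k (snd p) (u, x)))) \<le> T"
        using True by (simp add: extend_def last_time_def)
    qed
    then show ?thesis unfolding mark_mean_def by (auto intro!: Bochner_Integration.integral_cong)
  next
    case False
    then show ?thesis by (simp only: mark_mean_def if_False)
  qed
qed

lemma exists_solution_real:
  assumes Z: "\<And>k. k \<le> n \<Longrightarrow> indexed_optional M F E k (Zs k)"
  shows "\<exists>J. \<forall>k\<le>n. Jr_measurable k (J k) \<and> solves_real_at Zs k (J k) (J (Suc k))"
proof (rule backward_choice)
  fix k J' assume k: "k \<le> n" and J': "k < n \<Longrightarrow> Jr_measurable (Suc k) J'"
  have "\<exists>Y\<in>borel_measurable (M \<Otimes>\<^sub>M jump_space E k). \<forall>y\<in>space (jump_space E k).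
    AE \<omega> in M. Y (\<omega>, y) = real_cond_exp M (F (ennreal (last_time k (fst y)))) (\<lambda>\<omega>. recursion_rhs_real Zs k J' (\<omega>, y)) \<omega>"
    by (intro real_cond_exp_version_at_times recursion_rhs_real_measurable k Z J')
       (auto simp: space_jump_space last_time_nonneg)
  then show "\<exists>J. Jr_measurable k J \<and> solves_real_at Zs k J J'" by (auto simp: solves_real_at_def)
qed

lemma backward_real_of_solution:
  assumes J: "\<And>k. k \<le> n \<Longrightarrow> Jr_measurable k (J k) \<and> solves_real_at Zs k (J k) (J (Suc k))"
  shows "backward_real M F E n \<eta> \<alpha> Zs \<tau>s T (\<lambda>k \<omega> \<theta> e. J k (\<omega>, (\<theta>, e)))"
  unfolding backward_real_def
proof (intro conjI allI impI ballI)
  fix k assume "k \<le> n"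
  then show "(\<lambda>(\<omega>, \<theta>, e). J k (\<omega>, (\<theta>, e))) \<in> borel_measurable (M \<Otimes>\<^sub>M (time_space k (Delta_upto k T) \<Otimes>\<^sub>M mark_space E k))"
    using measurable_restrict_upto[of "J k" M E k borel T] J by (simp add: split_beta')
next
  fix \<theta> e assume \<theta>: "\<theta> \<in> Delta_upto n T" "e \<in> space (mark_space E n)"
  then have "(\<theta>, e) \<in> space S" using Delta_upto_subset by (auto simp: space_jump_space)
  with \<theta>(1) J[of n] show "AE \<omega> in M. J n (\<omega>, (\<theta>, e)) =
      real_cond_exp M (F (ennreal (last_time n \<theta>))) (\<lambda>\<omega>. stopped_real n \<eta> \<alpha> Zs \<tau>s n \<omega> \<theta> e) \<omega>"
    by (fastforce simp: solves_real_at_def recursion_rhs_real_def sreal_def)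
next
  fix k \<theta> e assume k: "k < n" and \<theta>: "\<theta> \<in> Delta_upto k T" "e \<in> space (mark_space E k)"
  then have y: "(\<theta>, e) \<in> space (jump_space E k)" using Delta_upto_subset by (auto simp: space_jump_space)
  have "AE \<omega> in M. J k (\<omega>, (\<theta>, e)) =
      real_cond_exp M (F (ennreal (last_time k \<theta>))) (\<lambda>\<omega>. recursion_rhs_real Zs k (J (Suc k)) (\<omega>, (\<theta>, e))) \<omega>"
    using J[of k] k \<theta>(1) y unfolding solves_real_at_def by fastforce
  then show "AE \<omega> in M. J k (\<omega>, (\<theta>, e)) =
        real_cond_exp M (F (ennreal (last_time k \<theta>)))
          (\<lambda>\<omega>. stopped_real n \<eta> \<alpha> Zs \<tau>s k \<omega> \<theta> e +
             (LINT u:{u. last_time k \<theta> \<le> u \<and> ennreal u \<le> min (\<tau>s k \<omega> \<theta> e) T}|lborel.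
                (LINT x|\<eta> (Suc k) \<theta> e. J (Suc k) (\<omega>, (\<theta>(Suc k := u), e(Suc k := x)))))) \<omega>"
    using k by (simp add: recursion_rhs_real_def sreal_def cont_real_eq[OF y])
qed

lemma solution_of_backward_real:
  assumes J: "backward_real M F E n \<eta> \<alpha> Zs \<tau>s T J" and k: "k \<le> n"
  defines "J' \<equiv> \<lambda>k p. if ennreal (last_time k (fst (snd p))) \<le> T then J k (fst p) (fst (snd p)) (snd (snd p)) else 0"
  shows "Jr_measurable k (J' k) \<and> solves_real_at Zs k (J' k) (J' (Suc k))"
proof
  have "(\<lambda>p. J k (fst p) (fst (snd p)) (snd (snd p))) \<in> borel_measurable (M \<Otimes>\<^sub>M (time_space k (Delta_upto k T) \<Otimes>\<^sub>M mark_space E k))"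
    using J k by (simp add: backward_real_def split_beta')
  from measurable_extend_upto[OF this] show "Jr_measurable k (J' k)" by (simp add: J'_def)
  show "solves_real_at Zs k (J' k) (J' (Suc k))"
    unfolding solves_real_at_def
  proof (intro ballI impI)
    fix y assume y: "y \<in> space (jump_space E k)" and up: "fst y \<in> Delta_upto k T"
    obtain \<theta> e where ye: "y = (\<theta>, e)" by (cases y)
    have e: "e \<in> space (mark_space E k)" and \<theta>: "\<theta> \<in> Delta_upto k T" using y up by (auto simp: space_jump_space ye)
    have le: "ennreal (last_time k \<theta>) \<le> T" using \<theta> Delta_upto_iff[of \<theta> k T] Delta_upto_subset by blast
    show "AE \<omega> in M. J' k (\<omega>, y) = real_cond_exp M (F (ennreal (last_time k (fst y)))) (\<lambda>\<omega>. recursion_rhs_real Zs k (J' (Suc k)) (\<omega>, y)) \<omega>"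
    proof (cases "k < n")
      case True
      \<comment> \<open>Here too the next time is at most \<open>T\<close> wherever the integrand
        differs from 0, and there the extension agrees with \<open>J\<close>.\<close>
      have "cont_real k (J' (Suc k)) (\<omega>, y) = cont_real k (\<lambda>p. J (Suc k) (fst p) (fst (snd p)) (snd (snd p))) (\<omega>, y)" for \<omega>
        by (rule cont_real_cong[OF True]) (use y in \<open>auto simp: J'_def\<close>)
      then have "recursion_rhs_real Zs k (J' (Suc k)) (\<omega>, y) = stopped_real n \<eta> \<alpha> Zs \<tau>s k \<omega> \<theta> e +
             (LINT u:{u. last_time k \<theta> \<le> u \<and> ennreal u \<le> min (\<tau>s k \<omega> \<theta> e) T}|lborel.
                (LINT x|\<eta> (Suc k) \<theta> e. J (Suc k) \<omega> (\<theta>(Suc k := u)) (e(Suc k := x))))" for \<omega>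
        using True cont_real_eq[OF y[unfolded ye]] by (simp add: recursion_rhs_real_def sreal_def ye)
      then show ?thesis
        using J True \<theta> e le unfolding backward_real_def by (simp add: J'_def ye)
    next
      case False
      with k have "k = n" by simp
      then show ?thesis
        using J \<theta> e le unfolding backward_real_def by (simp add: J'_def ye recursion_rhs_real_def sreal_def)
    qed
  qed
qed

section \<open>Comparison of the real recursion with the two nonnegative ones\<close>

lemma rhs_finite_where_reached:
  assumes Z: "\<And>k. k \<le> n \<Longrightarrow> indexed_optional M F E k (Zs k)"
    and J: "\<And>k. k \<le> n \<Longrightarrow> J_measurable k (J k)" "\<And>k. k \<le> n \<Longrightarrow> solves_at Zs k (J k) (J (Suc k))"
    and fin: "(\<Sum>k\<le>n. stage Zs k) < \<infinity>" and k: "k \<le> n"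
  shows "(\<integral>\<^sup>+p. of_bool (reached k p) * recursion_rhs Zs k (J (Suc k)) p \<partial>(M \<Otimes>\<^sub>M ref_measure k)) < \<infinity>"
    and "AE p in M \<Otimes>\<^sub>M ref_measure k. reached k p \<longrightarrow> recursion_rhs Zs k (J (Suc k)) p < \<infinity>"
proof -
  have m: "J_measurable k (recursion_rhs Zs k (J (Suc k)))"
    using k by (intro recursion_rhs_measurable Z J(1)) auto
  note [measurable] = m F_prod_M[OF reached_measurable[OF k]]
  \<comment> \<open>Over the reached set the right-hand side has the same mass as
    \<open>J k\<close>, which is the part of the finite total that belongs to the stages from
    \<open>k\<close> on.\<close>
  have "(\<integral>\<^sup>+p. of_bool (reached k p) * recursion_rhs Zs k (J (Suc k)) p \<partial>(M \<Otimes>\<^sub>M ref_measure k)) =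
      (\<integral>\<^sup>+p. of_bool (reached k p) * J k p \<partial>(M \<Otimes>\<^sub>M ref_measure k))"
    using J(2)[OF k] by (intro integral_reached_cond_exp[symmetric] J(1) k m) (auto simp: solves_at_def)
  also have "\<dots> = (\<Sum>i=k..n. stage Zs i)" by (rule integral_reached_solution[of Zs J, OF Z J k])
  also have "\<dots> \<le> (\<Sum>k\<le>n. stage Zs k)" by (intro sum_mono2) auto
  finally show *: "(\<integral>\<^sup>+p. of_bool (reached k p) * recursion_rhs Zs k (J (Suc k)) p \<partial>(M \<Otimes>\<^sub>M ref_measure k)) < \<infinity>"
    using fin by (rule le_less_trans)
  have "(\<lambda>p. of_bool (reached k p) * recursion_rhs Zs k (J (Suc k)) p) \<in> borel_measurable (M \<Otimes>\<^sub>M ref_measure k)"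
    unfolding measurable_ref_measure_iff[OF k] by measurable
  then have "AE p in M \<Otimes>\<^sub>M ref_measure k. of_bool (reached k p) * recursion_rhs Zs k (J (Suc k)) p \<noteq> \<infinity>"
    by (rule nn_integral_PInf_AE) (use * in simp)
  then show "AE p in M \<Otimes>\<^sub>M ref_measure k. reached k p \<longrightarrow> recursion_rhs Zs k (J (Suc k)) p < \<infinity>"
    by eventually_elim (auto simp: less_top)
qed

text \<open>Finiteness and the identity for \<open>r\<close> are given almost everywhere on the
  product, so by Fubini they hold for almost every \<open>y\<close>. For such \<open>y\<close> the
  conditional expectations are compared on the section of the reached set, which belongs to the
  conditioning sigma-algebra.\<close>

lemma AE_reached_cond_exp_real:
  assumes k: "k \<le> n" and J: "Jr_measurable k J" and r: "Jr_measurable k r"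
    and a: "J_measurable k a" and b: "J_measurable k b" and Ja: "J_measurable k Ja" and Jb: "J_measurable k Jb"
    and J_eq: "\<And>y. y \<in> space (jump_space E k) \<Longrightarrow> fst y \<in> Delta_upto k T \<Longrightarrow>
      AE \<omega> in M. J (\<omega>, y) = real_cond_exp M (F (ennreal (last_time k (fst y)))) (\<lambda>\<omega>. r (\<omega>, y)) \<omega>"
    and Ja_eq: "\<And>y. y \<in> space (jump_space E k) \<Longrightarrow> fst y \<in> Delta_upto k T \<Longrightarrow>
      AE \<omega> in M. Ja (\<omega>, y) = nn_cond_exp M (F (ennreal (last_time k (fst y)))) (\<lambda>\<omega>. a (\<omega>, y)) \<omega>"
    and Jb_eq: "\<And>y. y \<in> space (jump_space E k) \<Longrightarrow> fst y \<in> Delta_upto k T \<Longrightarrow>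
      AE \<omega> in M. Jb (\<omega>, y) = nn_cond_exp M (F (ennreal (last_time k (fst y)))) (\<lambda>\<omega>. b (\<omega>, y)) \<omega>"
    and fin: "(\<integral>\<^sup>+p. of_bool (reached k p) * a p \<partial>(M \<Otimes>\<^sub>M ref_measure k)) < \<infinity>"
      "(\<integral>\<^sup>+p. of_bool (reached k p) * b p \<partial>(M \<Otimes>\<^sub>M ref_measure k)) < \<infinity>"
    and eq: "AE p in M \<Otimes>\<^sub>M ref_measure k. reached k p \<longrightarrow> r p = enn2real (a p) - enn2real (b p)"
  shows "AE p in M \<Otimes>\<^sub>M ref_measure k. reached k p \<longrightarrow> J p = enn2real (Ja p) - enn2real (Jb p)"
proof -
  interpret k: pair_sigma_finite M "ref_measure k" by (rule pair_sigma_finite_ref[OF k])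
  note [measurable] = F_prod_M[OF reached_measurable[OF k]] J r a b Ja Jb
  have [measurable_cong]: "sets (ref_measure k) = sets (jump_space E k)" by (rule sets_ref_measure[OF k])
  let ?P = "\<lambda>\<omega> y. reached k (\<omega>, y) \<longrightarrow> J (\<omega>, y) = enn2real (Ja (\<omega>, y)) - enn2real (Jb (\<omega>, y))"
  have "AE \<omega> in M. AE y in ref_measure k. reached k (\<omega>, y) \<longrightarrow> r (\<omega>, y) = enn2real (a (\<omega>, y)) - enn2real (b (\<omega>, y))"
    using k.AE_pair[OF eq] by simp
  moreover have "{p\<in>space (M \<Otimes>\<^sub>M ref_measure k). reached k (fst p, snd p) \<longrightarrow>
      r (fst p, snd p) = enn2real (a (fst p, snd p)) - enn2real (b (fst p, snd p))} \<in> sets (M \<Otimes>\<^sub>M ref_measure k)"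
    unfolding prod.collapse by measurable
  ultimately have eq': "AE y in ref_measure k. AE \<omega> in M. reached k (\<omega>, y) \<longrightarrow> r (\<omega>, y) = enn2real (a (\<omega>, y)) - enn2real (b (\<omega>, y))"
    by (subst (asm) k.AE_commute)
  have fin': "AE y in ref_measure k. (\<integral>\<^sup>+\<omega>. of_bool (reached k (\<omega>, y)) * f (\<omega>, y) \<partial>M) \<noteq> \<infinity>"
    if f [measurable]: "J_measurable k f" and "(\<integral>\<^sup>+p. of_bool (reached k p) * f p \<partial>(M \<Otimes>\<^sub>M ref_measure k)) < \<infinity>" for f
  proof (rule nn_integral_PInf_AE)
    have m: "(\<lambda>p. of_bool (reached k p) * f p) \<in> borel_measurable (M \<Otimes>\<^sub>M ref_measure k)"
      unfolding measurable_ref_measure_iff[OF k] by measurable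
    show "(\<lambda>y. \<integral>\<^sup>+\<omega>. of_bool (reached k (\<omega>, y)) * f (\<omega>, y) \<partial>M) \<in> borel_measurable (ref_measure k)"
      using measurable_compose[OF measurable_pair_swap' m] by (intro borel_measurable_nn_integral) (simp add: split_beta')
    show "(\<integral>\<^sup>+y. \<integral>\<^sup>+\<omega>. of_bool (reached k (\<omega>, y)) * f (\<omega>, y) \<partial>M \<partial>ref_measure k) \<noteq> \<infinity>"
      using that(2) k.nn_integral_snd[OF m] by simp
  qed
  have "AE y in ref_measure k. AE \<omega> in M. ?P \<omega> y"
    using eq' fin'[OF a fin(1)] fin'[OF b fin(2)] AE_space
  proof eventually_elim
    case (elim y)
    then have y: "y \<in> space (jump_space E k)" by (simp add: space_ref_measure[OF k])
    let ?F = "F (ennreal (last_time k (fst y)))"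
    interpret sigma_finite_subalgebra M ?F by (rule sigma_finite_subalgebra_F)
    show ?case
    proof (cases "fst y \<in> Delta_upto k T")
      case True
      let ?G = "{\<omega>\<in>space M. reached k (\<omega>, y)}"
      have ind: "(\<integral>\<^sup>+\<omega>. indicator ?G \<omega> * f (\<omega>, y) \<partial>M) = (\<integral>\<^sup>+\<omega>. of_bool (reached k (\<omega>, y)) * f (\<omega>, y) \<partial>M)" for f :: "_ \<Rightarrow> ennreal"
        by (intro nn_integral_cong) (simp add: indicator_def)
      have "AE \<omega> in M. \<omega> \<in> ?G \<longrightarrow> real_cond_exp M ?F (\<lambda>\<omega>. r (\<omega>, y)) \<omega> =
          enn2real (nn_cond_exp M ?F (\<lambda>\<omega>. a (\<omega>, y)) \<omega>) - enn2real (nn_cond_exp M ?F (\<lambda>\<omega>. b (\<omega>, y)) \<omega>)"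
      proof (rule real_cond_exp_eq_diff_on[OF reached_section[OF k y]])
        show "(\<lambda>\<omega>. r (\<omega>, y)) \<in> borel_measurable M" by (rule measurable_compose[OF measurable_Pair2'[OF y] r])
        show "(\<lambda>\<omega>. a (\<omega>, y)) \<in> borel_measurable M" "(\<lambda>\<omega>. b (\<omega>, y)) \<in> borel_measurable M"
          by (rule measurable_section[OF a y] measurable_section[OF b y])+
        show "(\<integral>\<^sup>+\<omega>. indicator ?G \<omega> * a (\<omega>, y) \<partial>M) < \<infinity>" "(\<integral>\<^sup>+\<omega>. indicator ?G \<omega> * b (\<omega>, y) \<partial>M) < \<infinity>"
          unfolding ind using elim(2,3) by (simp_all add: less_top)
        show "AE \<omega> in M. \<omega> \<in> ?G \<longrightarrow> r (\<omega>, y) = enn2real (a (\<omega>, y)) - enn2real (b (\<omega>, y))"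
          using elim(1) by eventually_elim simp
      qed
      then show ?thesis
        using J_eq[OF y True] Ja_eq[OF y True] Jb_eq[OF y True] AE_space by eventually_elim simp
    next
      case False
      then have "\<not> reached k (\<omega>, y)" if "\<omega> \<in> space M" for \<omega>
        using reached_upto[of "(\<omega>, y)" k] that y by (auto simp: space_pair_measure)
      then show ?thesis by (intro AE_I2) simp
    qed
  qed
  moreover have m: "{p\<in>space (M \<Otimes>\<^sub>M ref_measure k). reached k p \<longrightarrow> J p = enn2real (Ja p) - enn2real (Jb p)} \<in> sets (M \<Otimes>\<^sub>M ref_measure k)"
    by measurable
  then have "{p\<in>space (M \<Otimes>\<^sub>M ref_measure k). ?P (fst p) (snd p)} \<in> sets (M \<Otimes>\<^sub>M ref_measure k)"
    unfolding prod.collapse .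
  ultimately have "AE \<omega> in M. AE y in ref_measure k. ?P \<omega> y" by (subst k.AE_commute)
  then show ?thesis by (rule k.AE_pair_measure[OF m])
qed

lemma cont_extend:
  assumes y: "y \<in> space (jump_space E k)" and k: "k < n"
  shows "cont k J (\<omega>, y) = (\<integral>\<^sup>+u. (if last_time k (fst y) \<le> u \<and> ennreal u \<le> min (st k (\<omega>, y)) T then
       (\<integral>\<^sup>+x. J (\<omega>, extend k y (u, x)) \<partial>\<eta> (Suc k) (fst y) (snd y)) else 0) \<partial>lborel)"
proof -
  obtain \<theta> e where ye: "y = (\<theta>, e)" by (cases y)
  show ?thesis
    unfolding ye cont_eq[OF y[unfolded ye] k]
    by (intro nn_integral_cong) (auto simp: extend_eq st_def split: split_indicator)
qed

text \<open>Both Bochner integrals, over the marks and over the time, must be kept from their value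
  0 in the nonintegrable case. Finite \<open>cont k a\<close> and \<open>cont k b\<close> make the
  inner nonnegative integrals finite for almost every \<open>u\<close>. The hypothesis
  \<open>eq\<close> says in integrated form that the identity at the next stage fails only for
  negligibly many next jumps.\<close>

lemma cont_real_eq_diff:
  assumes k: "k < n" and y: "y \<in> space (jump_space E k)" and \<omega>: "\<omega> \<in> space M" and reached: "reached k (\<omega>, y)"
    and J: "Jr_measurable (Suc k) J" and a: "J_measurable (Suc k) a" and b: "J_measurable (Suc k) b"
    and fin: "cont k a (\<omega>, y) < \<infinity>" "cont k b (\<omega>, y) < \<infinity>"
    and eq: "cont k (\<lambda>p. of_bool (\<not> (reached (Suc k) p \<longrightarrow> J p = enn2real (a p) - enn2real (b p)))) (\<omega>, y) = 0"
  shows "cont_real k J (\<omega>, y) = enn2real (cont k a (\<omega>, y)) - enn2real (cont k b (\<omega>, y))"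
proof -
  let ?\<eta> = "\<eta> (Suc k) (fst y) (snd y)"
  define U where "U u \<longleftrightarrow> last_time k (fst y) \<le> u \<and> ennreal u \<le> min (st k (\<omega>, y)) T" for u
  define I where "I f u = (if U u then (\<integral>\<^sup>+x. f (\<omega>, extend k y (u, x)) \<partial>?\<eta>) else 0)"
    for f :: "'a \<times> 'e jump_data \<Rightarrow> ennreal" and u
  define N where "N p = (of_bool (\<not> (reached (Suc k) p \<longrightarrow> J p = enn2real (a p) - enn2real (b p))) :: ennreal)" for p
  have cont_I: "cont k f (\<omega>, y) = (\<integral>\<^sup>+u. I f u \<partial>lborel)" for f
    unfolding cont_extend[OF y k] I_def U_def by simp
  have kn: "Suc k \<le> n" using k by simp
  note [measurable] = F_prod_M[OF reached_measurable[OF kn]] J a b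
  have N: "J_measurable (Suc k) N" unfolding N_def[abs_def] by measurable
  have [measurable]: "Measurable.pred lborel U" unfolding U_def[abs_def] by measurable
  have I: "I f \<in> borel_measurable lborel" if f: "J_measurable (Suc k) f" for f
  proof -
    have [measurable]: "(\<lambda>u. \<integral>\<^sup>+x. f (\<omega>, extend k y (u, x)) \<partial>?\<eta>) \<in> borel_measurable lborel"
      using measurable_mark_integral_section(3)[OF k y measurable_compose[OF measurable_Pair1'[OF \<omega>] f]] .
    show ?thesis unfolding I_def[abs_def] by measurable
  qed
  have I_fin: "AE u in lborel. I f u \<noteq> \<infinity>" if f: "J_measurable (Suc k) f" "cont k f (\<omega>, y) < \<infinity>" for f
    by (rule nn_integral_PInf_AE[OF I[OF f(1)]]) (use f(2) cont_I in simp)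
  have "AE u in lborel. I N u = 0"
  proof -
    have "cont k N (\<omega>, y) = 0" using eq unfolding N_def[abs_def] .
    then show ?thesis using cont_I[of N] nn_integral_0_iff_AE[OF I[OF N]] by simp
  qed
  then have mm: "AE u in lborel. mark_mean k J (\<omega>, y) u = enn2real (I a u) - enn2real (I b u)"
    using I_fin[OF a fin(1)] I_fin[OF b fin(2)]
  proof eventually_elim
    case (elim u)
    show ?case
    proof (cases "U u")
      case True
      have r: "reached (Suc k) (\<omega>, extend k y (u, x))" for x
        using True reached by (simp add: reached_extend[OF y] U_def)
      have "(\<integral>\<^sup>+x. N (\<omega>, extend k y (u, x)) \<partial>?\<eta>) = 0" using elim True by (simp add: I_def)
      then have "AE x in ?\<eta>. N (\<omega>, extend k y (u, x)) = 0"
        using nn_integral_0_iff_AE[OF measurable_J_section[OF k y \<omega> N]] by simp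
      then have "AE x in ?\<eta>. J (\<omega>, extend k y (u, x)) = enn2real (a (\<omega>, extend k y (u, x))) - enn2real (b (\<omega>, extend k y (u, x)))"
        by eventually_elim (auto simp: N_def r split: if_splits)
      then have "(LINT x|?\<eta>. J (\<omega>, extend k y (u, x))) =
          enn2real (\<integral>\<^sup>+x. a (\<omega>, extend k y (u, x)) \<partial>?\<eta>) - enn2real (\<integral>\<^sup>+x. b (\<omega>, extend k y (u, x)) \<partial>?\<eta>)"
        using elim True
        by (intro integral_eq_diff_nn_integral measurable_J_section[OF k y \<omega>] J a b) (auto simp: I_def less_top)
      then show ?thesis using True by (simp add: mark_mean_def I_def U_def)
    next
      case False
      then show ?thesis by (simp only: mark_mean_def I_def U_def fst_conv snd_conv if_False enn2real_0 diff_self)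
    qed
  qed
  have "(\<omega>, y) \<in> space (M \<Otimes>\<^sub>M jump_space E k)" using \<omega> y by (simp add: space_pair_measure)
  from measurable_compose[OF measurable_Pair1'[OF this] mark_mean_measurable[OF k J]]
  have "mark_mean k J (\<omega>, y) \<in> borel_measurable lborel" by simp
  then show ?thesis
    unfolding cont_real_def cont_I using mm fin
    by (intro integral_eq_diff_nn_integral I a b) (simp_all add: cont_I)
qed

text \<open>Downward induction. On the reached set conditional expectation preserves the difference
  once the right-hand sides satisfy it, so each stage reduces to the integral term.\<close>

lemma solution_real_eq_diff:
  assumes Z: "\<And>k. k \<le> n \<Longrightarrow> indexed_optional M F E k (Zs k)"
    and J: "\<And>k. k \<le> n \<Longrightarrow> Jr_measurable k (J k)" "\<And>k. k \<le> n \<Longrightarrow> solves_real_at Zs k (J k) (J (Suc k))"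
    and a: "\<And>k. k \<le> n \<Longrightarrow> J_measurable k (a k)" "\<And>k. k \<le> n \<Longrightarrow> solves_at Zs k (a k) (a (Suc k))"
    and b: "\<And>k. k \<le> n \<Longrightarrow> J_measurable k (b k)" "\<And>k. k \<le> n \<Longrightarrow> solves_at (minus Zs) k (b k) (b (Suc k))"
    and fin: "(\<Sum>k\<le>n. stage Zs k) < \<infinity>" "(\<Sum>k\<le>n. stage (minus Zs) k) < \<infinity>"
    and k: "k \<le> n"
  shows "AE p in M \<Otimes>\<^sub>M ref_measure k. reached k p \<longrightarrow> J k p = enn2real (a k p) - enn2real (b k p)"
proof -
  have Z': "indexed_optional M F E k (minus Zs k)" if "k \<le> n" for k
    by (rule indexed_optional_minus[where Zs = Zs, OF Z[OF that]])
  have rhs: "AE p in M \<Otimes>\<^sub>M ref_measure k. reached k p \<longrightarrow> J k p = enn2real (a k p) - enn2real (b k p)"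
    if k: "k \<le> n" and eq: "AE p in M \<Otimes>\<^sub>M ref_measure k. reached k p \<longrightarrow> recursion_rhs_real Zs k (J (Suc k)) p =
      enn2real (recursion_rhs Zs k (a (Suc k)) p) - enn2real (recursion_rhs (minus Zs) k (b (Suc k)) p)" for k
  proof (rule AE_reached_cond_exp_real[OF k J(1)[OF k] _ _ _ a(1)[OF k] b(1)[OF k] _ _ _ _ _ eq])
    show "Jr_measurable k (recursion_rhs_real Zs k (J (Suc k)))"
      using k by (intro recursion_rhs_real_measurable Z J(1)) auto
    show "J_measurable k (recursion_rhs Zs k (a (Suc k)))" using k by (intro recursion_rhs_measurable Z a(1)) auto
    show "J_measurable k (recursion_rhs (minus Zs) k (b (Suc k)))" using k by (intro recursion_rhs_measurable Z' b(1)) auto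
    show "(\<integral>\<^sup>+p. of_bool (reached k p) * recursion_rhs Zs k (a (Suc k)) p \<partial>(M \<Otimes>\<^sub>M ref_measure k)) < \<infinity>"
      by (rule rhs_finite_where_reached(1)[of Zs a, OF Z a fin(1) k])
    show "(\<integral>\<^sup>+p. of_bool (reached k p) * recursion_rhs (minus Zs) k (b (Suc k)) p \<partial>(M \<Otimes>\<^sub>M ref_measure k)) < \<infinity>"
      by (rule rhs_finite_where_reached(1)[of "minus Zs" b, OF Z' b fin(2) k])
  qed (use J(2)[OF k] a(2)[OF k] b(2)[OF k] in \<open>auto simp: solves_at_def solves_real_at_def\<close>)
  show ?thesis
    using k
  proof (induction rule: inc_induct)
    case base
    show ?case
      by (rule rhs) (auto simp: recursion_rhs_def recursion_rhs_real_def sreal_eq)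
  next
    case (step k)
    then have k: "k \<le> n" "Suc k \<le> n" by auto
    interpret Sk: pair_sigma_finite M "ref_measure (Suc k)" by (rule pair_sigma_finite_ref[OF k(2)])
    \<comment> \<open>\<open>N\<close> marks the failure of the induction hypothesis. Its mass over
      the reached set at stage \<open>Suc k\<close> is 0, and \<open>integral_reached_cont\<close>
      pulls this down: for almost every reached \<open>p\<close> at stage \<open>k\<close>, the next
      jumps at which it fails are negligible.\<close>
    define N where "N p = (of_bool (\<not> (reached (Suc k) p \<longrightarrow> J (Suc k) p = enn2real (a (Suc k) p) - enn2real (b (Suc k) p))) :: ennreal)" for p
    note [measurable] = F_prod_M[OF reached_measurable[OF k(2)]] F_prod_M[OF reached_measurable[OF k(1)]] J(1)[OF k(2)] a(1)[OF k(2)] b(1)[OF k(2)]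
    have N [measurable]: "J_measurable (Suc k) N" unfolding N_def[abs_def] by measurable
    note [measurable] = cont_measurable[OF step(2) N]
    have "(\<integral>\<^sup>+p. of_bool (reached k p) * cont k N p \<partial>(M \<Otimes>\<^sub>M ref_measure k)) =
        (\<integral>\<^sup>+p. of_bool (reached (Suc k) p) * N p \<partial>(M \<Otimes>\<^sub>M ref_measure (Suc k)))"
      by (rule integral_reached_cont[OF step(2) N])
    also have "\<dots> = (\<integral>\<^sup>+p. 0 \<partial>(M \<Otimes>\<^sub>M ref_measure (Suc k)))"
      by (rule nn_integral_cong_AE) (use step.IH in eventually_elim, simp add: N_def)
    finally have "(\<integral>\<^sup>+p. of_bool (reached k p) * cont k N p \<partial>(M \<Otimes>\<^sub>M ref_measure k)) = 0" by simp
    moreover have "(\<lambda>p. of_bool (reached k p) * cont k N p) \<in> borel_measurable (M \<Otimes>\<^sub>M ref_measure k)"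
      unfolding measurable_ref_measure_iff[OF k(1)] by measurable
    ultimately have N0: "AE p in M \<Otimes>\<^sub>M ref_measure k. of_bool (reached k p) * cont k N p = 0"
      using nn_integral_0_iff_AE by blast
    have fin_a: "AE p in M \<Otimes>\<^sub>M ref_measure k. reached k p \<longrightarrow> recursion_rhs Zs k (a (Suc k)) p < \<infinity>"
      by (rule rhs_finite_where_reached(2)[of Zs a, OF Z a fin(1) k(1)])
    have fin_b: "AE p in M \<Otimes>\<^sub>M ref_measure k. reached k p \<longrightarrow> recursion_rhs (minus Zs) k (b (Suc k)) p < \<infinity>"
      by (rule rhs_finite_where_reached(2)[of "minus Zs" b, OF Z' b fin(2) k(1)])
    show ?case
    proof (rule rhs[OF k(1)])
      show "AE p in M \<Otimes>\<^sub>M ref_measure k. reached k p \<longrightarrow> recursion_rhs_real Zs k (J (Suc k)) p =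
        enn2real (recursion_rhs Zs k (a (Suc k)) p) - enn2real (recursion_rhs (minus Zs) k (b (Suc k)) p)"
        using N0 fin_a fin_b AE_space
      proof eventually_elim
        case (elim p)
        obtain \<omega> y where p: "p = (\<omega>, y)" and \<omega>: "\<omega> \<in> space M" and y: "y \<in> space (jump_space E k)"
          using elim(4) by (cases p) (auto simp: space_pair_measure space_ref_measure[OF k(1)])
        show ?case
        proof
          assume r: "reached k p"
          then have f: "snn Zs k p < \<infinity>" "cont k (a (Suc k)) p < \<infinity>" "snn (minus Zs) k p < \<infinity>" "cont k (b (Suc k)) p < \<infinity>"
            using elim(2,3) step(2) by (auto simp: recursion_rhs_def)
          have "cont_real k (J (Suc k)) p = enn2real (cont k (a (Suc k)) p) - enn2real (cont k (b (Suc k)) p)"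
            unfolding p
            by (rule cont_real_eq_diff[OF step(2) y \<omega>])
               (use r f elim(1) in \<open>simp_all add: p N_def[abs_def] J(1)[OF k(2)] a(1)[OF k(2)] b(1)[OF k(2)]\<close>)
          then show "recursion_rhs_real Zs k (J (Suc k)) p =
            enn2real (recursion_rhs Zs k (a (Suc k)) p) - enn2real (recursion_rhs (minus Zs) k (b (Suc k)) p)"
            using f step(2) by (simp add: recursion_rhs_def recursion_rhs_real_def sreal_eq enn2real_add)
        qed
      qed
    qed
  qed
qed

lemma real_case:
  assumes Z: "process_decomposition M F E n \<zeta> L Z Zs"
    and bound: "\<And>t \<omega>. 0 \<le> t \<Longrightarrow> \<omega> \<in> space M \<Longrightarrow> \<bar>Z t \<omega>\<bar> \<le> C" and complete: "complete_measure M"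
  shows "\<exists>J. backward_real M F E n \<eta> \<alpha> Zs \<tau>s T J"
    and "backward_real M F E n \<eta> \<alpha> Zs \<tau>s T J \<Longrightarrow>
      AE \<omega> in M. (\<integral>\<omega>'. Z (enn2real (\<tau> \<omega>')) \<omega>' \<partial>M) = J 0 \<omega> (\<lambda>_. undefined) (\<lambda>_. undefined)"
proof -
  have Zi: "\<And>k. k \<le> n \<Longrightarrow> indexed_optional M F E k (Zs k)"
    using Z by (auto simp: process_decomposition_def)
  from exists_solution_real[of Zs, OF Zi] obtain J where J: "\<forall>k\<le>n. Jr_measurable k (J k) \<and> solves_real_at Zs k (J k) (J (Suc k))" by blast
  have "backward_real M F E n \<eta> \<alpha> Zs \<tau>s T (\<lambda>k \<omega> \<theta> e. J k (\<omega>, (\<theta>, e)))"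
    by (rule backward_real_of_solution) (use J in blast)
  then show "\<exists>J. backward_real M F E n \<eta> \<alpha> Zs \<tau>s T J" by blast
next
  assume backward: "backward_real M F E n \<eta> \<alpha> Zs \<tau>s T J"
  let ?Z = "\<lambda>\<omega>. Z (enn2real (\<tau> \<omega>)) \<omega>"
  note Z' = process_decomposition_minus[OF Z]
  have Zi: "\<And>k. k \<le> n \<Longrightarrow> indexed_optional M F E k (Zs k)"
    using Z by (auto simp: process_decomposition_def)
  have Zi': "\<And>k. k \<le> n \<Longrightarrow> indexed_optional M F E k (minus Zs k)"
    by (rule indexed_optional_minus[where Zs = Zs, OF Zi])
  \<comment> \<open>Boundedness makes both parts of \<open>Z\<close> at time \<tau> integrable; all
    subtractions in the comparison rest on this.\<close>
  have le_C: "(\<integral>\<^sup>+\<omega>. ennreal (?Z \<omega>) \<partial>M) < \<infinity>" "(\<integral>\<^sup>+\<omega>. ennreal (- ?Z \<omega>) \<partial>M) < \<infinity>"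
  proof -
    have "(\<integral>\<^sup>+\<omega>. ennreal (f \<omega>) \<partial>M) < \<infinity>" if "\<And>\<omega>. \<omega> \<in> space M \<Longrightarrow> f \<omega> \<le> C" for f
    proof -
      have "(\<integral>\<^sup>+\<omega>. ennreal (f \<omega>) \<partial>M) \<le> (\<integral>\<^sup>+\<omega>. ennreal C \<partial>M)"
        using that by (intro nn_integral_mono ennreal_leI)
      also have "\<dots> < \<infinity>" by (simp add: emeasure_space_1)
      finally show ?thesis .
    qed
    from this[of ?Z] this[of "\<lambda>\<omega>. - ?Z \<omega>"] bound
    show "(\<integral>\<^sup>+\<omega>. ennreal (?Z \<omega>) \<partial>M) < \<infinity>" "(\<integral>\<^sup>+\<omega>. ennreal (- ?Z \<omega>) \<partial>M) < \<infinity>"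
      by (meson abs_le_D1 abs_le_D2 enn2real_nonneg)+
  qed
  then have fin: "(\<Sum>k\<le>n. stage Zs k) < \<infinity>" "(\<Sum>k\<le>n. stage (minus Zs) k) < \<infinity>"
    unfolding expectation_eq_stages[OF Z, symmetric] expectation_eq_stages[OF Z', symmetric] .
  from exists_solution[of Zs, OF Zi] obtain a where a: "\<forall>k\<le>n. J_measurable k (a k) \<and> solves_at Zs k (a k) (a (Suc k))" by blast
  from exists_solution[of "minus Zs", OF Zi'] obtain b where b: "\<forall>k\<le>n. J_measurable k (b k) \<and> solves_at (minus Zs) k (b k) (b (Suc k))" by blast
  let ?J = "\<lambda>k p. if ennreal (last_time k (fst (snd p))) \<le> T then J k (fst p) (fst (snd p)) (snd (snd p)) else 0"
  have sol: "Jr_measurable k (?J k) \<and> solves_real_at Zs k (?J k) (?J (Suc k))" if "k \<le> n" for k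
    by (rule solution_of_backward_real[OF backward that])
  have "AE p in M \<Otimes>\<^sub>M ref_measure 0. reached 0 p \<longrightarrow> ?J 0 p = enn2real (a 0 p) - enn2real (b 0 p)"
    by (rule solution_real_eq_diff[where Zs = Zs and J = ?J and a = a and b = b, OF Zi _ _ _ _ _ _ fin]) (use sol a b in blast)+
  then have AE0: "AE p in M \<Otimes>\<^sub>M ref_measure 0. ?J 0 p = enn2real (a 0 p) - enn2real (b 0 p)"
    by eventually_elim (simp add: reached_def last_time_def)
  \<comment> \<open>The identity is known almost everywhere for the product with
    \<open>ref_measure 0\<close>. Integrating the indicator of its failure over this unit mass moves
    it to the empty vector.\<close>
  let ?N = "\<lambda>p. of_bool (\<not> (?J 0 p = enn2real (a 0 p) - enn2real (b 0 p))) :: ennreal"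
  have [measurable]: "Jr_measurable 0 (?J 0)" using sol[of 0] by blast
  have [measurable]: "J_measurable 0 (a 0)" "J_measurable 0 (b 0)" using a b by blast+
  have N: "J_measurable 0 ?N" by measurable
  have "(\<integral>\<^sup>+\<omega>. ?N (\<omega>, no_jumps) \<partial>M) = (\<integral>\<^sup>+p. of_bool (reached 0 p) * ?N p \<partial>(M \<Otimes>\<^sub>M ref_measure 0))"
    by (rule integral_reached_0[OF N, symmetric])
  also have "\<dots> = (\<integral>\<^sup>+p. 0 \<partial>(M \<Otimes>\<^sub>M ref_measure 0))"
    by (rule nn_integral_cong_AE) (use AE0 in eventually_elim, simp)
  finally have N0: "AE \<omega> in M. ?N (\<omega>, no_jumps) = 0"
    using nn_integral_0_iff_AE[OF measurable_section[OF N no_jumps_space]] by simp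
  have a0: "AE \<omega> in M. a 0 (\<omega>, no_jumps) = (\<integral>\<^sup>+\<omega>. ennreal (?Z \<omega>) \<partial>M)"
    unfolding expectation_eq_stages[OF Z] by (rule solution_at_0[where J = a, OF Zi]) (use a in blast)+
  have b0: "AE \<omega> in M. b 0 (\<omega>, no_jumps) = (\<integral>\<^sup>+\<omega>. ennreal (- ?Z \<omega>) \<partial>M)"
    unfolding expectation_eq_stages[OF Z'] by (rule solution_at_0[where J = b, OF Zi']) (use b in blast)+
  have int_eq: "(\<integral>\<omega>. ?Z \<omega> \<partial>M) = enn2real (\<integral>\<^sup>+\<omega>. ennreal (?Z \<omega>) \<partial>M) - enn2real (\<integral>\<^sup>+\<omega>. ennreal (- ?Z \<omega>) \<partial>M)"
  proof -
    have g: "(\<lambda>\<omega>. \<Sum>k\<le>n. stage_value Zs k \<omega>) \<in> borel_measurable M" "(\<lambda>\<omega>. \<Sum>k\<le>n. stage_value (minus Zs) k \<omega>) \<in> borel_measurable M"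
      by (auto intro!: borel_measurable_sum stage_value_measurable Zi Zi')
    have m: "(\<lambda>\<omega>. ennreal (?Z \<omega>)) \<in> borel_measurable M" "(\<lambda>\<omega>. ennreal (- ?Z \<omega>)) \<in> borel_measurable M"
      by (rule measurable_of_AE_eq[OF complete g(1) AE_value_eq_sum[OF Z]] measurable_of_AE_eq[OF complete g(2) AE_value_eq_sum[OF Z']])+
    have eq: "?Z \<omega> = enn2real (ennreal (?Z \<omega>)) - enn2real (ennreal (- ?Z \<omega>))" for \<omega>
      by (cases "0 \<le> ?Z \<omega>") (auto simp: ennreal_neg)
    have "?Z \<in> borel_measurable M" by (subst eq) (use m in measurable)
    then show ?thesis using m le_C eq by (intro integral_eq_diff_nn_integral) auto
  qed
  from N0 a0 b0 show "AE \<omega> in M. (\<integral>\<omega>'. ?Z \<omega>' \<partial>M) = J 0 \<omega> (\<lambda>_. undefined) (\<lambda>_. undefined)"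
    by eventually_elim (simp add: int_eq last_time_def)
qed

end

section \<open>The Brownian filtration\<close>

lemma sets_brownian_filtration:
  assumes "brownian_motion M W"
  shows "sets (brownian_filtration M W t) = sigma_sets (space M)
      ((\<Union>s\<in>{s. 0 \<le> s \<and> ennreal s \<le> t}. rv_events (space M) (W s)) \<union> null_sets M)" (is "_ = sigma_sets _ ?G")
    and "(\<Union>s\<in>{s. 0 \<le> s \<and> ennreal s \<le> t}. rv_events (space M) (W s)) \<union> null_sets M \<subseteq> sets M"
proof -
  have "rv_events (space M) (W s) \<subseteq> sets M" if "0 \<le> s" for s
    using assms that by (auto simp: brownian_motion_def rv_events_def intro: measurable_sets)
  then show sub: "?G \<subseteq> sets M" by auto
  then have "?G \<subseteq> Pow (space M)" using sets.sets_into_space by blast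
  then show "sets (brownian_filtration M W t) = sigma_sets (space M) ?G"
    by (simp add: brownian_filtration_def)
qed

lemma usual_filtration_brownian:
  assumes W: "brownian_motion M W" and usual: "usual_conditions M (brownian_filtration M W)"
  shows "usual_filtration M (brownian_filtration M W)"
proof -
  interpret prob_space M using W by (simp add: brownian_motion_def)
  note sets = sets_brownian_filtration[OF W]
  show ?thesis
  proof
    show "subalgebra M (brownian_filtration M W t)" for t
      using sets.sigma_sets_subset[OF sets(2)] sets(1)
      by (simp add: subalgebra_def) (simp add: brownian_filtration_def space_measure_of_conv)
    show "sets (brownian_filtration M W s) \<subseteq> sets (brownian_filtration M W t)" if "s \<le> t" for s t
      unfolding sets(1) using that by (intro sigma_sets_mono') (auto intro: order_trans)
    show "(\<Inter>s\<in>{t<..}. sets (brownian_filtration M W s)) = sets (brownian_filtration M W t)" if "t < \<infinity>" for t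
      using usual that by (simp add: usual_conditions_def)
  qed
qed

lemma brownian_filtration_infinity:
  assumes W: "brownian_motion M W"
  shows "sets (brownian_filtration M W \<infinity>) = sigma_sets (space M) (\<Union>t\<in>{0..}. sets (brownian_filtration M W (ennreal t)))"
proof (rule antisym)
  note sets = sets_brownian_filtration(1)[OF W]
  have "rv_events (space M) (W s) \<subseteq> sets (brownian_filtration M W (ennreal s))" if "0 \<le> s" for s
    unfolding sets using that by (auto intro!: sigma_sets.Basic)
  moreover have "null_sets M \<subseteq> sets (brownian_filtration M W (ennreal 0))"
    unfolding sets by auto
  ultimately have "(\<Union>s\<in>{s. 0 \<le> s \<and> ennreal s \<le> \<infinity>}. rv_events (space M) (W s)) \<union> null_sets M
      \<subseteq> (\<Union>t\<in>{0..}. sets (brownian_filtration M W (ennreal t)))"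
    by (intro Un_least UN_least) (blast intro: UN_I[of 0] order_refl)+
  then show "sets (brownian_filtration M W \<infinity>) \<subseteq> sigma_sets (space M) (\<Union>t\<in>{0..}. sets (brownian_filtration M W (ennreal t)))"
    unfolding sets[of \<infinity>] by (rule sigma_sets_mono')
  have "sets (brownian_filtration M W (ennreal t)) \<subseteq> sets (brownian_filtration M W \<infinity>)" for t
    unfolding sets by (intro sigma_sets_mono') auto
  then have "sigma_sets (space (brownian_filtration M W \<infinity>)) (\<Union>t\<in>{0..}. sets (brownian_filtration M W (ennreal t))) \<subseteq> sets (brownian_filtration M W \<infinity>)"
    by (intro sets.sigma_sets_subset) auto
  then show "sigma_sets (space M) (\<Union>t\<in>{0..}. sets (brownian_filtration M W (ennreal t))) \<subseteq> sets (brownian_filtration M W \<infinity>)"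
    by (simp add: brownian_filtration_def space_measure_of_conv)
qed

text \<open>The generators at time 0 are the null sets and the events of \<open>W 0\<close>, which
  is almost surely constant. Having probability 0 or 1 passes to complements and to countable
  unions.\<close>

lemma brownian_filtration_0_trivial:
  assumes W: "brownian_motion M W" and A: "A \<in> sets (brownian_filtration M W 0)"
  shows "measure M A = 0 \<or> measure M A = 1"
proof -
  interpret prob_space M using W by (simp add: brownian_motion_def)
  note sets = sets_brownian_filtration[OF W, of 0]
  have [measurable]: "W 0 \<in> borel_measurable M" and W0: "AE \<omega> in M. W 0 \<omega> = 0"
    using W by (auto simp: brownian_motion_def)
  from A have "A \<in> sigma_sets (space M) ((\<Union>s\<in>{s. 0 \<le> s \<and> ennreal s \<le> 0}. rv_events (space M) (W s)) \<union> null_sets M)"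
    by (simp only: sets(1))
  then have "A \<in> events \<and> (prob A = 0 \<or> prob A = 1)"
  proof (induction rule: sigma_sets.induct)
    case (Basic a)
    then have a: "a \<in> events" using sets(2) by blast
    from Basic consider "a \<in> rv_events (space M) (W 0)" | "a \<in> null_sets M" by auto
    then show ?case
    proof cases
      case 1
      then obtain B where B: "B \<in> sets borel" "a = W 0 -` B \<inter> space M" by (auto simp: rv_events_def)
      show ?thesis
      proof (cases "0 \<in> B")
        case True
        have "AE \<omega> in M. \<omega> \<in> a" using W0 AE_space by eventually_elim (simp add: B True)
        then show ?thesis using a by (simp add: prob_eq_1)
      next
        case False
        have "AE \<omega> in M. \<omega> \<notin> a" using W0 by eventually_elim (simp add: B False)
        then show ?thesis using a by (simp add: prob_eq_0)
      qed
    next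
      case 2
      then show ?thesis by (auto simp: null_sets_def measure_def)
    qed
  next
    case (Compl a)
    then show ?case by (auto simp: prob_compl)
  next
    case (Union a)
    then have a [measurable]: "a i \<in> events" for i by auto
    show ?case
    proof (cases "\<exists>i. prob (a i) = 1")
      case True
      then obtain i where i: "prob (a i) = 1" by blast
      have "prob (a i) \<le> prob (\<Union>i. a i)" by (intro finite_measure_mono) auto
      then have "prob (\<Union>i. a i) = 1" using i prob_le_1[of "\<Union>i. a i"] by linarith
      then show ?thesis by auto
    next
      case False
      then have "a i \<in> null_sets M" for i using Union(2) by (auto simp: null_sets_def emeasure_eq_measure)
      then have "(\<Union>i. a i) \<in> null_sets M" by (rule null_sets_UN)
      then show ?thesis by (auto simp: null_sets_def measure_def)
    qed
  qed simp
  then show ?thesis ..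
qed


section \<open>The backward recursion\<close>

theorem theorem3p3:
  fixes M :: "'a measure"
    and W :: "real \<Rightarrow> 'a \<Rightarrow> 'w::euclidean_space"
    and F :: "ennreal \<Rightarrow> 'a measure"
    and E :: "'e::euclidean_space set"
    and n :: nat
    and \<zeta> :: "nat \<Rightarrow> 'a \<Rightarrow> real"
    and L :: "nat \<Rightarrow> 'a \<Rightarrow> 'e"
    and \<eta> :: "'e mark_kernels"
    and \<alpha> :: "real \<Rightarrow> 'a \<Rightarrow> (nat \<Rightarrow> real) \<Rightarrow> (nat \<Rightarrow> 'e) \<Rightarrow> real"
    and Z :: "real \<Rightarrow> 'a \<Rightarrow> real"
    and Zs :: "nat \<Rightarrow> real \<Rightarrow> 'a \<Rightarrow> (nat \<Rightarrow> real) \<Rightarrow> (nat \<Rightarrow> 'e) \<Rightarrow> real"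
    and \<tau> :: "'a \<Rightarrow> ennreal"
    and \<tau>s :: "nat \<Rightarrow> 'a \<Rightarrow> (nat \<Rightarrow> real) \<Rightarrow> (nat \<Rightarrow> 'e) \<Rightarrow> ennreal"
    and T :: ennreal
  assumes "n \<ge> 1"
    and "brownian_motion M W"
    and "F = brownian_filtration M W"
    and "usual_conditions M F"
    and "E \<in> sets borel"
    and "jump_times_marks M E n \<zeta> L"
    and "transition_kernels E n \<eta>"
    and "jump_density M F E n \<zeta> L \<eta> \<alpha>"
    and "optional_process M (enlarged_filtration M F \<zeta> L n) Z"
    and "right_continuous_process M Z"
    and "process_decomposition M F E n \<zeta> L Z Zs"
    and "stopping_time (enlarged_filtration M F \<zeta> L n) \<tau>"
    and "AE \<omega> in M. \<tau> \<omega> < \<infinity>"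
    and "AE \<omega> in M. \<tau> \<omega> \<le> T"
    and "stopping_decomposition M F E n \<zeta> L \<tau> \<tau>s"
  shows
    "((\<forall>t\<ge>0. \<forall>\<omega>\<in>space M. 0 \<le> Z t \<omega>) \<longrightarrow>
        (\<exists>J. backward_nn M F E n \<eta> \<alpha> Zs \<tau>s T J) \<and>
        (\<forall>J. backward_nn M F E n \<eta> \<alpha> Zs \<tau>s T J \<longrightarrow>
           (AE \<omega> in M. (\<integral>\<^sup>+\<omega>'. ennreal (Z (enn2real (\<tau> \<omega>')) \<omega>') \<partial>M)
              = J 0 \<omega> (\<lambda>_. undefined) (\<lambda>_. undefined)))) \<and>
     ((\<exists>C. \<forall>t\<ge>0. \<forall>\<omega>\<in>space M. \<bar>Z t \<omega>\<bar> \<le> C) \<longrightarrow>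
        (\<exists>J. backward_real M F E n \<eta> \<alpha> Zs \<tau>s T J) \<and>
        (\<forall>J. backward_real M F E n \<eta> \<alpha> Zs \<tau>s T J \<longrightarrow>
           (AE \<omega> in M. (\<integral>\<omega>'. Z (enn2real (\<tau> \<omega>')) \<omega>' \<partial>M)
              = J 0 \<omega> (\<lambda>_. undefined) (\<lambda>_. undefined))))"
proof -
  interpret usual_filtration M F
    using assms(2-4) usual_filtration_brownian by simp
  interpret stopped_model M F E n \<eta> \<zeta> L \<alpha> \<tau> \<tau>s T
  proof
    show "sets (F \<infinity>) = sigma_sets (space M) (\<Union>t\<in>{0..}. sets (F (ennreal t)))"
      using brownian_filtration_infinity[OF assms(2)] assms(3) by simp
    show "prob A = 0 \<or> prob A = 1" if "A \<in> sets (F 0)" for A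
      using brownian_filtration_0_trivial[OF assms(2)] assms(3) that by simp
  qed (fact assms)+
  have "complete_measure M" using assms(4) by (simp add: usual_conditions_def)
  then show ?thesis
    using nn_case[OF assms(11)] real_case[OF assms(11)] by blast
qed

end
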